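(* Suppose $\tilde B$ has nondegenerate coefficients and $\mathcal U=\{u_m:m\in M^\circ_{\mathrm{uf}}\}$ is a subset of $\underline{\mathrm{can}}(\tilde B)$. The following are equivalent: (i) $\mathcal U$ is a reduced basis for $\underline{\mathrm{can}}(\tilde B)$ with $\mathbf g(u_p)=p$ for all $p$; (ii) each $u_m$ is $z^m$ times a formal power series in $\Bbbk[[\zeta]]$ with constant coefficient $1$; (iii) each $u_m=\vartheta_m+\sum_{n\in N^+_{\mathrm{uf}}}c^{(m)}_n\sigma^n\vartheta_{m+nB}$ (convergent) for some constants $c^{(m)}_n\in\Bbbk$; (iv) for every reduced basis $\{v_p:p\in M^\circ_{\mathrm{uf}}\}$ of $\underline{\mathrm{can}}(\tilde B)$ (with $\mathbf g(v_p)=p$), each $u_m=v_m+\sum_{n\in N^+_{\mathrm{uf}}}c^{(m)}_n\sigma^nv_{m+nB}$ for some constants $c^{(m)}_n\in\Bbbk$.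
   Context: Setup. $\Bbbk$ a field of characteristic $0$; $I$ finite, $I_{\mathrm{uf}}\subseteq I$, $I_{\mathrm{fr}}=I\setminus I_{\mathrm{uf}}$; $\tilde B=[\epsilon_{ij}]_{i\in I_{\mathrm{uf}},j\in I}$ an integer matrix with skew-symmetrizable square part $B$ (positive integers $d_i$, $d_i\epsilon_{ij}=-d_j\epsilon_{ji}$). $N_{\mathrm{uf}}$ lattice with basis $(e_i)_{i\in I_{\mathrm{uf}}}$ (componentwise order; $N^{0+}_{\mathrm{uf}}$ nonnegative elements, $N^+_{\mathrm{uf}}=N^{0+}_{\mathrm{uf}}\setminus\{0\}$), $M^\circ_{\mathrm{uf}}$ lattice with basis $(f_i)$, $\langle f_i,e_j\rangle=\delta_{ij}/d_i$. For $n=\sum a_ie_i$, $nB=\sum a_i\epsilon_{ij}f_j$. Indeterminates $(z_i)_{i\in I}$, $z^m=\prod z_i^{c_i}$ for $m=\sum c_if_i$; $\sigma_i=\prod_{j\in I_{\mathrm{fr}}}z_j^{\epsilon_{ij}}$, $\zeta_i=\prod_{j\in I}z_j^{\epsilon_{ij}}$; $\sigma^n,\zeta^n$ monomials with exponent vector $n$; $\zeta^n=z^{nB}\sigma^n$. Nondegenerate coefficients: rows of $[\epsilon_{ij}]_{i\in I_{\mathrm{uf}},j\in I_{\mathrm{fr}}}$ linearly independent. Theta functions $\vartheta_m$ ($m\in M^\circ_{\mathrm{uf}}$) are those of Gross–Hacking–Keel–Kontsevich for the cluster scattering diagram of $\tilde B$ (basepoint generic in the positive orthant); $\vartheta_m\in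 z^m\Bbbk[[\zeta]]$ with constant term $1$. Small canonical algebra. $\Bbbk((\zeta))$: series $\sum_{n\in N_{\mathrm{uf}}}c_n\zeta^n$ with support bounded below componentwise. $\mathcal A=\bigoplus_{m}z^m\Bbbk((\zeta))$; $\mathbf g(v)=m$ for $v\in z^m\Bbbk((\zeta))$ (so $\mathbf g(\sigma^n)=-nB$). $\underline{\mathrm{can}}(\tilde B)$ is the $\Bbbk[\sigma^{\pm1}]$-subalgebra of $\mathcal A$ generated by the $\vartheta_m$. Convergence in $\Bbbk((\zeta))$: common lower bound on supports and coefficientwise stabilization; in $\mathcal A$: finitely many $m$-components involved overall and each converges. A countable $\overline{\mathcal U}\subseteq\underline{\mathrm{can}}(\tilde B)$ is a basis if every element is a convergent sum $\sum a_uu$ for a unique $u\mapsto a_u\in\Bbbk$. A reduced basis is $\{u_m:m\in M^\circ_{\mathrm{uf}}\}\subseteq\underline{\mathrm{can}}(\tilde B)$ with $u_m\in z^m\Bbbk[[\zeta]]$ of constant coefficient $1$ such that $\{\sigma^nu_m\}$ is a basis. *)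

theory Defs
  imports "HOL-Computational_Algebra.Formal_Power_Series" "HOL-Library.Countable_Set" "HOL-Library.Function_Algebras"
begin

(* Conventions.  Indices live in a type 'i; the unfrozen index set is J = I_uf.
   Lattice vectors (elements of N_uf, coordinates w.r.t. e_i; or of M^o_uf, coordinates
   w.r.t. f_i) are functions 'i => int vanishing outside J.  Points of M_R (coordinates
   w.r.t. f_i) are functions 'i => real vanishing outside J. *)

type_synonym 'i lat = "'i \<Rightarrow> int"
type_synonym 'i vec = "'i \<Rightarrow> real"
(* power series in zeta: coefficient of zeta^n *)
type_synonym ('i,'k) zser = "'i lat \<Rightarrow> 'k"
(* elements of the ambient algebra A: coefficient of z^m zeta^n *)
type_synonym ('i,'k) elt = "'i lat \<Rightarrow> 'i lat \<Rightarrow> 'k"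
(* a wall: (primitive normal n0 in N_uf^+, cone d in M_R, wall function f(t), f_d = f(zeta^n0)) *)
type_synonym ('i,'k) wall = "'i lat \<times> 'i vec set \<times> 'k fps"

definition latt :: "'i set \<Rightarrow> 'i lat set" where
  "latt J = {v. \<forall>i. i \<notin> J \<longrightarrow> v i = 0}"

definition vecs :: "'i set \<Rightarrow> 'i vec set" where
  "vecs J = {x. \<forall>i. i \<notin> J \<longrightarrow> x i = 0}"

definition nonneg :: "'i set \<Rightarrow> 'i lat set" where
  "nonneg J = {v \<in> latt J. \<forall>i\<in>J. 0 \<le> v i}"

definition posN :: "'i set \<Rightarrow> 'i lat set" where
  "posN J = nonneg J - {0}"

definition degN :: "'i set \<Rightarrow> 'i lat \<Rightarrow> int" where
  "degN J n = (\<Sum>i\<in>J. n i)"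

definition matB :: "'i set \<Rightarrow> ('i \<Rightarrow> 'i \<Rightarrow> int) \<Rightarrow> 'i lat \<Rightarrow> 'i lat" where
  "matB J eps n = (\<lambda>j. if j \<in> J then (\<Sum>i\<in>J. n i * eps i j) else 0)"

(* pairing <x, n> for x in M_R, n in N_uf; <f_i, e_j> = delta_ij / d_i *)
definition pairR :: "'i set \<Rightarrow> ('i \<Rightarrow> nat) \<Rightarrow> 'i vec \<Rightarrow> 'i lat \<Rightarrow> real" where
  "pairR J d x n = (\<Sum>i\<in>J. x i * real_of_int (n i) / real (d i))"

definition primN :: "'i set \<Rightarrow> 'i lat \<Rightarrow> bool" where
  "primN J n \<longleftrightarrow> n \<in> posN J \<and> (\<forall>k::int. 1 < k \<longrightarrow> \<not> (\<forall>i\<in>J. k dvd n i))"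

(* n' = nscale * n0 is the primitive element of N^o = span(d_i e_i) on the ray of n0 *)
definition nscale :: "'i set \<Rightarrow> ('i \<Rightarrow> nat) \<Rightarrow> 'i lat \<Rightarrow> nat" where
  "nscale J d n0 = (LEAST k::nat. 0 < k \<and> (\<forall>i\<in>J. int (d i) dvd int k * n0 i))"

(* <n', mu> in Z for n' primitive in N^o on the ray of n0 and mu in M^o_uf *)
definition pairNo :: "'i set \<Rightarrow> ('i \<Rightarrow> nat) \<Rightarrow> 'i lat \<Rightarrow> 'i lat \<Rightarrow> int" where
  "pairNo J d n0 mu = (\<Sum>i\<in>J. ((int (nscale J d n0) * n0 i) div int (d i)) * mu i)"

definition gcone :: "'i lat set \<Rightarrow> 'i vec set" where
  "gcone S = {x. \<exists>l::'i lat \<Rightarrow> real. (\<forall>s\<in>S. 0 \<le> l s) \<and>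
                  x = (\<lambda>i. \<Sum>s\<in>S. l s * real_of_int (s i))}"

definition linind :: "'i lat set \<Rightarrow> bool" where
  "linind T \<longleftrightarrow> (\<forall>l::'i lat \<Rightarrow> real. (\<forall>i. (\<Sum>s\<in>T. l s * real_of_int (s i)) = 0)
                      \<longrightarrow> (\<forall>s\<in>T. l s = 0))"

definition is_wall :: "'i set \<Rightarrow> ('i \<Rightarrow> nat) \<Rightarrow> ('i,'k::field) wall \<Rightarrow> bool" where
  "is_wall J d w \<longleftrightarrow> (case w of (n0, C, f) \<Rightarrow>
      primN J n0 \<and> fps_nth f 0 = 1 \<and>
      (\<exists>S. finite S \<and> S \<subseteq> latt J \<and> C = gcone S \<and>
           (\<forall>s\<in>S. pairR J d (\<lambda>i. real_of_int (s i)) n0 = 0) \<and>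
           (\<exists>T\<subseteq>S. card T + 1 = card J \<and> linind T)))"

definition ntriv :: "'i set \<Rightarrow> nat \<Rightarrow> ('i,'k::field) wall \<Rightarrow> bool" where
  "ntriv J k w \<longleftrightarrow> (case w of (n0, C, f) \<Rightarrow>
      (\<exists>j::nat. 0 < j \<and> int j * degN J n0 < int k \<and> fps_nth f j \<noteq> 0))"

definition Dk :: "'i set \<Rightarrow> ('i,'k::field) wall set \<Rightarrow> nat \<Rightarrow> ('i,'k) wall set" where
  "Dk J D k = {w \<in> D. ntriv J k w}"

definition relint_w :: "'i set \<Rightarrow> ('i \<Rightarrow> nat) \<Rightarrow> ('i,'k) wall \<Rightarrow> 'i vec \<Rightarrow> bool" where
  "relint_w J d w x \<longleftrightarrow> (case w of (n0, C, f) \<Rightarrow> x \<in> C \<and>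
      (\<exists>e>0. \<forall>y\<in>vecs J. pairR J d y n0 = 0 \<and> (\<Sum>i\<in>J. (y i - x i)\<^sup>2) < e \<longrightarrow> y \<in> C))"

(* x avoids Sing(W): boundaries of walls and intersections of non-parallel walls *)
definition good_pt :: "'i set \<Rightarrow> ('i \<Rightarrow> nat) \<Rightarrow> ('i,'k) wall set \<Rightarrow> 'i vec \<Rightarrow> bool" where
  "good_pt J d W x \<longleftrightarrow> (\<forall>w\<in>W. x \<in> fst (snd w) \<longrightarrow>
      relint_w J d w x \<and> (\<forall>w'\<in>W. x \<in> fst (snd w') \<longrightarrow> fst w' = fst w))"

definition fpow :: "'k::field fps \<Rightarrow> int \<Rightarrow> 'k fps" where
  "fpow f e = (if 0 \<le> e then f ^ nat e else inverse f ^ nat (- e))"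

(* the zeta-series g(zeta^n0) *)
definition wzeta :: "'i lat \<Rightarrow> 'k::zero fps \<Rightarrow> ('i,'k) zser" where
  "wzeta n0 g = (\<lambda>v. if \<exists>j::nat. v = (\<lambda>i. int j * n0 i)
                      then fps_nth g (THE j::nat. v = (\<lambda>i. int j * n0 i)) else 0)"

definition box :: "'i set \<Rightarrow> 'i lat \<Rightarrow> 'i lat set" where
  "box J n' = {n \<in> nonneg J. \<forall>i\<in>J. n i \<le> n' i}"

(* Wall-crossing automorphism z^m zeta^n |-> z^m zeta^n f^(<s n', m + nB>), acting on the
   zeta-series h of the z^m-component (s = +-1 is the crossing sign). *)
definition cross :: "'i set \<Rightarrow> ('i \<Rightarrow> nat) \<Rightarrow> ('i \<Rightarrow> 'i \<Rightarrow> int) \<Rightarrow> ('i,'k::field) wall \<Rightarrow> int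
                     \<Rightarrow> 'i lat \<Rightarrow> ('i,'k) zser \<Rightarrow> ('i,'k) zser" where
  "cross J d eps w s m h = (\<lambda>n'. \<Sum>n\<in>box J n'. h n *
       wzeta (fst w) (fpow (snd (snd w)) (s * pairNo J d (fst w) (m + matB J eps n))) (n' - n))"

definition pt :: "'i vec \<Rightarrow> 'i vec \<Rightarrow> real \<Rightarrow> 'i vec" where
  "pt a b t = (\<lambda>i. a i + t * (b i - a i))"

definition seg_generic :: "'i set \<Rightarrow> ('i \<Rightarrow> nat) \<Rightarrow> ('i,'k) wall set \<Rightarrow> 'i vec \<Rightarrow> 'i vec \<Rightarrow> bool" where
  "seg_generic J d W a b \<longleftrightarrow> (\<forall>w\<in>W. a \<notin> fst (snd w) \<and> b \<notin> fst (snd w)) \<and>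
     (\<forall>t\<in>{0..1}. \<forall>w\<in>W. pt a b t \<in> fst (snd w) \<longrightarrow>
        good_pt J d W (pt a b t) \<and> pairR J d (\<lambda>i. b i - a i) (fst w) \<noteq> 0)"

definition crossed :: "('i,'k) wall set \<Rightarrow> 'i vec \<Rightarrow> 'i vec \<Rightarrow> ('i,'k) wall set" where
  "crossed W a b = {w\<in>W. \<exists>t\<in>{0..1}. pt a b t \<in> fst (snd w)}"

definition ctime :: "'i vec \<Rightarrow> 'i vec \<Rightarrow> ('i,'k) wall \<Rightarrow> real" where
  "ctime a b w = (THE t. t \<in> {0..1} \<and> pt a b t \<in> fst (snd w))"

(* path-ordered product along the straight segment a -> b (first crossed wall applied first) *)
definition seg_prod :: "'i set \<Rightarrow> ('i \<Rightarrow> nat) \<Rightarrow> ('i \<Rightarrow> 'i \<Rightarrow> int) \<Rightarrow> ('i,'k::field) wall set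
                        \<Rightarrow> 'i vec \<Rightarrow> 'i vec \<Rightarrow> 'i lat \<Rightarrow> ('i,'k) zser \<Rightarrow> ('i,'k) zser" where
  "seg_prod J d eps W a b m h =
     foldl (\<lambda>h w. cross J d eps w (if 0 < pairR J d (\<lambda>i. b i - a i) (fst w) then -1 else 1) m h) h
       (SOME ws. distinct ws \<and> set ws = crossed W a b \<and>
                 sorted_wrt (\<lambda>w w'. ctime a b w \<le> ctime a b w') ws)"

fun path_prod :: "'i set \<Rightarrow> ('i \<Rightarrow> nat) \<Rightarrow> ('i \<Rightarrow> 'i \<Rightarrow> int) \<Rightarrow> ('i,'k::field) wall set
                   \<Rightarrow> 'i vec list \<Rightarrow> 'i lat \<Rightarrow> ('i,'k) zser \<Rightarrow> ('i,'k) zser" where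
  "path_prod J d eps W (a # b # rest) m h = path_prod J d eps W (b # rest) m (seg_prod J d eps W a b m h)"
| "path_prod J d eps W ps m h = h"

definition delta :: "'i lat \<Rightarrow> ('i,'k::zero_neq_one) zser" where
  "delta n = (\<lambda>v. if v = n then 1 else 0)"

definition consistent_k :: "'i set \<Rightarrow> ('i \<Rightarrow> nat) \<Rightarrow> ('i \<Rightarrow> 'i \<Rightarrow> int) \<Rightarrow> ('i,'k::field) wall set
                            \<Rightarrow> nat \<Rightarrow> bool" where
  "consistent_k J d eps W k \<longleftrightarrow> (\<forall>ps. 2 \<le> length ps \<and> set ps \<subseteq> vecs J \<and> hd ps = last ps \<and>
       (\<forall>i. Suc i < length ps \<longrightarrow> seg_generic J d W (ps ! i) (ps ! Suc i)) \<longrightarrow>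
       (\<forall>m\<in>latt J. \<forall>n\<in>nonneg J. \<forall>n'. degN J n' < int k \<longrightarrow>
            path_prod J d eps W ps m (delta n) n' = (if n' = n then 1 else 0)))"

definition unitv :: "'i \<Rightarrow> 'i lat" where
  "unitv i = (\<lambda>j. if j = i then 1 else 0)"

definition Din :: "'i set \<Rightarrow> ('i,'k::field) wall set" where
  "Din J = {(unitv i, {x \<in> vecs J. x i = 0}, 1 + fps_X) | i. i \<in> J}"

definition outgoing :: "'i set \<Rightarrow> ('i \<Rightarrow> 'i \<Rightarrow> int) \<Rightarrow> ('i,'k) wall \<Rightarrow> bool" where
  "outgoing J eps w \<longleftrightarrow> (\<lambda>i. real_of_int (matB J eps (fst w) i)) \<notin> fst (snd w)"

(* a representative of the cluster scattering diagram of B (GHKK Thm 1.12) *)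
definition clusterSD :: "'i set \<Rightarrow> ('i \<Rightarrow> nat) \<Rightarrow> ('i \<Rightarrow> 'i \<Rightarrow> int) \<Rightarrow> ('i,'k::field) wall set \<Rightarrow> bool" where
  "clusterSD J d eps D \<longleftrightarrow> (\<forall>w\<in>D. is_wall J d w) \<and> (\<forall>k. finite (Dk J D k)) \<and>
      (\<forall>k. consistent_k J d eps (Dk J D k) k) \<and> Din J \<subseteq> D \<and>
      (\<forall>w\<in>D - Din J. outgoing J eps w)"

(* Broken lines.  L = [(t_1,c_1,n_1),...,(t_r,c_r,n_r)], t_1 < ... < t_r < 0 the bending
   times; on the j-th domain of linearity (t_j, t_{j+1}) (t_0 = -inf, t_{r+1} = 0) the
   monomial is c_j z^m0 zeta^(n_j), with (c_0,n_0) = (1,0); the velocity is -(m0 + n_j B). *)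
definition bl_t :: "(real \<times> 'k \<times> 'i lat) list \<Rightarrow> nat \<Rightarrow> real" where
  "bl_t L j = (if 1 \<le> j \<and> j \<le> length L then fst (L ! (j - 1)) else 0)"
definition bl_c :: "(real \<times> 'k::one \<times> 'i lat) list \<Rightarrow> nat \<Rightarrow> 'k" where
  "bl_c L j = (if 1 \<le> j \<and> j \<le> length L then fst (snd (L ! (j - 1))) else 1)"
definition bl_n :: "(real \<times> 'k \<times> 'i lat) list \<Rightarrow> nat \<Rightarrow> 'i lat" where
  "bl_n L j = (if 1 \<le> j \<and> j \<le> length L then snd (snd (L ! (j - 1))) else 0)"
definition bl_mu :: "'i set \<Rightarrow> ('i \<Rightarrow> 'i \<Rightarrow> int) \<Rightarrow> 'i lat \<Rightarrow> (real \<times> 'k \<times> 'i lat) list \<Rightarrow> nat \<Rightarrow> 'i lat" where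
  "bl_mu J eps m0 L j = m0 + matB J eps (bl_n L j)"
(* P_j = gamma(t_j), P_{r+1} = Q *)
definition bl_P :: "'i set \<Rightarrow> ('i \<Rightarrow> 'i \<Rightarrow> int) \<Rightarrow> 'i lat \<Rightarrow> 'i vec \<Rightarrow> (real \<times> 'k \<times> 'i lat) list \<Rightarrow> nat \<Rightarrow> 'i vec" where
  "bl_P J eps m0 Q L j = (\<lambda>i. Q i + (\<Sum>l\<in>{j..length L}.
       (bl_t L (l + 1) - bl_t L l) * real_of_int (bl_mu J eps m0 L l i)))"

definition brokenline :: "'i set \<Rightarrow> ('i \<Rightarrow> nat) \<Rightarrow> ('i \<Rightarrow> 'i \<Rightarrow> int) \<Rightarrow> ('i,'k::field) wall set
                          \<Rightarrow> 'i lat \<Rightarrow> 'i vec \<Rightarrow> (real \<times> 'k \<times> 'i lat) list \<Rightarrow> bool" where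
  "brokenline J d eps W m0 Q L \<longleftrightarrow>
     sorted_wrt (<) (map fst L) \<and> (\<forall>x\<in>set L. fst x < 0) \<and>
     (\<forall>j\<le>length L. \<forall>t. t \<le> bl_t L (j + 1) \<and> (j = 0 \<or> bl_t L j \<le> t) \<longrightarrow>
        good_pt J d W (\<lambda>i. bl_P J eps m0 Q L (j + 1) i
                           + (bl_t L (j + 1) - t) * real_of_int (bl_mu J eps m0 L j i))) \<and>
     (\<forall>j\<in>{1..length L}. \<exists>n0 (s::nat).
        0 < s \<and> (\<forall>w\<in>W. bl_P J eps m0 Q L j \<in> fst (snd w) \<longrightarrow> fst w = n0) \<and>
        bl_n L j = bl_n L (j - 1) + (\<lambda>i. int s * n0 i) \<and>
        bl_c L j = bl_c L (j - 1) *
           fps_nth (\<Prod>w\<in>{w\<in>W. bl_P J eps m0 Q L j \<in> fst (snd w)}.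
                      fpow (snd (snd w)) \<bar>pairNo J d n0 (bl_mu J eps m0 L (j - 1))\<bar>) s \<and>
        bl_c L j \<noteq> 0)"

(* coefficient of zeta^n in theta_{Q,m0} computed with the finite diagram W *)
definition thk :: "'i set \<Rightarrow> ('i \<Rightarrow> nat) \<Rightarrow> ('i \<Rightarrow> 'i \<Rightarrow> int) \<Rightarrow> ('i,'k::field) wall set
                   \<Rightarrow> 'i lat \<Rightarrow> 'i vec \<Rightarrow> 'i lat \<Rightarrow> 'k" where
  "thk J d eps W m0 Q n = (\<Sum>L\<in>{L. brokenline J d eps W m0 Q L \<and> bl_n L (length L) = n}.
                              bl_c L (length L))"

(* GHKK theta function theta_m (basepoint generic in the positive orthant), as the
   zeta-series s with theta_m = z^m s(zeta).  For each k, the coefficients in degree < k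
   are computed from D_k at every basepoint Q in the open positive orthant off a finite
   union of hyperplanes. *)
definition theta_ser :: "'i set \<Rightarrow> ('i \<Rightarrow> nat) \<Rightarrow> ('i \<Rightarrow> 'i \<Rightarrow> int) \<Rightarrow> 'i lat \<Rightarrow> ('i,'k::field) zser" where
  "theta_ser J d eps m = (THE s. \<forall>D::('i,'k) wall set. clusterSD J d eps D \<longrightarrow>
      (\<forall>k. \<exists>H. finite H \<and> (\<forall>h\<in>H. \<exists>i\<in>J. h i \<noteq> (0::real)) \<and>
         (\<forall>Q\<in>vecs J. (\<forall>i\<in>J. 0 < Q i) \<and> (\<forall>h\<in>H. (\<Sum>i\<in>J. h i * Q i) \<noteq> 0) \<longrightarrow>
             (\<forall>n. degN J n < int k \<longrightarrow> thk J d eps (Dk J D k) m Q n = s n))))"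

definition thetaA :: "'i set \<Rightarrow> ('i \<Rightarrow> nat) \<Rightarrow> ('i \<Rightarrow> 'i \<Rightarrow> int) \<Rightarrow> 'i lat \<Rightarrow> ('i,'k::field) elt" where
  "thetaA J d eps m = (\<lambda>m' n. if m' = m then theta_ser J d eps m n else 0)"

(* ---------- the algebra A = (+)_m z^m k((zeta)) ---------- *)

definition inA :: "'i set \<Rightarrow> ('i,'k::zero) elt \<Rightarrow> bool" where
  "inA J a \<longleftrightarrow> (\<forall>m n. a m n \<noteq> 0 \<longrightarrow> m \<in> latt J \<and> n \<in> latt J) \<and>
      finite {m. \<exists>n. a m n \<noteq> 0} \<and>
      (\<forall>m. \<exists>b. \<forall>n. a m n \<noteq> 0 \<longrightarrow> (\<forall>i\<in>J. b i \<le> n i))"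

definition addA :: "('i,'k::plus) elt \<Rightarrow> ('i,'k) elt \<Rightarrow> ('i,'k) elt" where
  "addA a b = (\<lambda>m n. a m n + b m n)"

definition smultA :: "'k::times \<Rightarrow> ('i,'k) elt \<Rightarrow> ('i,'k) elt" where
  "smultA c a = (\<lambda>m n. c * a m n)"

definition multA :: "('i,'k::comm_ring_1) elt \<Rightarrow> ('i,'k) elt \<Rightarrow> ('i,'k) elt" where
  "multA a b = (\<lambda>m n. \<Sum>x\<in>{((m1, n1), (m2, n2)). a m1 n1 \<noteq> 0 \<and> b m2 n2 \<noteq> 0 \<and>
                                   m1 + m2 = m \<and> n1 + n2 = n}.
                   (case x of ((m1, n1), (m2, n2)) \<Rightarrow> a m1 n1 * b m2 n2))"

definition sigmaA :: "'i set \<Rightarrow> ('i \<Rightarrow> 'i \<Rightarrow> int) \<Rightarrow> 'i lat \<Rightarrow> ('i,'k::zero_neq_one) elt" where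
  "sigmaA J eps n = (\<lambda>m' n'. if m' = - matB J eps n \<and> n' = n then 1 else 0)"

inductive_set canA :: "'i set \<Rightarrow> ('i \<Rightarrow> nat) \<Rightarrow> ('i \<Rightarrow> 'i \<Rightarrow> int) \<Rightarrow> ('i,'k::field) elt set"
  for J d eps where
  theta: "m \<in> latt J \<Longrightarrow> thetaA J d eps m \<in> canA J d eps"
| sigma: "n \<in> latt J \<Longrightarrow> sigmaA J eps n \<in> canA J d eps"
| add: "a \<in> canA J d eps \<Longrightarrow> b \<in> canA J d eps \<Longrightarrow> addA a b \<in> canA J d eps"
| mult: "a \<in> canA J d eps \<Longrightarrow> b \<in> canA J d eps \<Longrightarrow> multA a b \<in> canA J d eps"
| smult: "a \<in> canA J d eps \<Longrightarrow> smultA c a \<in> canA J d eps"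

definition sumsA :: "'i set \<Rightarrow> ('x \<Rightarrow> ('i,'k::comm_ring_1) elt) \<Rightarrow> 'x set \<Rightarrow> ('i,'k) elt \<Rightarrow> bool" where
  "sumsA J t X s \<longleftrightarrow> (\<forall>x\<in>X. inA J (t x)) \<and>
      finite {m. \<exists>x\<in>X. \<exists>n. t x m n \<noteq> 0} \<and>
      (\<exists>b. \<forall>x\<in>X. \<forall>m n. t x m n \<noteq> 0 \<longrightarrow> (\<forall>i\<in>J. b i \<le> n i)) \<and>
      (\<forall>m n. finite {x\<in>X. t x m n \<noteq> 0}) \<and>
      s = (\<lambda>m n. \<Sum>x\<in>{x\<in>X. t x m n \<noteq> 0}. t x m n)"

definition isBasis :: "'i set \<Rightarrow> ('i,'k::comm_ring_1) elt set \<Rightarrow> ('i,'k) elt set \<Rightarrow> bool" where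
  "isBasis J Cn U \<longleftrightarrow> U \<subseteq> Cn \<and> countable U \<and>
     (\<forall>x\<in>Cn. \<exists>!a. (\<forall>u. u \<notin> U \<longrightarrow> a u = 0) \<and> sumsA J (\<lambda>u. smultA (a u) u) U x)"

definition ps1 :: "'i set \<Rightarrow> 'i lat \<Rightarrow> ('i,'k::zero_neq_one) elt \<Rightarrow> bool" where
  "ps1 J m v \<longleftrightarrow> (\<forall>m' n. v m' n \<noteq> 0 \<longrightarrow> m' = m \<and> n \<in> nonneg J) \<and> v m 0 = 1"

definition reducedBasis :: "'i set \<Rightarrow> ('i \<Rightarrow> nat) \<Rightarrow> ('i \<Rightarrow> 'i \<Rightarrow> int) \<Rightarrow> ('i lat \<Rightarrow> ('i,'k::field) elt) \<Rightarrow> bool" where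
  "reducedBasis J d eps u \<longleftrightarrow> (\<forall>m\<in>latt J. u m \<in> canA J d eps \<and> ps1 J m (u m)) \<and>
     isBasis J (canA J d eps) {multA (sigmaA J eps n) (u m) | m n. m \<in> latt J \<and> n \<in> latt J}"

definition gdeg :: "('i,'k::zero) elt \<Rightarrow> 'i lat" where
  "gdeg v = (SOME m. v \<noteq> (\<lambda>_ _. 0) \<and> (\<forall>m' n. v m' n \<noteq> 0 \<longrightarrow> m' = m))"

definition nondeg_coeffs :: "'i set \<Rightarrow> 'i set \<Rightarrow> ('i \<Rightarrow> 'i \<Rightarrow> int) \<Rightarrow> bool" where
  "nondeg_coeffs I J eps \<longleftrightarrow> (\<forall>a\<in>latt J. (\<forall>j\<in>I - J. (\<Sum>i\<in>J. a i * eps i j) = 0) \<longrightarrow> a = 0)"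

end

theory Submission
  imports Defs "HOL-Computational_Algebra.Polynomial" Complex_Main
begin

text \<open>Every theta function is \<open>z\<^sup>m\<close> times a power series with constant term 1, and any family with this
  property expands every element of the algebra uniquely, because the expansion is triangular with respect to the
  degree; all four conditions then say that the \<open>u m\<close> are of this form.

  The substance is that the theta functions are well defined. A consistent diagram is built degree by
  degree: an element of the pro-unipotent group of wall crossings factors uniquely, at every point \<open>Q\<close>, into parts with
  negative, zero and positive pairing with \<open>Q\<close>; one word is adjusted so that its central part at \<open>nB\<close> carries
  exactly the incoming walls, and the walls of the diagram are read off from its central parts. Consistency makes path
  products depend on end points only, and a discrepancy of two diagrams in degree \<open>n\<close> could change only across
  the hyperplane orthogonal to \<open>n\<close>, but near \<open>nB\<close> only incoming walls are crossed there. Finally, a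
  series whose transport vanishes in degree \<open>n > 0\<close> near the ray of \<open>m + nB\<close> is unique, and
  following the last segment of broken lines backwards shows by induction that it counts broken lines.\<close>

text \<open>The group of wall crossings is never built. Its elements are finite words of
  automorphisms z^m |-> z^m exp(c <e, m> zeta^e), compared by their matrix coefficients below a
  given degree, and no Campbell-Hausdorff formula is used: every word preserves a Poisson bracket,
  and this alone forces its lowest nontrivial term to be a sum of new letters, which drives the
  existence of factorizations. That a coefficient of the central part at nB is well defined has a
  simple source: for e + e' = n with e orthogonal to nB one has <e, e'B> = <e, nB> = 0, so
  commutators of central letters never reach the exponent n. The value prescribed there comes from
  writing 1 + X as a product of exponentials. The obstacle in the geometry is that admissible paths
  avoid walls only, while chamber elements are defined off a finer hyperplane arrangement;
  perturbations outside codimension two bridge the gap. For theta functions the recursion moves the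
  end point onto walls, so genericity must be formulated relative to the direction of the last
  segment.\<close>

type_synonym ('i,'k) word = "('i lat * 'k) list"
type_synonym ('i,'k) rword = "('i lat * ('i lat => 'k fps)) list"

abbreviation cn :: "('i,'k) wall => 'i vec set" where "cn w == fst (snd w)"
abbreviation fn :: "('i,'k) wall => 'k fps" where "fn w == snd (snd w)"

section \<open>Lattice vectors, degrees and series supported on nonnegative vectors\<close>

definition nsc :: "nat => 'i lat => 'i lat" where
 "nsc s n = (%i. int s * n i)"

lemma nsc_0 [simp]: "nsc 0 n = 0" by (simp add: nsc_def fun_eq_iff)
lemma nsc_1 [simp]: "nsc (Suc 0) n = n" by (simp add: nsc_def fun_eq_iff)
lemma nsc_zero [simp]: "nsc s 0 = 0" by (simp add: nsc_def fun_eq_iff)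
lemma nsc_add: "nsc (s + t) n = nsc s n + nsc t n"
 by (simp add: nsc_def fun_eq_iff algebra_simps)
lemma nsc_nsc: "nsc s (nsc t n) = nsc (s * t) n"
 by (simp add: nsc_def fun_eq_iff algebra_simps)
lemma latt_0 [simp]: "0 \<in> latt J" by (simp add: latt_def)
lemma latt_add [simp]: "a \<in> latt J ==> b \<in> latt J ==> a + b \<in> latt J" by (simp add: latt_def)
lemma latt_diff [simp]: "a \<in> latt J ==> b \<in> latt J ==> a - b \<in> latt J" by (simp add: latt_def)
lemma latt_uminus [simp]: "a \<in> latt J ==> - a \<in> latt J" by (simp add: latt_def)
lemma latt_nsc [simp]: "a \<in> latt J ==> nsc s a \<in> latt J" by (simp add: latt_def nsc_def)
lemma latt_matB [simp]: "matB J eps n \<in> latt J" by (simp add: latt_def matB_def)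

lemma nonneg_latt: "n \<in> nonneg J ==> n \<in> latt J" by (simp add: nonneg_def)
lemma nonneg_0 [simp]: "0 \<in> nonneg J" by (simp add: nonneg_def)
lemma nonneg_add [simp]: "a \<in> nonneg J ==> b \<in> nonneg J ==> a + b \<in> nonneg J"
 by (simp add: nonneg_def)
lemma nonneg_nsc [simp]: "a \<in> nonneg J ==> nsc s a \<in> nonneg J"
 by (auto simp: nonneg_def nsc_def latt_def)
lemma posN_nonneg: "n \<in> posN J ==> n \<in> nonneg J" by (simp add: posN_def)
lemma posN_latt: "n \<in> posN J ==> n \<in> latt J" by (simp add: posN_def nonneg_def)
lemma posN_nz: "n \<in> posN J ==> n ~= 0" by (simp add: posN_def)

lemma degN_add: "degN J (a + b) = degN J a + degN J b" by (simp add: degN_def sum.distrib)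
lemma degN_diff: "degN J (a - b) = degN J a - degN J b" by (simp add: degN_def sum_subtractf)
lemma degN_0 [simp]: "degN J 0 = 0" by (simp add: degN_def)
lemma degN_nsc: "degN J (nsc s a) = int s * degN J a" by (simp add: degN_def nsc_def sum_distrib_left)
lemma degN_nonneg: "n \<in> nonneg J ==> 0 <= degN J n"
 by (auto simp: degN_def nonneg_def intro: sum_nonneg)

lemma matB_add: "matB J eps (a + b) = matB J eps a + matB J eps b"
 by (auto simp: matB_def fun_eq_iff sum.distrib algebra_simps)
lemma matB_diff: "matB J eps (a - b) = matB J eps a - matB J eps b"
 by (auto simp: matB_def fun_eq_iff sum_subtractf algebra_simps)
lemma matB_uminus: "matB J eps (- a) = - matB J eps a"
 by (auto simp: matB_def fun_eq_iff sum_negf)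
lemma matB_0 [simp]: "matB J eps 0 = 0" by (auto simp: matB_def fun_eq_iff)
lemma matB_nsc: "matB J eps (nsc s a) = nsc s (matB J eps a)"
 by (auto simp: matB_def nsc_def fun_eq_iff sum_distrib_left algebra_simps)

definition sup0 :: "'i set => ('i,'k::zero) zser => bool" where
 "sup0 J h \<longleftrightarrow> (ALL n. h n ~= 0 --> n \<in> nonneg J)"

lemma sup0_delta [simp]: "n \<in> nonneg J ==> sup0 J (delta n)"
 by (auto simp: sup0_def delta_def)

lemma sup0_0: "sup0 J h ==> n \<notin> nonneg J ==> h n = 0" by (auto simp: sup0_def)

lemma sup0_deg: "sup0 J h ==> degN J n < 0 ==> h n = 0"
 using degN_nonneg[of n J] by (auto simp: sup0_def)

text \<open>The series \<open>G n\<close> is read at the output exponent. For wall crossings it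
  depends on \<open>n\<close> only modulo multiples of \<open>e\<close>, so source and output give
  the same series. The bound \<open>nat (degN J n)\<close> loses nothing when \<open>h\<close> is
  supported on nonnegative vectors, since a direction \<open>e\<close> in \<open>posN J\<close> has
  degree at least 1.\<close>

definition ray :: "'i set => 'i lat => ('i lat => 'k::field fps) => ('i,'k) zser => ('i,'k) zser" where
 "ray J e G h n = (\<Sum>s\<le>nat (degN J n). h (n - nsc s e) * fps_nth (G n) s)"

locale seed =
 fixes J :: "'i set" and d :: "'i => nat" and eps :: "'i => 'i => int"
 assumes finJ: "finite J" and dpos: "\<And>i. i \<in> J ==> 0 < d i"
  and skew: "\<And>i j. i \<in> J ==> j \<in> J ==> int (d i) * eps i j = - (int (d j) * eps j i)"
begin

abbreviation B :: "'i lat => 'i lat" where "B \<equiv> matB J eps"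
abbreviation dg :: "'i lat => int" where "dg \<equiv> degN J"

lemma deg_pos: "n \<in> posN J ==> 0 < dg n"
proof -
 assume n: "n \<in> posN J"
 hence l: "ALL i:J. 0 <= n i" "ALL i. i \<notin> J --> n i = 0" "n ~= 0"
  by (auto simp: posN_def nonneg_def latt_def)
 then obtain i where i: "n i ~= 0" by (auto simp: fun_eq_iff)
 hence iJ: "i \<in> J" using l by auto
 have "0 < n i" using i l iJ by (metis order_le_less)
 moreover have "n i <= (\<Sum>i\<in>J. n i)"
  by (rule member_le_sum[OF iJ]) (use l finJ in auto)
 ultimately show ?thesis by (simp add: degN_def)
qed

lemma deg_pos1: "n \<in> posN J ==> 1 <= dg n" using deg_pos by fastforce

lemma nonneg_deg0: "n \<in> nonneg J ==> dg n <= 0 ==> n = 0"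
 using deg_pos[of n] by (cases "n = 0") (auto simp: posN_def)

lemma nsc_inj: "e \<in> posN J ==> nsc s e = nsc t e ==> s = t"
proof -
 assume e: "e \<in> posN J" and st: "nsc s e = nsc t e"
 have "int s * dg e = int t * dg e" using arg_cong[OF st, of dg] by (simp only: degN_nsc)
 thus "s = t" using deg_pos[OF e] by simp
qed

lemma posN_nsc [simp]: "e \<in> posN J ==> 0 < s ==> nsc s e \<in> posN J"
 by (metis Diff_iff nonneg_nsc nsc_0 nsc_inj posN_def posN_nonneg singletonD singletonI less_irrefl)

lemma posN_add: "a \<in> nonneg J ==> b \<in> posN J ==> a + b \<in> posN J"
proof -
 assume a: "a \<in> nonneg J" and b: "b \<in> posN J"
 have "dg (a + b) > 0" using deg_pos[OF b] degN_nonneg[OF a] by (simp add: degN_add)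
 hence "a + b ~= 0" by (metis degN_0 less_irrefl)
 thus ?thesis using a b by (auto simp: posN_def)
qed

lemma fin_deg: "finite {n \<in> nonneg J. dg n < k}"
proof -
 have "{n \<in> nonneg J. dg n < k} \<subseteq> (%f i. if i \<in> J then f i else 0) ` (PiE J (%_. {0..k}))"
 proof
  fix n assume "n \<in> {n \<in> nonneg J. dg n < k}"
  hence n: "n \<in> nonneg J" "dg n < k" by auto
  hence l: "ALL i:J. 0 <= n i" "ALL i. i \<notin> J --> n i = 0"
   by (auto simp: nonneg_def latt_def)
  have "n i <= k" if "i \<in> J" for i
  proof -
   have "n i <= (\<Sum>i\<in>J. n i)" by (rule member_le_sum[OF that]) (use l finJ in auto)
   thus ?thesis using n by (simp add: degN_def)
  qed
  hence "restrict n J \<in> PiE J (%_. {0..k})" using l by auto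
  moreover have "n = (%i. if i \<in> J then (restrict n J) i else 0)" using l by auto
  ultimately show "n \<in> (%f i. if i \<in> J then f i else 0) ` (PiE J (%_. {0..k}))" by blast
 qed
 moreover have "finite (PiE J (%_. {0..k}))" by (intro finite_PiE finJ) auto
 ultimately show ?thesis using finite_surj by blast
qed

section \<open>The pairing and its skew form\<close>

definition DD :: nat where "DD = (\<Prod>i\<in>J. d i)"
text \<open>\<open>DD\<close> clears the denominators \<open>d i\<close>, so that vanishing of the
  pairing becomes an integer condition. Orthogonality therefore means the same in the coefficient
  field (algebra of words) and in the reals (geometry of walls).\<close>

definition ipair :: "'i lat => 'i lat => int" where
 "ipair n mu = (\<Sum>i\<in>J. n i * mu i * int (DD div d i))"
definition pr :: "'i lat => 'i lat => 'k::field_char_0" where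
 "pr n mu = (\<Sum>i\<in>J. of_int (n i * mu i) / of_nat (d i))"

lemma DD_pos: "0 < DD" using dpos finJ by (auto simp: DD_def intro: prod_pos)
lemma d_dvd_DD: "i \<in> J ==> d i dvd DD" using finJ by (auto simp: DD_def)

lemma pr_ipair: "pr n mu = (of_int (ipair n mu) / of_nat DD :: 'k::field_char_0)"
proof -
 have "(of_int (n i * mu i) / of_nat (d i) :: 'k) = of_int (n i * mu i * int (DD div d i)) / of_nat DD"
  if "i \<in> J" for i
 proof -
  from d_dvd_DD[OF that] obtain c where c: "DD = d i * c" by (rule dvdE)
  have "c ~= 0" using c DD_pos by (cases c) auto
  thus ?thesis using dpos[OF that] by (simp add: c field_simps)
 qed
 thus ?thesis unfolding pr_def ipair_def by (simp add: sum_divide_distrib)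
qed

lemma pr_eq_0_iff: "(pr n mu :: 'k::field_char_0) = 0 \<longleftrightarrow> ipair n mu = 0"
 using DD_pos by (simp add: pr_ipair)

lemma pr_add1: "pr (a + b) mu = pr a mu + pr b mu"
 by (simp add: pr_def sum.distrib add_divide_distrib algebra_simps)
lemma pr_add2: "pr a (mu + nu) = pr a mu + pr a nu"
 by (simp add: pr_def sum.distrib add_divide_distrib algebra_simps)
lemma pr_diff2: "pr a (mu - nu) = pr a mu - pr a nu"
 by (simp add: pr_def sum_subtractf diff_divide_distrib algebra_simps)
lemma pr_0 [simp]: "pr 0 mu = 0" "pr n 0 = 0" by (simp_all add: pr_def)
lemma pr_nsc1: "pr (nsc s a) mu = of_nat s * pr a mu"
 by (simp add: pr_def nsc_def sum_distrib_left mult.assoc)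
lemma pr_nsc2: "pr a (nsc s mu) = of_nat s * pr a mu"
 by (simp add: pr_def nsc_def sum_distrib_left mult_ac)

text \<open>The form (a, b) |-> <a, bB> has matrix entries \<open>eps i j / d j\<close>, and
  skew-symmetrizability of \<open>eps\<close> says precisely that this matrix is
  antisymmetric.\<close>

lemma pr_skew: "pr a (B b) = - pr b (B a)"
proof -
 have "pr a (B b) = (\<Sum>j\<in>J. \<Sum>i\<in>J. of_int (a j * b i) * (of_int (eps i j) / of_nat (d j)))"
  unfolding pr_def matB_def
  by (intro sum.cong refl) (simp add: sum_distrib_left sum_divide_distrib mult_ac)
 also have "\<dots> = (\<Sum>j\<in>J. \<Sum>i\<in>J. - (of_int (a j * b i) * (of_int (eps j i) / of_nat (d i))))"
 proof (intro sum.cong refl)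
  fix i j assume ij: "j \<in> J" "i \<in> J"
  have "of_int (int (d i) * eps i j) = (of_int (- (int (d j) * eps j i)) :: 'b)"
   using skew[OF ij(2,1)] by simp
  hence "of_nat (d i) * of_int (eps i j) = - (of_nat (d j) * of_int (eps j i) :: 'b)" by simp
  hence "of_int (eps i j) / of_nat (d j) = (- (of_int (eps j i) / of_nat (d i)) :: 'b)"
   using dpos ij by (simp add: field_simps)
  thus "of_int (a j * b i) * (of_int (eps i j) / of_nat (d j)) =
   - (of_int (a j * b i) * (of_int (eps j i) / of_nat (d i)) :: 'b)" by simp
 qed
 also have "\<dots> = - (\<Sum>i\<in>J. \<Sum>j\<in>J. of_int (b i * a j) * (of_int (eps j i) / of_nat (d i)))"
  by (subst sum.swap) (simp add: sum_negf mult_ac)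
 also have "\<dots> = - pr b (B a)"
  unfolding pr_def matB_def
  by (intro arg_cong[where f=uminus] sum.cong refl) (simp add: sum_distrib_left sum_divide_distrib mult_ac)
 finally show ?thesis .
qed

lemma pr_self [simp]: "pr a (B a) = 0"
proof -
 have "ipair a (B a) = - ipair a (B a)"
  using pr_skew[of a a, where 'a=rat] DD_pos
  by (simp only: pr_ipair) (simp add: field_simps flip: of_int_minus)
 thus ?thesis by (simp add: pr_eq_0_iff)
qed

lemma pr_posN_ex: "n \<in> posN J ==> EX mu:latt J. (pr n mu :: 'k::field_char_0) ~= 0"
proof -
 assume n: "n \<in> posN J"
 hence l: "ALL i. i \<notin> J --> n i = 0" "n ~= 0" by (auto simp: posN_def nonneg_def latt_def)
 then obtain i where i: "n i ~= 0" by (auto simp: fun_eq_iff)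
 hence iJ: "i \<in> J" using l by auto
 have "(pr n (unitv i) :: 'k) = (\<Sum>j\<in>J. if j = i then of_int (n i) / of_nat (d i) else 0)"
  unfolding pr_def unitv_def by (intro sum.cong) auto
 also have "\<dots> = of_int (n i) / of_nat (d i)" using iJ finJ by simp
 finally have "(pr n (unitv i) :: 'k) ~= 0" using i dpos[OF iJ] by simp
 moreover have "unitv i \<in> latt J" using iJ by (auto simp: unitv_def latt_def)
 ultimately show ?thesis by blast
qed

lemma nscale_props:
 "0 < nscale J d n" "i \<in> J ==> int (d i) dvd int (nscale J d n) * n i"
proof -
 let ?P = "%k::nat. 0 < k & (ALL i:J. int (d i) dvd int k * n i)"
 have "?P DD" using DD_pos d_dvd_DD by (auto intro: dvd_mult2)
 hence "?P (nscale J d n)" unfolding nscale_def by (rule LeastI)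
 thus "0 < nscale J d n" "i \<in> J ==> int (d i) dvd int (nscale J d n) * n i" by auto
qed

lemma pairNo_pr: "(of_int (pairNo J d n mu) :: 'k::field_char_0) = of_nat (nscale J d n) * pr n mu"
 unfolding pairNo_def pr_def sum_distrib_left of_int_sum
proof (intro sum.cong refl)
 fix i assume i: "i \<in> J"
 obtain c where c: "int (nscale J d n) * n i = int (d i) * c" using nscale_props(2)[OF i] by (auto elim: dvdE)
 have "(of_nat (nscale J d n) * of_int (n i) :: 'k) = of_int (int (nscale J d n) * n i)" by simp
 also have "\<dots> = of_nat (d i) * of_int c" unfolding c by simp
 finally have e: "(of_nat (nscale J d n) * of_int (n i) :: 'k) = of_nat (d i) * of_int c" .
 have "(of_int (int (nscale J d n) * n i div int (d i) * mu i) :: 'k) = of_int c * of_int (mu i)"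
  unfolding c using dpos[OF i] by simp
 also have "\<dots> = (of_nat (d i) * of_int c) * of_int (mu i) / of_nat (d i)"
  using dpos[OF i] by (simp add: field_simps)
 also have "\<dots> = of_nat (nscale J d n) * (of_int (n i * mu i) / of_nat (d i))"
  unfolding e[symmetric] by simp
 finally show "(of_int (int (nscale J d n) * n i div int (d i) * mu i) :: 'k) =
    of_nat (nscale J d n) * (of_int (n i * mu i) / of_nat (d i))" .
qed

lemma pairNo_eq_0_iff: "pairNo J d n mu = 0 \<longleftrightarrow> ipair n mu = 0"
proof -
 have "(of_int (pairNo J d n mu) :: rat) = 0 \<longleftrightarrow> (pr n mu :: rat) = 0"
  using nscale_props(1)[of n] by (simp add: pairNo_pr)
 thus ?thesis by (simp add: pr_eq_0_iff)
qed

lemma pairNo_add: "pairNo J d n (mu + nu) = pairNo J d n mu + pairNo J d n nu"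
proof -
 have "(of_int (pairNo J d n (mu + nu)) :: rat) = of_int (pairNo J d n mu + pairNo J d n nu)"
  by (simp add: pairNo_pr pr_add2 algebra_simps)
 thus ?thesis by (simp only: of_int_eq_iff)
qed

lemma pairNo_self: "pairNo J d n (B (nsc s n)) = 0"
proof -
 have "(pr n (B (nsc s n)) :: rat) = 0" by (simp add: matB_nsc pr_nsc2)
 thus ?thesis by (simp add: pairNo_eq_0_iff pr_eq_0_iff)
qed

text \<open>Since <e, eB> = 0, moving an exponent along \<open>e\<close> does not change its pairing
  with \<open>e\<close>. This is why a wall crossing may take its power at the source or at the
  target exponent.\<close>

lemma pairNo_inv: "pairNo J d e (m + B (n - nsc s e)) = pairNo J d e (m + B n)"
proof -
 have "m + B n = (m + B (n - nsc s e)) + B (nsc s e)" by (simp add: matB_diff)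
 thus ?thesis using pairNo_add pairNo_self by (metis add_0_right)
qed

lemma pr_inv: "pr e (m + B (n - nsc s e)) = pr e (m + B n)"
 by (simp add: matB_diff matB_nsc pr_add2 pr_diff2 pr_nsc2)

subsection \<open>Ray operators\<close>

lemma ray_zero_tail:
 assumes "sup0 J h" "e \<in> posN J" "nat (dg n) < s"
 shows "h (n - nsc s e) = 0"
proof (rule sup0_deg[OF assms(1)])
 have "int s <= int s * dg e" using mult_left_mono[OF deg_pos1[OF assms(2)], of "int s"] by simp
 thus "dg (n - nsc s e) < 0" using assms(3) unfolding degN_diff degN_nsc by linarith
qed

lemma ray_eq:
 assumes "sup0 J h" "e \<in> posN J" "nat (dg n) <= K"
 shows "ray J e G h n = (\<Sum>s\<le>K. h (n - nsc s e) * fps_nth (G n) s)"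
 unfolding ray_def
 by (rule sum.mono_neutral_left) (use assms ray_zero_tail[OF assms(1,2)] in "auto simp: not_le")

lemma ray_sup0:
 assumes "sup0 J h" "e \<in> posN J"
 shows "sup0 J (ray J e G h)"
 unfolding sup0_def
proof (intro allI impI)
 fix n assume "ray J e G h n ~= 0"
 then obtain s where s: "h (n - nsc s e) ~= 0" unfolding ray_def by (auto elim!: sum.not_neutral_contains_not_neutral)
 hence "n - nsc s e \<in> nonneg J" using assms by (auto simp: sup0_def)
 moreover have "nsc s e \<in> nonneg J" using assms(2) by (simp add: posN_nonneg)
 ultimately have "(n - nsc s e) + nsc s e \<in> nonneg J" by (rule nonneg_add)
 thus "n \<in> nonneg J" by simp
qed

text \<open>A Cauchy product along the ray. Invariance of \<open>G2\<close> replaces the inner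
  series at \<open>n - nsc s e\<close> by \<open>G2 n\<close>; the square of summation indices is
  then cut to the triangle s + t <= K, beyond which \<open>h\<close> vanishes for degree
  reasons.\<close>

lemma ray_comp:
 assumes h: "sup0 J h" and e: "e \<in> posN J" and inv: "\<And>n s. G2 (n - nsc s e) = G2 n"
 shows "ray J e G1 (ray J e G2 h) = ray J e (%n. G1 n * G2 n) h"
proof
 fix n
 define K where "K = nat (dg n)"
 have A: "ray J e G2 h (n - nsc s e) = (\<Sum>t\<le>K. h (n - nsc (s + t) e) * fps_nth (G2 n) t)" for s
 proof -
  have "dg (n - nsc s e) <= dg n" using deg_pos[OF e] by (simp add: degN_diff degN_nsc)
  hence "nat (dg (n - nsc s e)) <= K" by (simp add: K_def nat_mono)
  from ray_eq[OF h e this] show ?thesis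
   by (simp add: inv nsc_add diff_diff_eq)
 qed
 have "ray J e G1 (ray J e G2 h) n =
   (\<Sum>s\<le>K. \<Sum>t\<le>K. h (n - nsc (s + t) e) * fps_nth (G2 n) t * fps_nth (G1 n) s)"
  unfolding ray_def[of J e G1] K_def[symmetric] A by (simp add: sum_distrib_right)
 also have "\<dots> = (\<Sum>(s,t)\<in>{..K}\<times>{..K}. h (n - nsc (s + t) e) * fps_nth (G2 n) t * fps_nth (G1 n) s)"
  by (simp add: sum.cartesian_product)
 also have "\<dots> = (\<Sum>(s,t)\<in>{(s,t). s + t <= K}. h (n - nsc (s + t) e) * fps_nth (G2 n) t * fps_nth (G1 n) s)"
 proof (rule sum.mono_neutral_right)
  have z: "h (n - nsc (a + b) e) = 0" if "\<not> a + b <= K" for a b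
   using ray_zero_tail[OF h e, of n "a + b"] that by (simp add: K_def)
  show "ALL i:{..K} \<times> {..K} - {(s, t). s + t <= K}.
    (case i of (s, t) => h (n - nsc (s + t) e) * fps_nth (G2 n) t * fps_nth (G1 n) s) = 0"
   by (intro ballI, elim DiffE SigmaE) (simp add: z)
 qed auto
 also have "\<dots> = (\<Sum>k\<le>K. \<Sum>s\<le>k. h (n - nsc (s + (k - s)) e) * fps_nth (G2 n) (k - s) * fps_nth (G1 n) s)"
  by (rule sum.triangle_reindex_eq)
 also have "\<dots> = (\<Sum>k\<le>K. h (n - nsc k e) * fps_nth (G1 n * G2 n) k)"
  by (intro sum.cong refl) (simp add: fps_mult_nth sum_distrib_left atMost_atLeast0 mult_ac)
 finally show "ray J e G1 (ray J e G2 h) n = ray J e (%n. G1 n * G2 n) h n"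
  by (simp add: ray_def K_def)
qed

lemma ray_1: "ray J e (%n. 1) h = h"
proof
 fix n show "ray J e (%n. 1) h n = h n"
  unfolding ray_def
  by (simp add: if_distrib[of "%x. _ * x"] cong: if_cong)
qed

text \<open>In the box sum only the points n' - j e meet the support of \<open>wzeta\<close>; those
  outside the box lie outside the support of \<open>h\<close>. Then \<open>pairNo_inv\<close> moves
  the power from the source to the target exponent.\<close>

lemma cross_ray:
 fixes h :: "('i, 'k::field) zser"
 assumes h: "sup0 J h" and e: "fst w \<in> posN J"
 shows "cross J d eps w s m h =
  ray J (fst w) (%n. fpow (fn w) (s * pairNo J d (fst w) (m + B n))) h"
proof
 fix n'
 let ?e = "fst w"
 let ?G = "%n. fpow (fn w) (s * pairNo J d (fst w) (m + B n))"
 have wz: "wzeta ?e g (nsc j ?e) = fps_nth g j" for g :: "'k fps" and j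
 proof -
  have "(THE i. nsc j ?e = (%x. int i * ?e x)) = j"
   using nsc_inj[OF e] by (intro the_equality) (auto simp: nsc_def)
  thus ?thesis unfolding wzeta_def by (auto simp: nsc_def)
 qed
 let ?S = "{j. j <= nat (dg n') & n' - nsc j ?e \<in> box J n'}"
 have "cross J d eps w s m h n' = (\<Sum>n\<in>(%j. n' - nsc j ?e) ` ?S.
   h n * wzeta ?e (?G n) (n' - n))"
  unfolding cross_def
 proof (rule sum.mono_neutral_right)
  show "finite (box J n')"
  proof (rule finite_subset[OF _ fin_deg[of "dg n' + 1"]])
   show "box J n' \<subseteq> {n \<in> nonneg J. dg n < dg n' + 1}"
    by (auto simp: box_def degN_def intro!: sum_mono)
  qed
  show "(%j. n' - nsc j ?e) ` ?S \<subseteq> box J n'" by auto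
  show "ALL n:box J n' - (%j. n' - nsc j ?e) ` ?S. h n * wzeta ?e (?G n) (n' - n) = 0"
  proof
   fix n assume n: "n \<in> box J n' - (%j. n' - nsc j ?e) ` ?S"
   show "h n * wzeta ?e (?G n) (n' - n) = 0"
   proof (rule ccontr)
    assume ne: "h n * wzeta ?e (?G n) (n' - n) ~= 0"
    then obtain j :: nat where "n' - n = (%i. int j * ?e i)"
     unfolding wzeta_def by (auto split: if_splits)
    hence nj: "n' - n = nsc j ?e" by (simp add: nsc_def)
    hence nn: "n = n' - nsc j ?e" by (simp add: nj[symmetric])
    have "h (n' - nsc j ?e) ~= 0" using ne nn by auto
    hence "j <= nat (dg n')" using ray_zero_tail[OF h e, of n' j] by linarith
    thus False using n nn by auto
   qed
  qed
 qed
 also have "\<dots> = (\<Sum>j\<in>?S. h (n' - nsc j ?e) * wzeta ?e (?G (n' - nsc j ?e)) (n' - (n' - nsc j ?e)))"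
  by (subst sum.reindex) (auto simp: inj_on_def dest: nsc_inj[OF e])
 also have "\<dots> = (\<Sum>j\<in>?S. h (n' - nsc j ?e) * fps_nth (?G n') j)"
  by (intro sum.cong refl) (simp add: wz pairNo_inv)
 also have "\<dots> = ray J ?e ?G h n'"
  unfolding ray_def
 proof (rule sum.mono_neutral_left)
  show "ALL i:{..nat (dg n')} - ?S. h (n' - nsc i ?e) * fps_nth (?G n') i = 0"
  proof
   fix j assume j: "j \<in> {..nat (dg n')} - ?S"
   have "n' - nsc j ?e \<notin> nonneg J"
   proof
    assume nn: "n' - nsc j ?e \<in> nonneg J"
    have "0 <= nsc j ?e i" if "i \<in> J" for i using e that by (auto simp: posN_def nonneg_def nsc_def)
    hence "n' - nsc j ?e \<in> box J n'" using nn by (auto simp: box_def)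
    thus False using j by auto
   qed
   thus "h (n' - nsc j ?e) * fps_nth (?G n') j = 0" using sup0_0[OF h] by simp
  qed
 qed auto
 finally show "cross J d eps w s m h n' = ray J ?e ?G h n'" .
qed

end

text \<open>Pointwise evaluation is switched off, so that the simplifier treats lattice vectors as
  elements of an abelian group; \<open>fun_app\<close> brings it back where coordinates
  matter.\<close>

lemmas fun_app = plus_fun_apply zero_fun_apply minus_apply uminus_apply
declare fun_app [simp del]

context seed begin

section \<open>Words of ray operators and their matrix coefficients below a degree\<close>

definition Nk :: "int => 'i lat set" where "Nk k = {n \<in> nonneg J. dg n < k}"

lemma Nk_fin [simp]: "finite (Nk k)" unfolding Nk_def by (rule fin_deg)
lemma NkI: "n \<in> nonneg J ==> dg n < k ==> n \<in> Nk k" by (simp add: Nk_def)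
lemma NkD: "n \<in> Nk k ==> n \<in> nonneg J" "n \<in> Nk k ==> dg n < k" "n \<in> Nk k ==> n \<in> latt J"
 by (auto simp: Nk_def nonneg_latt)

text \<open>The middle clause says that the series depends on \<open>mu\<close> only modulo
  \<open>B (fst r)\<close>. It is what makes operators along one ray compose by multiplying their
  series.\<close>

definition okr :: "'i lat \<times> ('i lat => 'k::field fps) => bool" where
 "okr r \<longleftrightarrow> fst r \<in> posN J & (ALL mu s. snd r (mu - B (nsc s (fst r))) = snd r mu) & (ALL mu. fps_nth (snd r mu) 0 = 1)"

definition rop :: "'i lat \<times> ('i lat => 'k::field fps) => 'i lat => ('i,'k) zser => ('i,'k) zser" where
 "rop r m h = ray J (fst r) (%n. snd r (m + B n)) h"

definition ract :: "('i,'k::field) rword => 'i lat => ('i,'k) zser => ('i,'k) zser" where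
 "ract rs m h = foldl (%h r. rop r m h) h rs"

text \<open>The coefficient of z^m zeta^n in the image of z^m. By \<open>ract_expand\<close> these
  numbers determine the whole operator, so words are compared through them.\<close>

definition rc :: "('i,'k::field) rword => 'i lat => 'i lat => 'k" where
 "rc rs m n = ract rs m (delta 0) n"

definition okrs :: "('i,'k::field) rword => bool" where
 "okrs rs \<longleftrightarrow> (ALL r:set rs. okr r)"

lemma okrs_simps [simp]: "okrs []" "okrs (r # rs) \<longleftrightarrow> okr r & okrs rs"
 "okrs (rs @ rs') \<longleftrightarrow> okrs rs & okrs rs'" "okrs (rev rs) \<longleftrightarrow> okrs rs"
 by (auto simp: okrs_def)

lemma ract_Nil [simp]: "ract [] m h = h" by (simp add: ract_def)
lemma ract_append: "ract (rs @ rs') m h = ract rs' m (ract rs m h)" by (simp add: ract_def)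
lemma ract_Cons: "ract (r # rs) m h = ract rs m (rop r m h)" by (simp add: ract_def)

lemma rop_sup0: "okr r ==> sup0 J h ==> sup0 J (rop r m h)"
 by (auto simp: rop_def okr_def intro: ray_sup0)

lemma ract_sup0: "okrs rs ==> sup0 J h ==> sup0 J (ract rs m h)"
 by (induction rs arbitrary: h) (auto simp: ract_Cons rop_sup0)

lemma rc_sup0: "okrs rs ==> sup0 J (rc rs m)"
 unfolding rc_def by (rule ract_sup0) auto

text \<open>A letter acts on z^m zeta^a through m + aB alone. Hence the series attached to z^m
  zeta^a is that of z^(m + aB), shifted by \<open>a\<close>; the claim is linearity in
  \<open>h\<close> on top of this, by induction from the end of the word.\<close>

lemma ract_expand:
 assumes "okrs rs" "sup0 J h" "dg n < k"
 shows "ract rs m h n = (\<Sum>a\<in>Nk k. h a * rc rs (m + B a) (n - a))"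
 using assms(1,3)
proof (induction rs arbitrary: n rule: rev_induct)
 case Nil
 have "(\<Sum>a\<in>Nk k. h a * delta 0 (n - a)) = (\<Sum>a\<in>Nk k. if a = n then h n else 0)"
  by (intro sum.cong) (auto simp: delta_def)
 also have "\<dots> = h n" using Nil sup0_0[OF assms(2), of n] by (auto simp: Nk_def fin_deg)
 finally show ?case unfolding rc_def ract_Nil by (rule sym)
next
 case (snoc r rs)
 let ?e = "fst r" let ?G = "snd r"
 have e: "?e \<in> posN J" and rs: "okrs rs" using snoc.prems by (auto simp: okr_def)
 have inv: "?G (mu - B (nsc s ?e)) = ?G mu" for mu s using snoc.prems by (auto simp: okr_def)
 have s0: "sup0 J (ract rs m h)" by (rule ract_sup0[OF rs assms(2)])
 define K where "K = nat (dg n)"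
 have dle: "dg (n - nsc s ?e) < k" for s
  using snoc.prems(2) deg_pos[OF e] by (simp add: degN_diff degN_nsc) (smt (verit) mult_nonneg_nonneg of_nat_0_le_iff)
 have A: "ract (rs @ [r]) m h n = (\<Sum>s\<le>K. ract rs m h (n - nsc s ?e) * fps_nth (?G (m + B n)) s)"
  unfolding ract_append by (simp add: ract_def rop_def) (simp add: ray_def K_def)
 also have "\<dots> = (\<Sum>s\<le>K. \<Sum>a\<in>Nk k. h a * rc rs (m + B a) (n - nsc s ?e - a) * fps_nth (?G (m + B n)) s)"
  by (simp add: snoc.IH[OF rs dle] sum_distrib_right)
 also have "\<dots> = (\<Sum>a\<in>Nk k. h a * (\<Sum>s\<le>K. rc rs (m + B a) (n - nsc s ?e - a) * fps_nth (?G (m + B n)) s))"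
  by (subst sum.swap) (simp add: sum_distrib_left mult.assoc)
 also have "\<dots> = (\<Sum>a\<in>Nk k. h a * rc (rs @ [r]) (m + B a) (n - a))"
 proof (intro sum.cong refl)
  fix a assume a: "a \<in> Nk k"
  have "rc (rs @ [r]) (m + B a) (n - a) = ray J ?e (%x. ?G (m + B a + B x)) (rc rs (m + B a)) (n - a)"
   by (simp add: rc_def[abs_def] ract_append) (simp add: ract_def rop_def)
  also have "\<dots> = (\<Sum>s\<le>K. rc rs (m + B a) (n - a - nsc s ?e) * fps_nth (?G (m + B a + B (n - a))) s)"
  proof (rule ray_eq[OF rc_sup0[OF rs] e])
   show "nat (dg (n - a)) <= K" using degN_nonneg[OF NkD(1)[OF a]] by (simp add: K_def degN_diff nat_mono)
  qed
  also have "\<dots> = (\<Sum>s\<le>K. rc rs (m + B a) (n - nsc s ?e - a) * fps_nth (?G (m + B n)) s)"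
   by (simp add: matB_diff algebra_simps)
  finally show "h a * (\<Sum>s\<le>K. rc rs (m + B a) (n - nsc s ?e - a) * fps_nth (?G (m + B n)) s) =
   h a * rc (rs @ [r]) (m + B a) (n - a)" by simp
 qed
 finally show ?case .
qed

lemma rc_append:
 assumes "okrs r1" "okrs r2" "dg n < k"
 shows "rc (r1 @ r2) m n = (\<Sum>a\<in>Nk k. rc r1 m a * rc r2 (m + B a) (n - a))"
 unfolding rc_def[of "r1 @ r2"] ract_append
 using ract_expand[OF assms(2) rc_sup0[OF assms(1)] assms(3)] by (simp add: rc_def[abs_def])

lemma rc_Nil [simp]: "rc [] m n = (if n = 0 then 1 else 0)" by (simp add: rc_def delta_def)

lemma rc_0: "okrs rs ==> rc rs m 0 = 1"
proof (induction rs rule: rev_induct)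
 case (snoc r rs)
 have "rc (rs @ [r]) m 0 = rc rs m 0 * fps_nth (snd r (m + B 0)) 0"
  unfolding rc_def ract_append by (simp add: ract_def rop_def) (simp add: ray_def)
 thus ?case using snoc by (simp add: okr_def)
qed simp

lemma rc_neg: "okrs rs ==> n \<notin> nonneg J ==> rc rs m n = 0"
 using rc_sup0 sup0_0 by blast

lemma rc_deg0: "okrs rs ==> dg n < 1 ==> rc rs m n = (if n = 0 then 1 else 0)"
 using rc_0 rc_neg nonneg_deg0[of n] by (cases "n \<in> nonneg J") auto

text \<open>Equality of group elements modulo the subgroup of elements that are trivial below degree
  \<open>k\<close>; every statement about the infinite group is made through these
  quotients.\<close>

definition req :: "int => ('i,'k::field) rword => ('i,'k) rword => bool"
 where "req k r r' \<longleftrightarrow> (ALL m:latt J. ALL n. dg n < k --> rc r m n = rc r' m n)"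

lemma reqD: "req k r r' ==> m \<in> latt J ==> dg n < k ==> rc r m n = rc r' m n"
 by (simp add: req_def)
lemma req_refl [simp]: "req k r r" by (simp add: req_def)
lemma req_sym: "req k r r' ==> req k r' r" by (simp add: req_def)
lemma req_trans [trans]: "req k r r' ==> req k r' r'' ==> req k r r''" by (simp add: req_def)
lemma req_mono: "req k r r' ==> l <= k ==> req l r r'" by (auto simp: req_def)

lemma req_1: "okrs r ==> okrs r' ==> k <= 1 ==> req k r r'"
 by (auto simp: req_def rc_deg0)

lemma req_ract:
 assumes "req k r r'" "okrs r" "okrs r'" "m \<in> latt J" "sup0 J h" "dg n < k"
 shows "ract r m h n = ract r' m h n"
proof -
 have "h a * rc r (m + B a) (n - a) = h a * rc r' (m + B a) (n - a)" if "a \<in> Nk k" for a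
  using reqD[OF assms(1), of "m + B a" "n - a"] assms(4,6) degN_nonneg[OF NkD(1)[OF that]]
  by (simp add: degN_diff)
 thus ?thesis
  unfolding ract_expand[OF assms(2,5,6)] ract_expand[OF assms(3,5,6)] by (intro sum.cong refl)
qed

lemma req_append:
 assumes "req k a a'" "req k b b'" "okrs a" "okrs a'" "okrs b" "okrs b'"
 shows "req k (a @ b) (a' @ b')"
 unfolding req_def
proof (intro ballI allI impI)
 fix m n assume mn: "m \<in> latt J" "dg n < k"
 have "rc a m x * rc b (m + B x) (n - x) = rc a' m x * rc b' (m + B x) (n - x)" if "x \<in> Nk k" for x
  using reqD[OF assms(2), of "m + B x" "n - x"] reqD[OF assms(1), of m x] NkD[OF that] mn
   degN_nonneg[OF NkD(1)[OF that]] by (simp add: degN_diff)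
 thus "rc (a @ b) m n = rc (a' @ b') m n"
  unfolding rc_append[OF assms(3,5) mn(2)] rc_append[OF assms(4,6) mn(2)] by (intro sum.cong refl)
qed

definition rinv :: "('i,'k::field) rword => ('i,'k) rword" where
 "rinv rs = rev (map (%r. (fst r, %mu. inverse (snd r mu))) rs)"

lemma okr_inv: "okr r ==> okr (fst r, %mu. inverse (snd r mu))"
 by (auto simp: okr_def)

lemma okrs_rinv [simp]: "okrs rs ==> okrs (rinv rs)"
 by (induction rs) (auto simp: rinv_def okr_inv)

lemma okr_shift: "okr r ==> snd r (m + B (n - nsc s (fst r))) = snd r (m + B n)"
proof -
 have e: "m + B (n - nsc s (fst r)) = (m + B n) - B (nsc s (fst r))" by (simp add: matB_diff algebra_simps)
 show "okr r ==> ?thesis" unfolding e by (simp add: okr_def)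
qed

lemma rop_inv:
 assumes "okr r" "sup0 J h"
 shows "rop (fst r, %mu. inverse (snd r mu)) m (rop r m h) = h"
  and "rop r m (rop (fst r, %mu. inverse (snd r mu)) m h) = h"
proof -
 have e: "fst r \<in> posN J" and nz: "fps_nth (snd r mu) 0 ~= 0" for mu using assms by (auto simp: okr_def)
 show "rop (fst r, %mu. inverse (snd r mu)) m (rop r m h) = h"
  unfolding rop_def fst_conv snd_conv
  by (subst ray_comp[OF assms(2) e]) (simp_all add: okr_shift[OF assms(1)] inverse_mult_eq_1 nz ray_1)
 show "rop r m (rop (fst r, %mu. inverse (snd r mu)) m h) = h"
  unfolding rop_def fst_conv snd_conv
  by (subst ray_comp[OF assms(2) e]) (simp_all add: okr_shift[OF assms(1)] inverse_mult_eq_1' nz ray_1)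
qed

lemma ract_rinv: "okrs rs ==> sup0 J h ==> ract (rinv rs) m (ract rs m h) = h"
proof (induction rs arbitrary: h)
 case (Cons r rs)
 have "rinv (r # rs) = rinv rs @ [(fst r, %mu. inverse (snd r mu))]" by (simp add: rinv_def)
 thus ?case using Cons rop_inv(1)[of r h m]
  by (simp add: ract_append ract_Cons rop_sup0)
qed (simp add: rinv_def)

lemma ract_rinv': "okrs rs ==> sup0 J h ==> ract rs m (ract (rinv rs) m h) = h"
proof (induction rs arbitrary: h rule: rev_induct)
 case (snoc r rs)
 have "rinv (rs @ [r]) = (fst r, %mu. inverse (snd r mu)) # rinv rs" by (simp add: rinv_def)
 thus ?case using snoc rop_inv(2)[of r h m]
  by (simp add: ract_append ract_Cons rop_sup0 okr_inv)
qed (simp add: rinv_def)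

lemma req_rinv: "okrs r ==> req k (r @ rinv r) []" "okrs r ==> req k (rinv r @ r) []"
 unfolding req_def rc_def ract_append by (auto simp: ract_rinv ract_rinv')

lemma req_cancel_left:
 assumes "req k (a @ b) (a' @ b')" "req k a a'" "okrs a" "okrs a'" "okrs b" "okrs b'"
 shows "req k b b'"
proof -
 have Y1: "req k (rinv a @ (a @ b)) (rinv a @ (a' @ b'))"
  by (rule req_append) (use assms in auto)
 have Y2: "req k (rinv a @ (a' @ b')) (rinv a @ (a @ b'))"
  by (intro req_append) (use assms in "auto intro: req_sym")
 have "req k ((rinv a @ a) @ x) ([] @ x)" if "okrs x" for x
  by (rule req_append) (use assms that in "auto intro: req_rinv")
 note X = this
 have "req k b (rinv a @ (a @ b))" using req_sym[OF X[OF assms(5)]] by simp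
 also note Y1
 also note Y2
 also have "req k (rinv a @ (a @ b')) b'" using X[OF assms(6)] by simp
 finally show ?thesis .
qed

lemma req_cancel_right:
 assumes "req k (b @ a) (b' @ a')" "req k a a'" "okrs a" "okrs a'" "okrs b" "okrs b'"
 shows "req k b b'"
proof -
 have Y1: "req k ((b @ a) @ rinv a) ((b' @ a') @ rinv a)"
  by (rule req_append) (use assms in auto)
 have Y2: "req k ((b' @ a') @ rinv a) ((b' @ a) @ rinv a)"
  by (intro req_append) (use assms in "auto intro: req_sym")
 have "req k (x @ (a @ rinv a)) (x @ [])" if "okrs x" for x
  by (rule req_append) (use assms that in "auto intro: req_rinv")
 note X = this
 have "req k b ((b @ a) @ rinv a)" using req_sym[OF X[OF assms(5)]] by simp
 also note Y1
 also note Y2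
 also have "req k ((b' @ a) @ rinv a) b'" using X[OF assms(6)] by simp
 finally show ?thesis .
qed

text \<open>An element that is trivial below degree \<open>k\<close> is central modulo degree
  \<open>k + 1\<close>: in a product of coefficients whose exponents add up to \<open>n\<close>, its
  part of degree \<open>k\<close> forces the other factors to have degree 0. So it contributes
  additively, wherever it stands in the word.\<close>

lemma rc_top:
 assumes ok: "okrs A" "okrs r" "okrs C" and triv: "req k r []" and k: "0 < k"
  and m: "m \<in> latt J" and n: "dg n <= k"
 shows "rc (A @ r @ C) m n = rc (A @ C) m n + rc r m n - (if n = 0 then 1 else 0)"
proof (cases "n \<in> nonneg J")
 case False
 thus ?thesis using ok by (auto simp: rc_neg)
next
 case nn: True
 show ?thesis
 proof (cases "dg n < k")
  case True
  have "req k (A @ r @ C) (A @ [] @ C)" by (intro req_append) (use ok triv in auto)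
  thus ?thesis using reqD[OF triv m True] reqD[OF _ m True] by auto
 next
  case False
  hence dn: "dg n = k" and n0: "n ~= 0" using n k by auto
  have lt: "dg n < k + 1" using dn by simp
  have rv: "rc r mu x = (if x = 0 then 1 else 0)" if "dg x < k" "mu \<in> latt J" for x mu
   using reqD[OF triv that(2,1)] by simp
  have r1: "rc (r @ C) mu n - rc C mu n = rc r mu n" if mu: "mu \<in> latt J" for mu
  proof -
   have "rc (r @ C) mu n - rc ([] @ C) mu n =
    (\<Sum>a\<in>Nk (k+1). (rc r mu a - rc [] mu a) * rc C (mu + B a) (n - a))"
    unfolding rc_append[OF ok(2,3) lt] rc_append[OF okrs_simps(1) ok(3) lt]
    by (simp add: sum_subtractf left_diff_distrib)
   also have "\<dots> = (\<Sum>a\<in>Nk (k+1). if a = n then rc r mu n else 0)"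
   proof (intro sum.cong refl)
    fix a assume a: "a \<in> Nk (k+1)"
    show "(rc r mu a - rc [] mu a) * rc C (mu + B a) (n - a) = (if a = n then rc r mu n else 0)"
    proof (cases "dg a < k")
     case True thus ?thesis using rv[OF True mu] dn by auto
    next
     case F: False
     hence "dg (n - a) < 1" using dn by (simp add: degN_diff)
     thus ?thesis using rc_deg0[OF ok(3)] n0 by auto
    qed
   qed
   also have "\<dots> = rc r mu n" using NkI[OF nn lt] by simp
   finally show ?thesis by simp
  qed
  have r2: "rc (r @ C) mu x - rc C mu x = 0" if mu: "mu \<in> latt J" and x: "dg x < k" for mu x
  proof -
   have "req k (r @ C) ([] @ C)" by (intro req_append) (use ok triv in auto)
   thus ?thesis using reqD[OF _ mu x] by auto
  qed
  have "rc (A @ r @ C) m n - rc (A @ C) m n =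
    (\<Sum>a\<in>Nk (k+1). rc A m a * (rc (r @ C) (m + B a) (n - a) - rc C (m + B a) (n - a)))"
   using ok lt by (subst (1 2) rc_append[of _ _ n "k+1"]) (auto simp: sum_subtractf right_diff_distrib)
  also have "\<dots> = (\<Sum>a\<in>Nk (k+1). if a = 0 then rc r m n else 0)"
  proof (intro sum.cong refl)
   fix a assume a: "a \<in> Nk (k+1)"
   show "rc A m a * (rc (r @ C) (m + B a) (n - a) - rc C (m + B a) (n - a)) = (if a = 0 then rc r m n else 0)"
   proof (cases "a = 0")
    case True thus ?thesis using r1[OF m] rc_0[OF ok(1)] by simp
   next
    case F: False
    hence "0 < dg a" using NkD[OF a] nonneg_deg0[of a] by force
    hence "dg (n - a) < k" using dn by (simp add: degN_diff)
    thus ?thesis using r2[of "m + B a" "n - a"] m F by simp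
   qed
  qed
  also have "\<dots> = rc r m n" using k NkI[of 0 "k+1"] by simp
  finally show ?thesis using n0 by (simp add: diff_eq_eq add.commute)
 qed
qed

text \<open>Each letter only adds multiples of its direction, so exponents stay inside any condition
  closed under such additions. It is applied to the sign of a linear form and to orthogonality with
  a fixed vector.\<close>

lemma rc_supp:
 assumes "okrs w" "ALL r:set w. Q (fst r)" "\<And>a e s. a = 0 \<or> Q a ==> Q e ==> 0 < s ==> Q (a + nsc s e)"
  and "rc w m n ~= 0"
 shows "n = 0 \<or> Q n"
 using assms(1,2,4)
proof (induction w arbitrary: n rule: rev_induct)
 case Nil thus ?case by (auto split: if_splits)
next
 case (snoc r w)
 have "rc (w @ [r]) m n = (\<Sum>s\<le>nat (dg n). rc w m (n - nsc s (fst r)) * fps_nth (snd r (m + B n)) s)"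
  by (simp add: rc_def[abs_def] ract_append) (simp add: ract_def rop_def ray_def)
 then obtain s where s: "rc w m (n - nsc s (fst r)) ~= 0"
  using snoc.prems(3) by (auto elim!: sum.not_neutral_contains_not_neutral)
 have "n - nsc s (fst r) = 0 \<or> Q (n - nsc s (fst r))" using snoc.IH[OF _ _ s] snoc.prems by auto
 thus ?case using assms(3)[of "n - nsc s (fst r)" "fst r" s] snoc.prems(2) by (cases "s = 0") auto
qed

text \<open>With e = \<open>fst l\<close> and c = \<open>snd l\<close> this is the exponential of
  the Hamiltonian derivation z^m |-> c <e, m> z^m zeta^e. Such letters generate the group of wall
  crossings.\<close>

definition rl :: "'i lat \<times> 'k::field_char_0 => 'i lat \<times> ('i lat => 'k fps)" where
 "rl l = (fst l, %mu. fps_exp (snd l * pr (fst l) mu))"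

abbreviation rw :: "('i,'k::field_char_0) word => ('i,'k) rword" where
 "rw w \<equiv> map rl w"

definition over :: "('i lat => bool) => ('i,'k) word => bool" where
 "over P w \<longleftrightarrow> (ALL l:set w. fst l \<in> posN J & P (fst l))"

abbreviation okw :: "('i,'k) word => bool" where "okw \<equiv> over (%_. True)"

lemma over_simps [simp]: "over P []" "over P (l # w) \<longleftrightarrow> fst l \<in> posN J & P (fst l) & over P w"
 "over P (w @ w') \<longleftrightarrow> over P w & over P w'" "over P (rev w) = over P w"
 by (auto simp: over_def)

lemma over_mono: "over P w ==> (\<And>e. e \<in> posN J ==> P e ==> Q e) ==> over Q w"
 by (auto simp: over_def)

lemma over_ok: "over P w ==> okw w" by (auto simp: over_def)

lemma okr_rl: "fst l \<in> posN J ==> okr (rl l)"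
 by (simp add: okr_def rl_def pr_diff2 matB_nsc pr_nsc2)

lemma okrs_rw [simp]: "okw w ==> okrs (rw w)"
 by (induction w) (auto simp: okr_rl)

lemma okrs_rw' [simp]: "over P w ==> okrs (rw w)"
 using okrs_rw over_ok by blast

definition winv :: "('i,'k::field_char_0) word => ('i,'k) word" where
 "winv w = rev (map (%l. (fst l, - snd l)) w)"

lemma over_winv [simp]: "over P (winv w) = over P w" by (auto simp: over_def winv_def)

lemma rw_winv: "rw (winv w) = rinv (rw w)"
 by (simp add: winv_def rinv_def rl_def rev_map o_def fps_exp_neg)

subsection \<open>Poisson bracket\<close>

text \<open>A log-canonical Poisson structure: the bracket of z^m zeta^a and z^m' zeta^b is
  \<open>Om m a m' b\<close> times their product. The monomials z^m commute with each other, and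
  antisymmetry is \<open>pr_skew\<close>.\<close>

definition Om :: "'i lat => 'i lat => 'i lat => 'i lat => 'k::field_char_0" where
 "Om m a m' b = pr a (m' + B b) - pr b m"

definition pb :: "'i lat => 'i lat => ('i,'k::field_char_0) zser => ('i,'k) zser => ('i,'k) zser" where
 "pb m m' f g n = (\<Sum>a\<in>Nk (dg n + 1). f a * g (n - a) * Om m a m' (n - a))"

lemma Om_shift: "(Om m (a + nsc s e) m' (b + nsc t e) :: 'k::field_char_0) =
  Om m a m' b + of_nat s * pr e (m' + B b) - of_nat t * pr e (m + B a)"
proof -
 have "(pr a (B e) :: 'k) = - pr e (B a)" by (rule pr_skew)
 thus ?thesis
  by (simp add: Om_def matB_add matB_nsc pr_add1 pr_add2 pr_nsc1 pr_nsc2 algebra_simps)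
qed

text \<open>Without the corrections this is the binomial theorem with weight \<open>W\<close>. The
  two correction sums cancel: after a shift of the index both equal c p q times the same convolution
  of exponentials in degree r - 1.\<close>

lemma exp_poisson_coeff:
 fixes p q c W :: "'k::field_char_0"
 shows "(\<Sum>s\<le>r. (c*p)^s / fact s * ((c*q)^(r-s) / fact (r-s)) * (W + of_nat s * q - of_nat (r-s) * p))
   = (c*(p+q))^r / fact r * W"
proof -
 have bin: "(\<Sum>s\<le>r. (c*p)^s / fact s * ((c*q)^(r-s) / fact (r-s))) = (c*(p+q))^r / fact r"
 proof -
  have "(c*(p+q))^r = (c*p + c*q)^r" by (simp add: algebra_simps)
  also have "\<dots> = (\<Sum>s\<le>r. of_nat (r choose s) * (c*p)^s * (c*q)^(r-s))" by (rule binomial_ring)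
  also have "\<dots> / fact r = (\<Sum>s\<le>r. (c*p)^s / fact s * ((c*q)^(r-s) / fact (r-s)))"
   unfolding sum_divide_distrib
   by (intro sum.cong refl) (simp add: binomial_fact field_simps)
  finally show ?thesis by simp
 qed
 have ex: "(\<Sum>s\<le>r. (c*p)^s / fact s * ((c*q)^(r-s) / fact (r-s)) * (of_nat s * q - of_nat (r-s) * p)) = 0"
 proof (cases r)
  case (Suc r')
  have "(\<Sum>s\<le>r. (c*p)^s / fact s * ((c*q)^(r-s) / fact (r-s)) * (of_nat s * q)) =
   (\<Sum>s\<le>r'. (c*p)^Suc s / fact (Suc s) * ((c*q)^(r-Suc s) / fact (r-Suc s)) * (of_nat (Suc s) * q))"
   unfolding Suc by (subst sum.atMost_Suc_shift) simp
  also have "\<dots> = (\<Sum>s\<le>r'. (c*p)^s / fact s * ((c*q)^(r-s) / fact (r-s)) * (of_nat (r-s) * p))"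
  proof (intro sum.cong refl)
   fix s assume "s \<in> {..r'}"
   then obtain t where t: "r - s = Suc t" "r - Suc s = t" using Suc by (metis Suc_diff_le atMost_iff diff_Suc_Suc)
   show "(c*p)^Suc s / fact (Suc s) * ((c*q)^(r-Suc s) / fact (r-Suc s)) * (of_nat (Suc s) * q) =
    (c*p)^s / fact s * ((c*q)^(r-s) / fact (r-s)) * (of_nat (r-s) * p)"
    unfolding t fact_Suc power_Suc
    by (simp add: divide_simps del: of_nat_Suc)
  qed
  also have "\<dots> = (\<Sum>s\<le>r. (c*p)^s / fact s * ((c*q)^(r-s) / fact (r-s)) * (of_nat (r-s) * p))"
   unfolding Suc by simp
  finally show ?thesis by (simp add: right_diff_distrib sum_subtractf)
 qed simp
 have "(\<Sum>s\<le>r. (c*p)^s / fact s * ((c*q)^(r-s) / fact (r-s)) * (W + of_nat s * q - of_nat (r-s) * p))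
  = (\<Sum>s\<le>r. (c*p)^s / fact s * ((c*q)^(r-s) / fact (r-s)) * W
    + (c*p)^s / fact s * ((c*q)^(r-s) / fact (r-s)) * (of_nat s * q - of_nat (r-s) * p))"
 proof (intro sum.cong refl)
  fix s
  have "x * (W + u - v) = x * W + x * (u - v)" for x u v :: 'k by (simp add: algebra_simps)
  thus "(c*p)^s / fact s * ((c*q)^(r-s) / fact (r-s)) * (W + of_nat s * q - of_nat (r-s) * p) =
   (c*p)^s / fact s * ((c*q)^(r-s) / fact (r-s)) * W
    + (c*p)^s / fact s * ((c*q)^(r-s) / fact (r-s)) * (of_nat s * q - of_nat (r-s) * p)" .
 qed
 also have "\<dots> = (c*(p+q))^r / fact r * W"
  unfolding sum.distrib ex sum_distrib_right[symmetric] bin by simp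
 finally show ?thesis .
qed

text \<open>Expand both arguments, shift the summation index so that \<open>Om_shift\<close>
  produces correction terms, group by the total exponent r = s + t, and sum over s with
  \<open>exp_poisson_coeff\<close>. The remaining power of p + q is the action on the component m +
  m'. Thus letters are Poisson automorphisms.\<close>

lemma pb_rop:
 fixes f g :: "('i,'k::field_char_0) zser"
 assumes e: "fst l \<in> posN J" and f: "sup0 J f" and g: "sup0 J g"
 shows "pb m m' (rop (rl l) m f) (rop (rl l) m' g) n = rop (rl l) (m + m') (pb m m' f g) n"
proof -
 let ?e = "fst l" let ?c = "snd l"
 define K where "K = nat (dg n)"
 define N where "N = Nk (dg n + 1)"
 define p :: "'i lat => 'k" where "p a = pr ?e (m + B a)" for a
 define q :: "'i lat => 'k" where "q b = pr ?e (m' + B b)" for b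
 have dge: "0 <= int s * dg ?e" for s using deg_pos[OF e] by simp
 have op: "rop (rl l) mu h x = (\<Sum>s\<le>K. h (x - nsc s ?e) * ((?c * pr ?e (mu + B x))^s / fact s))"
  if "sup0 J h" "dg x <= dg n" for mu h x
  unfolding rop_def using that ray_eq[OF that(1) e, of x K] by (simp add: rl_def K_def nat_mono)
 have "pb m m' (rop (rl l) m f) (rop (rl l) m' g) n =
   (\<Sum>a\<in>N. (\<Sum>s\<le>K. f (a - nsc s ?e) * ((?c * p a)^s / fact s)) *
    (\<Sum>t\<le>K. g (n - a - nsc t ?e) * ((?c * q (n - a))^t / fact t)) * Om m a m' (n - a))"
  unfolding pb_def N_def[symmetric]
 proof (intro sum.cong refl)
  fix a assume "a \<in> N"
  hence "a \<in> nonneg J" "dg a <= dg n" by (auto simp: N_def Nk_def)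
  hence "dg a <= dg n" "dg (n - a) <= dg n" using degN_nonneg[of a J] by (auto simp: degN_diff)
  thus "rop (rl l) m f a * rop (rl l) m' g (n - a) * Om m a m' (n - a) =
   (\<Sum>s\<le>K. f (a - nsc s ?e) * ((?c * p a)^s / fact s)) *
    (\<Sum>t\<le>K. g (n - a - nsc t ?e) * ((?c * q (n - a))^t / fact t)) * Om m a m' (n - a)"
   by (simp add: op[OF f] op[OF g] p_def q_def)
 qed
 also have "\<dots> = (\<Sum>a\<in>N. \<Sum>s\<le>K. \<Sum>t\<le>K. f (a - nsc s ?e) * g (n - a - nsc t ?e) *
   ((?c * p a)^s / fact s * ((?c * q (n - a))^t / fact t) * Om m a m' (n - a)))"
  unfolding sum_product unfolding sum_distrib_right by (intro sum.cong refl) (simp add: mult_ac)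
 also have "\<dots> = (\<Sum>s\<le>K. \<Sum>t\<le>K. \<Sum>a\<in>N. f (a - nsc s ?e) * g (n - a - nsc t ?e) *
   ((?c * p a)^s / fact s * ((?c * q (n - a))^t / fact t) * Om m a m' (n - a)))"
  by (subst sum.swap, intro sum.cong refl, rule sum.swap)
 also have "\<dots> = (\<Sum>s\<le>K. \<Sum>t\<le>K. \<Sum>a\<in>N. f a * g (n - nsc (s+t) ?e - a) *
   ((?c * p a)^s / fact s * ((?c * q (n - nsc (s+t) ?e - a))^t / fact t) *
    (Om m a m' (n - nsc (s+t) ?e - a) + of_nat s * q (n - nsc (s+t) ?e - a) - of_nat t * p a)))"
 proof (rule sum.cong[OF refl], rule sum.cong[OF refl])
  fix s t
  let ?F = "%a. f a * g (n - nsc (s+t) ?e - a) *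
   ((?c * p a)^s / fact s * ((?c * q (n - nsc (s+t) ?e - a))^t / fact t) *
    (Om m a m' (n - nsc (s+t) ?e - a) + of_nat s * q (n - nsc (s+t) ?e - a) - of_nat t * p a))"
  have pa: "p a = p (a - nsc s ?e)" for a unfolding p_def by (rule pr_inv[symmetric])
  have qa: "q (n - a) = q (n - a - nsc t ?e)" for a unfolding q_def by (rule pr_inv[symmetric])
  have eq: "f (a - nsc s ?e) * g (n - a - nsc t ?e) *
    ((?c * p a)^s / fact s * ((?c * q (n - a))^t / fact t) * Om m a m' (n - a)) = ?F (a - nsc s ?e)" for a
  proof -
   have x: "n - nsc (s+t) ?e - (a - nsc s ?e) = n - a - nsc t ?e" by (simp add: nsc_add algebra_simps)
   have "Om m ((a - nsc s ?e) + nsc s ?e) m' ((n - a - nsc t ?e) + nsc t ?e) =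
    Om m (a - nsc s ?e) m' (n - a - nsc t ?e) + of_nat s * q (n - a - nsc t ?e) - of_nat t * p (a - nsc s ?e)"
    unfolding p_def q_def by (rule Om_shift)
   thus ?thesis unfolding x pa[of a] qa[of a] by simp
  qed
  \<comment> \<open>The translation by s e does not preserve \<open>N\<close>; the terms lost at the
    lower end vanish by the support of \<open>f\<close>, those at the upper end by the degree of
    \<open>g\<close>.\<close>
  have "(\<Sum>a\<in>N. ?F (a - nsc s ?e)) = (\<Sum>a\<in>N. ?F a)"
  proof (rule sum.reindex_bij_witness_not_neutral[where S'="{a\<in>N. a - nsc s ?e \<notin> N}"
     and T'="{a\<in>N. a + nsc s ?e \<notin> N}" and i="%a. a + nsc s ?e" and j="%a. a - nsc s ?e"])
   fix a assume "a \<in> {a\<in>N. a - nsc s ?e \<notin> N}"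
   hence "a - nsc s ?e \<notin> N" "a \<in> N" by auto
   hence "a - nsc s ?e \<notin> nonneg J" using dge[of s] by (auto simp: N_def Nk_def degN_diff degN_nsc)
   thus "?F (a - nsc s ?e) = 0" using sup0_0[OF f] by simp
  next
   fix a assume "a \<in> {a\<in>N. a + nsc s ?e \<notin> N}"
   hence a: "a + nsc s ?e \<notin> N" "a \<in> nonneg J" by (auto simp: N_def Nk_def)
   moreover have "nsc s ?e \<in> nonneg J" using nonneg_nsc[OF posN_nonneg[OF e]] by blast
   ultimately have "dg n < dg (a + nsc s ?e)" by (auto simp: N_def Nk_def not_less)
   hence "dg (n - nsc (s+t) ?e - a) < 0" using dge[of t]
    by (simp add: degN_add degN_diff degN_nsc algebra_simps)
   thus "?F a = 0" using sup0_deg[OF g] by simp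
  qed (auto simp: N_def)
  thus "(\<Sum>a\<in>N. f (a - nsc s ?e) * g (n - a - nsc t ?e) *
    ((?c * p a)^s / fact s * ((?c * q (n - a))^t / fact t) * Om m a m' (n - a))) = (\<Sum>a\<in>N. ?F a)"
   by (simp only: eq)
 qed
 also have "\<dots> = (\<Sum>(s,t)\<in>{(s,t). s + t <= K}. \<Sum>a\<in>N. f a * g (n - nsc (s+t) ?e - a) *
   ((?c * p a)^s / fact s * ((?c * q (n - nsc (s+t) ?e - a))^t / fact t) *
    (Om m a m' (n - nsc (s+t) ?e - a) + of_nat s * q (n - nsc (s+t) ?e - a) - of_nat t * p a)))"
 proof (subst sum.cartesian_product, rule sum.mono_neutral_right)
  have z: "g (n - nsc (s+t) ?e - a) = 0" if "\<not> s + t <= K" "a \<in> N" for s t a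
  proof (rule sup0_deg[OF g])
   have "int (s+t) <= int (s+t) * dg ?e" using mult_left_mono[OF deg_pos1[OF e], of "int (s+t)"] by simp
   moreover have "0 <= dg a" using that by (auto simp: N_def Nk_def degN_nonneg)
   ultimately show "dg (n - nsc (s+t) ?e - a) < 0" using that(1) unfolding degN_diff degN_nsc K_def by linarith
  qed
  show "ALL i:{..K} \<times> {..K} - {(s, t). s + t <= K}. (case i of (s, t) => \<Sum>a\<in>N. f a * g (n - nsc (s+t) ?e - a) *
   ((?c * p a)^s / fact s * ((?c * q (n - nsc (s+t) ?e - a))^t / fact t) *
    (Om m a m' (n - nsc (s+t) ?e - a) + of_nat s * q (n - nsc (s+t) ?e - a) - of_nat t * p a))) = 0"
   by (intro ballI, elim DiffE SigmaE) (simp add: z)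
 qed auto
 also have "\<dots> = (\<Sum>r\<le>K. \<Sum>s\<le>r. \<Sum>a\<in>N. f a * g (n - nsc (s+(r-s)) ?e - a) *
   ((?c * p a)^s / fact s * ((?c * q (n - nsc (s+(r-s)) ?e - a))^(r-s) / fact (r-s)) *
    (Om m a m' (n - nsc (s+(r-s)) ?e - a) + of_nat s * q (n - nsc (s+(r-s)) ?e - a) - of_nat (r-s) * p a)))"
  by (rule sum.triangle_reindex_eq)
 also have "\<dots> = (\<Sum>r\<le>K. \<Sum>a\<in>N. f a * g (n - nsc r ?e - a) * (\<Sum>s\<le>r.
   ((?c * p a)^s / fact s * ((?c * q (n - nsc r ?e - a))^(r-s) / fact (r-s)) *
    (Om m a m' (n - nsc r ?e - a) + of_nat s * q (n - nsc r ?e - a) - of_nat (r-s) * p a))))"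
  by (rule sum.cong[OF refl], subst sum.swap) (simp add: sum_distrib_left)
 also have "\<dots> = (\<Sum>r\<le>K. \<Sum>a\<in>N. f a * g (n - nsc r ?e - a) *
    ((?c * (p a + q (n - nsc r ?e - a)))^r / fact r * Om m a m' (n - nsc r ?e - a)))"
  by (simp only: exp_poisson_coeff)
 also have "\<dots> = (\<Sum>r\<le>K. pb m m' f g (n - nsc r ?e) * ((?c * pr ?e (m + m' + B n))^r / fact r))"
 proof (intro sum.cong refl)
  fix r
  have pq: "p a + q (n - nsc r ?e - a) = pr ?e (m + m' + B n)" for a
   unfolding p_def q_def by (simp add: matB_diff matB_nsc pr_add2 pr_diff2 pr_nsc2)
  have "(\<Sum>a\<in>N. f a * g (n - nsc r ?e - a) * Om m a m' (n - nsc r ?e - a)) = pb m m' f g (n - nsc r ?e)"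
   unfolding pb_def
  proof (rule sum.mono_neutral_right)
   show "Nk (dg (n - nsc r ?e) + 1) \<subseteq> N" using dge[of r] by (auto simp: N_def Nk_def degN_diff degN_nsc)
   show "ALL a:N - Nk (dg (n - nsc r ?e) + 1). f a * g (n - nsc r ?e - a) * Om m a m' (n - nsc r ?e - a) = 0"
   proof
    fix a assume "a \<in> N - Nk (dg (n - nsc r ?e) + 1)"
    hence "dg (n - nsc r ?e - a) < 0" by (auto simp: N_def Nk_def degN_diff)
    thus "f a * g (n - nsc r ?e - a) * Om m a m' (n - nsc r ?e - a) = 0" using sup0_deg[OF g] by simp
   qed
  qed (simp add: N_def)
  note E = this
  show "(\<Sum>a\<in>N. f a * g (n - nsc r ?e - a) *
    ((?c * (p a + q (n - nsc r ?e - a)))^r / fact r * Om m a m' (n - nsc r ?e - a))) =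
    pb m m' f g (n - nsc r ?e) * ((?c * pr ?e (m + m' + B n))^r / fact r)"
   unfolding pq E[symmetric] sum_distrib_right by (intro sum.cong refl) (simp add: mult_ac)
 qed
 also have "\<dots> = rop (rl l) (m + m') (pb m m' f g) n"
  by (simp add: rop_def ray_def rl_def K_def)
 finally show ?thesis .
qed

text \<open>The monomials z^m and z^m' Poisson-commute and letters preserve the bracket, so their
  images Poisson-commute as well.\<close>

lemma pb_word: "okw w ==> pb m m' (rc (rw w) m) (rc (rw w) m') n = (0::'k::field_char_0)"
proof (induction w arbitrary: n rule: rev_induct)
 case Nil
 show ?case unfolding pb_def by (intro sum.neutral) (auto simp: Om_def)
next
 case (snoc l w)
 have r: "rc (rw (w @ [l])) mu = rop (rl l) mu (rc (rw w) mu)" for mu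
  by (simp add: rc_def[abs_def] ract_append) (simp add: ract_def)
 have l: "fst l \<in> posN J" and w: "okw w" using snoc.prems by auto
 have "pb m m' (rc (rw w) m) (rc (rw w) m') = (%n. 0)" using snoc.IH[OF w] by auto
 thus ?case unfolding r pb_rop[OF l rc_sup0[OF okrs_rw[OF w]] rc_sup0[OF okrs_rw[OF w]]]
  by (simp add: rop_def ray_def)
qed

text \<open>Below degree \<open>k\<close> the images agree with the monomials, so in the vanishing
  bracket of the images of z^m and z^m' only the splittings 0 + n and n + 0 of the exponent survive.
  They give a proportion between the coefficient and <n, m>: the leading term of a word is again a
  Hamiltonian derivation.\<close>

lemma leading_term:
 fixes w :: "('i,'k::field_char_0) word"
 assumes w: "okw w" and triv: "req k (rw w) []" and k: "0 < k" and n: "n \<in> posN J" and dn: "dg n = k"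
 shows "EX c. ALL m:latt J. rc (rw w) m n = c * pr n m"
proof -
 have key: "rc (rw w) m n * pr n m' = rc (rw w) m' n * pr n m" if m: "m \<in> latt J" "m' \<in> latt J" for m m'
 proof -
  let ?f = "rc (rw w) m" let ?g = "rc (rw w) m'"
  have "0 = pb m m' ?f ?g n" by (simp add: pb_word[OF w])
  also have "\<dots> = (\<Sum>a\<in>{0,n}. ?f a * ?g (n - a) * Om m a m' (n - a))"
   unfolding pb_def
  proof (rule sum.mono_neutral_right)
   show "{0, n} \<subseteq> Nk (dg n + 1)" using n k dn by (auto simp: Nk_def posN_nonneg)
   show "ALL a:Nk (dg n + 1) - {0, n}. ?f a * ?g (n - a) * Om m a m' (n - a) = 0"
   proof
    fix a assume a: "a \<in> Nk (dg n + 1) - {0, n}"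
    show "?f a * ?g (n - a) * Om m a m' (n - a) = 0"
    proof (cases "dg a < k")
     case True
     thus ?thesis using reqD[OF triv m(1) True] a by simp
    next
     case False
     hence "dg (n - a) < 1" using dn by (simp add: degN_diff)
     thus ?thesis using rc_deg0[OF okrs_rw[OF w], of "n - a" m'] a by auto
    qed
   qed
  qed simp
  also have "\<dots> = ?g n * Om m 0 m' n + ?f n * Om m n m' 0"
   using posN_nz[OF n] rc_0[OF okrs_rw[OF w]] by simp
  finally show ?thesis by (simp add: Om_def)
 qed
 obtain m' where m': "m' \<in> latt J" "(pr n m' :: 'k) ~= 0" using pr_posN_ex[OF n] by blast
 show ?thesis
  by (rule exI[of _ "rc (rw w) m' n / pr n m'"]) (use key[OF _ m'(1)] m'(2) in "simp add: field_simps")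
qed

subsection \<open>Layers and factorization\<close>

lemma rc_single:
 assumes e: "e \<in> posN J" and n: "dg n <= dg e"
 shows "rc (rw [(e, c)]) m n = (if n = 0 then 1 else 0) + (if n = e then c * pr e m else (0::'k::field_char_0))"
proof -
 have "rc (rw [(e, c)]) m n = (\<Sum>s\<le>nat (dg n). delta 0 (n - nsc s e) * ((c * pr e (m + B n))^s / fact s))"
  by (simp add: rc_def ract_def rop_def ray_def rl_def)
 also have "\<dots> = (\<Sum>s\<in>{..nat (dg n)} \<inter> {s. n = nsc s e}. ((c * pr e (m + B n))^s / fact s))"
  by (rule sum.mono_neutral_cong_right) (auto simp: delta_def)
 also have "\<dots> = (if n = 0 then 1 else 0) + (if n = e then c * pr e m else 0)"
 proof -
  have z: "n = nsc s e ==> s = 0 \<or> s = 1" for s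
  proof -
   assume "n = nsc s e"
   hence "int s * dg e <= 1 * dg e" using n by (simp add: degN_nsc)
   hence "s <= 1" using deg_pos[OF e] by (simp add: mult_le_cancel_right)
   thus "s = 0 \<or> s = 1" by linarith
  qed
  have ne: "e ~= 0" using posN_nz[OF e] .
  consider "n = 0" | "n = e" | "n ~= 0" "n ~= e" by blast
  thus ?thesis
  proof cases
   case 1
   hence "{..nat (dg n)} \<inter> {s. n = nsc s e} = {0}" using z ne by force
   thus ?thesis using 1 ne by simp
  next
   case 2
   have "1 <= nat (dg e)" using deg_pos[OF e] by linarith
   hence "{..nat (dg n)} \<inter> {s. n = nsc s e} = {1}" using z ne 2 by force
   thus ?thesis using 2 ne by (simp add: pr_add2)
  next
   case 3
   hence "{..nat (dg n)} \<inter> {s. n = nsc s e} = {}" using z by force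
   thus ?thesis using 3 by simp
  qed
 qed
 finally show ?thesis .
qed

text \<open>Letters of one degree interact only in twice that degree, so up to degree
  \<open>k\<close> their contributions add; formally this is \<open>rc_top\<close> applied to one
  letter at a time.\<close>

lemma layer_rc:
 assumes "ALL n:set ns. n \<in> posN J & dg n = k" "distinct ns" "0 < k" "m \<in> latt J" "dg n <= k"
 shows "rc (rw (map (%n. (n, c n)) ns)) m n =
  (if n = 0 then 1 else 0) + (if n \<in> set ns then c n * pr n m else (0::'k::field_char_0))"
 using assms(1,2)
proof (induction ns)
 case (Cons a ns)
 let ?L = "map (%n. (n, c n)) ns"
 have a: "a \<in> posN J" "dg a = k" and ok: "okw ?L" using Cons.prems by (auto simp: over_def)
 have "req k (rw [(a, c a)]) []"
  unfolding req_def
 proof (intro ballI allI impI)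
  fix m n assume "dg n < k"
  thus "rc (rw [(a, c a)]) m n = rc [] m n" using rc_single[OF a(1), of n "c a" m] a(2) by auto
 qed
 from rc_top[OF okrs_simps(1) _ okrs_rw[OF ok] this assms(3-5)]
 have "rc (rw (map (%n. (n, c n)) (a # ns))) m n = rc (rw ?L) m n + rc (rw [(a, c a)]) m n - (if n = 0 then 1 else 0)"
  using a by (simp add: okr_rl)
 also have "\<dots> = rc (rw ?L) m n + (if n = a then c a * pr a m else 0)"
  using rc_single[OF a(1), of n "c a" m] a(2) assms(5) by simp
 finally show ?case using Cons by auto
qed simp

lemma layer_triv:
 assumes "ALL n:set ns. n \<in> posN J & dg n = k" "distinct ns" "0 < k"
 shows "req k (rw (map (%n. (n, c n)) ns)) []"
 unfolding req_def using layer_rc[OF assms, of _ _ c] assms(1) by auto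

lemma leading_layer:
 fixes r :: "('i,'k::field_char_0) word"
 assumes r: "okw r" "req k (rw r) []" "0 < k"
  and ns: "set ns = {n \<in> posN J. dg n = k & S n}" "distinct ns"
  and S: "\<And>n m. n ~= 0 ==> \<not> S n ==> rc (rw r) m n = 0"
 obtains c where "req (k + 1) (rw r) (rw (map (%n. (n, c n)) ns))"
proof -
 have "ALL n. EX c. n \<in> posN J & dg n = k --> (ALL m:latt J. rc (rw r) m n = c * pr n m)"
  using leading_term[OF r] by blast
 then obtain c where c: "\<And>n m. n \<in> posN J ==> dg n = k ==> m \<in> latt J ==> rc (rw r) m n = c n * pr n m" by metis
 have "req (k + 1) (rw r) (rw (map (%n. (n, c n)) ns))"
  unfolding req_def
 proof (intro ballI allI impI)
  fix m n assume m: "m \<in> latt J" and n: "dg n < k + 1"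
  have L: "rc (rw (map (%n. (n, c n)) ns)) m n = (if n = 0 then 1 else 0) + (if n \<in> set ns then c n * pr n m else 0)"
   using layer_rc[OF _ ns(2) r(3) m, of n c] ns(1) n by auto
  show "rc (rw r) m n = rc (rw (map (%n. (n, c n)) ns)) m n"
  proof (cases "dg n < k")
   case True
   thus ?thesis unfolding L using reqD[OF r(2) m True] ns(1) by auto
  next
   case False
   hence dn: "dg n = k" "n ~= 0" using n r(3) by auto
   show ?thesis
   proof (cases "n \<in> nonneg J")
    case True
    hence "n \<in> posN J" using dn by (auto simp: posN_def)
    thus ?thesis unfolding L using c dn m ns(1) S[OF dn(2)] by (cases "S n") auto
   next
    case False
    thus ?thesis unfolding L using rc_neg[OF okrs_rw[OF r(1)]] ns(1) dn by (auto simp: posN_nonneg)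
   qed
  qed
 qed
 thus ?thesis by (rule that)
qed

lemma layer_list_ex: "EX ns. set ns = {n \<in> posN J. dg n = k & S n} & distinct ns"
proof -
 have "finite {n \<in> posN J. dg n = k & S n}"
  by (rule finite_subset[OF _ fin_deg[of "k+1"]]) (auto simp: posN_nonneg)
 thus ?thesis using finite_distinct_list by blast
qed

lemma over_layer: "over P (map (%n. (n, c n)) ns) \<longleftrightarrow> (ALL n:set ns. n \<in> posN J & P n)"
 by (auto simp: over_def)

text \<open>A layer of degree \<open>k\<close> is central modulo degree \<open>k + 1\<close>, so
  each of its letters may be moved to the factor whose condition it meets. The conditions are tested
  successively, which splits the layer into disjoint parts even when \<open>M\<close> and
  \<open>Z\<close> overlap.\<close>

lemma layer_distribute:
 fixes u w v :: "('i,'k::field_char_0) word" and c :: "'i lat => 'k" and M Z :: "'i lat => bool"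
 assumes ok: "okw u" "okw w" "okw v" and ns: "ALL n:set ns. n \<in> posN J & dg n = k" "distinct ns" and k0: "0 < k"
 defines "ly \<equiv> %ns. map (%n. (n, c n)) ns"
 shows "req (k + 1) (rw ((u @ w @ v) @ ly ns)) (rw ((u @ ly (filter M ns)) @
   (w @ ly (filter (%e. \<not> M e & Z e) ns)) @ (v @ ly (filter (%e. \<not> M e & \<not> Z e) ns))))"
 unfolding req_def
proof (intro ballI allI impI)
 define nm where "nm = filter M ns"
 define nz where "nz = filter (%e. \<not> M e & Z e) ns"
 define np where "np = filter (%e. \<not> M e & \<not> Z e) ns"
 have sub: "set nm \<subseteq> set ns" "set nz \<subseteq> set ns" "set np \<subseteq> set ns" "distinct nm" "distinct nz" "distinct np"
  using ns(2) by (auto simp: nm_def nz_def np_def)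
 have okly: "okw (ly ns)" "okw (ly nm)" "okw (ly nz)" "okw (ly np)"
  using ns sub unfolding ly_def by (auto simp: over_def)
 define X where "X = u @ w @ v"
 have okX: "okw X" using ok by (simp add: X_def)
 fix m n assume m: "m \<in> latt J" and n': "dg n < k + 1"
 hence n: "dg n <= k" by simp
 let ?d = "if n = 0 then 1 else (0::'k)"
 note T = layer_triv[OF _ _ k0, of _ c, folded ly_def] and L = layer_rc[OF _ _ k0 m n, of _ c, folded ly_def]
 have 1: "rc (rw X @ rw (ly ns) @ []) m n = rc (rw X @ []) m n + rc (rw (ly ns)) m n - ?d"
  by (rule rc_top[OF _ _ _ T k0 m n]) (use ns okX okly in "auto simp del: map_map")
 have 2: "rc (rw u @ rw (ly nm) @ rw ((w @ ly nz) @ (v @ ly np))) m n =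
   rc (rw u @ rw ((w @ ly nz) @ (v @ ly np))) m n + rc (rw (ly nm)) m n - ?d"
  by (rule rc_top[OF _ _ _ T k0 m n]) (use ns sub ok okly in "auto simp del: map_map")
 have 3: "rc (rw (u @ w) @ rw (ly nz) @ rw (v @ ly np)) m n =
   rc (rw (u @ w) @ rw (v @ ly np)) m n + rc (rw (ly nz)) m n - ?d"
  by (rule rc_top[OF _ _ _ T k0 m n]) (use ns sub ok okly in "auto simp del: map_map")
 have 4: "rc (rw X @ rw (ly np) @ []) m n = rc (rw X @ []) m n + rc (rw (ly np)) m n - ?d"
  by (rule rc_top[OF _ _ _ T k0 m n]) (use ns sub okX okly in "auto simp del: map_map")
 have "rc (rw (ly ns)) m n - ?d = (rc (rw (ly nm)) m n - ?d) + (rc (rw (ly nz)) m n - ?d) + (rc (rw (ly np)) m n - ?d)"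
  by (subst (1 2 3 4) L) (use ns sub in "auto simp: nm_def nz_def np_def")
 thus "rc (rw ((u @ w @ v) @ ly ns)) m n = rc (rw ((u @ ly (filter M ns)) @
   (w @ ly (filter (%e. \<not> M e & Z e) ns)) @ (v @ ly (filter (%e. \<not> M e & \<not> Z e) ns)))) m n"
  using 1 2 3 4 unfolding nm_def nz_def np_def X_def by simp
qed

text \<open>If X = u w v agrees with g below degree k, then the leading layer of X^-1 g in degree k
  is distributed over the three factors. The condition \<open>S\<close>, being closed under the
  additions made by letters, is inherited from \<open>g\<close> by the layer and hence by all
  factors.\<close>

theorem factorization:
 fixes g :: "('i,'k::field_char_0) word"
 assumes gS: "over S g" and S: "\<And>a e s. a = 0 \<or> S a ==> S e ==> 0 < s ==> S (a + nsc s e)"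
  and cl: "\<And>e. e \<in> posN J ==> M e \<or> Z e \<or> P e"
 shows "EX u w v. over (%e. M e & dg e < int k & S e) u & over (%e. Z e & dg e < int k & S e) w &
   over (%e. P e & dg e < int k & S e) v & req (int k) (rw g) (rw (u @ w @ v))"
proof (induction k)
 case 0
 have g: "okw g" using gS over_ok by blast
 thus ?case by (intro exI[of _ "[]"]) (auto simp: g intro!: req_1)
next
 case (Suc k)
 have g: "okw g" using gS over_ok by blast
 show ?case
 proof (cases "k = 0")
  case True
  thus ?thesis by (intro exI[of _ "[]"]) (auto simp: g intro!: req_1)
 next
  case False
  from Suc obtain u w v where uwv: "over (%e. M e & dg e < int k & S e) u" "over (%e. Z e & dg e < int k & S e) w"
   "over (%e. P e & dg e < int k & S e) v" and eq: "req (int k) (rw g) (rw (u @ w @ v))" by blast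
  define X where "X = u @ w @ v"
  have okX: "okw X" using uwv by (auto simp: X_def dest: over_ok)
  have okuwv: "okw u" "okw w" "okw v" using uwv by (auto dest: over_ok)
  have "req (int k) (rw (winv X) @ rw g) (rw (winv X) @ rw X)"
   by (rule req_append) (use eq okX g in "auto simp: X_def")
  also have "req (int k) (rw (winv X) @ rw X) []" unfolding rw_winv by (rule req_rinv) (use okX in auto)
  finally have triv: "req (int k) (rw (winv X @ g)) []" by simp
  obtain ns where ns: "set ns = {n \<in> posN J. dg n = int k & S n}" "distinct ns" using layer_list_ex by blast
  have k0: "0 < int k" using False by simp
  have okr: "okw (winv X @ g)" using okX g by simp
  obtain c where c: "req (int k + 1) (rw (winv X @ g)) (rw (map (%n. (n, c n)) ns))"
  proof (rule leading_layer[OF okr triv k0 ns])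
   fix n m assume n: "n ~= 0" "\<not> S n"
   have oS: "over S (winv X @ g)" using uwv gS by (auto simp: X_def intro: over_mono)
   show "rc (rw (winv X @ g)) m n = 0"
   proof (rule ccontr)
    assume "rc (rw (winv X @ g)) m n ~= 0"
    moreover have "ALL r:set (rw (winv X @ g)). S (fst r)"
    proof
     fix r assume "r \<in> set (rw (winv X @ g))"
     then obtain l where "l \<in> set (winv X @ g)" "r = rl l" by auto
     thus "S (fst r)" using oS unfolding over_def by (simp add: rl_def)
    qed
    ultimately have "n = 0 \<or> S n" using rc_supp[OF okrs_rw[OF okr], of S m n] S by blast
    thus False using n by simp
   qed
  qed blast
  let ?ly = "%ns. map (%n. (n, c n)) ns"
  define nm where "nm = filter M ns"
  define nz where "nz = filter (%e. \<not> M e & Z e) ns"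
  define np where "np = filter (%e. \<not> M e & \<not> Z e) ns"
  have sub: "set nm \<subseteq> set ns" "set nz \<subseteq> set ns" "set np \<subseteq> set ns" "distinct nm" "distinct nz" "distinct np"
   using ns(2) by (auto simp: nm_def nz_def np_def)
  have okly: "okw (?ly ns)" "okw (?ly nm)" "okw (?ly nz)" "okw (?ly np)"
   using ns sub unfolding over_layer by auto
  have "req (int k + 1) (rw X @ rw (winv X @ g)) (rw X @ rw (?ly ns))"
   by (rule req_append[OF req_refl c]) (use okX okr okly in "auto simp del: map_map")
  moreover have "req (int k + 1) ((rw X @ rw (winv X)) @ rw g) ([] @ rw g)"
   unfolding rw_winv by (rule req_append) (use okX g in "auto intro: req_rinv")
  ultimately have a1: "req (int k + 1) (rw X @ rw (winv X @ g)) (rw X @ rw (?ly ns))"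
    and a2: "req (int k + 1) (rw X @ rw (winv X @ g)) (rw g)" by (simp_all del: map_map)
  hence gX: "req (int k + 1) (rw g) (rw X @ rw (?ly ns))"
   by (intro req_trans[OF req_sym[OF a2] a1])
  have "req (int k + 1) (rw X @ rw (?ly ns)) (rw ((u @ ?ly nm) @ (w @ ?ly nz) @ (v @ ?ly np)))"
   using layer_distribute[OF okuwv _ ns(2) k0, of c M Z] ns(1) unfolding X_def nm_def nz_def np_def by simp
  from req_trans[OF gX this] have "req (int (Suc k)) (rw g) (rw ((u @ ?ly nm) @ (w @ ?ly nz) @ (v @ ?ly np)))"
   by (simp add: add.commute del: map_map)
  moreover have "over (%e. M e & dg e < int (Suc k) & S e) (u @ ?ly nm)"
   "over (%e. Z e & dg e < int (Suc k) & S e) (w @ ?ly nz)" "over (%e. P e & dg e < int (Suc k) & S e) (v @ ?ly np)"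
   using uwv ns cl by (auto simp: over_layer nm_def nz_def np_def intro: over_mono)
  ultimately show ?thesis by blast
 qed
qed

text \<open>Put X = u'^-1 u, so that X w = w' v' v^-1. A lowest nonzero exponent of X would survive
  in X w and have ph < 0, while the right side lives where ph >= 0; so X is trivial. Then w'^-1 w =
  v' v^-1 is supported where ph = 0 by its left side and, off 0, where ph > 0 by its right
  side.\<close>

theorem factorization_unique:
 fixes ph :: "'i lat => real" and u w v u' w' v' :: "('i,'k::field_char_0) word"
 assumes add: "\<And>a b. ph (a + b) = ph a + ph b"
  and u: "over (%e. ph e < 0) u" "over (%e. ph e < 0) u'"
  and w: "over (%e. ph e = 0) w" "over (%e. ph e = 0) w'"
  and v: "over (%e. 0 < ph e) v" "over (%e. 0 < ph e) v'"
  and eq: "req k (rw (u @ w @ v)) (rw (u' @ w' @ v'))"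
 shows "req k (rw u) (rw u')" "req k (rw w) (rw w')"
proof -
 have ok: "okw u" "okw u'" "okw w" "okw w'" "okw v" "okw v'" using u w v by (auto dest: over_ok)
 have ph0: "ph 0 = 0" using add[of 0 0] by simp
 have phs: "ph (nsc s e) = real s * ph e" for s e
 proof (induction s)
  case (Suc s)
  have "nsc (Suc s) e = nsc s e + e" using nsc_add[of s 1 e] by simp
  thus ?case using Suc add by (simp add: algebra_simps)
 qed (simp add: ph0)
 have suppn: "ph n < 0" if "over (%e. ph e < 0) x" "rc (rw x) m n ~= 0" "n ~= 0" for x :: "('i,'k) word" and m n
 proof -
  have "n = 0 \<or> ph n < 0"
  proof (rule rc_supp[where w="rw x" and Q="%n. ph n < 0"])
   fix a e and s :: nat assume "a = 0 \<or> ph a < 0" "ph e < 0" "0 < s"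
   moreover from this have "real s * ph e < 0" by (simp add: mult_pos_neg)
   ultimately show "ph (a + nsc s e) < 0" using ph0 by (auto simp: add phs)
  qed (use that in "auto simp: over_def rl_def over_ok")
  thus ?thesis using that by simp
 qed
 have suppp: "0 < ph n" if "over (%e. 0 < ph e) x" "rc (rw x) m n ~= 0" "n ~= 0" for x :: "('i,'k) word" and m n
 proof -
  have "n = 0 \<or> 0 < ph n"
  proof (rule rc_supp[where w="rw x" and Q="%n. 0 < ph n"])
   fix a e and s :: nat assume "a = 0 \<or> 0 < ph a" "0 < ph e" "0 < s"
   moreover from this have "real s * ph e > 0" by simp
   ultimately show "0 < ph (a + nsc s e)" using ph0 by (auto simp: add phs intro: add_pos_pos)
  qed (use that in "auto simp: over_def rl_def over_ok")
  thus ?thesis using that by simp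
 qed
 have supp0: "ph n = 0" if "over (%e. ph e = 0) x" "rc (rw x) m n ~= 0" for x :: "('i,'k) word" and m n
 proof -
  have "n = 0 \<or> ph n = 0"
   by (rule rc_supp[where w="rw x" and Q="%n. ph n = 0"])
     (use that ph0 in "auto simp: over_def rl_def over_ok add phs")
  thus ?thesis using ph0 by auto
 qed
 have suppge: "0 <= ph n" if "over (%e. 0 <= ph e) x" "rc (rw x) m n ~= 0" for x :: "('i,'k) word" and m n
 proof -
  have "n = 0 \<or> 0 <= ph n"
   by (rule rc_supp[where w="rw x" and Q="%n. 0 <= ph n"])
     (use that ph0 in "auto simp: over_def rl_def over_ok add phs")
  thus ?thesis using ph0 by auto
 qed
 define X where "X = winv u' @ u"
 have X: "over (%e. ph e < 0) X" using u by (simp add: X_def)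
 have okX: "okw X" using X over_ok by blast
 define Y where "Y = w' @ v' @ winv v"
 have Y: "over (%e. 0 <= ph e) Y" using w v unfolding Y_def by (auto intro: over_mono)
 have A: "req k (rw (u @ w)) (rw (u' @ Y))"
 proof (rule req_cancel_right[where a="rw v" and a'="rw v"])
  have "req k (rw (u' @ w' @ v') @ []) (rw (u' @ w' @ v') @ (rinv (rw v) @ rw v))"
   by (rule req_append) (use ok in "auto intro: req_sym[OF req_rinv(2)]")
  with eq show "req k (rw (u @ w) @ rw v) (rw (u' @ Y) @ rw v)"
   using req_trans[of k "rw (u @ w @ v)" "rw (u' @ w' @ v')"] by (simp add: Y_def rw_winv)
 qed (use ok Y in "auto simp: Y_def rw_winv")
 have XY: "req k (rw (X @ w)) (rw Y)"
 proof (rule req_cancel_left[where a="rw u'" and a'="rw u'"])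
  have "req k ((rw u' @ rinv (rw u')) @ rw (u @ w)) ([] @ rw (u @ w))"
   by (rule req_append) (use ok in "auto intro: req_rinv")
  from req_trans[OF this] A show "req k (rw u' @ rw (X @ w)) (rw u' @ rw Y)"
   by (simp add: X_def rw_winv)
 qed (use ok Y in "auto simp: Y_def X_def rw_winv")
 have X0: "rc (rw X) m n = 0" if "m \<in> latt J" "n ~= 0" "dg n < k" for m n
  using that
 proof (induction "nat (dg n)" arbitrary: m n rule: less_induct)
  case less
  show ?case
  proof (rule ccontr)
   assume nz: "rc (rw X) m n ~= 0"
   hence neg: "ph n < 0" using suppn[OF X] less.prems by blast
   have nn: "n \<in> nonneg J" using rc_neg[OF okrs_rw[OF okX]] nz by blast
   have "rc (rw X @ rw w) m n = (\<Sum>a\<in>Nk (dg n + 1). rc (rw X) m a * rc (rw w) (m + B a) (n - a))"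
    by (rule rc_append) (use okX ok in auto)
   also have "\<dots> = (\<Sum>a\<in>Nk (dg n + 1). if a = n then rc (rw X) m n else 0)"
   proof (intro sum.cong refl)
    fix a assume a: "a \<in> Nk (dg n + 1)"
    show "rc (rw X) m a * rc (rw w) (m + B a) (n - a) = (if a = n then rc (rw X) m n else 0)"
    proof (cases "a = n")
     case True thus ?thesis using rc_0[OF okrs_rw[OF ok(3)]] by simp
    next
     case False
     show ?thesis
     proof (rule ccontr)
      assume "\<not> ?thesis"
      hence z: "rc (rw X) m a ~= 0" "rc (rw w) (m + B a) (n - a) ~= 0" using False by auto
      have "n - a \<in> nonneg J" using rc_neg[OF okrs_rw[OF ok(3)]] z(2) by blast
      hence "0 < dg (n - a)" using nonneg_deg0[of "n - a"] False by force
      hence l: "dg a < dg n" by (simp add: degN_diff)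
      have "a = 0"
      proof (rule ccontr)
       assume "a ~= 0"
       moreover have "nat (dg a) < nat (dg n)" using l degN_nonneg[OF NkD(1)[OF a]] by linarith
       ultimately have "rc (rw X) m a = 0" using less.hyps[of a m] less.prems l by auto
       thus False using z by simp
      qed
      hence "ph n = 0" using supp0[OF w(1) z(2)] by simp
      thus False using neg by simp
     qed
    qed
   qed
   also have "\<dots> = rc (rw X) m n" using NkI[OF nn, of "dg n + 1"] by simp
   finally have "rc (rw Y) m n ~= 0" using nz reqD[OF XY less.prems(1,3)] by simp
   hence "0 <= ph n" using suppge[OF Y] by blast
   thus False using neg by simp
  qed
 qed
 have X1: "req k (rw X) []"
  unfolding req_def using X0 rc_0[OF okrs_rw[OF okX]] by auto
 show U: "req k (rw u) (rw u')"
 proof (rule req_cancel_left[where a="rw (winv u')" and a'="rw (winv u')"])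
  have "req k (rw (winv u') @ rw u') []" unfolding rw_winv by (rule req_rinv) (use ok in auto)
  thus "req k (rw (winv u') @ rw u) (rw (winv u') @ rw u')"
   using req_trans[OF X1[unfolded X_def map_append] req_sym] by blast
 qed (use ok in auto)
 have WV: "req k (rw (w @ v)) (rw (w' @ v'))"
  by (rule req_cancel_left[OF _ U]) (use eq ok in auto)
 have P0: "req k (rw w @ rw v) (rw w' @ rw v')" using WV by simp
 define R where "R = v' @ winv v"
 define L where "L = winv w' @ w"
 have okRL: "okw R" "okw L" using ok by (auto simp: R_def L_def)
 have "req k (rw L) (rw R)"
 proof (rule req_cancel_left[where a="rw w'" and a'="rw w'"])
  have s1: "req k ((rw w' @ rw (winv w')) @ rw w) ([] @ rw w)"
   unfolding rw_winv by (rule req_append) (use ok in "auto intro: req_rinv")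
  have s2: "req k (rw w @ []) (rw w @ (rw v @ rw (winv v)))"
   unfolding rw_winv by (rule req_append) (use ok in "auto intro: req_sym[OF req_rinv(1)]")
  have s3: "req k ((rw w @ rw v) @ rw (winv v)) ((rw w' @ rw v') @ rw (winv v))"
   by (rule req_append) (use ok P0 in auto)
  show "req k (rw w' @ rw L) (rw w' @ rw R)"
   using req_trans[OF s1[simplified] req_trans[OF s2[simplified] s3[simplified]]] by (simp add: L_def R_def)
 qed (use ok okRL in auto)
 hence "req k (rw L) []"
  unfolding req_def
 proof (intro ballI allI impI)
  fix m n assume H: "ALL m:latt J. ALL n. dg n < k --> rc (rw L) m n = rc (rw R) m n" and m: "m \<in> latt J" and n: "dg n < k"
  show "rc (rw L) m n = rc [] m n"
  proof (cases "n = 0")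
   case True thus ?thesis using rc_0[OF okrs_rw[OF okRL(2)]] by simp
  next
   case False
   have "over (%e. ph e = 0) L" "over (%e. 0 < ph e) R" using w v by (auto simp: L_def R_def)
   hence "rc (rw L) m n ~= 0 --> ph n = 0" "rc (rw R) m n ~= 0 --> 0 < ph n"
    using supp0 suppp[OF _ _ False] by blast+
   thus ?thesis using H m n False by auto
  qed
 qed
 hence L1: "req k (rw (winv w') @ rw w) []" by (simp add: L_def)
 show "req k (rw w) (rw w')"
 proof (rule req_cancel_left[where a="rw (winv w')" and a'="rw (winv w')"])
  have "req k (rw (winv w') @ rw w') []" unfolding rw_winv by (rule req_rinv) (use ok in auto)
  thus "req k (rw (winv w') @ rw w) (rw (winv w') @ rw w')"
   by (intro req_trans[OF L1 req_sym])
 qed (use ok in auto)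
qed

subsection \<open>The central part of a word\<close>

text \<open>For words whose letters are orthogonal to nB this is the component at \<open>n\<close>
  of the logarithm and hence an invariant of the element (\<open>csum_unique\<close>); for arbitrary
  words it depends on the word.\<close>

definition csum :: "('i,'k::field_char_0) word => 'i lat => 'k" where
 "csum w n = (\<Sum>l\<leftarrow>w. if fst l = n then snd l else 0)"

lemma csum_simps [simp]: "csum [] n = 0" "csum (l # w) n = (if fst l = n then snd l else 0) + csum w n"
 "csum (w @ w') n = csum w n + csum w' n"
 by (auto simp: csum_def)

lemma csum_over: "over P w ==> \<not> P n ==> csum w n = 0"
 by (induction w) auto

text \<open>Starting from the exponent 0, a letter with direction e could only reach a multiple n of
  e, and there its power <e, nB> is 0.\<close>

lemma rc_m0: "okw w ==> over (%e. True) w ==> rc (rw w) 0 n = (if n = 0 then 1 else (0::'k::field_char_0))"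
proof (induction w arbitrary: n rule: rev_induct)
 case (snoc l w)
 have l: "fst l \<in> posN J" and w: "okw w" using snoc.prems by auto
 have I: "rc (rw w) 0 = (delta 0 :: 'i lat => 'k)" using snoc.IH w by (auto simp: delta_def)
 have "rc (rw (w @ [l])) 0 n = (\<Sum>s\<le>nat (dg n). delta 0 (n - nsc s (fst l)) * ((snd l * pr (fst l) (0 + B n)) ^ s / fact s))"
  using I by (simp add: rc_def[abs_def] ract_append) (simp add: ract_def rop_def ray_def rl_def)
 also have "\<dots> = (\<Sum>s\<le>nat (dg n). if s = 0 then delta 0 n else 0)"
 proof (intro sum.cong refl)
  fix s
  show "delta 0 (n - nsc s (fst l)) * ((snd l * pr (fst l) (0 + B n)) ^ s / fact s) = (if s = 0 then delta 0 n else (0::'k))"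
  proof (cases "n = nsc s (fst l) & s ~= 0")
   case True
   hence "pr (fst l) (0 + B n) = (0::'k)" by (simp add: matB_nsc pr_nsc2)
   thus ?thesis using True by simp
  qed (auto simp: delta_def)
 qed
 also have "\<dots> = delta 0 n" by simp
 finally show ?case by (simp add: delta_def)
qed simp

text \<open>Along the line j |-> j m every coefficient is a polynomial in j, with constant term
  known from the action on z^0. If all letters are orthogonal to nB, the s-th term of a letter
  contributes at \<open>n\<close> a pure power of j of order s times an earlier polynomial, so the
  linear coefficient sees only single letters of direction \<open>n\<close>.\<close>

lemma word_poly:
 fixes w :: "('i,'k::field_char_0) word"
 assumes "over (%e. (pr e (B n) :: 'k) = 0) w" and n: "n \<in> posN J"
 shows "\<exists>p :: 'i lat => 'k poly. (ALL b j. rc (rw w) (nsc j m) b = poly (p b) (of_nat j)) & coeff (p n) 1 = csum w n * pr n m"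
 using assms(1)
proof (induction w rule: rev_induct)
 case Nil
 show ?case by (rule exI[of _ "%b. if b = 0 then 1 else 0"]) (use posN_nz[OF n] in auto)
next
 case (snoc l w)
 let ?e = "fst l"
 have l: "?e \<in> posN J" "(pr ?e (B n) :: 'k) = 0" and w: "over (%e. (pr e (B n) :: 'k) = 0) w" using snoc.prems by auto
 have okw: "okw w" using w over_ok by blast
 from snoc.IH[OF w] obtain p :: "'i lat => 'k poly" where p: "\<And>b j. rc (rw w) (nsc j m) b = poly (p b) (of_nat j)"
  and p1: "coeff (p n) 1 = csum w n * pr n m" by blast
 let ?X = "%b. [: snd l * pr ?e (B b), snd l * pr ?e m :]"
 define q where "q b = (\<Sum>s\<le>nat (dg b). smult (1 / fact s) (p (b - nsc s ?e) * ?X b ^ s))" for b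
 have "rc (rw (w @ [l])) (nsc j m) b = poly (q b) (of_nat j)" for b j
 proof -
  have "rc (rw (w @ [l])) (nsc j m) b = (\<Sum>s\<le>nat (dg b). rc (rw w) (nsc j m) (b - nsc s ?e) *
    ((snd l * pr ?e (nsc j m + B b)) ^ s / fact s))"
   by (simp add: rc_def[abs_def] ract_append) (simp add: ract_def rop_def ray_def rl_def)
  also have "\<dots> = poly (q b) (of_nat j)"
   unfolding q_def poly_sum p
   by (intro sum.cong refl) (simp add: pr_add2 pr_nsc2 algebra_simps)
  finally show ?thesis .
 qed
 moreover have "coeff (q n) 1 = csum (w @ [l]) n * pr n m"
 proof -
  have d1: "1 <= nat (dg n)" using deg_pos[OF n] by linarith
  have X: "?X n ^ s = monom ((snd l * pr ?e m) ^ s) s" for s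
  proof -
   have "?X n = monom (snd l * pr ?e m) 1" using l(2) by (simp add: monom_Suc monom_0)
   thus ?thesis by (simp add: monom_power)
  qed
  have p0: "coeff (p b) 0 = (if b = 0 then 1 else 0)" for b
   using p[of 0 b] rc_m0[OF okw okw, of b] by (simp add: poly_0_coeff_0)
  have "coeff (q n) 1 = (\<Sum>s\<le>nat (dg n). (1 / fact s) * coeff (p (n - nsc s ?e) * monom ((snd l * pr ?e m) ^ s) s) 1)"
   unfolding q_def X coeff_sum coeff_smult ..
  also have "\<dots> = (\<Sum>s\<le>nat (dg n). if s = 0 then coeff (p n) 1 else if s = 1 then
    (if ?e = n then snd l * pr n m else 0) else 0)"
  proof (intro sum.cong refl)
   fix s
   consider "s = 0" | "s = 1" | "(2::nat) <= s" by linarith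
   thus "(1 / fact s) * coeff (p (n - nsc s ?e) * monom ((snd l * pr ?e m) ^ s) s) 1 =
    (if s = 0 then coeff (p n) 1 else if s = 1 then (if ?e = n then snd l * pr n m else 0) else 0)"
   proof cases
    case 3
    hence "coeff (p (n - nsc s ?e) * monom ((snd l * pr ?e m) ^ s) s) 1 = 0"
     by (subst mult.commute) (simp add: coeff_monom_mult)
    thus ?thesis using 3 by simp
   next
    case 2
    have "coeff (p (n - ?e) * monom (snd l * pr ?e m) 1) 1 = snd l * pr ?e m * coeff (p (n - ?e)) 0"
     by (subst mult.commute) (simp add: coeff_monom_mult)
    thus ?thesis using 2 by (auto simp: p0)
   qed simp
  qed
  also have "\<dots> = (\<Sum>s\<in>{0::nat,1}. if s = 0 then coeff (p n) 1 else if s = 1 then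
    (if ?e = n then snd l * pr n m else 0) else 0)"
   by (rule sum.mono_neutral_right) (use d1 in auto)
  also have "\<dots> = csum (w @ [l]) n * pr n m" using p1 by (auto simp: algebra_simps)
  finally show ?thesis .
 qed
 ultimately show ?case by blast
qed

text \<open>Equal words give polynomials that agree at all natural numbers, hence are equal; their
  linear coefficients are compared at some \<open>m\<close> with <n, m> nonzero.\<close>

theorem csum_unique:
 fixes w w' :: "('i,'k::field_char_0) word"
 assumes "over (%e. (pr e (B n) :: 'k) = 0) w" "over (%e. (pr e (B n) :: 'k) = 0) w'"
  and n: "n \<in> posN J" "dg n < k" and eq: "req k (rw w) (rw w')"
 shows "csum w n = csum w' n"
proof -
 obtain m where m: "m \<in> latt J" "(pr n m :: 'k) ~= 0" using pr_posN_ex[OF n(1)] by blast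
 obtain p :: "'i lat => 'k poly" where p: "\<And>b j. rc (rw w) (nsc j m) b = poly (p b) (of_nat j)" "coeff (p n) 1 = csum w n * pr n m"
  using word_poly[OF assms(1) n(1)] by blast
 obtain p' :: "'i lat => 'k poly" where p': "\<And>b j. rc (rw w') (nsc j m) b = poly (p' b) (of_nat j)" "coeff (p' n) 1 = csum w' n * pr n m"
  using word_poly[OF assms(2) n(1)] by blast
 have "poly (p n - p' n) (of_nat j) = 0" for j
  using reqD[OF eq latt_nsc[OF m(1)] n(2), of j] p(1)[of j n] p'(1)[of j n] by simp
 hence "range (of_nat :: nat => 'k) \<subseteq> {x. poly (p n - p' n) x = 0}" by auto
 moreover have "infinite (range (of_nat :: nat => 'k))"
  by (rule range_inj_infinite) (simp add: inj_of_nat)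
 ultimately have "infinite {x. poly (p n - p' n) x = 0}" using finite_subset by blast
 hence "p n - p' n = 0" using poly_roots_finite by blast
 thus ?thesis using p(2) p'(2) m(2) by simp
qed

end

section \<open>Linear relations and finitely many crossings on an interval\<close>

lemma homogeneous_solution:
 fixes a :: "'s => 'j => real"
 assumes "finite J" "finite T" "card J < card T"
 shows "EX l. (EX s:T. l s ~= 0) & (ALL i:J. (\<Sum>s\<in>T. l s * a s i) = 0)"
 using assms
proof (induction J arbitrary: T a rule: finite_induct)
 case empty
 hence "T ~= {}" by auto
 thus ?case by (intro exI[of _ "%_. 1"]) auto
next
 case (insert j J)
 show ?case
 proof (cases "ALL s:T. a s j = 0")
  case True
  from insert.IH[of T a] insert.prems insert.hyps obtain l where
   "EX s:T. l s ~= 0" "ALL i:J. (\<Sum>s\<in>T. l s * a s i) = 0" by auto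
  thus ?thesis using True by (intro exI[of _ l]) auto
 next
  case False
  then obtain s0 where s0: "s0 \<in> T" "a s0 j ~= 0" by auto
  let ?T = "T - {s0}"
  let ?b = "%s i. a s i - a s j / a s0 j * a s0 i"
  have "finite ?T" "card J < card ?T" using insert s0 by auto
  from insert.IH[OF this, of ?b] obtain l where l: "EX s:?T. l s ~= 0"
   "ALL i:J. (\<Sum>s\<in>?T. l s * ?b s i) = 0" by auto
  let ?x = "- (\<Sum>s\<in>?T. l s * a s j / a s0 j)"
  let ?l = "l(s0 := ?x)"
  have S: "(\<Sum>s\<in>T. ?l s * a s i) = (\<Sum>s\<in>?T. l s * ?b s i)" for i
  proof -
   have "(\<Sum>s\<in>T. ?l s * a s i) = ?x * a s0 i + (\<Sum>s\<in>?T. ?l s * a s i)"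
    using s0 insert.prems by (subst sum.remove[of _ s0]) auto
   also have "(\<Sum>s\<in>?T. ?l s * a s i) = (\<Sum>s\<in>?T. l s * a s i)" by (intro sum.cong) auto
   also have "?x * a s0 i + \<dots> = (\<Sum>s\<in>?T. l s * ?b s i)"
   proof -
    have "(\<Sum>s\<in>?T. l s * ?b s i) = (\<Sum>s\<in>?T. l s * a s i - l s * a s j / a s0 j * a s0 i)"
     by (intro sum.cong refl) (simp add: algebra_simps)
    also have "\<dots> = (\<Sum>s\<in>?T. l s * a s i) + ?x * a s0 i"
     unfolding sum_subtractf sum_distrib_right[symmetric] by simp
    finally show ?thesis by simp
   qed
   finally show ?thesis .
  qed
  have "(\<Sum>s\<in>T. ?l s * a s j) = 0" unfolding S using s0 by simp
  moreover have "ALL i:J. (\<Sum>s\<in>T. ?l s * a s i) = 0" unfolding S using l by simp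
  moreover have "EX s:T. ?l s ~= 0" using l by auto
  ultimately show ?thesis by (intro exI[of _ ?l]) auto
 qed
qed

text \<open>Cut the interval halfway between the smallest crossing and the next one, and induct on
  the number of crossings that remain. All transport arguments use this to reduce a segment to
  pieces with at most one crossing; the relation \<open>P\<close> is needed only between points off
  \<open>X\<close>.\<close>

lemma finite_crossings:
 fixes X :: "real set"
 assumes "finite X" "a < b" "a \<notin> X" "b \<notin> X"
  and tr: "\<And>s t u. a <= s ==> s < t ==> t < u ==> u <= b ==> s \<notin> X ==> t \<notin> X ==> u \<notin> X ==> P s t ==> P t u ==> P s u"
  and st: "\<And>s t. a <= s ==> s < t ==> t <= b ==> s \<notin> X ==> t \<notin> X ==> card (X \<inter> {s..t}) <= 1 ==> P s t"
 shows "P a b"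
proof -
 have "P s b" if "a <= s" "s < b" "s \<notin> X" for s
  using that
 proof (induction "card (X \<inter> {s..b})" arbitrary: s rule: less_induct)
  case less
  show ?case
  proof (cases "card (X \<inter> {s..b}) <= 1")
   case True
   thus ?thesis using st less.prems assms by auto
  next
   case False
   define x where "x = Min (X \<inter> {s..b})"
   have fin: "finite (X \<inter> {s..b})" using assms by auto
   have ne: "X \<inter> {s..b} ~= {}" using False by auto
   have x: "x \<in> X" "s <= x" "x <= b" "ALL y:X \<inter> {s..b}. x <= y"
    using Min_in[OF fin ne] fin unfolding x_def by auto
   define Y where "Y = insert b (X \<inter> {x<..b})"
   have finY: "finite Y" "Y ~= {}" using assms by (auto simp: Y_def)
   define y where "y = Min Y"
   have y: "y \<in> Y" "ALL z:Y. y <= z" using Min_in[OF finY] finY unfolding y_def by auto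
   have xb: "x < b" using x assms(4) by (cases "x = b") auto
   have xy: "x < y" "y <= b" using y xb by (auto simp: Y_def)
   define t where "t = (x + y) / 2"
   have t: "x < t" "t < y" using xy by (auto simp: t_def)
   have tX: "t \<notin> X"
   proof
    assume "t \<in> X"
    hence "t \<in> Y" using t xy by (auto simp: Y_def)
    thus False using y(2) t by fastforce
   qed
   have "X \<inter> {s..t} \<subseteq> {x}"
   proof
    fix z assume z: "z \<in> X \<inter> {s..t}"
    hence "x <= z" using x t xy by auto
    moreover have "\<not> x < z"
    proof
     assume "x < z"
     hence "z \<in> Y" using z t xy by (auto simp: Y_def)
     thus False using y z t by fastforce
    qed
    ultimately show "z \<in> {x}" by auto
   qed
   hence "card (X \<inter> {s..t}) <= 1" using card_mono[of "{x}" "X \<inter> {s..t}"] by simp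
   hence P1: "P s t" using st[of s t] less.prems t x xy tX by auto
   have "x \<in> X \<inter> {s..b}" "x \<notin> X \<inter> {t..b}" "X \<inter> {t..b} \<subseteq> X \<inter> {s..b}" using x t less.prems by auto
   hence "X \<inter> {t..b} \<subset> X \<inter> {s..b}" by blast
   hence "card (X \<inter> {t..b}) < card (X \<inter> {s..b})" using fin by (rule psubset_card_mono[rotated])
   hence "P t b" using less.hyps[of t] t xy tX x less.prems by auto
   moreover have "s < t" "t < b" using x t xy by auto
   ultimately show ?thesis using tr[OF less.prems(1) _ _ order_refl less.prems(3) tX assms(4) P1] by blast
  qed
 qed
 thus ?thesis using assms by auto
qed

section \<open>Covectors, parallelism and neighbourhoods\<close>

definition rv :: "'i lat => 'i vec" where "rv n = (%i. real_of_int (n i))"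

context seed begin

definition dot :: "'i vec => 'i vec => real" where "dot h x = (\<Sum>i\<in>J. h i * x i)"
definition nz :: "'i vec => bool" where "nz h \<longleftrightarrow> (EX i:J. h i ~= 0)"
definition par :: "'i vec => 'i vec => bool" where "par h v \<longleftrightarrow> (EX c. ALL i:J. h i = c * v i)"
text \<open>The covector of \<open>n\<close> in the coordinates of the \<open>f_i\<close>, so that
  \<open>dot (nrm n) (rv mu)\<close> is <n, mu>. The hyperplane of a wall with normal
  \<open>n\<close> is the zero set of this covector.\<close>

definition nrm :: "'i lat => 'i vec" where "nrm n = (%i. real_of_int (n i) / real (d i))"
abbreviation nw :: "('i,'k) wall => 'i vec" where "nw w == nrm (fst w)"
definition close :: "real => 'i vec => 'i vec => bool" where "close e x y \<longleftrightarrow> (ALL i:J. \<bar>y i - x i\<bar> < e)"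
abbreviation uvec :: "'i => 'i vec" where "uvec j \<equiv> rv (unitv j)"

lemma pairR_dot: "pairR J d x n = dot (nrm n) x"
 by (simp add: pairR_def dot_def nrm_def mult_ac)

lemma dot_pr: "dot (nrm n) (rv mu) = pr n mu"
 by (simp add: dot_def nrm_def rv_def pr_def)

lemma dot_add: "dot h (%i. x i + y i) = dot h x + dot h y" by (simp add: dot_def algebra_simps sum.distrib)
lemma dot_scale: "dot h (%i. c * x i) = c * dot h x" by (simp add: dot_def sum_distrib_left mult_ac)
lemma dot_diff: "dot h (%i. x i - y i) = dot h x - dot h y" by (simp add: dot_def algebra_simps sum_subtractf)
lemma dot_addl: "dot (%i. h i + g i) x = dot h x + dot g x" by (simp add: dot_def algebra_simps sum.distrib)
lemma dot_scalel: "dot (%i. c * h i) x = c * dot h x" by (simp add: dot_def sum_distrib_left mult_ac)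
lemma dot_diffl: "dot (%i. h i - g i) x = dot h x - dot g x" by (simp add: dot_def algebra_simps sum_subtractf)
lemma dot_0 [simp]: "dot h (%i. 0) = 0" "dot (%i. 0) h = 0" by (simp_all add: dot_def)
lemma dot_sum: "finite A ==> dot h (%i. \<Sum>s\<in>A. l s * f s i) = (\<Sum>s\<in>A. l s * dot h (f s))"
 by (simp add: dot_def sum_distrib_left sum_distrib_right sum.swap[of _ A] mult_ac)
lemma dot_suml: "finite A ==> dot (%i. \<Sum>s\<in>A. l s * f s i) h = (\<Sum>s\<in>A. l s * dot (f s) h)"
 by (simp add: dot_def sum_distrib_left sum_distrib_right sum.swap[of _ A] mult_ac)
lemma dot_congl: "(\<And>i. i \<in> J ==> x i = y i) ==> dot x h = dot y h" by (simp add: dot_def)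
lemma dot_comm: "dot h x = dot x h" by (simp add: dot_def mult_ac)

lemma dot_uvec: "j \<in> J ==> dot h (uvec j) = h j"
proof -
 assume j: "j \<in> J"
 have "dot h (uvec j) = (\<Sum>i\<in>J. if i = j then h j else 0)"
  unfolding dot_def rv_def unitv_def by (intro sum.cong) auto
 thus ?thesis using j finJ by simp
qed

lemma uvec_vecs: "j \<in> J ==> uvec j \<in> vecs J" by (auto simp: vecs_def rv_def unitv_def)
lemma rv_vecs: "n \<in> latt J ==> rv n \<in> vecs J" by (auto simp: vecs_def rv_def latt_def)
lemma vecs_add: "x \<in> vecs J ==> y \<in> vecs J ==> (%i. x i + y i) \<in> vecs J" by (auto simp: vecs_def)
lemma vecs_diff: "x \<in> vecs J ==> y \<in> vecs J ==> (%i. x i - y i) \<in> vecs J" by (auto simp: vecs_def)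
lemma vecs_scale: "x \<in> vecs J ==> (%i. c * x i) \<in> vecs J" by (auto simp: vecs_def)
lemma vecs_0: "(%i. 0) \<in> vecs J" by (auto simp: vecs_def)
lemmas vecs_intros = vecs_add vecs_diff vecs_scale vecs_0 rv_vecs uvec_vecs

lemma nz_dot: "nz h ==> EX j:J. dot h (uvec j) ~= 0" by (auto simp: nz_def dot_uvec)

lemma nz_nrm: "n \<in> posN J ==> nz (nrm n)"
proof -
 assume n: "n \<in> posN J"
 hence l: "ALL i. i \<notin> J --> n i = 0" "n ~= 0" by (auto simp: posN_def nonneg_def latt_def)
 then obtain i where i: "n i ~= 0" by (auto simp: fun_eq_iff fun_app)
 hence iJ: "i \<in> J" using l by auto
 thus ?thesis using i dpos[OF iJ] by (auto simp: nz_def nrm_def)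
qed

subsection \<open>Generic points\<close>

lemma line_bad_finite:
 assumes "finite H" "ALL h:H. dot h x ~= 0 \<or> dot h v ~= 0"
 shows "finite {t. EX h:H. dot h (%i. x i + t * v i) = 0}"
proof -
 have "{t. EX h:H. dot h (%i. x i + t * v i) = 0} \<subseteq> (%h. - dot h x / dot h v) ` H"
 proof clarify
  fix t h assume h: "h \<in> H" "dot h (%i. x i + t * v i) = 0"
  hence e: "dot h x + t * dot h v = 0" by (simp add: dot_add dot_scale)
  hence "dot h v ~= 0" using assms(2) h(1) by auto
  hence "t = - dot h x / dot h v" using e by (simp add: field_simps)
  thus "t \<in> (%h. - dot h x / dot h v) ` H" using h by auto
 qed
 thus ?thesis using assms(1) finite_surj by blast
qed

lemma good_parameter:
 assumes "finite (X::real set)" "0 < e"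
 obtains t where "0 < t" "t < e" "t \<notin> X"
proof -
 have "infinite {0<..<e}" using assms by (simp add: infinite_Ioo)
 hence "\<not> {0<..<e} \<subseteq> X" using assms finite_subset by blast
 then obtain t where "t \<in> {0<..<e}" "t \<notin> X" by blast
 thus ?thesis using that[of t] by simp
qed

text \<open>Covectors are treated one at a time: a vector good for the earlier ones is moved along a
  coordinate vector on which the new one is nonzero, and only finitely many displacements spoil any
  of them.\<close>

lemma generic_direction:
 assumes "finite H" "ALL h:H. nz h"
 shows "EX v:vecs J. ALL h:H. dot h v ~= 0"
 using assms
proof (induction H rule: finite_induct)
 case empty
 thus ?case using vecs_0 by blast
next
 case (insert h H)
 then obtain v where v: "v \<in> vecs J" "ALL h:H. dot h v ~= 0" by auto
 obtain j where j: "j \<in> J" "dot h (uvec j) ~= 0" using nz_dot insert by blast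
 have "finite {t. EX g:insert h H. dot g (%i. v i + t * uvec j i) = 0}"
  by (rule line_bad_finite) (use insert v j in auto)
 then obtain t :: real where "0 < t" "t < 1"
  "t \<notin> {t. EX g:insert h H. dot g (%i. v i + t * uvec j i) = 0}"
  by (rule good_parameter[OF _ zero_less_one])
 hence "ALL g:insert h H. dot g (%i. v i + t * uvec j i) ~= 0" by blast
 moreover have "(%i. v i + t * uvec j i) \<in> vecs J" using v j by (intro vecs_intros) auto
 ultimately show ?case by blast
qed

lemma close_line:
 assumes "0 < e"
 obtains t0 where "0 < t0" "\<And>t. 0 < t ==> t < t0 ==> close e x (%i. x i + t * v i)"
proof -
 define M where "M = 1 + (\<Sum>i\<in>J. \<bar>v i\<bar>)"
 have M: "0 < M" "\<And>i. i \<in> J ==> \<bar>v i\<bar> < M"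
 proof -
  show "0 < M" unfolding M_def by (smt (verit) sum_nonneg abs_ge_zero)
  fix i assume "i \<in> J"
  hence "\<bar>v i\<bar> <= (\<Sum>i\<in>J. \<bar>v i\<bar>)" by (intro member_le_sum) (auto simp: finJ)
  thus "\<bar>v i\<bar> < M" by (simp add: M_def)
 qed
 show ?thesis
 proof (rule that[of "e / M"])
  show "0 < e / M" using M assms by simp
  fix t assume t: "0 < t" "t < e / M"
  show "close e x (%i. x i + t * v i)"
   unfolding close_def
  proof
   fix i assume i: "i \<in> J"
   have "\<bar>x i + t * v i - x i\<bar> = t * \<bar>v i\<bar>" using t by (simp add: abs_mult)
   also have "\<dots> <= t * M" using M(2)[OF i] t by (intro mult_left_mono) auto
   also have "\<dots> < e" using t M by (simp add: field_simps)
   finally show "\<bar>x i + t * v i - x i\<bar> < e" .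
  qed
 qed
qed

lemma generic_near:
 assumes "finite H" "ALL h:H. nz h" "x \<in> vecs J" "0 < e"
 obtains y where "y \<in> vecs J" "close e x y" "ALL h:H. dot h y ~= 0"
proof -
 obtain v where v: "v \<in> vecs J" "ALL h:H. dot h v ~= 0" using generic_direction[OF assms(1,2)] by blast
 obtain t0 where t0: "0 < t0" "\<And>t. 0 < t ==> t < t0 ==> close e x (%i. x i + t * v i)"
  by (rule close_line[OF assms(4), of x v]) blast
 have "finite {t. EX h:H. dot h (%i. x i + t * v i) = 0}" by (rule line_bad_finite) (use assms v in auto)
 then obtain t where t: "0 < t" "t < t0" "t \<notin> {t. EX h:H. dot h (%i. x i + t * v i) = 0}"
  by (rule good_parameter[OF _ t0(1)])
 show ?thesis
 proof (rule that)
  show "(%i. x i + t * v i) \<in> vecs J" using v assms by (intro vecs_intros) auto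
  show "close e x (%i. x i + t * v i)" by (rule t0(2)[OF t(1,2)])
  show "ALL h:H. dot h (%i. x i + t * v i) ~= 0" using t(3) by blast
 qed
qed

text \<open>Work modulo \<open>v\<close>: subtracting the multiple of \<open>v\<close> that kills
  the j-th coordinate of h leaves a nonzero covector, because h is not parallel to \<open>v\<close>.
  Correcting a generic w along the j-th unit vector puts it into the hyperplane and preserves the
  values of these reduced covectors.\<close>

lemma generic_direction_in:
 assumes "finite H" "nz v" "ALL h:H. \<not> par h v"
 shows "EX w:vecs J. dot v w = 0 & (ALL h:H. dot h w ~= 0)"
proof -
 obtain j where j: "j \<in> J" "v j ~= 0" using assms(2) by (auto simp: nz_def)
 let ?g = "%h i. h i - h j / v j * v i"
 have "ALL g:?g ` H. nz g"
 proof clarify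
  fix h assume h: "h \<in> H"
  show "nz (?g h)"
  proof (rule ccontr)
   assume "\<not> nz (?g h)"
   hence "ALL i:J. h i = (h j / v j) * v i" by (auto simp: nz_def)
   hence "par h v" unfolding par_def by blast
   thus False using assms(3) h by blast
  qed
 qed
 then obtain w where w: "w \<in> vecs J" "ALL g:?g ` H. dot g w ~= 0"
  using generic_direction[of "?g ` H"] assms(1) by auto
 let ?w = "%i. w i - dot v w / v j * uvec j i"
 have "?w \<in> vecs J" using w j by (intro vecs_intros) auto
 moreover have "dot v ?w = 0" unfolding dot_diff dot_scale dot_uvec[OF j(1)] using j by simp
 moreover have "dot h ?w ~= 0" if "h \<in> H" for h
 proof -
  have "dot h ?w = dot (?g h) w"
   unfolding dot_diff dot_scale dot_uvec[OF j(1)] dot_diffl dot_scalel by simp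
  thus ?thesis using w that by auto
 qed
 ultimately show ?thesis by blast
qed

lemma generic_near_in:
 assumes "finite H" "nz v" "ALL h:H. \<not> par h v" "x \<in> vecs J" "dot v x = 0" "0 < e"
 obtains y where "y \<in> vecs J" "close e x y" "dot v y = 0" "ALL h:H. dot h y ~= 0"
proof -
 obtain w where w: "w \<in> vecs J" "dot v w = 0" "ALL h:H. dot h w ~= 0"
  using generic_direction_in[OF assms(1-3)] by blast
 obtain t0 where t0: "0 < t0" "\<And>t. 0 < t ==> t < t0 ==> close e x (%i. x i + t * w i)"
  by (rule close_line[OF assms(6), of x w]) blast
 have "finite {t. EX h:H. dot h (%i. x i + t * w i) = 0}" by (rule line_bad_finite) (use assms w in auto)
 then obtain t where t: "0 < t" "t < t0" "t \<notin> {t. EX h:H. dot h (%i. x i + t * w i) = 0}"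
  by (rule good_parameter[OF _ t0(1)])
 show ?thesis
 proof (rule that)
  show "(%i. x i + t * w i) \<in> vecs J" using w assms by (intro vecs_intros) auto
  show "close e x (%i. x i + t * w i)" by (rule t0(2)[OF t(1,2)])
  show "dot v (%i. x i + t * w i) = 0" using w assms by (simp add: dot_add dot_scale)
  show "ALL h:H. dot h (%i. x i + t * w i) ~= 0" using t(3) by blast
 qed
qed

lemma sign_stable:
 assumes "finite H"
 obtains e where "0 < e" "\<And>y h. close e x y ==> h \<in> H ==> dot h x ~= 0 ==> 0 < dot h x * dot h y"
proof -
 have one: "\<exists>e>0. ALL y. close e x y --> dot h x ~= 0 --> 0 < dot h x * dot h y" for h
 proof (cases "dot h x = 0")
  case False
  define M where "M = 1 + (\<Sum>i\<in>J. \<bar>h i\<bar>)"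
  have M: "0 < M" unfolding M_def by (smt (verit) sum_nonneg abs_ge_zero)
  define e where "e = \<bar>dot h x\<bar> / M"
  have "0 < e" using False M by (simp add: e_def)
  moreover have "0 < dot h x * dot h y" if c: "close e x y" for y
  proof -
   have "\<bar>dot h y - dot h x\<bar> = \<bar>\<Sum>i\<in>J. h i * (y i - x i)\<bar>"
    by (simp add: dot_def sum_subtractf right_diff_distrib)
   also have "\<dots> <= (\<Sum>i\<in>J. \<bar>h i * (y i - x i)\<bar>)" by (rule sum_abs)
   also have "\<dots> <= (\<Sum>i\<in>J. \<bar>h i\<bar> * e)"
    using c unfolding close_def abs_mult by (intro sum_mono mult_left_mono) (auto simp: less_imp_le)
   also have "\<dots> = (M - 1) * e" by (simp add: M_def sum_distrib_right)
   also have "\<dots> < M * e" using \<open>0 < e\<close> by simp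
   also have "\<dots> = \<bar>dot h x\<bar>" using M by (simp add: e_def)
   finally have "\<bar>dot h y - dot h x\<bar> < \<bar>dot h x\<bar>" .
   thus ?thesis by (auto simp: zero_less_mult_iff abs_if split: if_splits)
  qed
  ultimately show ?thesis by blast
 qed (auto intro: exI[of _ 1])
 then obtain f where f: "\<And>h. 0 < f h" "\<And>h y. close (f h) x y ==> dot h x ~= 0 ==> 0 < dot h x * dot h y"
  by metis
 let ?e = "Min (insert 1 (f ` H))"
 have fin: "finite (insert 1 (f ` H))" using assms by auto
 show ?thesis
 proof (rule that[of ?e])
  show "0 < ?e" using f fin by (subst Min_gr_iff) auto
  fix y h assume "close ?e x y" "h \<in> H" "dot h x ~= 0"
  moreover have "?e <= f h" using fin \<open>h \<in> H\<close> by (intro Min_le) auto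
  ultimately show "0 < dot h x * dot h y" using f(2)[of h y] by (auto simp: close_def intro: less_le_trans)
 qed
qed

subsection \<open>Linear algebra\<close>

text \<open>Subtract from the new vector its expansion in the old ones. A nonzero coordinate of the
  remainder yields a functional that kills the old vectors and takes the value 1 on the new one; the
  old functionals are corrected by multiples of it.\<close>

lemma dual_functionals:
 assumes "finite T" "T \<subseteq> latt J" "linind T"
 shows "EX ph. ALL s:T. ALL s':T. dot (ph s) (rv s') = (if s = s' then 1 else 0)"
 using assms
proof (induction T rule: finite_induct)
 case (insert a T)
 have lT: "linind T"
  unfolding linind_def
 proof (intro allI impI)
  fix l :: "'i lat => real" assume l: "ALL i. (\<Sum>s\<in>T. l s * real_of_int (s i)) = 0"
  let ?l = "l(a := 0)"
  have "(\<Sum>s\<in>insert a T. ?l s * real_of_int (s i)) = 0" for i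
  proof -
   have "(\<Sum>s\<in>insert a T. ?l s * real_of_int (s i)) = (\<Sum>s\<in>T. ?l s * real_of_int (s i))"
    using insert.hyps by simp
   also have "\<dots> = (\<Sum>s\<in>T. l s * real_of_int (s i))" using insert.hyps by (intro sum.cong) auto
   finally show ?thesis using l by simp
  qed
  hence "ALL i. (\<Sum>s\<in>insert a T. ?l s * real_of_int (s i)) = 0" by blast
  hence z: "ALL s:insert a T. ?l s = 0" using insert.prems(2)[unfolded linind_def, rule_format, of ?l] by blast
  show "ALL s:T. l s = 0"
  proof
   fix s assume "s \<in> T"
   thus "l s = 0" using z insert.hyps(2) by (metis fun_upd_other insertI2)
  qed
 qed
 with insert obtain ph where ph: "ALL s:T. ALL s':T. dot (ph s) (rv s') = (if s = s' then 1 else 0)" by auto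
 define a' where "a' = (%i. rv a i - (\<Sum>s\<in>T. dot (ph s) (rv a) * rv s i))"
 have "EX j:J. a' j ~= 0"
 proof (rule ccontr)
  assume neg: "\<not> (EX j:J. a' j ~= 0)"
  let ?l = "%s. if s = a then 1 else - dot (ph s) (rv a)"
  have "(\<Sum>s\<in>insert a T. ?l s * real_of_int (s i)) = 0" for i
  proof (cases "i \<in> J")
   case True
   have "(\<Sum>s\<in>insert a T. ?l s * real_of_int (s i)) = rv a i + (\<Sum>s\<in>T. ?l s * real_of_int (s i))"
    using insert.hyps by (simp add: rv_def)
   also have "(\<Sum>s\<in>T. ?l s * real_of_int (s i)) = - (\<Sum>s\<in>T. dot (ph s) (rv a) * rv s i)"
    unfolding sum_negf[symmetric] using insert.hyps by (intro sum.cong) (auto simp: rv_def)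
   finally show ?thesis using neg True by (simp add: a'_def)
  next
   case False
   hence "s i = 0" if "s \<in> insert a T" for s using insert.prems(1) that by (auto simp: latt_def)
   thus ?thesis by (intro sum.neutral) auto
  qed
  hence "ALL i. (\<Sum>s\<in>insert a T. ?l s * real_of_int (s i)) = 0" by blast
  hence "ALL s:insert a T. ?l s = 0"
   using insert.prems(2)[unfolded linind_def, rule_format, of ?l] by blast
  thus False by auto
 qed
 then obtain j where j: "j \<in> J" "a' j ~= 0" by blast
 define ps where "ps = (%i. uvec j i / a' j - (\<Sum>s\<in>T. rv s j / a' j * ph s i))"
 have dps: "dot ps x = x j / a' j - (\<Sum>s\<in>T. rv s j / a' j * dot (ph s) x)" for x
 proof -
  have "dot ps x = dot (%i. (1 / a' j) * uvec j i) x - dot (%i. \<Sum>s\<in>T. rv s j / a' j * ph s i) x"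
   by (simp add: ps_def flip: dot_diffl)
  also have "dot (%i. (1 / a' j) * uvec j i) x = x j / a' j"
   unfolding dot_scalel dot_comm[of "uvec j"] dot_uvec[OF j(1)] by simp
  finally show ?thesis unfolding dot_suml[OF insert.hyps(1)] .
 qed
 have ps0: "dot ps (rv s) = 0" if s: "s \<in> T" for s
 proof -
  have "(\<Sum>s'\<in>T. rv s' j / a' j * dot (ph s') (rv s)) = (\<Sum>s'\<in>T. if s' = s then rv s j / a' j else 0)"
   using ph s by (intro sum.cong) auto
  thus ?thesis using insert.hyps s by (simp add: dps)
 qed
 have ps1: "dot ps (rv a) = 1"
 proof -
  have "dot ps (rv a) = (rv a j - (\<Sum>s\<in>T. dot (ph s) (rv a) * rv s j)) / a' j"
   unfolding dps by (simp add: diff_divide_distrib sum_divide_distrib mult_ac)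
  thus ?thesis using j by (simp add: a'_def)
 qed
 show ?case
 proof (rule exI[of _ "%s. if s = a then ps else (%i. ph s i - dot (ph s) (rv a) * ps i)"], intro ballI)
  fix s s' assume "s \<in> insert a T" "s' \<in> insert a T"
  thus "dot (if s = a then ps else (%i. ph s i - dot (ph s) (rv a) * ps i)) (rv s') = (if s = s' then 1 else 0)"
   using ph ps0 ps1 insert.hyps by (auto simp: dot_diffl dot_scalel)
 qed
qed simp

lemma linind_card: "finite T ==> T \<subseteq> latt J ==> linind T ==> card T <= card J"
proof (rule ccontr)
 assume T: "finite T" "T \<subseteq> latt J" "linind T" and "\<not> card T <= card J"
 then obtain l where l: "EX s:T. l s ~= 0" "ALL i:J. (\<Sum>s\<in>T. l s * real_of_int (s i)) = 0"
  using homogeneous_solution[OF finJ T(1), of "%s i. real_of_int (s i)"] by auto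
 have "(\<Sum>s\<in>T. l s * real_of_int (s i)) = 0" for i
 proof (cases "i \<in> J")
  case False
  thus ?thesis using T(2) by (intro sum.neutral) (auto simp: latt_def)
 qed (use l in auto)
 hence "ALL s:T. l s = 0" using T(3)[unfolded linind_def, rule_format, of l] by blast
 thus False using l by blast
qed

lemma linind_insert:
 assumes "finite T" "T \<subseteq> latt J" "linind T" "ALL s:T. dot h (rv s) = 0" "dot h (rv a) ~= 0"
 shows "linind (insert a T)"
 unfolding linind_def
proof (intro allI impI)
 fix l :: "'i lat => real" assume l: "ALL i. (\<Sum>s\<in>insert a T. l s * real_of_int (s i)) = 0"
 have aT: "a \<notin> T" using assms by auto
 have "0 = dot h (%i. \<Sum>s\<in>insert a T. l s * rv s i)" using l by (simp add: rv_def dot_def)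
 also have "\<dots> = (\<Sum>s\<in>insert a T. l s * dot h (rv s))" by (rule dot_sum) (use assms in auto)
 also have "\<dots> = l a * dot h (rv a)" using aT assms by simp
 finally have la: "l a = 0" using assms(5) by simp
 hence "ALL i. (\<Sum>s\<in>T. l s * real_of_int (s i)) = 0" using l aT assms(1) by simp
 hence "ALL s:T. l s = 0" using assms(3) by (auto simp: linind_def)
 thus "ALL s:insert a T. l s = 0" using la by auto
qed

text \<open>A trace count. The covectors \<open>?R i\<close>, rows of the identity minus a
  projection onto the span of \<open>T\<close>, all kill \<open>T\<close>; their diagonal entries
  add up to card J - card T, so one of them is nonzero.\<close>

lemma annihilator_ex:
 assumes "finite T" "T \<subseteq> latt J" "linind T" "card T < card J"
 shows "EX h. nz h & (ALL s:T. dot h (rv s) = 0)"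
proof -
 obtain ph where ph: "ALL s:T. ALL s':T. dot (ph s) (rv s') = (if s = s' then 1 else 0)"
  using dual_functionals[OF assms(1-3)] by blast
 let ?R = "%i k. uvec i k - (\<Sum>s\<in>T. rv s i * ph s k)"
 have "EX i:J. ?R i i ~= 0"
 proof (rule ccontr)
  assume "\<not> ?thesis"
  hence "(\<Sum>i\<in>J. ?R i i) = 0" by (intro sum.neutral) auto
  moreover have "(\<Sum>i\<in>J. ?R i i) = real (card J) - (\<Sum>s\<in>T. dot (ph s) (rv s))"
   by (simp add: sum_subtractf rv_def unitv_def dot_def sum.swap[of _ T] mult_ac)
  moreover have "(\<Sum>s\<in>T. dot (ph s) (rv s)) = real (card T)" using ph by simp
  ultimately show False using assms(4) by simp
 qed
 then obtain i where i: "i \<in> J" "?R i i ~= 0" by blast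
 have "dot (?R i) (rv s) = 0" if s: "s \<in> T" for s
 proof -
  have "(\<Sum>s'\<in>T. rv s' i * dot (ph s') (rv s)) = (\<Sum>s'\<in>T. if s' = s then rv s i else 0)"
   using ph s by (intro sum.cong) auto
  thus ?thesis using s assms(1) i by (simp add: dot_diffl dot_suml dot_comm[of "uvec i"] dot_uvec)
 qed
 moreover have "nz (?R i)" using i by (auto simp: nz_def)
 ultimately show ?thesis by blast
qed

text \<open>Adjoin to \<open>T\<close> a unit vector not killed by \<open>v\<close>. A nonzero
  covector killing the larger family cannot be a multiple of \<open>v\<close>.\<close>

lemma annihilator_ex2:
 assumes "finite T" "T \<subseteq> latt J" "linind T" "card T + 1 < card J" "nz v" "ALL s:T. dot v (rv s) = 0"
 shows "EX h. nz h & \<not> par h v & (ALL s:T. dot h (rv s) = 0)"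
proof -
 obtain j where j: "j \<in> J" "dot v (uvec j) ~= 0" using nz_dot assms(5) by blast
 have jl: "unitv j \<in> latt J" using j by (auto simp: unitv_def latt_def)
 have "linind (insert (unitv j) T)" by (rule linind_insert[of T v]) (use assms j in auto)
 moreover have "card (insert (unitv j) T) < card J" using assms(1,4) card_insert_le_m1[of "card J" T] by (simp add: card_insert_if)
 ultimately obtain h where h: "nz h" "ALL s:insert (unitv j) T. dot h (rv s) = 0"
  using annihilator_ex[of "insert (unitv j) T"] assms(1,2) jl by auto
 have "\<not> par h v"
 proof
  assume "par h v"
  then obtain c where c: "ALL i:J. h i = c * v i" by (auto simp: par_def)
  have "dot h (uvec j) = c * dot v (uvec j)" using j c by (simp add: dot_uvec)
  hence "c = 0" using h j by simp
  thus False using c h(1) by (auto simp: nz_def)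
 qed
 thus ?thesis using h by auto
qed

lemma basis_expand:
 assumes T: "finite T" "T \<subseteq> latt J" "linind T" and c: "card J <= card T"
  and ph: "ALL s:T. ALL s':T. dot (ph s) (rv s') = (if s = s' then 1 else 0)" and y: "y \<in> vecs J"
 shows "y i = (\<Sum>s\<in>T. dot (ph s) y * rv s i)"
proof (cases "i \<in> J")
 case False
 hence "rv s i = 0" if "s \<in> T" for s using T(2) that by (auto simp: rv_def latt_def)
 thus ?thesis using y False by (simp add: vecs_def)
next
 case i: True
 let ?R = "%k. uvec i k - (\<Sum>s\<in>T. rv s i * ph s k)"
 have dR: "dot ?R x = x i - (\<Sum>s\<in>T. rv s i * dot (ph s) x)" for x
  using T(1) i by (simp add: dot_diffl dot_suml dot_comm[of "uvec i"] dot_uvec)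
 have R0: "dot ?R (rv s) = 0" if s: "s \<in> T" for s
 proof -
  have "(\<Sum>s'\<in>T. rv s' i * dot (ph s') (rv s)) = (\<Sum>s'\<in>T. if s' = s then rv s i else 0)"
   using ph s by (intro sum.cong) auto
  thus ?thesis using s T(1) i unfolding dR by simp
 qed
 have "?R k = 0" if k: "k \<in> J" for k
 proof (rule ccontr)
  assume "?R k ~= 0"
  hence nzk: "dot ?R (uvec k) ~= 0" using dot_uvec[OF k, of ?R] by simp
  have li: "linind (insert (unitv k) T)" by (rule linind_insert[of T ?R]) (use T R0 nzk in auto)
  have "unitv k \<notin> T" using R0 nzk by auto
  hence "card (insert (unitv k) T) > card J" using c T by simp
  moreover have "insert (unitv k) T \<subseteq> latt J" using T k by (auto simp: unitv_def latt_def)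
  ultimately show False using linind_card[OF _ _ li] T by auto
 qed
 hence "dot ?R y = 0" by (simp add: dot_def)
 thus ?thesis unfolding dR by (simp add: mult_ac)
qed

end

section \<open>Finitely generated cones: closedness and relative boundary\<close>

lemma gconeI: "ALL s:S. 0 <= l s ==> x = (%i. \<Sum>s\<in>S. l s * rv s i) ==> x \<in> gcone S"
 unfolding gcone_def rv_def by blast

lemma gconeE:
 assumes "x \<in> gcone S"
 obtains l where "ALL s:S. 0 <= l s" "x = (%i. \<Sum>s\<in>S. l s * rv s i)"
 using assms unfolding gcone_def rv_def by blast

lemma gcone_add: "x \<in> gcone S ==> y \<in> gcone S ==> (%i. x i + y i) \<in> gcone S"
proof -
 assume "x \<in> gcone S" "y \<in> gcone S"
 then obtain l l' where l: "ALL s:S. 0 <= l s" "x = (%i. \<Sum>s\<in>S. l s * rv s i)"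
  and l': "ALL s:S. 0 <= l' s" "y = (%i. \<Sum>s\<in>S. l' s * rv s i)" by (auto elim!: gconeE)
 show ?thesis
  by (rule gconeI[where l="%s. l s + l' s"]) (use l l' in "auto simp: sum.distrib distrib_right")
qed

lemma gcone_scale: "x \<in> gcone S ==> 0 <= c ==> (%i. c * x i) \<in> gcone S"
proof -
 assume "x \<in> gcone S" and c: "0 <= c"
 then obtain l where l: "ALL s:S. 0 <= l s" "x = (%i. \<Sum>s\<in>S. l s * rv s i)" by (auto elim!: gconeE)
 show ?thesis
  by (rule gconeI[where l="%s. c * l s"]) (use l c in "auto simp: sum_distrib_left mult.assoc")
qed

lemma gcone_0: "(%i. 0) \<in> gcone S"
 by (rule gconeI[where l="%s. 0"]) auto

lemma gcone_mem: "finite S ==> s \<in> S ==> rv s \<in> gcone S"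
proof (rule gconeI[where l="%t. if t = s then 1 else 0"])
 assume S: "finite S" "s \<in> S"
 have "(\<Sum>t\<in>S. (if t = s then 1 else 0) * rv t i) = (\<Sum>t\<in>S. if t = s then rv s i else 0)" for i
  by (intro sum.cong) auto
 thus "rv s = (%i. \<Sum>t\<in>S. (if t = s then 1 else 0) * rv t i)" using S by auto
qed auto

lemma gcone_sum: "finite A ==> (\<And>a. a \<in> A ==> f a \<in> gcone S) ==> (%i. \<Sum>a\<in>A. f a i) \<in> gcone S"
 by (induction A rule: finite_induct) (auto intro: gcone_0 gcone_add)

lemma gcone_subset:
 assumes "finite T" "\<And>t. t \<in> T ==> rv t \<in> gcone S"
 shows "gcone T \<subseteq> gcone S"
proof
 fix x assume "x \<in> gcone T"
 then obtain l where l: "ALL s:T. 0 <= l s" "x = (%i. \<Sum>s\<in>T. l s * rv s i)" by (auto elim!: gconeE)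
 show "x \<in> gcone S" unfolding l(2)
  by (rule gcone_sum) (use assms l in "auto intro!: gcone_scale")
qed

lemma gcone_mono: "finite S ==> T \<subseteq> S ==> gcone T \<subseteq> gcone S"
 by (rule gcone_subset) (auto intro: finite_subset gcone_mem)

text \<open>Take a generating subset of least cardinality. A linear relation among its members, with
  a positive coefficient somewhere, could be subtracted until the first coefficient of x reaches
  zero, which would give a smaller subset.\<close>

lemma conic_caratheodory:
 assumes S: "finite S" and x: "x \<in> gcone S"
 obtains T l where "T \<subseteq> S" "linind T" "ALL s:T. 0 < l s" "x = (%i. \<Sum>s\<in>T. l s * rv s i)"
proof -
 let ?P = "%T. T \<subseteq> S & (EX l. (ALL s:T. 0 <= l s) & x = (%i. \<Sum>s\<in>T. l s * rv s i))"
 have "?P S" using x by (auto elim!: gconeE)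
 then obtain T where T: "?P T" and min: "\<And>T'. ?P T' ==> card T <= card T'"
  using ex_has_least_nat[of ?P S card] by blast
 then obtain l where l: "ALL s:T. 0 <= l s" "x = (%i. \<Sum>s\<in>T. l s * rv s i)" and TS: "T \<subseteq> S" by blast
 have fT: "finite T" using TS S finite_subset by blast
 have red: False if s0: "s0 \<in> T" and l': "ALL s:T. 0 <= l' s" "l' s0 = 0" "x = (%i. \<Sum>s\<in>T. l' s * rv s i)" for s0 l'
 proof -
  have "(\<Sum>s\<in>T. l' s * rv s i) = (\<Sum>s\<in>T - {s0}. l' s * rv s i)" for i
   using sum.remove[OF fT s0, of "%s. l' s * rv s i"] l'(2) by simp
  hence "x = (%i. \<Sum>s\<in>T - {s0}. l' s * rv s i)" using l'(3) by simp
  moreover have "ALL s:T - {s0}. 0 <= l' s" using l'(1) by blast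
  ultimately have "?P (T - {s0})" using TS by blast
  hence "card T <= card (T - {s0})" by (rule min)
  moreover have "card (T - {s0}) < card T" using fT s0 by (rule card_Diff1_less)
  ultimately show False by simp
 qed
 have pos: "ALL s:T. 0 < l s" using red[OF _ l(1) _ l(2)] l(1) by (metis less_eq_real_def)
 have "linind T"
 proof (rule ccontr)
  assume "\<not> linind T"
  then obtain mu s where mu: "ALL i. (\<Sum>s\<in>T. mu s * rv s i) = 0" "s \<in> T" "mu s ~= (0::real)"
   unfolding linind_def rv_def by blast
  have "EX mu. (ALL i. (\<Sum>s\<in>T. mu s * rv s i) = 0) & 0 < mu s"
  proof (cases "0 < mu s")
   case False
   thus ?thesis using mu by (intro exI[of _ "%s. - mu s"]) (auto simp: sum_negf)
  qed (use mu in blast)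
  then obtain nu where nu: "ALL i. (\<Sum>s\<in>T. nu s * rv s i) = 0" "0 < nu s" by blast
  define A where "A = {s\<in>T. 0 < nu s}"
  have A: "finite A" "A ~= {}" using fT mu(2) nu(2) by (auto simp: A_def)
  define t where "t = Min ((%s. l s / nu s) ` A)"
  have "t \<in> (%s. l s / nu s) ` A" unfolding t_def using A by (intro Min_in) auto
  then obtain s0 where s0: "s0 \<in> A" "t = l s0 / nu s0" by auto
  have tle: "t <= l s / nu s" if "s \<in> A" for s unfolding t_def using A that by (intro Min_le) auto
  have t0: "0 <= t" using s0 l(1) by (auto simp: A_def)
  show False
  proof (rule red[of s0 "%s. l s - t * nu s"])
   show "s0 \<in> T" using s0 by (auto simp: A_def)
   show "ALL s:T. 0 <= l s - t * nu s"
   proof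
    fix s assume s: "s \<in> T"
    show "0 <= l s - t * nu s"
    proof (cases "0 < nu s")
     case True
     thus ?thesis using tle[of s] s by (simp add: A_def field_simps)
    next
     case False
     hence "t * nu s <= 0" using t0 by (simp add: mult_nonneg_nonpos)
     thus ?thesis using l(1) s by fastforce
    qed
   qed
   show "l s0 - t * nu s0 = 0" using s0 by (auto simp: A_def)
   have "(\<Sum>s\<in>T. (l s - t * nu s) * rv s i) = (\<Sum>s\<in>T. l s * rv s i) - t * (\<Sum>s\<in>T. nu s * rv s i)" for i
    by (simp add: left_diff_distrib sum_subtractf sum_distrib_left mult.assoc)
   thus "x = (%i. \<Sum>s\<in>T. (l s - t * nu s) * rv s i)" using nu(1) l(2) by simp
  qed
 qed
 thus ?thesis using that TS pos l(2) by blast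
qed

context seed begin

lemma gcone_vecs: "S \<subseteq> latt J ==> gcone S \<subseteq> vecs J"
proof
 fix x assume S: "S \<subseteq> latt J" and "x \<in> gcone S"
 then obtain l where l: "x = (%i. \<Sum>s\<in>S. l s * rv s i)" by (auto elim!: gconeE)
 show "x \<in> vecs J" unfolding vecs_def
 proof (rule CollectI, intro allI impI)
  fix i assume "i \<notin> J"
  hence "rv s i = 0" if "s \<in> S" for s using S that by (auto simp: rv_def latt_def)
  thus "x i = 0" unfolding l by simp
 qed
qed

lemma close_mono: "close e x y ==> e <= e' ==> close e' x y" by (auto simp: close_def)

text \<open>Dual functionals describe the cone by nonnegative coordinates together with exactness of
  the expansion. A point outside violates one of these by a strict inequality, which persists
  nearby.\<close>

lemma simplicial_closed:
 assumes T: "finite T" "T \<subseteq> latt J" "linind T" and x: "x \<in> vecs J" "x \<notin> gcone T"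
 shows "\<exists>e>0. ALL y:vecs J. close e x y --> y \<notin> gcone T"
proof -
 obtain ph where ph: "ALL s:T. ALL s':T. dot (ph s) (rv s') = (if s = s' then 1 else 0)"
  using dual_functionals[OF T] by blast
 have key: "(ALL s:T. 0 <= dot (ph s) y) & (ALL i. y i = (\<Sum>s\<in>T. dot (ph s) y * rv s i))" if y: "y \<in> gcone T" for y
 proof -
  obtain l where l: "ALL s:T. 0 <= l s" "y = (%i. \<Sum>s\<in>T. l s * rv s i)" using y by (auto elim!: gconeE)
  have "dot (ph s) y = l s" if s: "s \<in> T" for s
  proof -
   have "dot (ph s) y = (\<Sum>s'\<in>T. l s' * dot (ph s) (rv s'))" unfolding l(2) by (rule dot_sum[OF T(1)])
   also have "\<dots> = (\<Sum>s'\<in>T. if s' = s then l s else 0)" using ph s by (intro sum.cong) auto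
   finally show ?thesis using s T(1) by simp
  qed
  hence d: "s \<in> T ==> dot (ph s) y = l s" for s .
  have "y i = (\<Sum>s\<in>T. dot (ph s) y * rv s i)" for i
  proof -
   have "(\<Sum>s\<in>T. dot (ph s) y * rv s i) = (\<Sum>s\<in>T. l s * rv s i)" by (intro sum.cong) (auto simp: d)
   thus ?thesis using l(2) by simp
  qed
  thus ?thesis using d l(1) by auto
 qed
 let ?R = "%i k. uvec i k - (\<Sum>s\<in>T. rv s i * ph s k)"
 have dR: "i \<in> J ==> dot (?R i) y = y i - (\<Sum>s\<in>T. dot (ph s) y * rv s i)" for i y
  using T(1) by (simp add: dot_diffl dot_suml dot_comm[of "uvec i"] dot_uvec mult_ac)
 show ?thesis
 proof (cases "ALL s:T. 0 <= dot (ph s) x")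
  case False
  then obtain s where s: "s \<in> T" "dot (ph s) x < 0" by (auto simp: not_le)
  obtain e where e: "0 < e" "\<And>y h. close e x y ==> h \<in> {ph s} ==> dot h x ~= 0 ==> 0 < dot h x * dot h y"
   by (rule sign_stable[of "{ph s}" x]) auto
  have "y \<notin> gcone T" if "close e x y" for y
  proof
   assume "y \<in> gcone T"
   hence "0 <= dot (ph s) y" using key s by blast
   moreover have "0 < dot (ph s) x * dot (ph s) y" using e(2)[OF that, of "ph s"] s by auto
   ultimately show False using s by (simp add: zero_less_mult_iff)
  qed
  thus ?thesis using e(1) by blast
 next
  case True
  have "EX i. x i ~= (\<Sum>s\<in>T. dot (ph s) x * rv s i)"
  proof (rule ccontr)
   assume "\<not> ?thesis"
   hence "x = (%i. \<Sum>s\<in>T. dot (ph s) x * rv s i)" by auto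
   thus False using gconeI[OF True] x by blast
  qed
  then obtain i where i: "x i ~= (\<Sum>s\<in>T. dot (ph s) x * rv s i)" by blast
  have iJ: "i \<in> J"
  proof (rule ccontr)
   assume "i \<notin> J"
   hence "rv s i = 0" if "s \<in> T" for s using T that by (auto simp: rv_def latt_def)
   thus False using i x \<open>i \<notin> J\<close> by (simp add: vecs_def)
  qed
  hence R: "dot (?R i) x ~= 0" using i unfolding dR[OF iJ] by simp
  obtain e where e: "0 < e" "\<And>y h. close e x y ==> h \<in> {?R i} ==> dot h x ~= 0 ==> 0 < dot h x * dot h y"
   by (rule sign_stable[of "{?R i}" x]) auto
  have "y \<notin> gcone T" if c: "close e x y" for y
  proof
   assume "y \<in> gcone T"
   hence "y i = (\<Sum>s\<in>T. dot (ph s) y * rv s i)" using key by blast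
   hence "dot (?R i) y = 0" unfolding dR[OF iJ] by simp
   moreover have "0 < dot (?R i) x * dot (?R i) y" by (rule e(2)[OF c]) (use R in auto)
   ultimately show False by simp
  qed
  thus ?thesis using e(1) by blast
 qed
qed

text \<open>By Caratheodory the cone is the union of its finitely many simplicial subcones, each of
  which is closed.\<close>

lemma gcone_closed:
 assumes S: "finite S" "S \<subseteq> latt J" and x: "x \<in> vecs J" "x \<notin> gcone S"
 shows "\<exists>e>0. ALL y:vecs J. close e x y --> y \<notin> gcone S"
proof -
 let ?F = "{T. T \<subseteq> S & linind T}"
 have fin: "finite ?F" using S by auto
 have "\<exists>e>0. ALL y:vecs J. close e x y --> y \<notin> gcone T" if T: "T \<in> ?F" for T
 proof (rule simplicial_closed)
  show "x \<notin> gcone T" using gcone_mono[OF S(1)] T x by blast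
 qed (use T S x finite_subset in auto)
 hence "ALL T:?F. EX e. 0 < e & (ALL y:vecs J. close e x y --> y \<notin> gcone T)" by blast
 from bchoice[OF this] obtain f where
  f0: "ALL T:?F. 0 < f T & (ALL y:vecs J. close (f T) x y --> y \<notin> gcone T)" by blast
 have f: "\<And>T. T \<in> ?F ==> 0 < f T"
   "\<And>T y. T \<in> ?F ==> y \<in> vecs J ==> close (f T) x y ==> y \<notin> gcone T" using f0 by blast+
 let ?e = "Min (insert 1 (f ` ?F))"
 have fin': "finite (insert 1 (f ` ?F))" using fin by blast
 have "0 < ?e" using f(1) fin' by (subst Min_gr_iff) auto
 moreover have "y \<notin> gcone S" if y: "y \<in> vecs J" "close ?e x y" for y
 proof
  assume "y \<in> gcone S"
  then obtain T l where T: "T \<subseteq> S" "linind T" "ALL s:T. 0 < l s" "y = (%i. \<Sum>s\<in>T. l s * rv s i)"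
   by (rule conic_caratheodory[OF S(1)])
  hence "y \<in> gcone T" by (intro gconeI[where l=l]) (auto simp: less_imp_le)
  moreover have "close (f T) x y" using y(2) by (rule close_mono) (use fin' T in "auto intro!: Min_le")
  ultimately show False using f(2)[of T y] T y by auto
 qed
 ultimately show ?thesis by blast
qed

text \<open>If x is a positive combination of fewer than card J - 1 independent generators, it lies
  on the hyperplane of a covector killing them, chosen not parallel to \<open>v\<close>; one such
  covector per small set makes up \<open>H\<close>. Any other x has card J - 1 independent
  generators with positive coefficients, and these stay positive nearby.\<close>

lemma gcone_boundary:
 assumes S: "finite S" "S \<subseteq> latt J" and v: "nz v" and Sv: "ALL s:S. dot v (rv s) = 0"
 shows "EX H. finite H & (ALL h:H. nz h & \<not> par h v) &
  (ALL x:gcone S. (ALL h:H. dot h x ~= 0) -->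
    (\<exists>e>0. ALL y:vecs J. dot v y = 0 & close e x y --> y \<in> gcone S))"
proof -
 let ?F = "{T. T \<subseteq> S & linind T & card T + 1 < card J}"
 have fin: "finite ?F" using S by auto
 have "EX h. nz h & \<not> par h v & (ALL s:T. dot h (rv s) = 0)" if T: "T \<in> ?F" for T
  by (rule annihilator_ex2) (use T S v Sv finite_subset in auto)
 hence "ALL T:?F. EX h. nz h & \<not> par h v & (ALL s:T. dot h (rv s) = 0)" by blast
 from bchoice[OF this] obtain f where
  f0: "ALL T:?F. nz (f T) & \<not> par (f T) v & (ALL s:T. dot (f T) (rv s) = 0)" by blast
 have f: "\<And>T. T \<in> ?F ==> nz (f T) & \<not> par (f T) v & (ALL s:T. dot (f T) (rv s) = 0)" using f0 by blast
 obtain j where j: "j \<in> J" "dot v (uvec j) ~= 0" using nz_dot v by blast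
 have jl: "unitv j \<in> latt J" using j by (auto simp: unitv_def latt_def)
 have "\<exists>e>0. ALL y:vecs J. dot v y = 0 & close e x y --> y \<in> gcone S"
  if x: "x \<in> gcone S" and hx: "ALL h:f ` ?F. dot h x ~= 0" for x
 proof -
  obtain T l where T: "T \<subseteq> S" "linind T" "ALL s:T. 0 < l s" "x = (%i. \<Sum>s\<in>T. l s * rv s i)"
   using x by (rule conic_caratheodory[OF S(1)])
  have fT: "finite T" "T \<subseteq> latt J" using T S finite_subset by auto
  have c: "card J <= card T + 1"
  proof (rule ccontr)
   assume "\<not> ?thesis"
   hence TF: "T \<in> ?F" using T by auto
   have "dot (f T) x = (\<Sum>s\<in>T. l s * dot (f T) (rv s))" unfolding T(4) by (rule dot_sum[OF fT(1)])
   also have "\<dots> = 0" using f[OF TF] by simp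
   finally show False using hx TF by blast
  qed
  \<comment> \<open>A vector off the hyperplane completes \<open>T\<close> to a basis; the
    coordinate along it vanishes on the hyperplane.\<close>
  let ?U = "insert (unitv j) T"
  have ujT: "unitv j \<notin> T" using Sv T(1) j by auto
  have li: "linind ?U" by (rule linind_insert[of T v]) (use fT T Sv j in auto)
  have U: "finite ?U" "?U \<subseteq> latt J" "card J <= card ?U" using fT jl c ujT by auto
  obtain ph where ph: "ALL s:?U. ALL s':?U. dot (ph s) (rv s') = (if s = s' then 1 else 0)"
   using dual_functionals[OF U(1,2) li] by blast
  have phx: "dot (ph s) x = l s" if s: "s \<in> T" for s
  proof -
   have "dot (ph s) x = (\<Sum>s'\<in>T. l s' * dot (ph s) (rv s'))" unfolding T(4) by (rule dot_sum[OF fT(1)])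
   also have "\<dots> = (\<Sum>s'\<in>T. if s' = s then l s else 0)" using ph s by (intro sum.cong) auto
   finally show ?thesis using s fT by simp
  qed
  obtain e where e: "0 < e" "\<And>y h. close e x y ==> h \<in> ph ` T ==> dot h x ~= 0 ==> 0 < dot h x * dot h y"
   by (rule sign_stable[of "ph ` T" x]) (use fT in auto)
  have "y \<in> gcone S" if y: "y \<in> vecs J" "dot v y = 0" "close e x y" for y
  proof -
   have ex: "y i = (\<Sum>s\<in>?U. dot (ph s) y * rv s i)" for i
    by (rule basis_expand[OF U(1,2) li U(3) ph y(1)])
   have exf: "y = (%i. \<Sum>s\<in>?U. dot (ph s) y * rv s i)" using ex by (rule ext)
   have "0 = dot v y" using y(2) by simp
   also have "\<dots> = dot v (%i. \<Sum>s\<in>?U. dot (ph s) y * rv s i)" by (rule arg_cong[OF exf])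
   also have "\<dots> = (\<Sum>s\<in>?U. dot (ph s) y * dot v (rv s))" by (rule dot_sum[OF U(1)])
   also have "\<dots> = dot (ph (unitv j)) y * dot v (uvec j)"
    using fT(1) ujT Sv T(1) by (simp add: subset_iff)
   finally have z: "dot (ph (unitv j)) y = 0" using j by simp
   have "y = (%i. \<Sum>s\<in>T. dot (ph s) y * rv s i)"
   proof
    fix i show "y i = (\<Sum>s\<in>T. dot (ph s) y * rv s i)" using ex[of i] fT(1) ujT z by simp
   qed
   moreover have "ALL s:T. 0 <= dot (ph s) y"
   proof
    fix s assume s: "s \<in> T"
    have "0 < dot (ph s) x * dot (ph s) y" by (rule e(2)[OF y(3)]) (use s T phx in auto)
    thus "0 <= dot (ph s) y" using phx[OF s] T(3)[rule_format, OF s] by (simp add: zero_less_mult_iff)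
   qed
   ultimately have "y \<in> gcone T" by (intro gconeI)
   thus ?thesis using gcone_mono[OF S(1) T(1)] by blast
  qed
  thus ?thesis using e(1) by blast
 qed
 thus ?thesis using f fin by (intro exI[of _ "f ` ?F"]) blast
qed

subsection \<open>Walls\<close>

lemma is_wall_props:
 assumes "is_wall J d w"
 shows "primN J (fst w)" "fst w \<in> posN J" "fps_nth (fn w) 0 = 1"
  "EX S. finite S & S \<subseteq> latt J & cn w = gcone S & (ALL s:S. dot (nw w) (rv s) = 0)"
 using assms unfolding is_wall_def by (auto simp: pairR_dot rv_def primN_def split: prod.splits)

lemma wall_perp: "is_wall J d w ==> x \<in> cn w ==> dot (nw w) x = 0"
proof -
 assume w: "is_wall J d w" and x: "x \<in> cn w"
 obtain S where S: "finite S" "cn w = gcone S" "ALL s:S. dot (nw w) (rv s) = 0"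
  using is_wall_props(4)[OF w] by blast
 obtain l where "x = (%i. \<Sum>s\<in>S. l s * rv s i)" using x S by (auto elim!: gconeE)
 thus ?thesis using dot_sum[OF S(1)] S(3) by simp
qed

lemma wall_closed: "is_wall J d w ==> x \<in> vecs J ==> x \<notin> cn w ==>
  \<exists>e>0. ALL y:vecs J. close e x y --> y \<notin> cn w"
 using is_wall_props(4)[of w] gcone_closed by metis

lemma walls_closed:
 assumes W: "finite W" "ALL w:W. is_wall J d w" and x: "x \<in> vecs J"
 obtains e where "0 < e" "\<And>y w. y \<in> vecs J ==> close e x y ==> w \<in> W ==> y \<in> cn w ==> x \<in> cn w"
proof -
 have "\<exists>e>0. ALL y:vecs J. close e x y --> y \<in> cn w --> x \<in> cn w" if "w \<in> W" for w
  using wall_closed[of w x] W that x by (cases "x \<in> cn w") (auto intro: exI[of _ 1])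
 hence "ALL w:W. EX e. 0 < e & (ALL y:vecs J. close e x y --> y \<in> cn w --> x \<in> cn w)" by blast
 from bchoice[OF this] obtain f where
  f0: "ALL w:W. 0 < f w & (ALL y:vecs J. close (f w) x y --> y \<in> cn w --> x \<in> cn w)" by blast
 have f: "\<And>w. w \<in> W ==> 0 < f w"
  "\<And>w y. w \<in> W ==> y \<in> vecs J ==> close (f w) x y ==> y \<in> cn w ==> x \<in> cn w" using f0 by blast+
 let ?e = "Min (insert 1 (f ` W))"
 have fin: "finite (insert 1 (f ` W))" using W by blast
 show ?thesis
 proof (rule that[of ?e])
  show "0 < ?e" using f(1) fin by (subst Min_gr_iff) auto
  fix y w assume "y \<in> vecs J" "close ?e x y" "w \<in> W" "y \<in> cn w"
  moreover from this have "close (f w) x y" using close_mono[of ?e x y "f w"] fin by (auto intro!: Min_le)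
  ultimately show "x \<in> cn w" using f(2) by blast
 qed
qed

text \<open>The Euclidean balls of \<open>relint_w\<close> and the coordinate boxes of
  \<open>close\<close> contain each other after rescaling; the constant card J + 1 stays positive
  even for empty \<open>J\<close>.\<close>

lemma relint_iff:
 "relint_w J d w x \<longleftrightarrow> x \<in> cn w &
  (\<exists>e>0. ALL y:vecs J. dot (nw w) y = 0 & close e x y --> y \<in> cn w)"
proof -
 have A: "close e x y" if "0 < e" "(\<Sum>i\<in>J. (y i - x i)\<^sup>2) < e\<^sup>2" for e y
  unfolding close_def
 proof
  fix i assume i: "i \<in> J"
  have "(y i - x i)\<^sup>2 <= (\<Sum>i\<in>J. (y i - x i)\<^sup>2)" by (rule member_le_sum[OF i]) (auto simp: finJ)
  hence "(y i - x i)\<^sup>2 < e\<^sup>2" using that by simp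
  thus "\<bar>y i - x i\<bar> < e" using that(1) power2_less_imp_less[of "\<bar>y i - x i\<bar>" e] by simp
 qed
 have B: "(\<Sum>i\<in>J. (y i - x i)\<^sup>2) < e" if e: "0 < e" "close (sqrt (e / (real (card J) + 1))) x y" for e y
 proof -
  have "(y i - x i)\<^sup>2 <= e / (real (card J) + 1)" if i: "i \<in> J" for i
  proof -
   have "\<bar>y i - x i\<bar> <= sqrt (e / (real (card J) + 1))" using e(2) i by (auto simp: close_def less_imp_le)
   hence "(\<bar>y i - x i\<bar>)\<^sup>2 <= (sqrt (e / (real (card J) + 1)))\<^sup>2" by (intro power_mono) auto
   thus ?thesis using e(1) by simp
  qed
  hence "(\<Sum>i\<in>J. (y i - x i)\<^sup>2) <= (\<Sum>i\<in>J. e / (real (card J) + 1))" by (rule sum_mono)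
  also have "\<dots> < e" using e(1) by (simp add: field_simps)
  finally show ?thesis .
 qed
 obtain n C f where w: "w = (n, C, f)" by (cases w)
 show ?thesis unfolding relint_w_def w prod.case pairR_dot fst_conv snd_conv
 proof (intro conj_cong refl iffI)
  assume "\<exists>e>0. ALL y:vecs J. dot (nrm n) y = 0 & (\<Sum>i\<in>J. (y i - x i)\<^sup>2) < e --> y \<in> C"
  then obtain e where e: "0 < e" "ALL y:vecs J. dot (nrm n) y = 0 & (\<Sum>i\<in>J. (y i - x i)\<^sup>2) < e --> y \<in> C" by blast
  have "0 < sqrt (e / (real (card J) + 1))" using e(1) by simp
  thus "\<exists>e>0. ALL y:vecs J. dot (nrm n) y = 0 & close e x y --> y \<in> C"
   using e B[OF e(1)] by blast
 next
  assume "\<exists>e>0. ALL y:vecs J. dot (nrm n) y = 0 & close e x y --> y \<in> C"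
  then obtain e where e: "0 < e" "ALL y:vecs J. dot (nrm n) y = 0 & close e x y --> y \<in> C" by blast
  have "0 < e\<^sup>2" using e(1) by simp
  thus "\<exists>e>0. ALL y:vecs J. dot (nrm n) y = 0 & (\<Sum>i\<in>J. (y i - x i)\<^sup>2) < e --> y \<in> C"
   using e A[OF e(1)] by blast
 qed
qed

lemma wall_boundary:
 assumes "is_wall J d w"
 shows "EX H. finite H & (ALL h:H. nz h & \<not> par h (nw w)) &
  (ALL x:cn w. (ALL h:H. dot h x ~= 0) --> relint_w J d w x)"
proof -
 obtain S where S: "finite S" "S \<subseteq> latt J" "cn w = gcone S" "ALL s:S. dot (nw w) (rv s) = 0"
  using is_wall_props(4)[OF assms] by blast
 from gcone_boundary[OF S(1,2) nz_nrm[OF is_wall_props(2)[OF assms]] S(4)] obtain H where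
  H: "finite H" "ALL h:H. nz h & \<not> par h (nw w)" "ALL x:gcone S. (ALL h:H. dot h x ~= 0) -->
    (\<exists>e>0. ALL y:vecs J. dot (nw w) y = 0 & close e x y --> y \<in> gcone S)" by blast
 have "relint_w J d w x" if "x \<in> gcone S" "ALL h:H. dot h x ~= 0" for x
  unfolding relint_iff S(3) using H(3) that by blast
 thus ?thesis using H(1,2) unfolding S(3) by (intro exI[of _ H]) blast
qed

subsection \<open>Primitive normals\<close>

lemma par_int:
 assumes a: "a \<in> posN J" and b: "b \<in> posN J" and p: "par (nrm a) (nrm b)"
 obtains p q :: int where "0 < p" "0 < q" "coprime p q" "\<And>i. q * a i = p * b i"
proof -
 obtain c where c: "ALL i:J. nrm a i = c * nrm b i" using p by (auto simp: par_def)
 have cr: "real_of_int (a i) = c * real_of_int (b i)" if "i \<in> J" for i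
  using c[rule_format, OF that] dpos[OF that] by (simp add: nrm_def)
 have la: "ALL i:J. 0 <= a i" "ALL i. i \<notin> J --> a i = 0" "a ~= 0"
  and lb: "ALL i:J. 0 <= b i" "ALL i. i \<notin> J --> b i = 0"
  using a b by (auto simp: posN_def nonneg_def latt_def)
 obtain k where k: "a k ~= 0" using la by (auto simp: fun_eq_iff fun_app)
 hence kJ: "k \<in> J" using la by auto
 have ak: "0 < a k" using k la kJ by (metis order_le_less)
 have bk: "0 < b k"
 proof -
  have "b k ~= 0" using cr[OF kJ] ak by auto
  thus ?thesis using lb kJ by (metis order_le_less)
 qed
 have e: "b k * a i = a k * b i" for i
 proof (cases "i \<in> J")
  case True
  have "real_of_int (b k * a i) = real_of_int (a k * b i)" using cr[OF True] cr[OF kJ] by simp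
  thus ?thesis by (simp only: of_int_eq_iff)
 qed (use la lb in auto)
 define g where "g = gcd (a k) (b k)"
 have g: "0 < g" using ak by (simp add: g_def)
 obtain p q where pq: "a k = p * g" "b k = q * g" "coprime p q"
  using gcd_coprime_exists[of "a k" "b k"] ak unfolding g_def by auto
 show ?thesis
 proof (rule that[of p q])
  show "0 < p" "0 < q" using pq g ak bk by (auto simp: zero_less_mult_iff)
  show "coprime p q" by (rule pq(3))
  fix i show "q * a i = p * b i" using e[of i] g unfolding pq(1,2) by (simp add: mult_ac)
 qed
qed

text \<open>In a relation q a = p b with coprime positive p and q, p divides all coordinates of a
  and q those of b, so primitivity makes both equal to 1.\<close>

lemma par_prim:
 assumes a: "primN J a" and b: "primN J b" and p: "par (nrm a) (nrm b)"
 shows "a = b"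
proof -
 have ab: "a \<in> posN J" "b \<in> posN J" using a b by (auto simp: primN_def)
 obtain p q where pq: "0 < p" "0 < q" "coprime p q" "\<And>i. q * a i = p * b i" by (rule par_int[OF ab p]) blast
 have "p dvd a i" for i using pq(3) pq(4)[of i] by (metis coprime_dvd_mult_right_iff dvd_triv_left)
 hence "\<not> 1 < p" using a unfolding primN_def by blast
 moreover have "q dvd b i" for i
  using pq(3) pq(4)[of i] by (metis coprime_commute coprime_dvd_mult_right_iff dvd_triv_left)
 hence "\<not> 1 < q" using b unfolding primN_def by blast
 ultimately have "p = 1" "q = 1" using pq by auto
 thus ?thesis using pq(4) by auto
qed

lemma prim_decomp:
 assumes n: "n \<in> posN J"
 obtains n0 j where "primN J n0" "0 < j" "n = nsc j n0"
proof -
 define g where "g = Gcd (n ` J)"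
 have ln: "ALL i:J. 0 <= n i" "ALL i. i \<notin> J --> n i = 0" "n ~= 0" using n by (auto simp: posN_def nonneg_def latt_def)
 obtain k where k: "n k ~= 0" using ln by (auto simp: fun_eq_iff fun_app)
 hence kJ: "k \<in> J" using ln by auto
 have gd: "g dvd n i" for i using ln by (cases "i \<in> J") (auto simp: g_def)
 have g0: "0 < g"
 proof -
  have "g ~= 0" using gd[of k] k by auto
  moreover have "0 <= g" by (simp add: g_def)
  ultimately show ?thesis by simp
 qed
 define n0 where "n0 = (%i. n i div g)"
 have nn: "n i = g * n0 i" for i using gd[of i] by (simp add: n0_def)
 have n0p: "n0 \<in> posN J"
 proof -
  have "n0 i = 0" if "i \<notin> J" for i using ln that by (simp add: n0_def)
  moreover have "0 <= n0 i" if "i \<in> J" for i using ln that g0 by (simp add: n0_def pos_imp_zdiv_nonneg_iff)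
  moreover have "n0 k ~= 0" using nn[of k] k by auto
  ultimately show ?thesis by (auto simp: posN_def nonneg_def latt_def fun_app)
 qed
 have "primN J n0" unfolding primN_def
 proof (intro conjI n0p allI impI notI)
  fix p :: int assume p: "1 < p" "ALL i:J. p dvd n0 i"
  hence "ALL i:J. g * p dvd n i" by (simp add: nn)
  hence "g * p dvd g" unfolding g_def by (intro Gcd_greatest) auto
  hence "p dvd 1" using g0 by simp
  thus False using p by auto
 qed
 moreover have "n = nsc (nat g) n0" using nn g0 by (simp add: nsc_def fun_eq_iff)
 ultimately show ?thesis using g0 by (intro that[of n0 "nat g"]) auto
qed

lemma nrm_nsc: "nrm (nsc s n) = (%i. real s * nrm n i)" by (simp add: nrm_def nsc_def fun_eq_iff)

lemma par_nsc: "par (nrm (nsc s n)) (nrm n)" unfolding par_def nrm_nsc by blast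
lemma par_trans: "par a b ==> par b c ==> par a c" unfolding par_def by (metis mult.assoc)
lemma par_sym: "nz a ==> par a b ==> par b a"
proof -
 assume a: "nz a" "par a b"
 then obtain c where c: "ALL i:J. a i = c * b i" by (auto simp: par_def)
 hence "c ~= 0" using a by (auto simp: nz_def)
 hence "ALL i:J. b i = (1 / c) * a i" using c by simp
 thus ?thesis unfolding par_def by blast
qed

lemma par_dot: "par a b ==> dot b x = 0 ==> dot a x = 0"
proof -
 assume "par a b" "dot b x = 0"
 then obtain c where c: "ALL i:J. a i = c * b i" by (auto simp: par_def)
 have "dot a x = c * dot b x" using c by (simp add: dot_def sum_distrib_left mult.assoc)
 thus ?thesis using \<open>dot b x = 0\<close> by simp
qed

lemma par_prim_multiple:
 assumes n: "n \<in> posN J" and n0: "primN J n0" and p: "par (nrm n) (nrm n0)"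
 obtains j where "0 < j" "n = nsc j n0"
proof -
 obtain n1 j where n1: "primN J n1" "0 < j" "n = nsc j n1" by (rule prim_decomp[OF n]) blast
 have "n1 \<in> posN J" using n1 by (auto simp: primN_def)
 hence "par (nrm n1) (nrm n)" using par_sym[OF nz_nrm[OF n] ] par_nsc[of j n1] n1(3) by simp
 hence "n1 = n0" using par_prim[OF n1(1) n0] par_trans p by blast
 thus ?thesis using that n1 by blast
qed

subsection \<open>Bad points lie in codimension two\<close>

text \<open>\<open>Z\<close> collects pairs of nonparallel covectors: a wall normal with a boundary
  covector of that wall, or two distinct normals. Their common zero sets have codimension two, so
  generic segments can miss them.\<close>

lemma bad_set:
 assumes W: "finite W" "ALL w:W. is_wall J d w"
 shows "EX Z. finite Z & (\<forall>(h1,h2)\<in>Z. nz h1 & nz h2 & \<not> par h2 h1) &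
  (ALL x:vecs J. \<not> good_pt J d W x --> (\<exists>(h1,h2)\<in>Z. dot h1 x = 0 & dot h2 x = 0)) &
  (ALL w:W. ALL w':W. fst w ~= fst w' --> (nw w, nw w') \<in> Z)"
proof -
 have "ALL w:W. EX H. finite H & (ALL h:H. nz h & \<not> par h (nw w)) &
  (ALL x:cn w. (ALL h:H. dot h x ~= 0) --> relint_w J d w x)"
  using W wall_boundary by blast
 from bchoice[OF this] obtain H where H0: "ALL w:W. finite (H w) & (ALL h:H w. nz h & \<not> par h (nw w)) &
  (ALL x:cn w. (ALL h:H w. dot h x ~= 0) --> relint_w J d w x)" by blast
 have H: "\<And>w. w \<in> W ==> finite (H w)" "\<And>w h. w \<in> W ==> h \<in> H w ==> nz h & \<not> par h (nw w)"
  "\<And>w x. w \<in> W ==> x \<in> cn w ==> ALL h:H w. dot h x ~= 0 ==> relint_w J d w x" using H0 by blast+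
 define Z where "Z = (\<Union>w\<in>W. (%h. (nw w, h)) ` H w) \<union>
   (%(w,w'). (nw w, nw w')) ` {(w,w'). w \<in> W & w' \<in> W & fst w ~= fst w'}"
 have "finite {(w,w'). w \<in> W & w' \<in> W & fst w ~= fst w'}"
  by (rule finite_subset[of _ "W \<times> W"]) (use W in auto)
 hence fZ: "finite Z" unfolding Z_def using W H(1) by auto
 have nzW: "nz (nw w)" if "w \<in> W" for w using W that nz_nrm is_wall_props(2) by blast
 have Z1: "\<forall>(h1,h2)\<in>Z. nz h1 & nz h2 & \<not> par h2 h1"
 proof clarify
  fix h1 h2 assume "(h1, h2) \<in> Z"
  then consider w where "w \<in> W" "h1 = nw w" "h2 \<in> H w"
   | w w' where "w \<in> W" "w' \<in> W" "fst w ~= fst w'" "h1 = nw w" "h2 = nw w'"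
   unfolding Z_def by auto
  thus "nz h1 & nz h2 & \<not> par h2 h1"
  proof cases
   case 1
   thus ?thesis using H(2)[of w h2] nzW[of w] by simp
  next
   case 2
   thus ?thesis using nzW par_prim[OF is_wall_props(1) is_wall_props(1), of w' w] W(2) by metis
  qed
 qed
 have Z3: "ALL w:W. ALL w':W. fst w ~= fst w' --> (nw w, nw w') \<in> Z"
 proof (intro ballI impI)
  fix w w' assume "w \<in> W" "w' \<in> W" "fst w ~= fst w'"
  hence "(w, w') \<in> {(w,w'). w \<in> W & w' \<in> W & fst w ~= fst w'}" by simp
  thus "(nw w, nw w') \<in> Z" unfolding Z_def by (intro UnI2 image_eqI[where x="(w,w')"]) auto
 qed
 have Z2: "\<exists>(h1,h2)\<in>Z. dot h1 x = 0 & dot h2 x = 0" if x: "x \<in> vecs J" "\<not> good_pt J d W x" for x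
 proof -
  obtain w where w: "w \<in> W" "x \<in> cn w" and
   no: "\<not> relint_w J d w x \<or> (EX w':W. x \<in> cn w' & fst w' ~= fst w)"
   using x(2) unfolding good_pt_def by blast
  have p: "dot (nw w) x = 0" if "w \<in> W" "x \<in> cn w" for w using that W wall_perp by blast
  from no show ?thesis
  proof
   assume "\<not> relint_w J d w x"
   then obtain h where h: "h \<in> H w" "dot h x = 0" using H(3)[OF w] by blast
   hence "(nw w, h) \<in> Z" using w by (auto simp: Z_def)
   thus ?thesis using h p[OF w] by blast
  next
   assume "EX w':W. x \<in> cn w' & fst w' ~= fst w"
   then obtain w' where w': "w' \<in> W" "x \<in> cn w'" "fst w' ~= fst w" by blast
   hence "(nw w, nw w') \<in> Z" using Z3 w by metis
   thus ?thesis using p[OF w] p[OF w'(1,2)] by blast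
  qed
 qed
 show ?thesis using fZ Z1 Z2 Z3 by (intro exI[of _ Z] conjI) blast+
qed

end

subsection \<open>Integer powers and exponentials of power series\<close>

lemma fpow_0 [simp]: "fpow f 0 = 1" by (simp add: fpow_def)

lemma fpow_1s [simp]: "fpow 1 e = (1 :: 'k::field fps)" by (simp add: fpow_def)

lemma fpow_nth_0: "fps_nth f 0 = 1 ==> fps_nth (fpow f e) 0 = 1"
 by (simp add: fpow_def fps_nth_power_0)

lemma fpow_Suc: "fps_nth f 0 = 1 ==> fpow f (e + 1) = fpow f e * (f :: 'k::field fps)"
proof -
 assume f: "fps_nth f 0 = 1"
 have inv: "inverse f * f = 1" using f by (simp add: inverse_mult_eq_1)
 consider "0 <= e" | "e = -1" | "e < -1" by linarith
 thus ?thesis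
 proof cases
  case 1
  thus ?thesis by (simp add: fpow_def nat_add_distrib mult.commute)
 next
  case 2
  thus ?thesis using inv by (simp add: fpow_def)
 next
  case 3
  define n where "n = nat (- e - 1)"
  have n: "nat (- e) = Suc n" "nat (- 1 - e) = n" "nat (- e - 1) = n" using 3 by (auto simp: n_def)
  have "inverse f ^ Suc n * f = inverse f ^ n * (inverse f * f)" by (simp add: mult_ac)
  thus ?thesis using 3 n inv by (simp add: fpow_def)
 qed
qed

lemma fpow_pred: "fps_nth f 0 = 1 ==> fpow f (e - 1) = fpow f e * inverse (f :: 'k::field fps)"
proof -
 assume f: "fps_nth f 0 = 1"
 have inv: "f * inverse f = 1" using f by (simp add: inverse_mult_eq_1')
 have "fpow f e = fpow f (e - 1) * f" using fpow_Suc[OF f, of "e - 1"] by simp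
 hence "fpow f e * inverse f = fpow f (e - 1) * (f * inverse f)" by (simp add: mult.assoc)
 thus ?thesis using inv by simp
qed

lemma fpow_add: "fps_nth f 0 = 1 ==> fpow f (a + b) = fpow f a * fpow (f :: 'k::field fps) b"
proof (induction b rule: int_induct[where k=0])
 case (step1 i)
 thus ?case using fpow_Suc[of f "a + i"] fpow_Suc[of f i] by (simp add: add.assoc mult.assoc)
next
 case (step2 i)
 thus ?case using fpow_pred[of f "a + i"] fpow_pred[of f i] by (simp add: add_diff_eq mult.assoc)
qed simp

lemma fpow_mult: "fps_nth f 0 = 1 ==> fps_nth g 0 = 1 ==> fpow (f * g) a = fpow f a * fpow (g :: 'k::field fps) a"
proof (induction a rule: int_induct[where k=0])
 case (step1 i)
 thus ?case by (simp add: fpow_Suc mult_ac)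
next
 case (step2 i)
 thus ?case by (simp add: fpow_pred fps_inverse_mult mult_ac)
qed simp

lemma fps_prod_nth_0: "(\<And>x. x \<in> A ==> fps_nth (f x) 0 = 1) ==> fps_nth (prod f A) 0 = (1 :: 'k::field)"
 by (induction A rule: infinite_finite_induct) auto

lemma fpow_prod: "(\<And>x. x \<in> A ==> fps_nth (f x) 0 = 1) ==> fpow (prod f A) e = (\<Prod>x\<in>A. fpow (f x :: 'k::field fps) e)"
 by (induction A rule: infinite_finite_induct) (auto simp: fpow_mult fps_prod_nth_0)

text \<open>The series exp(a X^j): what a letter in direction j v contributes to a wall function
  along the primitive vector v.\<close>

definition fexp :: "nat => 'k::field_char_0 => 'k fps" where
 "fexp j a = fps_compose (fps_exp a) (fps_X ^ j)"

lemma fexp_nth: "0 < j ==> fps_nth (fexp j a) s = (if j dvd s then a ^ (s div j) / fact (s div j) else 0)"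
proof -
 assume j: "0 < j"
 have "fps_nth (fexp j a) s = (\<Sum>i=0..s. a ^ i / fact i * (if s = j * i then 1 else 0))"
 proof -
  have X: "fps_nth ((fps_X ^ j) ^ i) s = (if s = j * i then 1 else (0::'a))" for i
   unfolding power_mult[symmetric] by (rule fps_X_power_nth)
  show ?thesis unfolding fexp_def fps_compose_nth X by simp
 qed
 also have "\<dots> = (if j dvd s then a ^ (s div j) / fact (s div j) else 0)"
 proof (cases "j dvd s")
  case True
  then obtain t where t: "s = j * t" by (elim dvdE)
  have "(\<Sum>i=0..s. a ^ i / fact i * (if s = j * i then 1 else 0)) = (\<Sum>i=0..s. if i = t then a ^ t / fact t else 0)"
   using t j by (intro sum.cong) auto
  also have "\<dots> = a ^ t / fact t" using t j by simp
  finally show ?thesis using t j by simp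
 next
  case False
  thus ?thesis by (auto intro!: sum.neutral)
 qed
 finally show ?thesis .
qed

lemma fexp_nth_0 [simp]: "0 < j ==> fps_nth (fexp j a) 0 = 1" by (simp add: fexp_nth)
lemma fexp_nth_j: "0 < j ==> fps_nth (fexp j a) j = a" by (simp add: fexp_nth)
lemma fexp_nth_lt: "0 < s ==> s < j ==> fps_nth (fexp j a) s = 0" by (auto simp: fexp_nth dest: dvd_imp_le)

lemma fexp_add: "0 < j ==> fexp j (a + b) = fexp j a * fexp j b"
 unfolding fexp_def fps_exp_add_mult by (rule fps_compose_mult_distrib) (simp add: fps_X_power_iff)

lemma fexp_0 [simp]: "0 < j ==> fexp j 0 = 1"
 by (rule fps_ext) (auto simp: fexp_nth power_0_left dvd_div_eq_0_iff)

lemma fpow_fexp: "0 < j ==> fpow (fexp j a) e = fexp j (of_int e * a)"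
proof (induction e rule: int_induct[where k=0])
 case (step1 i)
 thus ?case by (simp add: fpow_Suc fexp_add distrib_right)
next
 case (step2 i)
 have "fexp j (of_int (i - 1) * a) * fexp j a = fexp j (of_int i * a)"
  using fexp_add[OF step2.prems, of "of_int (i-1) * a" a] by (simp add: algebra_simps)
 moreover have "fexp j a * inverse (fexp j a) = 1" using step2.prems by (simp add: inverse_mult_eq_1')
 ultimately have "fexp j (of_int i * a) * inverse (fexp j a) = fexp j (of_int (i - 1) * a)"
  by (metis mult.assoc mult.right_neutral)
 thus ?case using step2 by (simp add: fpow_pred)
qed simp

text \<open>The exponents are fixed one degree at a time: the factor for \<open>Suc K\<close> leaves
  the coefficients up to \<open>K\<close> alone and adds in degree \<open>Suc K\<close> exactly the
  difference that is still missing.\<close>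

lemma fps_exp_factors:
 fixes f :: "'k::field_char_0 fps"
 assumes f: "fps_nth f 0 = 1"
 shows "EX b. ALL K. \<forall>s\<le>K. fps_nth f s = fps_nth (\<Prod>j\<in>{1..K}. fexp j (b j)) s"
proof -
 define G where "G = rec_nat (1 :: 'k fps) (%K g. g * fexp (Suc K) (fps_nth f (Suc K) - fps_nth g (Suc K)))"
 have G0: "G 0 = 1" and GS: "G (Suc K) = G K * fexp (Suc K) (fps_nth f (Suc K) - fps_nth (G K) (Suc K))" for K
  by (simp_all add: G_def)
 define b where "b j = fps_nth f j - fps_nth (G (j - 1)) j" for j
 have P: "G K = (\<Prod>j\<in>{1..K}. fexp j (b j))" for K
  by (induction K) (simp_all add: G0 GS b_def mult.commute)
 have "\<forall>s\<le>K. fps_nth f s = fps_nth (G K) s" for K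
 proof (induction K)
  case 0 thus ?case using f by (simp add: G0)
 next
  case (Suc K)
  let ?e = "fexp (Suc K) (fps_nth f (Suc K) - fps_nth (G K) (Suc K))"
  have g0: "fps_nth (G K) 0 = 1" using Suc f by simp
  have "fps_nth (G (Suc K)) s = fps_nth (G K) s + (if s = Suc K then fps_nth f (Suc K) - fps_nth (G K) (Suc K) else 0)"
   if s: "s <= Suc K" for s
  proof -
   have "fps_nth (G (Suc K)) s = (\<Sum>i=0..s. fps_nth (G K) i * fps_nth ?e (s - i))" by (simp add: GS fps_mult_nth)
   also have "\<dots> = (\<Sum>i\<in>{0..s}. (if i = s then fps_nth (G K) s else 0) +
     (if i = 0 then (if s = Suc K then fps_nth f (Suc K) - fps_nth (G K) (Suc K) else 0) else 0))"
   proof (intro sum.cong refl)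
    fix i assume i: "i \<in> {0..s}"
    consider "i = s" "i ~= 0" | "i = s" "i = 0" | "i < s" "i ~= 0" | "i < s" "i = 0" using i by force
    thus "fps_nth (G K) i * fps_nth ?e (s - i) = (if i = s then fps_nth (G K) s else 0) +
      (if i = 0 then (if s = Suc K then fps_nth f (Suc K) - fps_nth (G K) (Suc K) else 0) else 0)"
    proof cases
     case 3
     hence "fps_nth ?e (s - i) = 0" using s by (intro fexp_nth_lt) auto
     thus ?thesis using 3 by simp
    next
     case 4
     show ?thesis
     proof (cases "s = Suc K")
      case True
      thus ?thesis using 4 g0 fexp_nth_j[of "Suc K"] by simp
     next
      case False
      hence "fps_nth ?e s = 0" using 4 s by (intro fexp_nth_lt) auto
      thus ?thesis using 4 False by simp
     qed
    qed auto
   qed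
   also have "\<dots> = fps_nth (G K) s + (if s = Suc K then fps_nth f (Suc K) - fps_nth (G K) (Suc K) else 0)"
    by (simp add: sum.distrib)
   finally show ?thesis .
  qed
  thus ?case using Suc by (auto simp: le_Suc_eq)
 qed
 thus ?thesis unfolding P by blast
qed

lemma fps_mult_cong_le:
 "(\<And>i. i <= s ==> fps_nth f i = fps_nth f' i) ==> (\<And>i. i <= s ==> fps_nth g i = fps_nth g' i) ==>
  fps_nth (f * g) s = fps_nth (f' * g' :: 'k::field fps) s"
 by (simp add: fps_mult_nth)

lemma fps_inverse_cong_le:
 assumes "fps_nth f 0 = 1" "fps_nth f' 0 = 1" "\<And>i. i <= s ==> fps_nth f i = fps_nth (f' :: 'k::field fps) i"
 shows "fps_nth (inverse f) s = fps_nth (inverse f') s"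
proof -
 have "inverse f * f' * inverse f' = inverse f" using assms by (simp add: mult.assoc inverse_mult_eq_1')
 moreover have "inverse f * f * inverse f' = inverse f'" using assms by (simp add: inverse_mult_eq_1)
 moreover have "fps_nth (inverse f * f' * inverse f') s = fps_nth (inverse f * f * inverse f') s"
  by (intro fps_mult_cong_le) (use assms in auto)
 ultimately show ?thesis by metis
qed

lemma fpow_cong_le:
 assumes "fps_nth f 0 = 1" "fps_nth f' 0 = 1" "\<And>i. i <= s ==> fps_nth f i = fps_nth (f' :: 'k::field fps) i"
 shows "fps_nth (fpow f e) s = fps_nth (fpow f' e) s"
proof -
 have pw: "fps_nth (g ^ n) i = fps_nth (g' ^ n) i" if "i <= s" "\<And>i. i <= s ==> fps_nth g i = fps_nth g' i" for g g' :: "'k fps" and n i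
  using that by (induction n arbitrary: i) (auto intro!: fps_mult_cong_le)
 show ?thesis unfolding fpow_def
  using pw[OF order_refl assms(3)] pw[OF order_refl, of "inverse f" "inverse f'"]
   fps_inverse_cong_le[OF assms(1,2)] assms(3) by auto
qed

context seed begin

subsection \<open>Crossing a wall as a ray operator\<close>

definition crF :: "'i lat => 'k::field fps => int => 'i lat \<times> ('i lat => 'k fps)" where
 "crF v F s = (v, %mu. fpow F (s * pairNo J d v mu))"

lemma pairNo_diff_self: "pairNo J d v (mu - B (nsc s v)) = pairNo J d v mu"
 using pairNo_add[of v "mu - B (nsc s v)" "B (nsc s v)"] pairNo_self by simp

lemma okr_crF: "v \<in> posN J ==> fps_nth F 0 = 1 ==> okr (crF v F s)"
 by (simp add: okr_def crF_def pairNo_diff_self fpow_nth_0)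

lemma cross_rop: "sup0 J h ==> fst w \<in> posN J ==> cross J d eps w s m h = rop (crF (fst w) (fn w) s) m h"
 by (simp add: cross_ray rop_def crF_def)

lemma rop_crF_comp:
 assumes "sup0 J h" "v \<in> posN J" "fps_nth F 0 = 1" "fps_nth G 0 = 1"
 shows "rop (crF v F s) m (rop (crF v G s) m h) = rop (crF v (G * F) s) m h"
 unfolding rop_def crF_def fst_conv snd_conv
 by (subst ray_comp[OF assms(1,2)]) (use assms in "simp_all add: pairNo_inv fpow_mult mult.commute")

lemma rop_crF_1: "rop (crF v 1 s) m h = h"
 by (simp add: rop_def crF_def ray_1)

lemma ract_crF_list:
 assumes "sup0 J h" "v \<in> posN J" "ALL w:set ws. fst w = v & fps_nth (fn w) 0 = 1" "distinct ws"
 shows "ract (map (%w. crF (fst w) (fn w) s) ws) m h = rop (crF v (\<Prod>w\<in>set ws. fn w) s) m h"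
 using assms(3,4)
proof (induction ws rule: rev_induct)
 case Nil
 thus ?case by (simp add: rop_crF_1)
next
 case (snoc w ws)
 have w: "fst w = v" "fps_nth (fn w) 0 = 1" "w \<notin> set ws" using snoc.prems by auto
 have P0: "fps_nth (\<Prod>w\<in>set ws. fn w) 0 = 1" using snoc.prems by (intro fps_prod_nth_0) auto
 have "ract (map (%w. crF (fst w) (fn w) s) (ws @ [w])) m h =
   rop (crF v (fn w) s) m (rop (crF v (\<Prod>w\<in>set ws. fn w) s) m h)"
  using snoc w by (simp add: ract_append) (simp add: ract_def)
 also have "\<dots> = rop (crF v (\<Prod>w\<in>set (ws @ [w]). fn w) s) m h"
  using rop_crF_comp[OF assms(1,2) w(2) P0] w(3) by (simp add: mult.commute)
 finally show ?case .
qed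

definition sgnc :: "'i vec => 'i vec => 'i lat => int" where
 "sgnc a b v = (if 0 < pairR J d (%i. b i - a i) v then -1 else 1)"

definition crs :: "'i vec => 'i vec => ('i,'k::field) wall list => ('i,'k) rword" where
 "crs a b ws = map (%w. crF (fst w) (fn w) (sgnc a b (fst w))) ws"

text \<open>The same choice of ordering as inside \<open>seg_prod\<close>, named so that
  path-ordered products can be handled as words.\<close>

definition segl :: "('i,'k::field) wall set => 'i vec => 'i vec => ('i,'k) wall list" where
 "segl W a b = (SOME ws. distinct ws & set ws = crossed W a b & sorted_wrt (%w w'. ctime a b w <= ctime a b w') ws)"

fun pathl :: "('i,'k::field) wall set => 'i vec list => ('i,'k) rword" where
 "pathl W (a # b # r) = crs a b (segl W a b) @ pathl W (b # r)"
| "pathl W _ = []"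

lemma segl_props:
 assumes "finite W"
 shows "distinct (segl W a b)" "set (segl W a b) = crossed W a b"
  "sorted_wrt (%w w'. ctime a b w <= ctime a b w') (segl W a b)"
proof -
 have "finite (crossed W a b)" using assms by (simp add: crossed_def)
 then obtain l where l: "set l = crossed W a b" "distinct l" using finite_distinct_list by blast
 have "sorted (map (ctime a b) (sort_key (ctime a b) l))" by simp
 hence "sorted_wrt (%w w'. ctime a b w <= ctime a b w') (sort_key (ctime a b) l)"
  by (simp add: sorted_wrt_map)
 hence "EX ws. distinct ws & set ws = crossed W a b & sorted_wrt (%w w'. ctime a b w <= ctime a b w') ws"
  using l by (intro exI[of _ "sort_key (ctime a b) l"]) simp
 from someI_ex[OF this] show "distinct (segl W a b)" "set (segl W a b) = crossed W a b"
  "sorted_wrt (%w w'. ctime a b w <= ctime a b w') (segl W a b)" by (auto simp: segl_def)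
qed

definition okW :: "('i,'k::field) wall set => bool" where
 "okW W \<longleftrightarrow> finite W & (ALL w:W. is_wall J d w)"

lemma okrs_crs: "ALL w:set ws. is_wall J d w ==> okrs (crs a b ws)"
 unfolding crs_def okrs_def by (auto simp del: split_paired_All split_paired_Ex intro!: okr_crF is_wall_props(2,3))

lemma crs_simps [simp]: "crs a b [] = []" "crs a b (xs @ ys) = crs a b xs @ crs a b ys"
 by (simp_all add: crs_def)

lemma okrs_segl: "okW W ==> okrs (crs a b (segl W a b))"
 by (rule okrs_crs) (auto simp: okW_def segl_props crossed_def)

lemma okrs_pathl: "okW W ==> okrs (pathl W ps)"
 by (induction W ps rule: pathl.induct) (auto simp: okrs_segl)

lemma seg_prod_ract:
 assumes W: "okW W" and h: "sup0 J h"
 shows "seg_prod J d eps W a b m h = ract (crs a b (segl W a b)) m h"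
proof -
 have "foldl (%h w. cross J d eps w (sgnc a b (fst w)) m h) h ws = ract (crs a b ws) m h"
  if "ALL w:set ws. is_wall J d w" for ws
  using that h
 proof (induction ws arbitrary: h)
  case (Cons w ws)
  have w: "fst w \<in> posN J" "fps_nth (fn w) 0 = 1" using is_wall_props(2,3)[of w] Cons.prems by simp_all
  have "sup0 J (rop (crF (fst w) (fn w) (sgnc a b (fst w))) m h)"
   by (rule rop_sup0) (use w okr_crF Cons.prems in auto)
  thus ?case using Cons cross_rop[OF Cons.prems(2) w(1)] by (simp add: crs_def ract_Cons)
 qed (simp add: crs_def)
 moreover have "ALL w:set (segl W a b). is_wall J d w" using W by (auto simp: okW_def segl_props crossed_def)
 ultimately show ?thesis unfolding seg_prod_def segl_def sgnc_def by simp
qed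

lemma path_prod_ract:
 assumes W: "okW W" and h: "sup0 J h"
 shows "path_prod J d eps W ps m h = ract (pathl W ps) m h"
 using h
proof (induction ps arbitrary: h rule: induct_list012)
 case (3 a b r)
 thus ?case using seg_prod_ract[OF W 3(3), of a b m] ract_sup0[OF okrs_segl[OF W] 3(3)]
  by (simp add: ract_append)
qed auto

subsection \<open>Rational cones in a hyperplane are finitely generated\<close>

text \<open>The vectors \<open>b i\<close>, combinations of the i-th and a fixed j-th basis vector
  on which v vanishes, span the hyperplane; together with their negatives they generate it as a
  cone.\<close>

lemma hyperplane_gcone:
 assumes v: "v \<in> posN J"
 shows "EX S. finite S & S \<subseteq> latt J & gcone S = {x\<in>vecs J. dot (nrm v) x = 0}"
proof -
 obtain j where j: "j \<in> J" "nrm v j ~= 0" using nz_nrm[OF v] by (auto simp: nz_def)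
 have vj: "real_of_int (v j) ~= 0" using j by (auto simp: nrm_def)
 define b where "b i = (%k. (if k = i then v j * int (d i) else 0) - (if k = j then v i * int (d j) else 0))" for i
 have rb: "rv (b i) = (%k. (real_of_int (v j) * real (d i)) * uvec i k - (real_of_int (v i) * real (d j)) * uvec j k)" for i
  by (auto simp: rv_def b_def unitv_def)
 have rnb: "rv (- b i) = (%k. (-1) * rv (b i) k)" for i by (auto simp: rv_def fun_app)
 have bl: "b i \<in> latt J" if "i \<in> J" for i using that j by (auto simp: latt_def b_def)
 have db: "dot (nrm v) (rv (b i)) = 0" if i: "i \<in> J" for i
  unfolding rb dot_diff dot_scale dot_uvec[OF i] dot_uvec[OF j(1)]
  using dpos[OF i] dpos[OF j(1)] by (simp add: nrm_def)
 define S where "S = b ` J \<union> (%i. - b i) ` J"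
 have S: "finite S" "S \<subseteq> latt J" using finJ bl by (auto simp: S_def)
 have Sd: "dot (nrm v) (rv s) = 0" if "s \<in> S" for s
 proof -
  have "dot (nrm v) (rv (- b i)) = 0" if "i \<in> J" for i unfolding rnb dot_scale using db[OF that] by simp
  thus ?thesis using that db by (auto simp: S_def)
 qed
 have "gcone S = {x\<in>vecs J. dot (nrm v) x = 0}"
 proof (intro set_eqI iffI)
  fix x assume x: "x \<in> gcone S"
  then obtain l where l: "x = (%i. \<Sum>s\<in>S. l s * rv s i)" by (auto elim!: gconeE)
  have "dot (nrm v) x = 0" unfolding l dot_sum[OF S(1)] using Sd by simp
  thus "x \<in> {x\<in>vecs J. dot (nrm v) x = 0}" using x gcone_vecs[OF S(2)] by auto
 next
  fix x assume "x \<in> {x\<in>vecs J. dot (nrm v) x = 0}"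
  hence x: "x \<in> vecs J" "dot (nrm v) x = 0" by auto
  have eq: "x k = (\<Sum>i\<in>J. x i / (real_of_int (v j) * real (d i)) * rv (b i) k)" for k
  proof -
   have "(\<Sum>i\<in>J. x i / (real_of_int (v j) * real (d i)) * rv (b i) k) =
    (\<Sum>i\<in>J. (if i = k then x k else 0) - (if k = j then real (d j) / real_of_int (v j) else 0) * (nrm v i * x i))"
   proof (intro sum.cong refl)
    fix i assume i: "i \<in> J"
    have di: "real (d i) ~= 0" using dpos[OF i] by simp
    have rbk: "rv (b i) k = real_of_int (v j) * real (d i) * (if i = k then 1 else 0) -
      real_of_int (v i) * real (d j) * (if k = j then 1 else 0)" by (auto simp: rv_def b_def)
    show "x i / (real_of_int (v j) * real (d i)) * rv (b i) k =
     (if i = k then x k else 0) - (if k = j then real (d j) / real_of_int (v j) else 0) * (nrm v i * x i)"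
     unfolding rbk nrm_def using di vj by (auto simp: field_simps)
   qed
   also have "\<dots> = (if k \<in> J then x k else 0) - (if k = j then real (d j) / real_of_int (v j) else 0) * dot (nrm v) x"
    using finJ by (simp add: sum_subtractf sum_distrib_left dot_def)
   also have "\<dots> = x k" using x by (auto simp: vecs_def)
   finally show ?thesis by simp
  qed
  have "(%k. \<Sum>i\<in>J. x i / (real_of_int (v j) * real (d i)) * rv (b i) k) \<in> gcone S"
  proof (rule gcone_sum[OF finJ])
   fix i assume i: "i \<in> J"
   let ?c = "x i / (real_of_int (v j) * real (d i))"
   show "(%k. ?c * rv (b i) k) \<in> gcone S"
   proof (cases "0 <= ?c")
    case True
    show ?thesis by (rule gcone_scale[OF gcone_mem[OF S(1)] True]) (use i in "auto simp: S_def")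
   next
    case False
    have "(%k. (- ?c) * rv (- b i) k) \<in> gcone S"
     by (rule gcone_scale[OF gcone_mem[OF S(1)]]) (use i False in "auto simp: S_def")
    thus ?thesis by (simp add: rnb)
   qed
  qed
  moreover have "x = (%k. \<Sum>i\<in>J. x i / (real_of_int (v j) * real (d i)) * rv (b i) k)" using eq by (rule ext)
  ultimately show "x \<in> gcone S" by (rule ssubst[rotated])
 qed
 thus ?thesis using S by blast
qed

text \<open>One step of the double description method: keep the generators with nonnegative value
  and add, for every pair of opposite signs, the positive combination of value 0. For a point of the
  half-space the negative generators are cancelled against the fraction Vn / Vp of the positive
  ones.\<close>

lemma halfspace_gcone:
 assumes S: "finite S" "S \<subseteq> latt J" and p: "p \<in> latt J"
 shows "EX S'. finite S' & S' \<subseteq> latt J & gcone S' = {x\<in>gcone S. 0 <= dot (nrm p) x}"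
proof -
 define val where "val s = dot (nrm p) (rv s)" for s
 have vi: "val s = real_of_int (ipair p s) / real DD" for s
  unfolding val_def dot_pr by (simp add: pr_ipair)
 \<comment> \<open>Using the integers \<open>ipair\<close> instead of the real values
   \<open>val\<close> keeps the new generators in the lattice; the two differ by the factor
   \<open>DD\<close>.\<close>
 define cmb where "cmb a b = (%i. ipair p a * b i - ipair p b * a i)" for a b :: "'i lat"
 define S' where "S' = {s\<in>S. 0 <= val s} \<union> (%(a,b). cmb a b) ` {(a,b). a \<in> S & b \<in> S & 0 < val a & val b < 0}"
 have "finite {(a,b). a \<in> S & b \<in> S & 0 < val a & val b < 0}"
  by (rule finite_subset[of _ "S \<times> S"]) (use S in auto)
 moreover have "cmb a b \<in> latt J" if "a \<in> S" "b \<in> S" for a b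
 proof -
  have "a \<in> latt J" "b \<in> latt J" using that S by auto
  thus ?thesis by (simp add: cmb_def latt_def)
 qed
 ultimately have S': "finite S'" "S' \<subseteq> latt J" using S by (auto simp: S'_def)
 have DD: "0 < real DD" using DD_pos by simp
 have rc: "rv (cmb a b) = (%i. (real DD * val a) * rv b i + (- (real DD * val b)) * rv a i)" for a b
  using DD by (auto simp: rv_def cmb_def vi)
 have sub: "rv s \<in> gcone S & 0 <= dot (nrm p) (rv s)" if s: "s \<in> S'" for s
 proof -
  from s consider "s \<in> S" "0 <= val s" | a b where "a \<in> S" "b \<in> S" "0 < val a" "val b < 0" "s = cmb a b"
   unfolding S'_def by auto
  thus ?thesis
  proof cases
   case 1
   thus ?thesis using gcone_mem[OF S(1)] by (simp add: val_def)
  next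
   case 2
   have "rv s \<in> gcone S" unfolding 2(5) rc
    by (intro gcone_add gcone_scale gcone_mem S(1) 2(1,2)) (use 2 DD in "auto simp: mult_nonneg_nonpos")
   moreover have "dot (nrm p) (rv s) = 0"
    unfolding 2(5) rc dot_add dot_scale val_def by simp
   ultimately show ?thesis by simp
  qed
 qed
 have "gcone S' = {x\<in>gcone S. 0 <= dot (nrm p) x}"
 proof (intro set_eqI iffI)
  fix x assume x: "x \<in> gcone S'"
  hence xS: "x \<in> gcone S" using gcone_subset[OF S'(1)] sub by blast
  obtain l where l: "ALL s:S'. 0 <= l s" "x = (%i. \<Sum>s\<in>S'. l s * rv s i)" using x by (auto elim!: gconeE)
  have "0 <= dot (nrm p) x" unfolding l(2) dot_sum[OF S'(1)] using l(1) sub by (intro sum_nonneg) auto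
  thus "x \<in> {x\<in>gcone S. 0 <= dot (nrm p) x}" using xS by auto
 next
  fix x assume "x \<in> {x\<in>gcone S. 0 <= dot (nrm p) x}"
  hence x: "x \<in> gcone S" "0 <= dot (nrm p) x" by auto
  obtain l where l: "ALL s:S. 0 <= l s" "x = (%i. \<Sum>s\<in>S. l s * rv s i)" using x(1) by (auto elim!: gconeE)
  define Sp where "Sp = {s\<in>S. 0 < val s}"
  define Sn where "Sn = {s\<in>S. val s < 0}"
  define Sz where "Sz = {s\<in>S. val s = 0}"
  have fin: "finite Sp" "finite Sn" "finite Sz" using S by (auto simp: Sp_def Sn_def Sz_def)
  have Su: "S = Sz \<union> (Sp \<union> Sn)" "Sz \<inter> (Sp \<union> Sn) = {}" "Sp \<inter> Sn = {}" by (auto simp: Sp_def Sn_def Sz_def)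
  have split: "(\<Sum>s\<in>S. f s) = (\<Sum>s\<in>Sz. f s) + (\<Sum>s\<in>Sp. f s) + (\<Sum>s\<in>Sn. f s)" for f :: "_ => real"
   using fin Su(2,3) by (subst Su(1)) (simp add: sum.union_disjoint)
  define Vp where "Vp = (\<Sum>s\<in>Sp. l s * val s)"
  define Vn where "Vn = (\<Sum>s\<in>Sn. l s * (- val s))"
  have "dot (nrm p) x = (\<Sum>s\<in>S. l s * val s)" unfolding l(2) dot_sum[OF S(1)] val_def ..
  also have "\<dots> = Vp - Vn" unfolding split Vp_def Vn_def by (simp add: Sz_def sum_negf)
  finally have VV: "Vn <= Vp" using x(2) by simp
  have Vn0: "0 <= Vn" unfolding Vn_def using l(1) by (intro sum_nonneg) (auto simp: Sn_def mult_nonneg_nonpos)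
  have termS': "(%i. c * rv s i) \<in> gcone S'" if "s \<in> S'" "0 <= c" for c s
   by (intro gcone_scale gcone_mem S' that)
  show "x \<in> gcone S'"
  proof (cases "Vp = 0")
   case True
   hence Vn00: "Vn = 0" using VV Vn0 by simp
   have lp: "l s = 0" if "s \<in> Sp" for s
   proof -
    have "ALL s:Sp. 0 <= l s * val s" using l(1) by (auto simp: Sp_def)
    hence "l s * val s = 0" using True fin(1) that unfolding Vp_def by (simp add: sum_nonneg_eq_0_iff)
    thus ?thesis using that by (auto simp: Sp_def)
   qed
   have ln: "l s = 0" if "s \<in> Sn" for s
   proof -
    have "ALL s:Sn. 0 <= l s * (- val s)" using l(1) by (auto simp: Sn_def mult_nonneg_nonpos)
    hence "l s * (- val s) = 0" using Vn00 fin(2) that unfolding Vn_def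
     using sum_nonneg_eq_0_iff[of Sn "%s. l s * (- val s)"] by blast
    thus ?thesis using that by (auto simp: Sn_def)
   qed
   have "x = (%i. \<Sum>s\<in>Sz. l s * rv s i)" unfolding l(2) split using lp ln by simp
   moreover have "\<dots> \<in> gcone S'"
   proof (rule gcone_sum[OF fin(3)])
    fix s assume "s \<in> Sz"
    thus "(%i. l s * rv s i) \<in> gcone S'" using l(1) by (intro termS') (auto simp: Sz_def S'_def)
   qed
   ultimately show ?thesis by simp
  next
   case False
   hence Vp: "0 < Vp" using VV Vn0 by simp
   have c1: "(\<Sum>a\<in>Sp. l a * (1 - Vn / Vp) * rv a i) = (\<Sum>a\<in>Sp. l a * rv a i) - Vn / Vp * (\<Sum>a\<in>Sp. l a * rv a i)" for i
    by (simp add: algebra_simps sum_subtractf sum_distrib_left)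
   have c2: "(\<Sum>ab\<in>Sp \<times> Sn. l (fst ab) * l (snd ab) / (Vp * real DD) * rv (cmb (fst ab) (snd ab)) i) =
    (\<Sum>b\<in>Sn. l b * rv b i) + Vn / Vp * (\<Sum>a\<in>Sp. l a * rv a i)" for i
   proof -
    have "(\<Sum>ab\<in>Sp \<times> Sn. l (fst ab) * l (snd ab) / (Vp * real DD) * rv (cmb (fst ab) (snd ab)) i) =
     (\<Sum>a\<in>Sp. \<Sum>b\<in>Sn. (l a * val a) * (l b * rv b i) / Vp + (l b * (- val b)) * (l a * rv a i) / Vp)"
     unfolding sum.cartesian_product
     by (intro sum.cong refl) (use DD Vp in "auto simp: rc field_simps")
    also have "\<dots> = (\<Sum>a\<in>Sp. \<Sum>b\<in>Sn. (l a * val a) * (l b * rv b i) / Vp) +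
      (\<Sum>a\<in>Sp. \<Sum>b\<in>Sn. (l b * (- val b)) * (l a * rv a i) / Vp)"
     by (simp only: sum.distrib)
    also have "(\<Sum>a\<in>Sp. \<Sum>b\<in>Sn. (l a * val a) * (l b * rv b i) / Vp) = Vp * (\<Sum>b\<in>Sn. l b * rv b i) / Vp"
     unfolding Vp_def sum_product sum_divide_distrib ..
    also have "(\<Sum>a\<in>Sp. \<Sum>b\<in>Sn. (l b * (- val b)) * (l a * rv a i) / Vp) = Vn * (\<Sum>a\<in>Sp. l a * rv a i) / Vp"
     unfolding Vn_def sum_product sum_divide_distrib by (rule sum.swap)
    finally show ?thesis using Vp by simp
   qed
   have "x = (%i. (\<Sum>s\<in>Sz. l s * rv s i) + ((\<Sum>a\<in>Sp. l a * (1 - Vn / Vp) * rv a i) +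
     (\<Sum>ab\<in>Sp \<times> Sn. l (fst ab) * l (snd ab) / (Vp * real DD) * rv (cmb (fst ab) (snd ab)) i)))"
    unfolding c1 c2 l(2) split by (simp add: fun_eq_iff)
   moreover have "\<dots> \<in> gcone S'"
   proof (intro gcone_add gcone_sum fin finite_cartesian_product)
    fix s assume "s \<in> Sz"
    thus "(%i. l s * rv s i) \<in> gcone S'" using l(1) by (intro termS') (auto simp: Sz_def S'_def)
   next
    fix a assume "a \<in> Sp"
    thus "(%i. l a * (1 - Vn / Vp) * rv a i) \<in> gcone S'" using l(1) VV Vp
     by (intro termS') (auto simp: Sp_def S'_def)
   next
    fix ab assume "ab \<in> Sp \<times> Sn"
    thus "(%i. l (fst ab) * l (snd ab) / (Vp * real DD) * rv (cmb (fst ab) (snd ab)) i) \<in> gcone S'"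
     using l(1) Vp DD by (intro termS') (auto simp: Sp_def Sn_def S'_def intro!: image_eqI[where x="(fst ab, snd ab)"])
   qed
   ultimately show ?thesis by simp
  qed
 qed
 thus ?thesis using S' by blast
qed

definition hcone :: "'i lat => 'i lat set => 'i vec set" where
 "hcone v P = {x\<in>vecs J. dot (nrm v) x = 0 & (ALL p:P. 0 <= dot (nrm p) x)}"

lemma hcone_gcone:
 assumes v: "v \<in> posN J" and P: "finite P" "P \<subseteq> latt J"
 shows "EX S. finite S & S \<subseteq> latt J & gcone S = hcone v P"
 using P
proof (induction P rule: finite_induct)
 case empty
 thus ?case using hyperplane_gcone[OF v] by (simp add: hcone_def)
next
 case (insert p P)
 then obtain S where S: "finite S" "S \<subseteq> latt J" "gcone S = hcone v P" by auto
 obtain S' where S': "finite S'" "S' \<subseteq> latt J" "gcone S' = {x\<in>gcone S. 0 <= dot (nrm p) x}"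
  using halfspace_gcone[OF S(1,2), of p] insert.prems by auto
 have "gcone S' = hcone v (insert p P)" unfolding S'(3) S(3) by (auto simp: hcone_def)
 thus ?case using S' by blast
qed

text \<open>\<open>is_wall\<close> demands card J - 1 independent generators. If a maximal
  independent set were smaller, a covector not parallel to v would vanish on the whole cone. But the
  cone contains a neighbourhood of \<open>z\<close> in the hyperplane of v, because every constraint
  is strict at \<open>z\<close> or parallel to v.\<close>

lemma is_wall_hcone:
 assumes v: "primN J v" and P: "finite P" "P \<subseteq> latt J" and z: "z \<in> hcone v P"
  and int: "\<And>p. p \<in> P ==> 0 < dot (nrm p) z \<or> par (nrm p) (nrm v)" and f: "fps_nth f 0 = 1"
 shows "is_wall J d (v, hcone v P, f)"
proof -
 have vp: "v \<in> posN J" using v by (simp add: primN_def)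
 obtain S where S: "finite S" "S \<subseteq> latt J" "gcone S = hcone v P" using hcone_gcone[OF vp P] by blast
 have Sv: "dot (nrm v) (rv s) = 0" if "s \<in> S" for s
  using gcone_mem[OF S(1) that] unfolding S(3) by (auto simp: hcone_def)
 have zv: "z \<in> vecs J" "dot (nrm v) z = 0" using z by (auto simp: hcone_def)
 have ball: "\<exists>e>0. ALL y:vecs J. dot (nrm v) y = 0 & close e z y --> y \<in> hcone v P"
 proof -
  have "finite (nrm ` P)" using P by simp
  then obtain e where e: "0 < e" "\<And>y h. close e z y ==> h \<in> nrm ` P ==> dot h z ~= 0 ==> 0 < dot h z * dot h y"
   by (rule sign_stable[of "nrm ` P" z]) blast
  have "y \<in> hcone v P" if y: "y \<in> vecs J" "dot (nrm v) y = 0" "close e z y" for y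
   unfolding hcone_def
  proof (intro CollectI conjI y ballI)
   fix p assume p: "p \<in> P"
   show "0 <= dot (nrm p) y"
   proof (cases "par (nrm p) (nrm v)")
    case True thus ?thesis using par_dot[OF True y(2)] by simp
   next
    case False
    hence z0: "0 < dot (nrm p) z" using int[OF p] by blast
    hence "0 < dot (nrm p) z * dot (nrm p) y" using e(2)[OF y(3), of "nrm p"] p by auto
    thus ?thesis using z0 by (simp add: zero_less_mult_iff)
   qed
  qed
  thus ?thesis using e(1) by blast
 qed
 let ?Q = "%T. T \<subseteq> S & linind T & card T + 1 <= card J"
 obtain j where jJ: "j \<in> J" using nz_nrm[OF vp] by (auto simp: nz_def)
 have "linind {}" by (simp add: linind_def)
 moreover have "1 <= card J" using jJ finJ by (simp add: Suc_le_eq card_gt_0_iff) blast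
 ultimately have Q0: "?Q {}" by simp
 have "ALL T. ?Q T --> card T < card J" by auto
 then obtain T where T: "?Q T" and max: "\<And>T'. ?Q T' ==> card T' <= card T"
  using ex_has_greatest_nat[of ?Q "{}" card "card J"] Q0 by blast
 have fT: "finite T" "T \<subseteq> latt J" using T S finite_subset by auto
 have cT: "card T + 1 = card J"
 proof (rule ccontr)
  assume "card T + 1 ~= card J"
  hence lt: "card T + 1 < card J" using T by simp
  have "ALL s:T. dot (nrm v) (rv s) = 0" using T Sv by auto
  then obtain h where h: "nz h" "\<not> par h (nrm v)" "ALL s:T. dot h (rv s) = 0"
   using annihilator_ex2[OF fT _ lt nz_nrm[OF vp]] T by blast
  have hS: "dot h (rv s) = 0" if s: "s \<in> S" for s
  proof (rule ccontr)
   assume ne: "dot h (rv s) ~= 0"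
   have "linind (insert s T)" by (rule linind_insert[of T h]) (use fT T h ne in auto)
   moreover have "s \<notin> T" using h ne by auto
   ultimately have "?Q (insert s T)" using T s fT lt by simp
   thus False using max[of "insert s T"] \<open>s \<notin> T\<close> fT by simp
  qed
  have hC: "dot h x = 0" if "x \<in> hcone v P" for x
  proof -
   obtain l where "x = (%i. \<Sum>s\<in>S. l s * rv s i)" using \<open>x \<in> hcone v P\<close> unfolding S(3)[symmetric] by (auto elim!: gconeE)
   thus ?thesis using dot_sum[OF S(1)] hS by simp
  qed
  obtain e where e: "0 < e" "ALL y:vecs J. dot (nrm v) y = 0 & close e z y --> y \<in> hcone v P" using ball by blast
  obtain y where "y \<in> vecs J" "close e z y" "dot (nrm v) y = 0" "ALL h':{h}. dot h' y ~= 0"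
   by (rule generic_near_in[of "{h}" "nrm v" z e]) (use h nz_nrm[OF vp] zv e in auto)
  thus False using hC[of y] e(2) by auto
 qed
 show ?thesis unfolding is_wall_def prod.case
 proof (intro conjI v f, rule exI[of _ S], intro conjI S(1,2))
  show "hcone v P = gcone S" using S(3) by simp
  show "ALL s:S. pairR J d (%i. real_of_int (s i)) v = 0" using Sv by (simp add: pairR_dot rv_def)
  show "\<exists>T\<subseteq>S. card T + 1 = card J & linind T" using T cT by blast
 qed
qed

subsection \<open>Words along a ray\<close>

text \<open>Only exponents that are multiples of j along v occur, hence the reindexing s = j t. The
  factor j in the exponent comes from <j v, mu> = j <v, mu>.\<close>

lemma letter_ray:
 fixes c :: "'k::field_char_0"
 assumes h: "sup0 J h" and v: "v \<in> posN J" and j: "0 < j"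
 shows "rop (rl (nsc j v, c)) m h = rop (v, %mu. fexp j (c * of_nat j * pr v mu)) m h"
proof
 fix n
 define K where "K = nat (dg n)"
 have e: "nsc j v \<in> posN J" using v j by simp
 let ?a = "c * of_nat j * pr v (m + B n)"
 have "rop (v, %mu. fexp j (c * of_nat j * pr v mu)) m h n =
   (\<Sum>s\<le>j * K. h (n - nsc s v) * (if j dvd s then ?a ^ (s div j) / fact (s div j) else 0))"
  unfolding rop_def fst_conv snd_conv using ray_eq[OF h v, of n "j * K"] j by (simp add: K_def fexp_nth[OF j])
 also have "\<dots> = (\<Sum>s\<in>(%t. j * t) ` {..K}. h (n - nsc s v) * (if j dvd s then ?a ^ (s div j) / fact (s div j) else 0))"
  by (rule sum.mono_neutral_right) (use j in "auto elim!: dvdE")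
 also have "\<dots> = (\<Sum>t\<le>K. h (n - nsc (j * t) v) * (?a ^ t / fact t))"
  by (subst sum.reindex) (use j in "auto simp: inj_on_def")
 also have "\<dots> = rop (rl (nsc j v, c)) m h n"
  by (simp add: rop_def ray_def rl_def K_def nsc_nsc mult.commute pr_nsc1 mult_ac)
 finally show "rop (rl (nsc j v, c)) m h n = rop (v, %mu. fexp j (c * of_nat j * pr v mu)) m h n" by simp
qed

lemma rop_comp:
 assumes "sup0 J h" "okr (v, G)" "okr (v, F)"
 shows "rop (v, F) m (rop (v, G) m h) = rop (v, %mu. F mu * G mu) m h"
 unfolding rop_def fst_conv snd_conv
 by (rule ray_comp) (use assms okr_shift[OF assms(2)] in "auto simp: okr_def")

lemma okr_fexp: "v \<in> posN J ==> 0 < j ==> okr (v, %mu. fexp j (c * of_nat j * pr v mu))"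
 by (simp add: okr_def pr_diff2 matB_nsc pr_nsc2)

lemma okr_prod: "v \<in> posN J ==> (\<And>x. x \<in> A ==> okr (v, F x)) ==> okr (v, %mu. \<Prod>x\<in>A. F x mu)"
 by (auto simp: okr_def intro!: fps_prod_nth_0)

text \<open>Letters on one ray commute, so only the total coefficient at each multiple of v
  matters.\<close>

lemma ray_word:
 fixes w :: "('i,'k::field_char_0) word"
 assumes h: "sup0 J h" and v: "v \<in> posN J" and w: "ALL l:set w. EX j:{1..K}. fst l = nsc j v"
 shows "ract (rw w) m h = rop (v, %mu. \<Prod>j\<in>{1..K}. fexp j (csum w (nsc j v) * of_nat j * pr v mu)) m h"
 using w
proof (induction w rule: rev_induct)
 case Nil
 thus ?case by (simp add: rop_def ray_1)
next
 case (snoc l w)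
 obtain i where i: "i \<in> {1..K}" "fst l = nsc i v" using snoc.prems by auto
 have l: "l = (nsc i v, snd l)" using i by (metis prod.collapse)
 let ?F = "%w mu. \<Prod>j\<in>{1..K}. fexp j (csum w (nsc j v) * of_nat j * pr v mu)"
 have ok: "okr (v, ?F w)" by (rule okr_prod[OF v], rule okr_fexp[OF v]) simp
 have s: "sup0 J (rop (v, ?F w) m h)" by (rule rop_sup0[OF ok h])
 have "ract (rw (w @ [l])) m h = rop (rl l) m (rop (v, ?F w) m h)"
  using snoc by (simp add: ract_append) (simp add: ract_def)
 also have "\<dots> = rop (v, %mu. fexp i (snd l * of_nat i * pr v mu)) m (rop (v, ?F w) m h)"
  by (subst l, rule letter_ray[OF s v]) (use i in auto)
 also have "\<dots> = rop (v, %mu. fexp i (snd l * of_nat i * pr v mu) * ?F w mu) m h"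
  by (rule rop_comp[OF h ok okr_fexp[OF v]]) (use i in auto)
 also have "(%mu. fexp i (snd l * of_nat i * pr v mu) * ?F w mu) = ?F (w @ [l])"
 proof
  fix mu
  have ne: "nsc j v = nsc i v \<longleftrightarrow> j = i" for j using nsc_inj[OF v] by blast
  have "?F (w @ [l]) mu = (\<Prod>j\<in>{1..K}. (if j = i then fexp i (snd l * of_nat i * pr v mu) else 1) *
    fexp j (csum w (nsc j v) * of_nat j * pr v mu))"
  proof (intro prod.cong refl)
   fix j assume j: "j \<in> {1..K}"
   show "fexp j (csum (w @ [l]) (nsc j v) * of_nat j * pr v mu) =
    (if j = i then fexp i (snd l * of_nat i * pr v mu) else 1) * fexp j (csum w (nsc j v) * of_nat j * pr v mu)"
   proof (cases "j = i")
    case True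
    hence "csum (w @ [l]) (nsc j v) * of_nat j * pr v mu =
     snd l * of_nat i * pr v mu + csum w (nsc j v) * of_nat j * pr v mu"
     using i(2) by (simp add: distrib_right)
    thus ?thesis using True i(1) by (simp add: fexp_add)
   next
    case False
    hence "fst l ~= nsc j v" using i(2) ne by metis
    thus ?thesis using False by simp
   qed
  qed
  also have "\<dots> = fexp i (snd l * of_nat i * pr v mu) * ?F w mu"
   using i by (simp add: prod.distrib)
  finally show "fexp i (snd l * of_nat i * pr v mu) * ?F w mu = ?F (w @ [l]) mu" by simp
 qed
 finally show ?case .
qed

text \<open>Two normalizations meet here: wall crossings use the power \<open>pairNo\<close>, which
  is \<open>nscale\<close> times <v, mu>, while letters use <v, mu> itself. This is the origin of
  the division by \<open>nscale\<close>.\<close>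

lemma crF_fexp:
 "fpow (\<Prod>j\<in>{1..K}. fexp j (c j * of_nat j / of_nat (nscale J d v))) (pairNo J d v mu) =
  (\<Prod>j\<in>{1..K}. fexp j (c j * of_nat j * (pr v mu :: 'k::field_char_0)))"
proof -
 have ns: "of_nat (nscale J d v) ~= (0::'k)" using nscale_props(1)[of v] by simp
 have "fpow (\<Prod>j\<in>{1..K}. fexp j (c j * of_nat j / of_nat (nscale J d v))) (pairNo J d v mu) =
  (\<Prod>j\<in>{1..K}. fpow (fexp j (c j * of_nat j / of_nat (nscale J d v))) (pairNo J d v mu))"
  by (rule fpow_prod) auto
 also have "\<dots> = (\<Prod>j\<in>{1..K}. fexp j (c j * of_nat j * pr v mu))"
  by (intro prod.cong refl) (use ns in "simp add: fpow_fexp pairNo_pr field_simps")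
 finally show ?thesis .
qed

subsection \<open>Factorizations along a point\<close>

text \<open>The middle factor \<open>w\<close> is the central part at \<open>z\<close> and will
  become the wall crossing there. When \<open>z\<close> lies off all hyperplanes, \<open>w\<close>
  is empty and \<open>u\<close> becomes the chamber element of \<open>z\<close>.\<close>

definition isfac :: "nat => 'i vec => ('i,'k::field_char_0) word => ('i,'k) word =>
  ('i,'k) word => ('i,'k) word => bool" where
 "isfac k z g u w v \<longleftrightarrow> over (%e. dot (nrm e) z < 0 & dg e < int k) u &
   over (%e. dot (nrm e) z = 0 & dg e < int k) w & over (%e. 0 < dot (nrm e) z & dg e < int k) v &
   req (int k) (rw g) (rw (u @ w @ v))"

lemma nrm_dot_add: "dot (nrm (a + b)) z = dot (nrm a) z + dot (nrm b) z"
 unfolding dot_addl[symmetric] by (intro dot_congl) (simp add: nrm_def add_divide_distrib fun_app)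

lemma nrm_dot_nsc: "dot (nrm (nsc s e)) z = real s * dot (nrm e) z"
 by (simp add: nrm_nsc dot_scalel)

lemma isfac_ex: "okw g ==> EX u w v. isfac k z g u w v"
proof -
 assume g: "okw g"
 have "EX u w v. over (%e. dot (nrm e) z < 0 & dg e < int k & True) u &
   over (%e. dot (nrm e) z = 0 & dg e < int k & True) w &
   over (%e. 0 < dot (nrm e) z & dg e < int k & True) v & req (int k) (rw g) (rw (u @ w @ v))"
 proof (rule factorization[OF g])
  fix e show "dot (nrm e) z < 0 \<or> dot (nrm e) z = 0 \<or> 0 < dot (nrm e) z" by linarith
 qed simp
 thus ?thesis unfolding isfac_def by simp
qed

lemma isfac_unique:
 assumes "isfac k z g u w v" "isfac k' z g' u' w' v'" "K <= int k" "K <= int k'" "req K (rw g) (rw g')"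
 shows "req K (rw u) (rw u')" "req K (rw w) (rw w')"
proof -
 have "req K (rw g) (rw (u @ w @ v))" "req K (rw g') (rw (u' @ w' @ v'))"
  using assms req_mono by (auto simp: isfac_def)
 hence "req K (rw (u @ w @ v)) (rw (u' @ w' @ v'))" using assms(5) req_sym req_trans by blast
 moreover have "over (%e. dot (nrm e) z < 0) u" "over (%e. dot (nrm e) z < 0) u'"
  "over (%e. dot (nrm e) z = 0) w" "over (%e. dot (nrm e) z = 0) w'"
  "over (%e. 0 < dot (nrm e) z) v" "over (%e. 0 < dot (nrm e) z) v'"
  using assms(1,2) unfolding isfac_def by (auto intro: over_mono)
 ultimately show "req K (rw u) (rw u')" "req K (rw w) (rw w')"
  using factorization_unique[of "%n. dot (nrm n) z", OF nrm_dot_add] by blast+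
qed

definition same_signs :: "nat => 'i vec => 'i vec => bool" where
 "same_signs k z z' \<longleftrightarrow> (ALL e:posN J. dg e < int k -->
   (dot (nrm e) z < 0 \<longleftrightarrow> dot (nrm e) z' < 0) & (0 < dot (nrm e) z \<longleftrightarrow> 0 < dot (nrm e) z'))"

lemma same_signs_sym: "same_signs k z z' ==> same_signs k z' z" by (auto simp: same_signs_def)

lemma same_signs_0: "same_signs k z z' ==> e \<in> posN J ==> dg e < int k ==> dot (nrm e) z = 0 \<longleftrightarrow> dot (nrm e) z' = 0"
 unfolding same_signs_def by (metis linorder_neq_iff less_irrefl)

lemma isfac_cong: "same_signs k z z' ==> isfac k z g u w v ==> isfac k z' g u w v"
 unfolding isfac_def by (auto intro: over_mono simp: same_signs_0 same_signs_def)

subsection \<open>A word with prescribed central parts\<close>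

text \<open>These numbers are the coefficients (-1)^(j-1) / j of log(1 + X); the arguments use only
  the product formula that defines them.\<close>

definition beta :: "nat => 'k::field_char_0" where
 "beta = (SOME b. ALL K. \<forall>s\<le>K. fps_nth (1 + fps_X) s = fps_nth (\<Prod>j\<in>{1..K}. fexp j (b j)) s)"

lemma beta: "s <= K ==> fps_nth (1 + fps_X :: 'k::field_char_0 fps) s = fps_nth (\<Prod>j\<in>{1..K}. fexp j (beta j)) s"
proof -
 have "\<exists>b::nat => 'k. ALL K. \<forall>s\<le>K. fps_nth (1 + fps_X) s = fps_nth (\<Prod>j\<in>{1..K}. fexp j (b j)) s"
  by (rule fps_exp_factors) simp
 from someI_ex[OF this] show "s <= K ==> ?thesis" unfolding beta_def by blast
qed

text \<open>The letter coefficients that reproduce the incoming walls: by \<open>crF_fexp\<close>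
  the multiple j of a unit vector v must satisfy tgt * j / nscale = beta j. All other directions
  carry 0.\<close>

definition tgt :: "'i lat => 'k::field_char_0" where
 "tgt n = (if EX i:J. \<exists>j>0. n = nsc j (unitv i)
   then (case (SOME (v,j). v \<in> unitv ` J & 0 < j & n = nsc j v) of (v,j) => beta j * of_nat (nscale J d v) / of_nat j) else 0)"

lemma unitv_prim: "i \<in> J ==> primN J (unitv i)"
proof -
 assume i: "i \<in> J"
 have "unitv i ~= (0 :: 'i lat)" by (auto simp: unitv_def fun_eq_iff fun_app)
 hence "unitv i \<in> posN J" using i by (auto simp: posN_def nonneg_def latt_def unitv_def)
 thus ?thesis using i unfolding primN_def by (auto simp: unitv_def split: if_splits dest!: bspec[where x=i])
qed

lemma prim_unique:
 assumes "primN J v" "primN J v'" "nsc j v = nsc j' v'" "0 < j" "0 < j'"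
 shows "v = v' & j = j'"
proof -
 have v: "v \<in> posN J" "v' \<in> posN J" using assms by (auto simp: primN_def)
 have n: "nsc j v \<in> posN J" using v assms by simp
 have "par (nrm v) (nrm (nsc j v))" by (rule par_sym[OF nz_nrm[OF n] par_nsc])
 moreover have "par (nrm (nsc j v)) (nrm v')" unfolding assms(3) by (rule par_nsc)
 ultimately have "v = v'" using par_prim[OF assms(1,2)] par_trans by blast
 thus ?thesis using nsc_inj v assms(3) by blast
qed

lemma tgt_prim:
 assumes "primN J v" "0 < j"
 shows "tgt (nsc j v) = (if v \<in> unitv ` J then beta j * of_nat (nscale J d v) / of_nat j else (0::'k::field_char_0))"
proof (cases "v \<in> unitv ` J")
 case True
 have ex: "EX i:J. \<exists>j'>0. nsc j v = nsc j' (unitv i)" using True assms(2) by auto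
 have "(SOME (v',j'). v' \<in> unitv ` J & 0 < j' & nsc j v = nsc j' v') = (v, j)"
 proof (rule some_equality)
  show "case (v, j) of (v',j') => v' \<in> unitv ` J & 0 < j' & nsc j v = nsc j' v'" using True assms(2) by simp
  fix x assume "case x of (v',j') => v' \<in> unitv ` J & 0 < j' & nsc j v = nsc j' v'"
  then obtain v' j' where x: "x = (v',j')" "v' \<in> unitv ` J" "0 < j'" "nsc j v = nsc j' v'" by (cases x) auto
  have "primN J v'" using x(2) unitv_prim by auto
  thus "x = (v, j)" using prim_unique[OF assms(1) _ x(4) assms(2) x(3)] x(1) by simp
 qed
 thus ?thesis unfolding tgt_def using ex True by simp
next
 case False
 have "\<not> (EX i:J. \<exists>j'>0. nsc j v = nsc j' (unitv i))"
 proof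
  assume "EX i:J. \<exists>j'>0. nsc j v = nsc j' (unitv i)"
  then obtain i j' where "i \<in> J" "0 < j'" "nsc j v = nsc j' (unitv i)" by blast
  hence "v = unitv i" using prim_unique[OF assms(1) unitv_prim _ assms(2)] by blast
  thus False using False \<open>i \<in> J\<close> by blast
 qed
 hence "tgt (nsc j v) = (0::'k)" unfolding tgt_def by (rule if_not_P)
 thus ?thesis using False by simp
qed

definition step_ok :: "nat => ('i,'k::field_char_0) word => ('i,'k) word => bool" where
 "step_ok k g g' \<longleftrightarrow> req (int k) (rw g) (rw g') & (ALL n:posN J. dg n = int k -->
   (ALL u w v. isfac (Suc k) (rv (B n)) g' u w v --> csum w n = tgt n))"

lemma dot_B_0: "dot (nrm e) (rv (B n)) = 0 ==> (pr e (B n) :: 'k::field_char_0) = 0"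
 unfolding dot_pr pr_eq_0_iff .

lemma csum_layer: "distinct ns ==> csum (map (%n. (n, c n)) ns) n = (if n \<in> set ns then c n else 0)"
 by (induction ns) auto

text \<open>Append one layer of degree \<open>k\<close> whose coefficient at n is the deficit
  \<open>tgt n - csum\<close>. At each point nB its letters distribute over the three factors, and
  the letter n falls into the central one because <n, nB> = 0. One layer thus corrects all n of
  degree \<open>k\<close> at once.\<close>

lemma step_ex:
 fixes g :: "('i,'k::field_char_0) word"
 assumes g: "okw g"
 shows "EX g'. okw g' & step_ok k g g'"
proof (cases "k = 0")
 case True
 thus ?thesis using g deg_pos by (intro exI[of _ g]) (fastforce simp: step_ok_def)
next
 case False
 hence k0: "0 < int k" by simp
 have "ALL n. EX uwv. isfac (Suc k) (rv (B n)) g (fst uwv) (fst (snd uwv)) (snd (snd uwv))"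
  using isfac_ex[OF g] by fastforce
 then obtain F where F: "\<And>n. isfac (Suc k) (rv (B n)) g (fst (F n)) (fst (snd (F n))) (snd (snd (F n)))" by metis
 define c where "c n = tgt n - csum (fst (snd (F n))) n" for n
 obtain ns where ns: "set ns = {n \<in> posN J. dg n = int k & True}" "distinct ns" using layer_list_ex[of "int k" "%_. True"] by blast
 have ns': "ALL n:set ns. n \<in> posN J & dg n = int k" using ns by auto
 let ?ly = "%ns. map (%n. (n, c n)) ns"
 let ?g = "g @ ?ly ns"
 have okly: "okw (?ly ns)" using ns' by (auto simp: over_def)
 have okg': "okw ?g" using g okly by simp
 have A: "req (int k) (rw g) (rw ?g)"
 proof -
  have "req (int k) (rw g @ rw (?ly ns)) (rw g @ [])"
   by (rule req_append[OF req_refl layer_triv[OF ns' ns(2) k0]]) (use g okly in "auto simp del: map_map")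
  thus ?thesis using req_sym by simp
 qed
 have "csum w' n = tgt n" if n: "n \<in> posN J" "dg n = int k" and fac: "isfac (Suc k) (rv (B n)) ?g u' w' v'" for n u' w' v'
 proof -
  obtain u w v where uwv: "F n = (u, w, v)" by (cases "F n") auto
  have f: "isfac (Suc k) (rv (B n)) g u w v" using F[of n] uwv by simp
  let ?M = "%e. dot (nrm e) (rv (B n)) < 0" and ?Z = "%e. dot (nrm e) (rv (B n)) = 0"
  let ?nz = "filter (%e. \<not> ?M e & ?Z e) ns"
  have ok: "okw u" "okw w" "okw v" using f by (auto simp: isfac_def dest: over_ok)
  have "req (int k + 1) (rw g @ rw (?ly ns)) (rw (u @ w @ v) @ rw (?ly ns))"
   by (rule req_append) (use f g ok okly in "auto simp: isfac_def add.commute simp del: map_map")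
  moreover have "req (int k + 1) (rw ((u @ w @ v) @ ?ly ns)) (rw ((u @ ?ly (filter ?M ns)) @
   (w @ ?ly ?nz) @ (v @ ?ly (filter (%e. \<not> ?M e & \<not> ?Z e) ns))))"
   by (rule layer_distribute[OF ok ns' ns(2) k0])
  ultimately have "req (int k + 1) (rw ?g) (rw ((u @ ?ly (filter ?M ns)) @
   (w @ ?ly ?nz) @ (v @ ?ly (filter (%e. \<not> ?M e & \<not> ?Z e) ns))))"
   using req_trans by (simp del: map_map)
  hence "isfac (Suc k) (rv (B n)) ?g (u @ ?ly (filter ?M ns)) (w @ ?ly ?nz) (v @ ?ly (filter (%e. \<not> ?M e & \<not> ?Z e) ns))"
   using f ns' unfolding isfac_def by (auto simp: over_layer add.commute simp del: map_map)
  from isfac_unique(2)[OF fac this, of "int (Suc k)"]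
  have eq: "req (int (Suc k)) (rw w') (rw (w @ ?ly ?nz))" by simp
  have "csum w' n = csum (w @ ?ly ?nz) n"
  proof (rule csum_unique[OF _ _ n(1) _ eq])
   show "over (%e. (pr e (B n) :: 'k) = 0) w'" using fac unfolding isfac_def
    by (auto intro: over_mono dot_B_0)
   show "over (%e. (pr e (B n) :: 'k) = 0) (w @ ?ly ?nz)" using f ns' unfolding isfac_def
    by (auto intro: over_mono dot_B_0 simp: over_layer)
  qed (use n in simp)
  also have "\<dots> = csum w n + c n"
   using n ns csum_layer[of ?nz c n] by (simp add: dot_pr)
  also have "\<dots> = tgt n" using uwv by (simp add: c_def)
  finally show ?thesis .
 qed
 thus ?thesis using okg' A unfolding step_ok_def by blast
qed

definition gseq :: "(nat => ('i,'k::field_char_0) word) => bool" where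
 "gseq f \<longleftrightarrow> (ALL k. okw (f k) & step_ok k (f k) (f (Suc k)))"

text \<open>The words stabilize modulo every degree (\<open>gg_req\<close>), so the sequence stands
  for one element of the pro-unipotent group.\<close>

definition gg :: "nat => ('i,'k::field_char_0) word" where "gg = (SOME f. gseq f)"

lemma gg_gseq: "gseq (gg :: nat => ('i,'k::field_char_0) word)"
proof -
 have "\<exists>f::nat => ('i,'k) word. ALL k. okw (f k) & step_ok k (f k) (f (Suc k))"
  by (rule dependent_nat_choice) (use step_ex in \<open>auto intro: exI[of _ "[]"]\<close>)
 hence "\<exists>f::nat => ('i,'k) word. gseq f" by (simp add: gseq_def)
 thus ?thesis unfolding gg_def by (rule someI_ex)
qed

lemma gg_ok [simp]: "okw (gg k)" using gg_gseq by (auto simp: gseq_def)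

lemma gg_req: "k <= l ==> req (int k) (rw (gg k)) (rw (gg l))"
proof (induction l)
 case (Suc l)
 have "req (int l) (rw (gg l)) (rw (gg (Suc l)))" using gg_gseq by (auto simp: gseq_def step_ok_def)
 hence *: "k <= l ==> req (int k) (rw (gg l)) (rw (gg (Suc l)))" by (rule req_mono) simp
 show ?case
 proof (cases "k = Suc l")
  case False
  hence "k <= l" using Suc.prems by simp
  thus ?thesis using req_trans[OF Suc.IH *] by blast
 qed simp
qed simp

lemma gg_tgt: "n \<in> posN J ==> isfac (nat (dg n + 1)) (rv (B n)) (gg (nat (dg n + 1))) u w v ==> csum w n = tgt n"
proof -
 assume n: "n \<in> posN J" and f: "isfac (nat (dg n + 1)) (rv (B n)) (gg (nat (dg n + 1))) u w v"
 have e: "nat (dg n + 1) = Suc (nat (dg n))" "int (nat (dg n)) = dg n" using deg_pos[OF n] by linarith+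
 show ?thesis using gg_gseq f n e(2) unfolding gseq_def step_ok_def e(1) by metis
qed

subsection \<open>Wall coefficients\<close>

definition gen :: "nat => 'i lat => 'i vec => bool" where
 "gen k v z \<longleftrightarrow> z \<in> vecs J & dot (nrm v) z = 0 &
   (ALL e:posN J. dg e < int k --> dot (nrm e) z = 0 --> par (nrm e) (nrm v))"

abbreviation lev :: "'i lat => nat" where "lev n \<equiv> nat (dg n + 1)"

text \<open>The coefficient at \<open>n\<close> of the central part at \<open>z\<close>.
  Independence of the chosen factorization and of the truncation is guaranteed, by
  \<open>cf_val\<close>, for n on the ray of a primitive v and z generic on the hyperplane of
  v.\<close>

definition cf :: "'i vec => 'i lat => 'k::field_char_0" where
 "cf z n = (SOME c. EX u w v. isfac (lev n) z (gg (lev n)) u w v & c = csum w n)"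

lemma lev_int: "n \<in> posN J ==> int (lev n) = dg n + 1" using deg_pos[of n] by simp

lemma gen_mono: "gen k v z ==> l <= k ==> gen l v z" by (auto simp: gen_def)

lemma cf_cong: "same_signs (lev n) z z' ==> cf z n = (cf z' n :: 'k::field_char_0)"
proof -
 assume s: "same_signs (lev n) z z'"
 have "isfac (lev n) z (gg (lev n)) u w v \<longleftrightarrow> isfac (lev n) z' (gg (lev n)) u w v" for u w v :: "('i,'k) word"
  using isfac_cong[OF s] isfac_cong[OF same_signs_sym[OF s]] by blast
 thus ?thesis by (simp add: cf_def)
qed

lemma ray_over:
 assumes v: "primN J v" and z: "gen k v z" and w: "over (%e. dot (nrm e) z = 0 & dg e < int k) w"
 shows "over (%e. \<exists>j>0. e = nsc j v) w"
 using w
proof (rule over_mono)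
 fix e assume "e \<in> posN J" "dot (nrm e) z = 0 & dg e < int k"
 thus "\<exists>j>0. e = nsc j v" using z v par_prim_multiple[of e v] unfolding gen_def by metis
qed

text \<open>A factorization at a high level is also one at every lower level. For generic
  \<open>z\<close> all central letters lie on the ray of \<open>v\<close>, hence are orthogonal to
  nB for n on that ray, so \<open>csum_unique\<close> applies.\<close>

lemma cf_val:
 fixes u w x :: "('i,'k::field_char_0) word"
 assumes v: "primN J v" and z: "gen k v z" and j: "0 < j" "dg (nsc j v) < int k"
  and f: "isfac k z (gg k) u w x"
 shows "csum w (nsc j v) = cf z (nsc j v)"
proof -
 let ?n = "nsc j v"
 have n: "?n \<in> posN J" using v j by (auto simp: primN_def)
 have lk: "lev ?n <= k" using lev_int[OF n] j by linarith
 have "\<exists>c::'k. EX u' w' x'. isfac (lev ?n) z (gg (lev ?n)) u' w' x' & c = csum w' ?n" using isfac_ex[OF gg_ok] by blast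
 from someI_ex[OF this] obtain u' w' x' :: "('i,'k) word" where f': "isfac (lev ?n) z (gg (lev ?n)) u' w' x'" "cf z ?n = csum w' ?n"
  unfolding cf_def[symmetric] by blast
 have eq: "req (int (lev ?n)) (rw w) (rw w')"
  by (rule isfac_unique(2)[OF f f'(1)]) (use lk gg_req[OF lk] req_sym in auto)
 have z0: "(pr e (B ?n)) = (0::'k)" if "\<exists>i>0. e = nsc i v" for e
  using that by (auto simp: matB_nsc pr_nsc1 pr_nsc2)
 have "csum w ?n = csum w' ?n"
 proof (rule csum_unique[OF _ _ n _ eq])
  show "over (%e. pr e (B ?n) = (0::'k)) w"
   by (rule over_mono[OF ray_over[OF v z]]) (use f z0 in "auto simp: isfac_def")
  show "over (%e. pr e (B ?n) = (0::'k)) w'"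
   by (rule over_mono[OF ray_over[OF v gen_mono[OF z lk]]]) (use f' z0 in "auto simp: isfac_def")
 qed (use lev_int[OF n] in simp)
 thus ?thesis using f' by simp
qed

text \<open>Covectors required to be nonnegative on the closed cell of \<open>z\<close> in the
  arrangement up to degree dg n; negative signs enter through - e, and hyperplanes through
  \<open>z\<close> impose nothing.\<close>

definition Pz :: "'i lat => 'i vec => 'i lat set" where
 "Pz n z = {e \<in> posN J. dg e < dg n + 1 & 0 < dot (nrm e) z} \<union> uminus ` {e \<in> posN J. dg e < dg n + 1 & dot (nrm e) z < 0}"

lemma nrm_uminus: "nrm (- e) = (%i. - nrm e i)" by (auto simp: nrm_def fun_app)
lemma dot_uminusl: "dot (%i. - h i) x = - dot h x" by (simp add: dot_def sum_negf)

lemma hcone_Pz: "x \<in> hcone v (Pz n z) \<longleftrightarrow> x \<in> vecs J & dot (nrm v) x = 0 &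
  (ALL e:posN J. dg e < dg n + 1 --> (0 < dot (nrm e) z --> 0 <= dot (nrm e) x) & (dot (nrm e) z < 0 --> dot (nrm e) x <= 0))"
 unfolding hcone_def Pz_def ball_Un by (auto simp: nrm_uminus dot_uminusl)

lemma Pz_fin: "finite (Pz n z)" "Pz n z \<subseteq> latt J"
proof -
 have "finite {e \<in> posN J. dg e < dg n + 1}"
  by (rule finite_subset[OF _ fin_deg[of "dg n + 1"]]) (auto simp: posN_nonneg)
 thus "finite (Pz n z)" unfolding Pz_def by (intro finite_UnI finite_imageI) (auto elim: rev_finite_subset)
 show "Pz n z \<subseteq> latt J" by (auto simp: Pz_def posN_latt)
qed

text \<open>As nB lies in the closed cell of \<open>z\<close>, strict signs at nB persist at
  \<open>z\<close>. Refining the central part w at nB by the signs at \<open>z\<close>, w = a b c,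
  turns u w x into the factorization (u a) b (c x) at \<open>z\<close>. No letter of a or c has
  direction n, because n is orthogonal to \<open>z\<close>, so w and b have the same coefficient at
  n.\<close>

lemma cf_out:
 fixes v n :: "'i lat" assumes v: "primN J v" and j: "0 < j" and n_def: "n = nsc j v" and z: "gen (lev n) v z"
  and out: "rv (B v) \<in> hcone v (Pz n z)"
 shows "cf z n = (tgt n :: 'k::field_char_0)"
proof -
 have n: "n \<in> posN J" using v j by (auto simp: primN_def n_def)
 let ?y = "rv (B n)"
 have yB: "dot (nrm e) ?y = real j * dot (nrm e) (rv (B v))" for e
  unfolding dot_pr n_def by (simp add: matB_nsc pr_nsc2)
 have jr: "0 < real j" using j by simp
 obtain u w x :: "('i,'k) word" where f: "isfac (lev n) ?y (gg (lev n)) u w x" using isfac_ex[OF gg_ok] by blast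
 have c1: "csum w n = tgt n" using gg_tgt[OF n f] .
 have zy: "dot (nrm e) ?y < 0 ==> dot (nrm e) z < 0" "0 < dot (nrm e) ?y ==> 0 < dot (nrm e) z"
  if e: "e \<in> posN J" "dg e < int (lev n)" for e
 proof -
  have s: "0 < dot (nrm e) z ==> 0 <= dot (nrm e) ?y" "dot (nrm e) z < 0 ==> dot (nrm e) ?y <= 0"
   using out e lev_int[OF n] jr unfolding hcone_Pz yB by (auto simp: mult_nonneg_nonpos)
  have z0: "dot (nrm e) ?y = 0" if "dot (nrm e) z = 0"
  proof -
   have "par (nrm e) (nrm v)" using z e that by (auto simp: gen_def)
   moreover have "dot (nrm v) ?y = 0" unfolding yB unfolding dot_pr by simp
   ultimately show ?thesis by (rule par_dot)
  qed
  show "dot (nrm e) ?y < 0 ==> dot (nrm e) z < 0" "0 < dot (nrm e) ?y ==> 0 < dot (nrm e) z"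
   using s z0 by (metis linorder_neq_iff not_le)+
 qed
 let ?S = "%e. dot (nrm e) ?y = 0"
 have "EX a b c. over (%e. dot (nrm e) z < 0 & dg e < int (lev n) & ?S e) a &
   over (%e. dot (nrm e) z = 0 & dg e < int (lev n) & ?S e) b &
   over (%e. 0 < dot (nrm e) z & dg e < int (lev n) & ?S e) c & req (int (lev n)) (rw w) (rw (a @ b @ c))"
 proof (rule factorization)
  show "over ?S w" using f unfolding isfac_def by (auto intro: over_mono)
  show "a = 0 \<or> ?S a ==> ?S e ==> 0 < s ==> ?S (a + nsc s e)" for a e and s :: nat
   by (auto simp: nrm_dot_add nrm_dot_nsc) (simp add: dot_def nrm_def fun_app)
  show "dot (nrm e) z < 0 \<or> dot (nrm e) z = 0 \<or> 0 < dot (nrm e) z" for e by linarith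
 qed
 then obtain a b c where abc: "over (%e. dot (nrm e) z < 0 & dg e < int (lev n) & ?S e) a"
   "over (%e. dot (nrm e) z = 0 & dg e < int (lev n) & ?S e) b"
   "over (%e. 0 < dot (nrm e) z & dg e < int (lev n) & ?S e) c" "req (int (lev n)) (rw w) (rw (a @ b @ c))" by blast
 have ok: "okw a" "okw b" "okw c" "okw u" "okw x" "okw w" using abc f by (auto simp: isfac_def dest: over_ok)
 have "req (int (lev n)) (rw u @ (rw w @ rw x)) (rw u @ (rw (a @ b @ c) @ rw x))"
  by (intro req_append req_refl abc(4)) (use ok in auto)
 hence "req (int (lev n)) (rw (gg (lev n))) (rw ((u @ a) @ b @ (c @ x)))"
  using f req_trans[of "int (lev n)" "rw (gg (lev n))" "rw (u @ w @ x)"] unfolding isfac_def by simp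
 hence "isfac (lev n) z (gg (lev n)) (u @ a) b (c @ x)"
  using f abc zy unfolding isfac_def by (auto intro: over_mono)
 hence fac: "isfac (lev (nsc j v)) z (gg (lev (nsc j v))) (u @ a) b (c @ x)" by (simp add: n_def)
 have "dg (nsc j v) < int (lev (nsc j v))" using lev_int[OF n] by (simp add: n_def)
 from cf_val[OF v z[unfolded n_def] j this fac] have "csum b n = cf z n" by (simp add: n_def)
 moreover have "csum w n = csum (a @ b @ c) n"
  by (rule csum_unique[OF _ _ n _ abc(4)])
    (use f abc lev_int[OF n] in "auto simp: isfac_def intro: over_mono dot_B_0")
 moreover have "csum a n = 0" "csum c n = 0"
 proof -
  have "dot (nrm n) z = 0" using z unfolding n_def nrm_dot_nsc gen_def by simp
  thus "csum a n = 0" "csum c n = 0" using csum_over[OF abc(1)] csum_over[OF abc(3)] by auto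
 qed
 ultimately show ?thesis using c1 by simp
qed

subsection \<open>The scattering diagram\<close>

text \<open>The incoming walls already carry \<open>tgt\<close>, so the other walls carry only the
  difference; the normalization is the one of \<open>crF_fexp\<close>.\<close>

definition wb :: "'i lat => nat => 'i vec => 'k::field_char_0" where
 "wb v j z = (cf z (nsc j v) - tgt (nsc j v)) * of_nat j / of_nat (nscale J d v)"

definition wl :: "'i lat => nat => 'i vec => ('i,'k::field_char_0) wall" where
 "wl v j z = (v, hcone v (Pz (nsc j v) z), fexp j (wb v j z))"

text \<open>Although \<open>z\<close> ranges over a continuum, points of one cell give the same
  wall, so each degree contributes finitely many. Walls with trivial function are left out, and this
  is what makes the remaining ones outgoing.\<close>

definition WD :: "('i,'k::field_char_0) wall set" where
 "WD = {wl v j z | v j z. primN J v & 0 < j & gen (lev (nsc j v)) v z & (wb v j z :: 'k) ~= 0}"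

definition SD :: "('i,'k::field_char_0) wall set" where "SD = Din J \<union> WD"

lemma Din_hcone: "i \<in> J ==> {x \<in> vecs J. x i = 0} = hcone (unitv i) {}"
proof -
 assume i: "i \<in> J"
 have "dot (nrm (unitv i)) x = x i / real (d i)" for x
 proof -
  have "dot (nrm (unitv i)) x = (\<Sum>k\<in>J. if k = i then x i / real (d i) else 0)"
   unfolding dot_def nrm_def unitv_def by (intro sum.cong) auto
  thus ?thesis using i finJ by simp
 qed
 thus ?thesis using dpos[OF i] by (auto simp: hcone_def)
qed

lemma gen_hcone: "gen k v z ==> z \<in> hcone v (Pz n z)"
 unfolding hcone_Pz gen_def by auto

lemma SD_wall:
 fixes w :: "('i,'k::field_char_0) wall" assumes "w \<in> SD" shows "is_wall J d w"
 using assms unfolding SD_def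
proof
 assume "w \<in> Din J"
 then obtain i where i: "i \<in> J" "w = (unitv i, {x \<in> vecs J. x i = 0}, 1 + fps_X)" by (auto simp: Din_def)
 show ?thesis unfolding i(2) Din_hcone[OF i(1)]
  by (rule is_wall_hcone[OF unitv_prim[OF i(1)], where z="%_. 0"]) (auto simp: hcone_def vecs_0)
next
 assume "w \<in> WD"
 then obtain v j z where w: "w = wl v j z" "primN J v" "0 < j" "gen (lev (nsc j v)) v z" by (auto simp: WD_def)
 have n: "nsc j v \<in> posN J" using w by (auto simp: primN_def)
 show ?thesis unfolding w(1) wl_def
 proof (rule is_wall_hcone[OF w(2) Pz_fin gen_hcone[OF w(4)]])
  fix p assume "p \<in> Pz (nsc j v) z"
  thus "0 < dot (nrm p) z \<or> par (nrm p) (nrm v)"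
   by (auto simp: Pz_def nrm_uminus dot_uminusl)
 qed (use w in simp)
qed

lemma Pz_signs: "Pz n z = Pz n z' ==> n \<in> posN J ==> same_signs (lev n) z z'"
proof -
 assume P: "Pz n z = Pz n z'" and n: "n \<in> posN J"
 have np: "- e \<notin> posN J" if "e \<in> posN J" for e
 proof
  assume "- e \<in> posN J"
  hence "0 < dg (- e)" by (rule deg_pos)
  thus False using deg_pos[OF that] by (simp add: degN_def sum_negf fun_app)
 qed
 have pos: "0 < dot (nrm e) y \<longleftrightarrow> e \<in> Pz n y" and neg: "dot (nrm e) y < 0 \<longleftrightarrow> - e \<in> Pz n y"
  if "e \<in> posN J" "dg e < dg n + 1" for e y
  using that np unfolding Pz_def by auto
 show ?thesis unfolding same_signs_def lev_int[OF n] using pos neg P by auto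
qed

lemma finite_image_via:
 assumes "finite (g ` Z)" "\<And>z z'. z \<in> Z ==> z' \<in> Z ==> g z = g z' ==> f z = f z'"
 shows "finite (f ` Z)"
proof -
 have "f ` Z \<subseteq> (%s. f (SOME z. z \<in> Z & g z = s)) ` (g ` Z)"
 proof
  fix y assume "y \<in> f ` Z"
  then obtain z where z: "z \<in> Z" "y = f z" by auto
  have "EX z'. z' \<in> Z & g z' = g z" using z by auto
  from someI_ex[OF this] have "f z = f (SOME z'. z' \<in> Z & g z' = g z)" using assms(2) z by metis
  thus "y \<in> (%s. f (SOME z. z \<in> Z & g z = s)) ` (g ` Z)" using z by auto
 qed
 thus ?thesis using assms(1) finite_surj by blast
qed

lemma wl_ntriv: "primN J v ==> 0 < j ==> (wb v j z :: 'k::field_char_0) ~= 0 ==>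
  ntriv J k (wl v j z :: ('i,'k) wall) \<longleftrightarrow> dg (nsc j v) < int k"
proof -
 assume v: "primN J v" and j: "0 < j" and b: "(wb v j z :: 'k) ~= 0"
 have vp: "v \<in> posN J" using v by (simp add: primN_def)
 have nt: "ntriv J k (wl v j z :: ('i,'k) wall) \<longleftrightarrow>
   (\<exists>i::nat. 0 < i & int i * dg v < int k & fps_nth (fexp j (wb v j z :: 'k)) i ~= 0)"
  by (simp add: ntriv_def wl_def)
 show ?thesis
 proof
  assume "ntriv J k (wl v j z :: ('i,'k) wall)"
  then obtain i where i: "0 < i" "int i * dg v < int k" "fps_nth (fexp j (wb v j z :: 'k)) i ~= 0"
   unfolding nt by (elim exE conjE)
  hence "j <= i" using fexp_nth_lt[OF i(1), of j "wb v j z :: 'k"] by fastforce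
  hence "int j * dg v <= int i * dg v" using deg_pos[OF vp] by (intro mult_right_mono) auto
  thus "dg (nsc j v) < int k" using i by (simp add: degN_nsc)
 next
  assume "dg (nsc j v) < int k"
  thus "ntriv J k (wl v j z :: ('i,'k) wall)" unfolding nt using j b
   by (intro exI[of _ j]) (simp add: degN_nsc fexp_nth_j)
 qed
qed

lemma SD_finite: "finite (Dk J (SD :: ('i,'k::field_char_0) wall set) k)"
proof -
 have f1: "finite (Din J :: ('i,'k) wall set)"
 proof -
  have "Din J = (%i. (unitv i, {x \<in> vecs J. x i = 0}, 1 + fps_X :: 'k fps)) ` J" by (auto simp: Din_def)
  thus ?thesis using finJ by simp
 qed
 let ?Z = "%v j. {z. gen (lev (nsc j v)) v z}"
 let ?I = "{(v,j). primN J v & 0 < j & dg (nsc j v) < int k}"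
 have f2: "finite ?I"
 proof (rule finite_imageD[of "%(v,j). nsc j v"])
  show "finite ((%(v,j). nsc j v) ` ?I)"
   by (rule finite_subset[OF _ fin_deg[of "int k"]]) (auto simp: primN_def posN_nonneg)
  show "inj_on (%(v,j). nsc j v) ?I" using prim_unique by (auto simp: inj_on_def)
 qed
 have f3: "finite ((wl v j :: 'i vec => ('i,'k) wall) ` ?Z v j)" if v: "primN J v" and j: "0 < j" for v j
 proof (rule finite_image_via[where g="Pz (nsc j v)"])
  have n: "nsc j v \<in> posN J" using v j by (auto simp: primN_def)
  let ?E = "{e \<in> posN J. dg e < dg (nsc j v) + 1}"
  have fe: "finite ?E" by (rule finite_subset[OF _ fin_deg[of "dg (nsc j v) + 1"]]) (auto simp: posN_nonneg)
  have "Pz (nsc j v) ` ?Z v j \<subseteq> Pow (?E \<union> uminus ` ?E)" by (auto simp: Pz_def)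
  thus "finite (Pz (nsc j v) ` ?Z v j)" using fe by (meson finite_Pow_iff finite_UnI finite_imageI finite_subset)
  fix z z' assume P: "Pz (nsc j v) z = Pz (nsc j v) z'"
  have "cf z (nsc j v) = (cf z' (nsc j v) :: 'k)" by (rule cf_cong[OF Pz_signs[OF P n]])
  thus "wl v j z = (wl v j z' :: ('i,'k) wall)" using P by (simp add: wl_def wb_def)
 qed
 have "Dk J (SD :: ('i,'k) wall set) k \<subseteq> Din J \<union> (\<Union>(v,j)\<in>?I. wl v j ` ?Z v j)"
 proof
  fix w :: "('i,'k) wall" assume w: "w \<in> Dk J SD k"
  show "w \<in> Din J \<union> (\<Union>(v,j)\<in>?I. wl v j ` ?Z v j)"
  proof (cases "w \<in> Din J")
   case False
   then obtain v j z where x: "w = wl v j z" "primN J v" "0 < j" "gen (lev (nsc j v)) v z" "(wb v j z :: 'k) ~= 0"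
    using w unfolding Dk_def SD_def WD_def by blast
   have "ntriv J k w" using w by (simp add: Dk_def)
   hence I: "(v, j) \<in> ?I" using wl_ntriv[OF x(2,3,5)] x(1,2,3) by simp
   have "w \<in> wl v j ` ?Z v j" using x(1,4) by blast
   thus ?thesis using I by (intro UnI2 UN_I[of "(v,j)"]) simp_all
  qed simp
 qed
 moreover have "finite (\<Union>(v,j)\<in>?I. (wl v j :: 'i vec => ('i,'k) wall) ` ?Z v j)" using f2 f3 by auto
 ultimately show ?thesis using f1 by (meson finite_UnI finite_subset)
qed

text \<open>If the wall contained B v, then \<open>cf_out\<close> would equate \<open>cf\<close>
  with \<open>tgt\<close>, and the exponent \<open>wb\<close> would be 0.\<close>

lemma SD_outgoing:
 fixes w :: "('i,'k::field_char_0) wall" assumes "w \<in> SD - Din J" shows "outgoing J eps w"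
proof -
 obtain v j z where w: "w = wl v j z" "primN J v" "0 < j" "gen (lev (nsc j v)) v z" "(wb v j z :: 'k) ~= 0"
  using assms by (auto simp: SD_def WD_def)
 show ?thesis
 proof (rule ccontr)
  assume "\<not> outgoing J eps w"
  hence "rv (B v) \<in> hcone v (Pz (nsc j v) z)" by (simp add: outgoing_def w(1) wl_def rv_def)
  hence "cf z (nsc j v) = (tgt (nsc j v) :: 'k)" by (rule cf_out[OF w(2,3) refl w(4)])
  hence "wb v j z = (0::'k)" by (simp add: wb_def)
  thus False using w by simp
 qed
qed

end

section \<open>Points on segments and the walls through a generic point\<close>

lemma pt_pt: "pt (pt a b s) (pt a b t) r = pt a b (s + r * (t - s))"
 by (simp add: pt_def fun_eq_iff algebra_simps)

lemma pt_0 [simp]: "pt a b 0 = a" and pt_1 [simp]: "pt a b 1 = b"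
 by (simp_all add: pt_def fun_eq_iff)

lemma pt_end: "pt (pt a b t) b r = pt a b (t + r * (1 - t))"
 using pt_pt[of a b t 1 r] by simp

lemma affine_zero:
 fixes p q :: real assumes "s < t" "(p + s * q) * (p + t * q) < 0"
 obtains r where "s < r" "r < t" "p + r * q = 0"
proof -
 have q: "q ~= 0" using assms(2) by (auto simp: mult_less_0_iff)
 let ?r = "- p / q"
 have e: "p + x * q = (x - ?r) * q" for x using q by (simp add: field_simps)
 have "(s - ?r) * (t - ?r) * (q * q) < 0" using assms(2) unfolding e by (simp add: mult_ac)
 moreover have "0 < q * q" using q by (metis not_square_less_zero linorder_neqE_linordered_idom mult_eq_0_iff)
 ultimately have "(s - ?r) * (t - ?r) < 0" by (simp add: mult_less_0_iff)
 hence "s < ?r" "?r < t" using assms(1) by (auto simp: mult_less_0_iff)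
 thus ?thesis using that[of ?r] q by simp
qed

context seed begin

lemma dot_pt: "dot h (pt a b t) = dot h a + t * (dot h b - dot h a)"
 by (simp add: pt_def dot_add dot_scale dot_diff)

lemma vecs_pt: "a \<in> vecs J ==> b \<in> vecs J ==> pt a b t \<in> vecs J"
 by (auto simp: vecs_def pt_def)

lemma Pz_cong: "same_signs (lev n) z z' ==> n \<in> posN J ==> Pz n z = Pz n z'"
proof -
 assume s: "same_signs (lev n) z z'" and n: "n \<in> posN J"
 have "{e \<in> posN J. dg e < dg n + 1 & 0 < dot (nrm e) z} = {e \<in> posN J. dg e < dg n + 1 & 0 < dot (nrm e) z'}"
  "{e \<in> posN J. dg e < dg n + 1 & dot (nrm e) z < 0} = {e \<in> posN J. dg e < dg n + 1 & dot (nrm e) z' < 0}"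
  using s unfolding same_signs_def lev_int[OF n] by blast+
 thus ?thesis unfolding Pz_def by simp
qed

lemma ray_bound:
 assumes "v \<in> posN J"
 obtains K :: nat where "\<forall>j>0. j <= K \<longleftrightarrow> int j * dg v < int k"
proof -
 have dv: "0 < dg v" by (rule deg_pos[OF assms])
 define m where "m = nat (dg v)"
 have m: "0 < m" "int m = dg v" using dv by (auto simp: m_def)
 show ?thesis
 proof (rule that[of "(k - 1) div m"], intro allI impI)
  fix j :: nat assume j: "0 < j"
  have "j <= (k - 1) div m \<longleftrightarrow> j * m <= k - 1" by (rule less_eq_div_iff_mult_less_eq[OF m(1)])
  also have "\<dots> \<longleftrightarrow> j * m < k" using j m by (cases k) auto
  also have "\<dots> \<longleftrightarrow> int j * dg v < int k" unfolding m(2)[symmetric] by (simp flip: of_nat_mult)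
  finally show "j <= (k - 1) div m \<longleftrightarrow> int j * dg v < int k" .
 qed
qed

lemma fexp_inj: "0 < j ==> 0 < j' ==> b ~= 0 ==> b' ~= 0 ==> fexp j b = fexp j' b' ==> j = j'"
 using fexp_nth_lt[of j j' b'] fexp_nth_lt[of j' j b] fexp_nth_j[of j b] fexp_nth_j[of j' b']
 by (metis linorder_neqE_nat)

lemma fexp_not_Din: "0 < j ==> b ~= 0 ==> fexp j b ~= 1 + (fps_X :: 'k::field_char_0 fps)"
proof
 assume j: "0 < j" and b: "b ~= 0" and e: "fexp j b = 1 + (fps_X :: 'k fps)"
 have 1: "fps_nth (fexp j b) 1 = 1" "fps_nth (fexp j b) 2 = 0" unfolding e by (simp_all add: numeral_2_eq_2)
 have "j = 1" using 1(1) fexp_nth_lt[of 1 j b] j by force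
 thus False using 1(2) b by (simp add: fexp_nth)
qed

text \<open>A wall through \<open>z\<close> was defined by some base point z' whose closed cell
  contains \<open>z\<close>. Since \<open>z\<close> and z' lie on the hyperplane of \<open>v\<close>
  and off all others of the relevant degrees, their signs agree, and the wall may be rebased at
  \<open>z\<close>. An incoming wall passes through \<open>z\<close> only if \<open>v\<close> is a
  unit vector, and it survives truncation only for 1 < k.\<close>

lemma wall_set_at:
 fixes z :: "'i vec"
 assumes v: "primN J v" and z: "gen k v z" and K: "\<forall>j>0. j <= K \<longleftrightarrow> int j * dg v < int k"
 shows "{w\<in>Dk J (SD :: ('i,'k::field_char_0) wall set) k. z \<in> cn w} =
  (%j. wl v j z) ` {j\<in>{1..K}. (wb v j z :: 'k) ~= 0} \<union>
  (if v \<in> unitv ` J & 1 < k then {(v, hcone v {}, 1 + fps_X)} else {})"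
  (is "?A = ?B \<union> ?E")
proof (intro set_eqI iffI)
 fix w assume "w \<in> ?A"
 hence w: "w \<in> SD" "ntriv J k w" "z \<in> cn w" by (auto simp: Dk_def)
 have zv: "z \<in> vecs J" "dot (nrm v) z = 0" using z by (auto simp: gen_def)
 have toV: "v' = v" if "primN J v'" "dg v' < int k" "dot (nrm v') z = 0" for v'
  using z that par_prim[OF that(1) v] by (auto simp: gen_def primN_def)
 show "w \<in> ?B \<union> ?E"
 proof (cases "w \<in> Din J")
  case True
  then obtain i where i: "i \<in> J" "w = (unitv i, {x \<in> vecs J. x i = 0}, 1 + fps_X)" by (auto simp: Din_def)
  have u: "unitv i \<in> posN J" using unitv_prim[OF i(1)] by (simp add: primN_def)
  have wh: "w = (unitv i, hcone (unitv i) {}, 1 + fps_X)" using i Din_hcone by simp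
  obtain j :: nat where j: "0 < j" "int j * dg (unitv i) < int k" "fps_nth (1 + fps_X :: 'k fps) j ~= 0"
   using w(2) unfolding i(2) ntriv_def prod.case by blast
  have "j = 1" using j(1,3) by (cases "j = 1") auto
  moreover have "dg (unitv i) = 1" using i(1) finJ by (simp add: degN_def unitv_def)
  ultimately have "1 < k" "dg (unitv i) < int k" using j by auto
  moreover have "unitv i = v"
   by (rule toV[OF unitv_prim[OF i(1)]]) (use calculation w(3) wh in "auto simp: hcone_def")
  ultimately show ?thesis using wh i(1) by auto
 next
  case False
  then obtain v' j z' where x: "w = wl v' j z'" "primN J v'" "0 < j" "gen (lev (nsc j v')) v' z'" "(wb v' j z' :: 'k) ~= 0"
   using w(1) unfolding SD_def WD_def by blast
  let ?n = "nsc j v'"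
  have vp': "v' \<in> posN J" using x(2) by (simp add: primN_def)
  have n: "?n \<in> posN J" using vp' x(3) by simp
  have dn: "dg ?n < int k" using wl_ntriv[OF x(2,3,5)] w(2) x(1) by simp
  have zh: "z \<in> hcone v' (Pz ?n z')" using w(3) unfolding x(1) wl_def by simp
  have "1 * dg v' <= int j * dg v'" using x(3) deg_pos[OF vp'] by (intro mult_right_mono) auto
  hence "dg v' < int k" using dn by (simp add: degN_nsc)
  hence vv: "v' = v" using toV x(2) zh by (simp add: hcone_def)
  have ss: "same_signs (lev ?n) z' z"
   unfolding same_signs_def
  proof (intro ballI impI)
   fix e assume e: "e \<in> posN J" "dg e < int (lev ?n)"
   have ek: "dg e < int k" using e dn lev_int[OF n] by simp
   have z0: "dot (nrm e) z = 0 ==> dot (nrm e) z' = 0"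
    using z x(4) e ek par_dot[of "nrm e" "nrm v" z'] unfolding gen_def vv by blast
   have z0': "dot (nrm e) z' = 0 ==> dot (nrm e) z = 0"
    using z x(4) e par_dot[of "nrm e" "nrm v" z] unfolding gen_def vv by blast
   show "(dot (nrm e) z' < 0 \<longleftrightarrow> dot (nrm e) z < 0) & (0 < dot (nrm e) z' \<longleftrightarrow> 0 < dot (nrm e) z)"
    using zh e z0 z0' lev_int[OF n] unfolding hcone_Pz by (smt (verit))
  qed
  have "cf z' ?n = (cf z ?n :: 'k)" by (rule cf_cong[OF ss])
  hence "wb v' j z' = (wb v j z :: 'k)" "wl v' j z' = (wl v j z :: ('i,'k) wall)"
   using Pz_cong[OF ss n] vv by (simp_all add: wb_def wl_def)
  moreover have "j \<in> {1..K}" using K[rule_format, OF x(3)] dn x(3) vv by (simp add: degN_nsc)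
  ultimately show ?thesis using x by auto
 qed
next
 fix w assume "w \<in> ?B \<union> ?E"
 thus "w \<in> ?A"
 proof
  assume "w \<in> ?B"
  then obtain j where j: "w = wl v j z" "j \<in> {1..K}" "(wb v j z :: 'k) ~= 0" by auto
  have j0: "0 < j" using j by simp
  have dn: "dg (nsc j v) < int k" using K[rule_format, OF j0] j(2) by (simp add: degN_nsc)
  have n: "nsc j v \<in> posN J" using v j0 by (auto simp: primN_def)
  have g: "gen (lev (nsc j v)) v z" by (rule gen_mono[OF z]) (use dn lev_int[OF n] in linarith)
  have "w \<in> SD" unfolding SD_def WD_def using j(1,3) v j0 g by blast
  moreover have "ntriv J k w" unfolding j(1) using wl_ntriv[OF v j0 j(3)] dn by blast
  moreover have "z \<in> cn w" unfolding j(1) wl_def using gen_hcone[OF g] by simp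
  ultimately show ?thesis by (simp add: Dk_def)
 next
  assume "w \<in> ?E"
  hence w: "w = (v, hcone v {}, 1 + fps_X)" "v \<in> unitv ` J" "1 < k" by (auto split: if_splits)
  then obtain i where i: "i \<in> J" "v = unitv i" by auto
  have "w \<in> Din J" unfolding Din_def using w(1) i Din_hcone[OF i(1)] by auto
  moreover have "dg v = 1" using i finJ by (simp add: degN_def unitv_def)
  hence "ntriv J k w" unfolding ntriv_def w(1) using w(3) by (auto intro!: exI[of _ 1])
  moreover have "z \<in> cn w" using z unfolding w(1) by (simp add: hcone_def gen_def)
  ultimately show ?thesis by (simp add: Dk_def SD_def)
 qed
qed

text \<open>The exponents \<open>tgt\<close> of the incoming wall and cf - tgt of the other walls
  add up to \<open>cf\<close>. Equality holds up to degree \<open>K\<close> because the finite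
  product of exponentials agrees with 1 + X only so far.\<close>

lemma wall_product:
 fixes z :: "'i vec"
 assumes v: "primN J v" and z: "gen k v z" and K: "\<forall>j>0. j <= K \<longleftrightarrow> int j * dg v < int k"
  and s: "s <= K"
 shows "fps_nth (\<Prod>w\<in>{w\<in>Dk J (SD :: ('i,'k::field_char_0) wall set) k. z \<in> cn w}. fn w) s =
  fps_nth (\<Prod>j\<in>{1..K}. fexp j (cf z (nsc j v) * of_nat j / of_nat (nscale J d v)) :: 'k fps) s"
proof -
 define E where "E = (if v \<in> unitv ` J & 1 < k then {(v, hcone v {}, 1 + fps_X)} else ({} :: ('i,'k) wall set))"
 let ?I = "{j\<in>{1..K}. (wb v j z :: 'k) ~= 0}"
 have ns: "of_nat (nscale J d v) ~= (0::'k)" using nscale_props(1)[of v] by simp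
 have inj: "inj_on (%j. wl v j z :: ('i,'k) wall) ?I"
  by (rule inj_onI) (auto simp: wl_def dest: fexp_inj[rotated -1])
 have dj: "((%j. wl v j z :: ('i,'k) wall) ` ?I) \<inter> E = {}"
 proof (rule ccontr)
  assume "\<not> ?thesis"
  then obtain j where "j \<in> ?I" "(wl v j z :: ('i,'k) wall) \<in> E" by blast
  hence "0 < j" "(wb v j z :: 'k) ~= 0" "fexp j (wb v j z :: 'k) = 1 + fps_X"
   by (auto simp: E_def wl_def split: if_splits)
  thus False using fexp_not_Din by blast
 qed
 have finE: "finite E" by (simp add: E_def)
 have "(\<Prod>w\<in>{w\<in>Dk J (SD :: ('i,'k) wall set) k. z \<in> cn w}. fn w) =
   (\<Prod>w\<in>(%j. wl v j z :: ('i,'k) wall) ` ?I. fn w) * (\<Prod>w\<in>E. fn w)"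
  unfolding wall_set_at[OF v z K] E_def[symmetric] using dj finE by (subst prod.union_disjoint) auto
 also have "(\<Prod>w\<in>(%j. wl v j z :: ('i,'k) wall) ` ?I. fn w) = (\<Prod>j\<in>?I. fexp j (wb v j z))"
  unfolding prod.reindex[OF inj] by (simp add: wl_def)
 also have "\<dots> = (\<Prod>j\<in>{1..K}. fexp j (wb v j z))"
  by (rule prod.mono_neutral_left) auto
 finally have 1: "(\<Prod>w\<in>{w\<in>Dk J (SD :: ('i,'k) wall set) k. z \<in> cn w}. fn w) =
   (\<Prod>j\<in>{1..K}. fexp j (wb v j z)) * (\<Prod>w\<in>E. fn w)" .
 let ?t = "%j. tgt (nsc j v) * of_nat j / of_nat (nscale J d v) :: 'k"
 have tp: "fps_nth (\<Prod>w\<in>E. fn w) i = fps_nth (\<Prod>j\<in>{1..K}. fexp j (?t j)) i" if i: "i <= K" for i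
 proof (cases "v \<in> unitv ` J")
  case True
  have "(\<Prod>j\<in>{1..K}. fexp j (?t j)) = (\<Prod>j\<in>{1..K}. fexp j (beta j))"
   by (intro prod.cong refl) (use True ns in "simp add: tgt_prim[OF v]")
  moreover have "fps_nth (\<Prod>w\<in>E. fn w) i = fps_nth (1 + fps_X :: 'k fps) i"
  proof (cases "1 < k")
   case False
   have "dg v = 1" using True finJ by (auto simp: degN_def unitv_def)
   hence "\<not> 1 <= K" using K[rule_format, of 1] False by simp
   thus ?thesis using i False by (simp add: E_def)
  qed (use True in "simp add: E_def")
  ultimately show ?thesis using beta[OF i] by simp
 next
  case False
  have "(\<Prod>j\<in>{1..K}. fexp j (?t j)) = (\<Prod>j\<in>{1..K}. 1)"
   by (intro prod.cong refl) (use False in "simp add: tgt_prim[OF v]")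
  thus ?thesis using False by (simp add: E_def)
 qed
 have "fps_nth ((\<Prod>j\<in>{1..K}. fexp j (wb v j z)) * (\<Prod>w\<in>E. fn w)) s =
   fps_nth ((\<Prod>j\<in>{1..K}. fexp j (wb v j z)) * (\<Prod>j\<in>{1..K}. fexp j (?t j))) s"
  by (rule fps_mult_cong_le) (use tp s in auto)
 also have "(\<Prod>j\<in>{1..K}. fexp j (wb v j z)) * (\<Prod>j\<in>{1..K}. fexp j (?t j)) =
   (\<Prod>j\<in>{1..K}. fexp j (cf z (nsc j v) * of_nat j / of_nat (nscale J d v)))"
  unfolding prod.distrib[symmetric]
  by (intro prod.cong refl) (simp add: wb_def fexp_add[symmetric] diff_divide_distrib left_diff_distrib)
 finally show ?thesis using 1 by simp
qed

definition wprod :: "('i,'k::field) wall set => 'i vec => 'k fps" where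
 "wprod W z = (\<Prod>w\<in>{w\<in>W. z \<in> cn w}. fn w)"

lemma wprod_0: "ALL w:W. is_wall J d w ==> fps_nth (wprod W z) 0 = 1"
 unfolding wprod_def by (rule fps_prod_nth_0) (auto dest: is_wall_props(3))

lemma okW_SD: "okW (Dk J SD k)"
 unfolding okW_def using SD_finite SD_wall by (auto simp: Dk_def)

text \<open>By \<open>ray_word\<close> the central part at \<open>z\<close> is a single ray operator
  with exponents \<open>cf\<close>, and by \<open>wall_product\<close> these are the exponents of
  all walls through \<open>z\<close> together.\<close>

lemma ray_cross:
 fixes u w x :: "('i,'k::field_char_0) word"
 assumes v: "primN J v" and z: "gen k v z" and f: "isfac k z (gg k) u w x"
 shows "req (int k) (rw w) [crF v (wprod (Dk J SD k) z) 1]"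
 unfolding req_def
proof (intro ballI allI impI)
 fix m n assume n: "dg n < int k"
 have vp: "v \<in> posN J" using v by (simp add: primN_def)
 obtain K :: nat where K: "\<forall>j>0. j <= K \<longleftrightarrow> int j * dg v < int k" using ray_bound[OF vp] by blast
 have w: "over (%e. dot (nrm e) z = 0 & dg e < int k) w" using f by (simp add: isfac_def)
 have wv: "over (%e. \<exists>j>0. e = nsc j v) w" by (rule ray_over[OF v z w])
 have wK: "ALL l:set w. EX j:{1..K}. fst l = nsc j v"
 proof
  fix l assume l: "l \<in> set w"
  obtain j where j: "0 < j" "fst l = nsc j v" using wv l by (auto simp: over_def)
  have "dg (fst l) < int k" using w l by (auto simp: over_def)
  hence "j <= K" using K[rule_format, OF j(1)] j(2) by (simp add: degN_nsc)
  thus "EX j:{1..K}. fst l = nsc j v" using j by (intro bexI[of _ j]) auto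
 qed
 let ?F = "\<Prod>j\<in>{1..K}. fexp j (cf z (nsc j v) * of_nat j / of_nat (nscale J d v)) :: 'k fps"
 have "rc (rw w) m n = rop (v, %mu. \<Prod>j\<in>{1..K}. fexp j (csum w (nsc j v) * of_nat j * pr v mu)) m (delta 0) n"
  unfolding rc_def by (subst ray_word[OF _ vp wK]) simp_all
 also have "(%mu. \<Prod>j\<in>{1..K}. fexp j (csum w (nsc j v) * of_nat j * pr v mu)) = (%mu. fpow ?F (pairNo J d v mu))"
 proof
  fix mu
  have "(\<Prod>j\<in>{1..K}. fexp j (csum w (nsc j v) * of_nat j * pr v mu)) = (\<Prod>j\<in>{1..K}. fexp j (cf z (nsc j v) * of_nat j * pr v mu))"
  proof (intro prod.cong refl)
   fix j assume j: "j \<in> {1..K}"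
   hence j0: "0 < j" by simp
   have "dg (nsc j v) < int k" using K[rule_format, OF j0] j by (simp add: degN_nsc)
   from cf_val[OF v z j0 this f] show "fexp j (csum w (nsc j v) * of_nat j * pr v mu) = fexp j (cf z (nsc j v) * of_nat j * pr v mu)" by simp
  qed
  thus "(\<Prod>j\<in>{1..K}. fexp j (csum w (nsc j v) * of_nat j * pr v mu)) = fpow ?F (pairNo J d v mu)"
   by (simp only: crF_fexp)
 qed
 also have "rop (v, %mu. fpow ?F (pairNo J d v mu)) m (delta 0) n = rop (crF v (wprod (Dk J SD k) z) 1) m (delta 0) n"
  unfolding rop_def crF_def fst_conv snd_conv ray_def
 proof (intro sum.cong refl)
  fix s assume "s \<in> {..nat (dg n)}"
  show "delta 0 (n - nsc s v) * fps_nth (fpow ?F (pairNo J d v (m + B n))) s =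
   delta 0 (n - nsc s v) * fps_nth (fpow (wprod (Dk J SD k) z) (1 * pairNo J d v (m + B n))) s"
  proof (cases "n = nsc s v")
   case True
   have sK: "s <= K"
   proof (cases "s = 0")
    case False
    thus ?thesis using K[rule_format, of s] n True by (simp add: degN_nsc)
   qed simp
   have "fps_nth (fpow ?F e) s = fps_nth (fpow (wprod (Dk J SD k) z) e) s" for e
   proof (rule fpow_cong_le)
    show "fps_nth ?F 0 = 1" by (rule fps_prod_nth_0) auto
    show "fps_nth (wprod (Dk J SD k) z) 0 = 1" by (rule wprod_0) (use okW_SD in "auto simp: okW_def")
    fix i assume "i <= s"
    hence "i <= K" using sK by simp
    thus "fps_nth ?F i = fps_nth (wprod (Dk J SD k) z) i"
     unfolding wprod_def by (intro wall_product[OF v z K, symmetric])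
   qed
   thus ?thesis by simp
  qed (simp add: delta_def)
 qed
 finally show "rc (rw w) m n = rc [crF v (wprod (Dk J SD k) z) 1] m n" by (simp add: rc_def ract_def)
qed

subsection \<open>Chamber elements\<close>

definition arr :: "nat => 'i vec => bool" where
 "arr k Q \<longleftrightarrow> Q \<in> vecs J & (ALL e:posN J. dg e < int k --> dot (nrm e) Q ~= 0)"

text \<open>The element attached to the chamber of \<open>Q\<close>: the negative part of the
  factorization of \<open>gg\<close> there. Path-ordered products from Q to Q' will be shown to
  equal pw(Q)^-1 pw(Q').\<close>

definition pw :: "nat => 'i vec => ('i,'k::field_char_0) word" where
 "pw k Q = (SOME u. EX v. isfac k Q (gg k) u [] v)"

lemma pw_fac: "arr k Q ==> EX v. isfac k Q (gg k) (pw k Q :: ('i,'k::field_char_0) word) [] v"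
proof -
 assume Q: "arr k Q"
 obtain u w v :: "('i,'k) word" where f: "isfac k Q (gg k) u w v" using isfac_ex[OF gg_ok] by blast
 have "w = []"
 proof (rule ccontr)
  assume "w ~= []"
  hence "hd w \<in> set w" by simp
  thus False using f Q unfolding isfac_def over_def arr_def by blast
 qed
 hence "\<exists>u v :: ('i,'k) word. isfac k Q (gg k) u [] v" using f by blast
 thus ?thesis unfolding pw_def by (rule someI_ex)
qed

lemma pw_ok [simp]: "arr k Q ==> okw (pw k Q)"
 using pw_fac unfolding isfac_def by (blast dest: over_ok)

lemma pw_eq: "arr k Q ==> isfac k Q (gg k) u [] v ==> req (int k) (rw (pw k Q)) (rw u)"
 using pw_fac isfac_unique(1)[of k Q "gg k" "pw k Q" "[]" _ k "gg k" u "[]" v "int k"] by auto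

lemma pw_cong: "arr k Q ==> arr k Q' ==> same_signs k Q Q' ==>
  req (int k) (rw (pw k Q)) (rw (pw k Q' :: ('i,'k::field_char_0) word))"
proof -
 assume Q: "arr k Q" "arr k Q'" and s: "same_signs k Q Q'"
 obtain v :: "('i,'k) word" where "isfac k Q' (gg k) (pw k Q') [] v" using pw_fac[OF Q(2)] by blast
 thus ?thesis by (intro pw_eq[OF Q(1)] isfac_cong[OF same_signs_sym[OF s]])
qed

text \<open>At \<open>z\<close> the factorization is u w x, and the letters of w are positive
  multiples of \<open>v\<close>. On the side where \<open>v\<close> is positive they join x, on the
  other side they join u; so the two negative parts differ by w, the wall crossing at
  \<open>z\<close>.\<close>

lemma pw_cross:
 assumes v: "primN J v" and z: "gen k v z" and Q: "arr k Q" "arr k Q'"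
  and near: "\<And>e. e \<in> posN J ==> dg e < int k ==> \<not> par (nrm e) (nrm v) ==>
    0 < dot (nrm e) z * dot (nrm e) Q & 0 < dot (nrm e) z * dot (nrm e) Q'"
  and side: "0 < dot (nrm v) Q" "dot (nrm v) Q' < 0"
 shows "req (int k) (rw (pw k Q' :: ('i,'k::field_char_0) word)) (rw (pw k Q) @ [crF v (wprod (Dk J SD k) z) 1])"
proof -
 obtain u w x :: "('i,'k) word" where f: "isfac k z (gg k) u w x" using isfac_ex[OF gg_ok] by blast
 have vp: "v \<in> posN J" using v by (simp add: primN_def)
 have ok: "okw u" "okw w" "okw x" using f by (auto simp: isfac_def dest: over_ok)
 have np: "\<not> par (nrm e) (nrm v)" if "dot (nrm e) z ~= 0" for e
  using par_dot[of "nrm e" "nrm v" z] z that by (auto simp: gen_def)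
 have sg: "(dot (nrm e) z < 0 --> dot (nrm e) Q < 0 & dot (nrm e) Q' < 0) & (0 < dot (nrm e) z --> 0 < dot (nrm e) Q & 0 < dot (nrm e) Q')"
  if "e \<in> posN J" "dg e < int k" for e
  using near[OF that] np[of e] by (auto simp: zero_less_mult_iff)
 have ray: "over (%e. \<exists>j>0. e = nsc j v) w" by (rule ray_over[OF v z]) (use f in "simp add: isfac_def")
 have w1: "over (%e. 0 < dot (nrm e) Q & dg e < int k) w" "over (%e. dot (nrm e) Q' < 0 & dg e < int k) w"
  using ray f side unfolding isfac_def over_def
  by (auto simp: nrm_dot_nsc mult_pos_neg)
 have 1: "isfac k Q (gg k) u [] (w @ x)"
  using f sg w1 unfolding isfac_def by (auto intro: over_mono)
 have 2: "isfac k Q' (gg k) (u @ w) [] x"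
  using f sg w1 unfolding isfac_def by (auto intro: over_mono)
 have okc: "okrs [crF v (wprod (Dk J SD k) z) (1::int) :: _ \<times> (_ => 'k fps)]"
 proof -
  have "okW (Dk J (SD :: ('i,'k) wall set) k)" by (rule okW_SD)
  thus ?thesis by (simp add: okW_def okr_crF[OF vp wprod_0])
 qed
 have "req (int k) (rw (pw k Q')) (rw u @ rw w)" using pw_eq[OF Q(2) 2] by simp
 also have "req (int k) (rw u @ rw w) (rw (pw k Q) @ [crF v (wprod (Dk J SD k) z) 1])"
  by (rule req_append[OF req_sym[OF pw_eq[OF Q(1) 1]] ray_cross[OF v z f]]) (use ok Q okc in auto)
 finally show ?thesis .
qed

definition avoid :: "('i,'k) wall set => 'i vec => bool" where
 "avoid W x \<longleftrightarrow> (ALL w:W. x \<notin> cn w)"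

lemma fin_posN: "finite {e \<in> posN J. dg e < k}"
 by (rule finite_subset[OF _ fin_deg[of k]]) (auto simp: posN_nonneg)

lemma close_pt:
 assumes "0 < e"
 obtains r where "0 < r" "\<And>s t. \<bar>s - t\<bar> < r ==> close e (pt a b t) (pt a b s)"
proof -
 define M where "M = 1 + (\<Sum>i\<in>J. \<bar>b i - a i\<bar>)"
 have M0: "0 < M" unfolding M_def by (smt (verit) sum_nonneg abs_ge_zero)
 have M: "\<bar>b i - a i\<bar> < M" if "i \<in> J" for i
 proof -
  have "\<bar>b i - a i\<bar> <= (\<Sum>i\<in>J. \<bar>b i - a i\<bar>)" using that by (intro member_le_sum) (auto simp: finJ)
  thus ?thesis by (simp add: M_def)
 qed
 show ?thesis
 proof (rule that[of "e / M"])
  show "0 < e / M" using assms M0 by simp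
  fix s t :: real assume st: "\<bar>s - t\<bar> < e / M"
  show "close e (pt a b t) (pt a b s)" unfolding close_def
  proof
   fix i assume i: "i \<in> J"
   have "pt a b s i - pt a b t i = (s - t) * (b i - a i)" by (simp add: pt_def algebra_simps)
   hence "\<bar>pt a b s i - pt a b t i\<bar> = \<bar>s - t\<bar> * \<bar>b i - a i\<bar>" by (simp add: abs_mult)
   also have "\<dots> <= \<bar>s - t\<bar> * M" using M[OF i] by (intro mult_left_mono) auto
   also have "\<dots> < e" using st M0 by (simp add: field_simps)
   finally show "\<bar>pt a b s i - pt a b t i\<bar> < e" .
  qed
 qed
qed

lemma line_zeros_finite:
 assumes "finite H" "ALL h:H. dot h a ~= 0 \<or> dot h b ~= 0"
 shows "finite {t. EX h:H. dot h (pt a b t) = 0}"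
proof -
 have "pt a b t = (%i. a i + t * (%i. b i - a i) i)" for t by (simp add: pt_def)
 moreover have "ALL h:H. dot h a ~= 0 \<or> dot h (%i. b i - a i) ~= 0" using assms(2) by (auto simp: dot_diff)
 ultimately show ?thesis using line_bad_finite[OF assms(1), of a "%i. b i - a i"] by simp
qed

lemma no_zero_sign:
 assumes "s < t" "dot h (pt a b s) ~= 0" "dot h (pt a b t) ~= 0" "\<And>r. s < r ==> r < t ==> dot h (pt a b r) ~= 0"
 shows "0 < dot h (pt a b s) * dot h (pt a b t)"
proof (rule ccontr)
 assume "\<not> ?thesis"
 hence "dot h (pt a b s) * dot h (pt a b t) < 0" using assms(2,3) by (simp add: less_le)
 hence "(dot h a + s * (dot h b - dot h a)) * (dot h a + t * (dot h b - dot h a)) < 0" by (simp add: dot_pt)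
 then obtain r where "s < r" "r < t" "dot h a + r * (dot h b - dot h a) = 0" by (rule affine_zero[OF assms(1)])
 thus False using assms(4)[of r] by (simp add: dot_pt)
qed

lemma one_zero_sign:
 assumes "s < r" "r < t" "dot h (pt a b r) = 0" "dot h (pt a b s) ~= 0"
 shows "dot h (pt a b s) * dot h (pt a b t) < 0"
proof -
 let ?p = "dot h a" and ?q = "dot h b - dot h a"
 have e: "dot h (pt a b x) = (x - r) * ?q" for x using assms(3) by (simp add: dot_pt algebra_simps)
 have q: "?q ~= 0" using assms(4) e by auto
 have "dot h (pt a b s) * dot h (pt a b t) = ((s - r) * (t - r)) * (?q * ?q)" unfolding e by (simp add: mult_ac)
 moreover have "(s - r) * (t - r) < 0" using assms(1,2) by (intro mult_neg_pos) auto
 moreover have "0 < ?q * ?q" using q by (metis not_square_less_zero linorder_neqE_linordered_idom mult_eq_0_iff)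
 ultimately show ?thesis by (simp add: mult_neg_pos)
qed

text \<open>A hyperplane of the arrangement may be crossed away from all walls. There the product of
  wall functions is empty, so \<open>pw_cross\<close> leaves the chamber element unchanged; the
  hypothesis on parallel covectors excludes joints.\<close>

lemma seg_free:
 assumes a: "arr k a" and b: "arr k b"
  and nj: "\<And>t e e'. 0 <= t ==> t <= 1 ==> e \<in> posN J ==> e' \<in> posN J ==> dg e < int k ==> dg e' < int k ==>
    dot (nrm e) (pt a b t) = 0 ==> dot (nrm e') (pt a b t) = 0 ==> par (nrm e) (nrm e')"
  and av: "\<And>t. 0 <= t ==> t <= 1 ==> avoid (Dk J (SD :: ('i,'k::field_char_0) wall set) k) (pt a b t)"
 shows "req (int k) (rw (pw k a)) (rw (pw k b :: ('i,'k) word))"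
proof -
 have ab: "a \<in> vecs J" "b \<in> vecs J" using a b by (auto simp: arr_def)
 define H where "H = nrm ` {e \<in> posN J. dg e < int k}"
 have fH: "finite H" unfolding H_def using fin_posN by simp
 define X where "X = {t. EX h:H. dot h (pt a b t) = 0}"
 have fX: "finite X" unfolding X_def by (rule line_zeros_finite[OF fH]) (use a in "auto simp: H_def arr_def")
 have arrX: "arr k (pt a b t)" if "t \<notin> X" for t
  using that vecs_pt[OF ab] by (auto simp: arr_def X_def H_def)
 have "req (int k) (rw (pw k (pt a b 0))) (rw (pw k (pt a b 1) :: ('i,'k) word))"
 proof (rule finite_crossings[OF fX])
  show "0 \<notin> X" "1 \<notin> X" using a b by (auto simp: X_def H_def arr_def)
  show "req (int k) (rw (pw k (pt a b s))) (rw (pw k (pt a b t) :: ('i,'k) word)) ==>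
    req (int k) (rw (pw k (pt a b t))) (rw (pw k (pt a b u) :: ('i,'k) word)) ==>
    req (int k) (rw (pw k (pt a b s))) (rw (pw k (pt a b u) :: ('i,'k) word))" for s t u
   by (rule req_trans)
  fix s t :: real assume st: "0 <= s" "s < t" "t <= 1" "s \<notin> X" "t \<notin> X" "card (X \<inter> {s..t}) <= 1"
  have fXs: "finite (X \<inter> {s..t})" using fX by simp
  have A: "arr k (pt a b s)" "arr k (pt a b t)" using arrX st by auto
  show "req (int k) (rw (pw k (pt a b s))) (rw (pw k (pt a b t) :: ('i,'k) word))"
  proof (cases "X \<inter> {s..t} = {}")
   case True
   have "0 < dot (nrm e) (pt a b s) * dot (nrm e) (pt a b t)" if e: "e \<in> posN J" "dg e < int k" for e
   proof (rule no_zero_sign[OF st(2)])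
    show "dot (nrm e) (pt a b s) ~= 0" "dot (nrm e) (pt a b t) ~= 0" using A e by (auto simp: arr_def)
    fix r assume "s < r" "r < t"
    hence "r \<notin> X" using True by auto
    thus "dot (nrm e) (pt a b r) ~= 0" using e by (auto simp: X_def H_def)
   qed
   hence "same_signs k (pt a b s) (pt a b t)" unfolding same_signs_def
    by (metis zero_less_mult_iff less_asym)
   thus ?thesis by (rule pw_cong[OF A])
  next
   case False
   then obtain r where r: "X \<inter> {s..t} = {r}" using st(6) fXs
    by (metis card_1_singletonE card_gt_0_iff le_antisym Suc_leI One_nat_def)
   hence r0: "r \<in> X" "s <= r" "r <= t" by auto
   have "s ~= r" "r ~= t" using r0(1) st(4,5) by auto
   hence rX: "r \<in> X" "s < r" "r < t" using r0 by auto
   define z where "z = pt a b r"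
   obtain e0 where e0: "e0 \<in> posN J" "dg e0 < int k" "dot (nrm e0) z = 0" using rX by (auto simp: X_def H_def z_def)
   obtain v j where v: "primN J v" "0 < j" "e0 = nsc j v" by (rule prim_decomp[OF e0(1)]) blast
   have vp: "v \<in> posN J" using v by (simp add: primN_def)
   have "1 * dg v <= int j * dg v" using v(2) deg_pos[OF vp] by (intro mult_right_mono) auto
   hence dv: "dg v < int k" using e0(2) v(3) by (simp add: degN_nsc)
   have zv: "dot (nrm v) z = 0" using e0(3) v by (simp add: nrm_dot_nsc)
   have g: "gen k v z" unfolding gen_def
    using nj[of r _ v] vp dv zv st rX vecs_pt[OF ab] by (auto simp: z_def)
   have near: "0 < dot (nrm e) z * dot (nrm e) (pt a b s) & 0 < dot (nrm e) z * dot (nrm e) (pt a b t)"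
    if e: "e \<in> posN J" "dg e < int k" "\<not> par (nrm e) (nrm v)" for e
   proof -
    have nz: "dot (nrm e) (pt a b x) ~= 0" if "s <= x" "x <= t" for x
    proof
     assume x: "dot (nrm e) (pt a b x) = 0"
     hence "x \<in> X \<inter> {s..t}" using e that by (auto simp: X_def H_def)
     hence "x = r" using r by simp
     thus False using g e x unfolding gen_def z_def by blast
    qed
    have "0 < dot (nrm e) (pt a b s) * dot (nrm e) (pt a b r)"
     by (rule no_zero_sign) (use nz rX in auto)
    moreover have "0 < dot (nrm e) (pt a b r) * dot (nrm e) (pt a b t)"
     by (rule no_zero_sign) (use nz rX in auto)
    ultimately show ?thesis unfolding z_def by (simp add: mult.commute)
   qed
   have opp: "dot (nrm v) (pt a b s) * dot (nrm v) (pt a b t) < 0"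
    by (rule one_zero_sign[OF rX(2,3)]) (use zv A vp dv in "auto simp: z_def arr_def")
   have W1: "wprod (Dk J (SD :: ('i,'k) wall set) k) z = 1"
    using av[of r] st rX unfolding wprod_def avoid_def z_def by (auto intro!: prod.neutral)
   have triv: "req (int k) (x @ [crF v (1 :: 'k fps) 1]) x" if "okrs x" for x
    unfolding req_def rc_def by (simp add: ract_append) (simp add: ract_def rop_crF_1)
   consider "0 < dot (nrm v) (pt a b s)" "dot (nrm v) (pt a b t) < 0" | "0 < dot (nrm v) (pt a b t)" "dot (nrm v) (pt a b s) < 0"
    using opp by (auto simp: mult_less_0_iff)
   thus ?thesis
   proof cases
    case 1
    have "req (int k) (rw (pw k (pt a b t) :: ('i,'k) word)) (rw (pw k (pt a b s)) @ [crF v (wprod (Dk J SD k) z) 1])"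
     by (rule pw_cross[OF v(1) g A near 1])
    thus ?thesis unfolding W1 using req_trans triv[of "rw (pw k (pt a b s))"] req_sym A by (meson okrs_rw pw_ok)
   next
    case 2
    have "req (int k) (rw (pw k (pt a b s) :: ('i,'k) word)) (rw (pw k (pt a b t)) @ [crF v (wprod (Dk J SD k) z) 1])"
     by (rule pw_cross[OF v(1) g A(2,1) _ 2]) (use near in blast)
    thus ?thesis unfolding W1 using req_trans triv[of "rw (pw k (pt a b t))"] A by (meson okrs_rw pw_ok)
   qed
  qed
 qed auto
 thus ?thesis by simp
qed

text \<open>Convexity supplies segments, and openness leaves room to perturb their end
  points.\<close>

definition region :: "('i,'k) wall set => 'i vec set => bool" where
 "region W K \<longleftrightarrow> K \<subseteq> vecs J & (ALL x:K. ALL y:K. ALL t:{0..1}. pt x y t \<in> K) &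
   (ALL x:K. \<exists>e>0. ALL y:vecs J. close e x y --> y \<in> K) & (ALL x:K. avoid W x)"

text \<open>The combination of the two covectors vanishes at \<open>Q\<close> and wherever both of
  them vanish. If it is nonzero at \<open>c\<close>, the line from \<open>Q\<close> to
  \<open>c\<close> can meet the joint only at t = 0, where \<open>Q\<close> is off both
  hyperplanes.\<close>

lemma joint_avoid:
 assumes Q: "arr k Q" and e: "e \<in> posN J" "e' \<in> posN J" "dg e < int k" "dg e' < int k"
  and z: "dot (nrm e) (pt Q c t) = 0" "dot (nrm e') (pt Q c t) = 0"
  and c: "dot (%i. dot (nrm e') Q * nrm e i - dot (nrm e) Q * nrm e' i) c ~= 0"
 shows False
proof -
 let ?h = "%i. dot (nrm e') Q * nrm e i - dot (nrm e) Q * nrm e' i"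
 have "dot ?h (pt Q c t) = 0" using z by (simp add: dot_diffl dot_scalel)
 moreover have "dot ?h Q = 0" by (simp add: dot_diffl dot_scalel)
 ultimately have "t = 0" using c by (simp add: dot_pt)
 thus False using z Q e by (simp add: arr_def)
qed

lemma joint_fun_nz:
 assumes Q: "arr k Q" and e: "e \<in> posN J" "e' \<in> posN J" "dg e < int k" "dg e' < int k" and np: "\<not> par (nrm e) (nrm e')"
 shows "nz (%i. dot (nrm e') Q * nrm e i - dot (nrm e) Q * nrm e' i)"
proof (rule ccontr)
 assume "\<not> ?thesis"
 hence "ALL i:J. dot (nrm e') Q * nrm e i = dot (nrm e) Q * nrm e' i" by (simp add: nz_def)
 moreover have "dot (nrm e') Q ~= 0" using Q e by (auto simp: arr_def)
 ultimately have "ALL i:J. nrm e i = (dot (nrm e) Q / dot (nrm e') Q) * nrm e' i" by (simp add: field_simps)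
 thus False using np unfolding par_def by blast
qed

text \<open>The straight segment between the two points may hit a joint. Both are therefore joined
  to a third point of the region that is generic as seen from each of them.\<close>

lemma region_const:
 assumes K: "region (Dk J (SD :: ('i,'k::field_char_0) wall set) k) K" and Q: "Q \<in> K" "arr k Q" "Q' \<in> K" "arr k Q'"
 shows "req (int k) (rw (pw k Q)) (rw (pw k Q' :: ('i,'k) word))"
proof -
 define E where "E = {e \<in> posN J. dg e < int k}"
 have fE: "finite E" unfolding E_def by (rule fin_posN)
 let ?P = "{(e,e'). e \<in> E & e' \<in> E & \<not> par (nrm e) (nrm e')}"
 have fP: "finite ?P" by (rule finite_subset[of _ "E \<times> E"]) (use fE in auto)
 let ?h = "%R (e,e') i. dot (nrm e') R * nrm e i - dot (nrm e) R * nrm e' i"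
 define H where "H = ?h Q ` ?P \<union> ?h Q' ` ?P \<union> nrm ` E"
 have fH: "finite H" unfolding H_def using fP fE by auto
 have nzH: "ALL h:H. nz h"
  unfolding H_def using joint_fun_nz[OF Q(2)] joint_fun_nz[OF Q(4)] nz_nrm by (auto simp: E_def)
 obtain e where e: "0 < e" "ALL y:vecs J. close e Q y --> y \<in> K" using K Q(1) unfolding region_def by blast
 have Qv: "Q \<in> vecs J" using Q by (simp add: arr_def)
 obtain c where c: "c \<in> vecs J" "close e Q c" "ALL h:H. dot h c ~= 0"
  by (rule generic_near[OF fH nzH Qv e(1)])
 have cK: "c \<in> K" using e c by blast
 have ca: "arr k c" unfolding arr_def using c by (auto simp: H_def E_def)
 have seg: "req (int k) (rw (pw k R)) (rw (pw k c :: ('i,'k) word))"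
  if R: "R \<in> K" "arr k R" "?h R ` ?P \<subseteq> H" for R
 proof (rule seg_free[OF R(2) ca])
  fix t e e' assume t: "0 <= t" "t <= 1" and ee: "e \<in> posN J" "e' \<in> posN J" "dg e < int k" "dg e' < int k"
   and z: "dot (nrm e) (pt R c t) = 0" "dot (nrm e') (pt R c t) = 0"
  show "par (nrm e) (nrm e')"
  proof (rule ccontr)
   assume np: "\<not> par (nrm e) (nrm e')"
   have "?h R (e,e') \<in> H" using R(3) ee np unfolding E_def by blast
   hence "dot (?h R (e,e')) c ~= 0" using c(3) by blast
   thus False using joint_avoid[OF R(2) ee z] by simp
  qed
 next
  fix t :: real assume t: "0 <= t" "t <= 1"
  thus "avoid (Dk J (SD :: ('i,'k) wall set) k) (pt R c t)" using K R(1) cK unfolding region_def by auto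
 qed
 have "req (int k) (rw (pw k Q)) (rw (pw k c :: ('i,'k) word))" by (rule seg[OF Q(1,2)]) (auto simp: H_def)
 moreover have "req (int k) (rw (pw k Q')) (rw (pw k c :: ('i,'k) word))" by (rule seg[OF Q(3,4)]) (auto simp: H_def)
 ultimately show ?thesis using req_trans req_sym by blast
qed

lemma region_ball:
 assumes "x \<in> vecs J" "0 < e" "ALL y:vecs J. close e x y --> avoid W y"
 shows "region W {y \<in> vecs J. close e x y}"
 unfolding region_def
proof (intro conjI ballI)
 fix y z t assume y: "y \<in> {y \<in> vecs J. close e x y}" and z: "z \<in> {y \<in> vecs J. close e x y}" and t: "t \<in> {0..1::real}"
 have "close e x (pt y z t)" unfolding close_def
 proof
  fix i assume i: "i \<in> J"
  have "pt y z t i - x i = (1 - t) * (y i - x i) + t * (z i - x i)" by (simp add: pt_def algebra_simps)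
  hence "\<bar>pt y z t i - x i\<bar> <= \<bar>(1 - t) * (y i - x i)\<bar> + \<bar>t * (z i - x i)\<bar>" by linarith
  also have "\<dots> = (1 - t) * \<bar>y i - x i\<bar> + t * \<bar>z i - x i\<bar>" using t by (simp add: abs_mult)
  also have "\<dots> < e"
  proof -
   have yi: "\<bar>y i - x i\<bar> < e" "\<bar>z i - x i\<bar> < e" using y z i by (auto simp: close_def)
   show ?thesis
   proof (cases "t = 0")
    case False
    hence "t * \<bar>z i - x i\<bar> < t * e" using yi t by simp
    moreover have "(1 - t) * \<bar>y i - x i\<bar> <= (1 - t) * e" using yi t by (intro mult_left_mono) auto
    ultimately show ?thesis by (simp add: algebra_simps)
   qed (use yi in simp)
  qed
  finally show "\<bar>pt y z t i - x i\<bar> < e" .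
 qed
 thus "pt y z t \<in> {y \<in> vecs J. close e x y}" using y z vecs_pt by auto
next
 fix y assume y: "y \<in> {y \<in> vecs J. close e x y}"
 define m where "m = Min (insert 1 ((%i. e - \<bar>y i - x i\<bar>) ` J))"
 have fin: "finite (insert 1 ((%i. e - \<bar>y i - x i\<bar>) ` J))" using finJ by simp
 have m0: "0 < m" unfolding m_def using y fin by (subst Min_gr_iff) (auto simp: close_def)
 have "close e x z" if "close m y z" for z unfolding close_def
 proof
  fix i assume i: "i \<in> J"
  have "m <= e - \<bar>y i - x i\<bar>" unfolding m_def using fin i by (intro Min_le) auto
  moreover have "\<bar>z i - y i\<bar> < m" using that i by (auto simp: close_def)
  ultimately show "\<bar>z i - x i\<bar> < e" by linarith
 qed
 thus "\<exists>e'>0. ALL z:vecs J. close e' y z --> z \<in> {y \<in> vecs J. close e x y}" using m0 by blast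
qed (use assms in auto)

lemma region_half:
 assumes "region W' K0" "K0 \<subseteq> vecs J" "ALL y:K0. 0 < dot h y --> avoid W y"
 shows "region W {y \<in> K0. 0 < dot h y}"
 unfolding region_def
proof (intro conjI ballI)
 fix y z t assume y: "y \<in> {y \<in> K0. 0 < dot h y}" and z: "z \<in> {y \<in> K0. 0 < dot h y}" and t: "t \<in> {0..1::real}"
 have "dot h (pt y z t) = (1 - t) * dot h y + t * dot h z" by (simp add: dot_pt algebra_simps)
 moreover have "0 < (1 - t) * dot h y + t * dot h z"
 proof (cases "t = 0")
  case False
  hence "0 < t * dot h z" "0 <= (1 - t) * dot h y" using y z t by auto
  thus ?thesis by linarith
 qed (use y in simp)
 ultimately show "pt y z t \<in> {y \<in> K0. 0 < dot h y}" using y z t assms(1) unfolding region_def by auto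
next
 fix y assume y: "y \<in> {y \<in> K0. 0 < dot h y}"
 obtain e where e: "0 < e" "ALL z:vecs J. close e y z --> z \<in> K0" using assms(1) y unfolding region_def by blast
 obtain e' where e': "0 < e'" "\<And>z g. close e' y z ==> g \<in> {h} ==> dot g y ~= 0 ==> 0 < dot g y * dot g z"
  by (rule sign_stable[of "{h}" y]) auto
 have "z \<in> {y \<in> K0. 0 < dot h y}" if z: "z \<in> vecs J" "close (min e e') y z" for z
 proof -
  have "z \<in> K0" using e z close_mono[of "min e e'" y z e] by auto
  moreover have "0 < dot h y * dot h z" by (rule e'(2)) (use y z close_mono[of "min e e'" y z e'] in auto)
  ultimately show ?thesis using y by (simp add: zero_less_mult_iff)
 qed
 thus "\<exists>e>0. ALL z:vecs J. close e y z --> z \<in> {y \<in> K0. 0 < dot h y}" using e e' by (intro exI[of _ "min e e'"]) auto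
qed (use assms in auto)

text \<open>Consistency is tested at points that avoid the walls but may lie on other hyperplanes of
  the arrangement. The chamber element is transferred to such a point from a generic point in a
  wall-free ball around it.\<close>

definition pd :: "nat => 'i vec => ('i,'k::field_char_0) word" where
 "pd k x = pw k (SOME Q. arr k Q & (\<exists>e>0. close e x Q &
   (ALL y:vecs J. close e x y --> avoid (Dk J (SD :: ('i,'k) wall set) k) y)))"

lemma arr_near:
 assumes "x \<in> vecs J" "0 < e"
 obtains Q where "arr k Q" "close e x Q"
proof -
 have "finite (nrm ` {e \<in> posN J. dg e < int k})" "ALL h:nrm ` {e \<in> posN J. dg e < int k}. nz h"
  using fin_posN nz_nrm by auto
 then obtain y where "y \<in> vecs J" "close e x y" "ALL h:nrm ` {e \<in> posN J. dg e < int k}. dot h y ~= 0"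
  by (rule generic_near[OF _ _ assms])
 thus ?thesis using that[of y] by (auto simp: arr_def)
qed

lemma avoid_ball:
 assumes W: "okW W" and x: "x \<in> vecs J" "avoid W x"
 obtains e where "0 < e" "ALL y:vecs J. close e x y --> avoid W y"
proof -
 obtain e where e: "0 < e" "\<And>y w. y \<in> vecs J ==> close e x y ==> w \<in> W ==> y \<in> cn w ==> x \<in> cn w"
  by (rule walls_closed[of W x]) (use W x in "auto simp: okW_def")
 show ?thesis
 proof (rule that[OF e(1)], intro ballI impI)
  fix y assume "y \<in> vecs J" "close e x y"
  thus "avoid W y" using e(2) x(2) unfolding avoid_def by blast
 qed
qed

lemma pd_ex:
 assumes x: "x \<in> vecs J" "avoid (Dk J (SD :: ('i,'k::field_char_0) wall set) k) x"
 obtains Q e where "(pd k x :: ('i,'k) word) = pw k Q" "arr k Q" "0 < e" "close e x Q"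
   "ALL y:vecs J. close e x y --> avoid (Dk J (SD :: ('i,'k) wall set) k) y"
proof -
 let ?W = "Dk J (SD :: ('i,'k) wall set) k"
 let ?P = "%Q. arr k Q & (\<exists>e>0. close e x Q & (ALL y:vecs J. close e x y --> avoid ?W y))"
 obtain e where e: "0 < e" "ALL y:vecs J. close e x y --> avoid ?W y" by (rule avoid_ball[OF okW_SD x])
 obtain Q where "arr k Q" "close e x Q" by (rule arr_near[OF x(1) e(1)])
 hence "?P Q" using e by blast
 hence "?P (SOME Q. ?P Q)" by (rule someI[of ?P])
 thus ?thesis using that[of "SOME Q. ?P Q"] unfolding pd_def by blast
qed

lemma pd_ok [simp]:
 "x \<in> vecs J ==> avoid (Dk J (SD :: ('i,'k::field_char_0) wall set) k) x ==> okw (pd k x :: ('i,'k) word)"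
 by (rule pd_ex) auto

lemma pd_region:
 assumes K: "region (Dk J (SD :: ('i,'k::field_char_0) wall set) k) K" and x: "x \<in> K" and Q: "Q \<in> K" "arr k Q"
 shows "req (int k) (rw (pd k x)) (rw (pw k Q :: ('i,'k) word))"
proof -
 let ?W = "Dk J (SD :: ('i,'k) wall set) k"
 have xv: "x \<in> vecs J" "avoid ?W x" using K x unfolding region_def by auto
 obtain Q0 e where q: "(pd k x :: ('i,'k) word) = pw k Q0" "arr k Q0" "0 < e" "close e x Q0"
   "ALL y:vecs J. close e x y --> avoid ?W y" by (rule pd_ex[OF xv])
 obtain e' where e': "0 < e'" "ALL y:vecs J. close e' x y --> y \<in> K" using K x unfolding region_def by blast
 obtain Q1 where Q1: "arr k Q1" "close (min e e') x Q1" by (rule arr_near[OF xv(1), of "min e e'"]) (use q e' in auto)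
 have v: "Q0 \<in> vecs J" "Q1 \<in> vecs J" using q Q1 by (auto simp: arr_def)
 have "req (int k) (rw (pw k Q0)) (rw (pw k Q1 :: ('i,'k) word))"
  by (rule region_const[OF region_ball[OF xv(1) q(3,5)]]) (use q Q1 v close_mono[of "min e e'" x Q1 e] in auto)
 moreover have "req (int k) (rw (pw k Q1)) (rw (pw k Q :: ('i,'k) word))"
  by (rule region_const[OF K]) (use e' Q1 v Q close_mono[of "min e e'" x Q1 e'] in auto)
 ultimately show ?thesis using req_trans q(1) by simp
qed

lemma pd_const:
 assumes K: "region (Dk J (SD :: ('i,'k::field_char_0) wall set) k) K" and x: "x \<in> K" "y \<in> K"
 shows "req (int k) (rw (pd k x)) (rw (pd k y :: ('i,'k) word))"
proof -
 obtain e' where e': "0 < e'" "ALL y:vecs J. close e' x y --> y \<in> K" using K x unfolding region_def by blast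
 have xv: "x \<in> vecs J" using K x unfolding region_def by auto
 obtain Q1 where Q1: "arr k Q1" "close e' x Q1" by (rule arr_near[OF xv e'(1)])
 have "Q1 \<in> K" using e' Q1 by (auto simp: arr_def)
 thus ?thesis using pd_region[OF K x(1) _ Q1(1)] pd_region[OF K x(2) _ Q1(1)] req_sym req_trans by blast
qed

text \<open>The congruence class of the element, encoded as a set so that it can be compared by
  equality, is locally constant on the connected unit interval.\<close>

lemma pd_segment:
 assumes a: "a \<in> vecs J" "b \<in> vecs J"
  and av: "\<And>t. 0 <= t ==> t <= 1 ==> avoid (Dk J (SD :: ('i,'k::field_char_0) wall set) k) (pt a b t)"
 shows "req (int k) (rw (pd k a)) (rw (pd k b :: ('i,'k) word))"
proof -
 let ?W = "Dk J (SD :: ('i,'k) wall set) k"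
 define f where "f t = {r. req (int k) (rw (pd k (pt a b t) :: ('i,'k) word)) r}" for t
 have "f 0 = f 1"
 proof (rule connected_local_const[where A="{0..1}"])
  show "connected {0..1::real}" by (rule connected_Icc)
  show "ALL t:{0..1}. eventually (%s. f t = f s) (at t within {0..1})"
  proof
   fix t :: real assume t: "t \<in> {0..1}"
   have xv: "pt a b t \<in> vecs J" by (rule vecs_pt[OF a])
   obtain e where e: "0 < e" "ALL y:vecs J. close e (pt a b t) y --> avoid ?W y"
    by (rule avoid_ball[OF okW_SD xv av]) (use t in auto)
   obtain r where r: "0 < r" "\<And>s t. \<bar>s - t\<bar> < r ==> close e (pt a b t) (pt a b s)" by (rule close_pt[OF e(1), of a b]) blast
   have "f t = f s" if s: "dist s t < r" for s
   proof -
    have "req (int k) (rw (pd k (pt a b t))) (rw (pd k (pt a b s) :: ('i,'k) word))"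
     by (rule pd_const[OF region_ball[OF xv e]])
       (use r s xv vecs_pt[OF a] e in "auto simp: dist_real_def close_def")
    thus ?thesis unfolding f_def using req_trans req_sym by blast
   qed
   thus "eventually (%s. f t = f s) (at t within {0..1})"
    unfolding eventually_at using r(1) by blast
  qed
 qed auto
 thus ?thesis unfolding f_def using req_sym by fastforce
qed

lemma rop_crF_inv:
 assumes "sup0 J h" "v \<in> posN J" "fps_nth F 0 = 1"
 shows "rop (crF v F (- s)) m (rop (crF v F s) m h) = h"
proof -
 have "rop (crF v F (- s)) m (rop (crF v F s) m h) =
  rop (v, %mu. fpow F (- s * pairNo J d v mu) * fpow F (s * pairNo J d v mu)) m h"
  unfolding crF_def
  by (rule rop_comp[OF assms(1) okr_crF[OF assms(2,3), unfolded crF_def] okr_crF[OF assms(2,3), unfolded crF_def]])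
 also have "\<dots> = h" by (simp add: fpow_add[OF assms(3), symmetric] rop_def ray_1)
 finally show ?thesis .
qed

lemma okW_wall: "okW W ==> w \<in> W ==> is_wall J d w" by (simp add: okW_def)

lemma ntriv_deg:
 assumes "is_wall J d w" "ntriv J k w" shows "dg (fst w) < int k"
proof -
 have p: "0 < dg (fst w)" using assms(1) is_wall_props(2) deg_pos by blast
 obtain j :: nat where "0 < j" "int j * dg (fst w) < int k" using assms(2) by (auto simp: ntriv_def split: prod.splits)
 moreover have "1 * dg (fst w) <= int j * dg (fst w)" using \<open>0 < j\<close> p by (intro mult_right_mono) auto
 ultimately show ?thesis by simp
qed

lemma crs_single:
 fixes W :: "('i,'k::field) wall set"
 assumes W: "okW W" and v: "v \<in> posN J" and ws: "distinct ws" "set ws = {w\<in>W. x \<in> cn w}" "ALL w:set ws. fst w = v"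
  and h: "sup0 J h"
 shows "ract (crs a b ws) m h = rop (crF v (wprod W x) (sgnc a b v)) m h"
proof -
 have "crs a b ws = map (%w. crF (fst w) (fn w) (sgnc a b v)) ws"
  unfolding crs_def using ws(3) by simp
 thus ?thesis
  using ract_crF_list[OF h v _ ws(1), of "sgnc a b v" m] ws W is_wall_props(3) okW_wall[OF W]
  unfolding wprod_def by (metis (mono_tags, lifting) mem_Collect_eq)
qed

text \<open>At a good point the walls through it share one normal v and fill a neighbourhood in its
  hyperplane. The point itself may be special for the arrangement, so the crossing is made at a
  nearby generic \<open>z\<close> of the hyperplane, between points \<open>Qp\<close> and
  \<open>Qn\<close> on its two sides; the two half-balls are wall-free regions that join them to the
  segment.\<close>

lemma local_cross:
 fixes ws :: "('i,'k::field_char_0) wall list" and k :: nat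
 defines "W \<equiv> Dk J (SD :: ('i,'k) wall set) k"
 assumes ab: "a \<in> vecs J" "b \<in> vecs J" and gx: "good_pt J d W (pt a b r)"
  and st: "0 <= s" "s < r" "r < t" "t <= 1"
  and ws: "distinct ws" "ws ~= []" "set ws = {w\<in>W. pt a b r \<in> cn w}"
  and tr: "ALL w:set ws. pairR J d (%i. b i - a i) (fst w) ~= 0"
  and av: "\<And>y. s <= y ==> y <= t ==> y ~= r ==> avoid W (pt a b y)"
 shows "req (int k) (rw (pd k (pt a b s)) @ crs a b ws) (rw (pd k (pt a b t)))"
proof -
 let ?x = "pt a b r"
 have okW: "okW W" unfolding W_def by (rule okW_SD)
 have xv: "?x \<in> vecs J" by (rule vecs_pt[OF ab])
 obtain w1 where w1: "w1 \<in> set ws" using ws(2) by (cases ws) auto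
 define v where "v = fst w1"
 have w1W: "w1 \<in> W" "?x \<in> cn w1" using w1 ws(3) by auto
 have wall1: "is_wall J d w1" using okW_wall[OF okW w1W(1)] .
 have v: "primN J v" "v \<in> posN J" using is_wall_props[OF wall1] by (auto simp: v_def)
 have same: "fst w = v" "relint_w J d w ?x" if "w \<in> W" "?x \<in> cn w" for w
  using gx that w1W unfolding good_pt_def v_def by metis+
 have dv: "dg v < int k" using ntriv_deg[OF wall1] w1W(1) by (simp add: W_def Dk_def v_def)
 obtain e1 where e1: "0 < e1" "\<And>y w. y \<in> vecs J ==> close e1 ?x y ==> w \<in> W ==> y \<in> cn w ==> ?x \<in> cn w"
  by (rule walls_closed[of W ?x]) (use okW xv in "auto simp: okW_def")
 have "\<exists>e2>0. ALL w:W. ?x \<in> cn w --> (ALL y:vecs J. dot (nrm v) y = 0 & close e2 ?x y --> y \<in> cn w)"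
 proof -
  let ?A = "{w\<in>W. ?x \<in> cn w}"
  have fA: "finite ?A" using okW by (simp add: okW_def)
  have "ALL w:?A. \<exists>e>0. ALL y:vecs J. dot (nrm v) y = 0 & close e ?x y --> y \<in> cn w"
   using same unfolding relint_iff by fastforce
  hence "EX f. ALL w:?A. 0 < f w & (ALL y:vecs J. dot (nrm v) y = 0 & close (f w) ?x y --> y \<in> cn w)"
   by (intro bchoice) blast
  then obtain f where f: "ALL w:?A. 0 < f w & (ALL y:vecs J. dot (nrm v) y = 0 & close (f w) ?x y --> y \<in> cn w)" by blast
  let ?e = "Min (insert 1 (f ` ?A))"
  have fin: "finite (insert 1 (f ` ?A))" using fA by blast
  have "0 < ?e" using f fin by (subst Min_gr_iff) auto
  moreover have "y \<in> cn w" if "w \<in> W" "?x \<in> cn w" "y \<in> vecs J" "dot (nrm v) y = 0" "close ?e ?x y" for w y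
  proof -
   have "close (f w) ?x y" using that(5) by (rule close_mono) (use fin that in "auto intro!: Min_le")
   thus ?thesis using f that by blast
  qed
  ultimately show ?thesis by blast
 qed
 then obtain e2 where e2: "0 < e2" "\<And>w y. w \<in> W ==> ?x \<in> cn w ==> y \<in> vecs J ==> dot (nrm v) y = 0 ==> close e2 ?x y ==> y \<in> cn w" by blast
 define e where "e = min e1 e2"
 have e0: "0 < e" using e1 e2 by (simp add: e_def)
 have c1: "close e1 ?x y" and c2: "close e2 ?x y" if "close e ?x y" for y using that close_mono by (auto simp: e_def)
 define K0 where "K0 = {y \<in> vecs J. close e ?x y}"
 have K0: "region ({} :: ('i,'k) wall set) K0" unfolding K0_def by (rule region_ball[OF xv e0]) (simp add: avoid_def)
 have K0av: "avoid W y" if y: "y \<in> K0" "dot (nrm v) y ~= 0" for y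
  unfolding avoid_def
 proof (intro ballI notI)
  fix w assume w: "w \<in> W" "y \<in> cn w"
  have "y \<in> vecs J" "close e1 ?x y" using y c1 by (auto simp: K0_def)
  hence "?x \<in> cn w" using e1(2) w by blast
  hence "fst w = v" using same w by blast
  thus False using wall_perp[OF okW_wall[OF okW w(1)] w(2)] y by simp
 qed
 have regP: "region W {y \<in> K0. 0 < dot (nrm v) y}"
  by (rule region_half[OF K0]) (use K0av in "auto simp: K0_def")
 have regN: "region W {y \<in> K0. 0 < dot (%i. - nrm v i) y}"
  by (rule region_half[OF K0]) (use K0av in "auto simp: K0_def dot_uminusl")
 have xperp: "dot (nrm v) ?x = 0" using wall_perp[OF wall1 w1W(2)] by (simp add: v_def)
 define H where "H = nrm ` {e \<in> posN J. dg e < int k & \<not> par (nrm e) (nrm v)}"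
 have fH: "finite H" unfolding H_def using fin_posN[of "int k"] by (auto elim: rev_finite_subset)
 obtain z where z: "z \<in> vecs J" "close e ?x z" "dot (nrm v) z = 0" "ALL h:H. dot h z ~= 0"
  by (rule generic_near_in[OF fH nz_nrm[OF v(2)] _ xv xperp e0]) (auto simp: H_def)
 have gz: "gen k v z" unfolding gen_def using z by (auto simp: H_def)
 \<comment> \<open>One inclusion uses that walls are closed, the other that the crossing point is in
   the relative interior of each wall through it.\<close>
 have zset: "{w\<in>W. z \<in> cn w} = {w\<in>W. ?x \<in> cn w}"
  using e1(2)[OF z(1) c1[OF z(2)]] e2(2)[OF _ _ z(1,3) c2[OF z(2)]] by blast
 hence wpz: "wprod W z = wprod W ?x" by (simp add: wprod_def)
 have "finite (nrm ` {e \<in> posN J. dg e < int k})" "ALL h:nrm ` {e \<in> posN J. dg e < int k}. nz h"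
  using fin_posN nz_nrm by auto
 then obtain q where q: "q \<in> vecs J" "ALL h:nrm ` {e \<in> posN J. dg e < int k}. dot h q ~= 0"
  using generic_direction by blast
 have qv: "dot (nrm v) q ~= 0" using q v dv by auto
 obtain q' where q': "q' \<in> vecs J" "0 < dot (nrm v) q'" "\<And>e. e \<in> posN J ==> dg e < int k ==> dot (nrm e) q' ~= 0"
 proof (cases "0 < dot (nrm v) q")
  case True thus ?thesis using that[of q] q by auto
 next
  case False
  have "dot h (%i. -1 * q i) = - dot h q" for h using dot_scale[of h "-1" q] by simp
  thus ?thesis using that[of "%i. -1 * q i"] q qv False vecs_scale[OF q(1), of "-1"] by (auto simp del: mult_minus1)
 qed
 obtain e3 where e3: "0 < e3" "\<And>y h. close e3 z y ==> h \<in> H ==> dot h z ~= 0 ==> 0 < dot h z * dot h y"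
  by (rule sign_stable[OF fH, of z]) blast
 obtain e4 where e4: "0 < e4" "ALL y:vecs J. close e4 z y --> y \<in> K0"
  using K0 z unfolding region_def K0_def by blast
 define e5 where "e5 = min e3 e4"
 have e50: "0 < e5" using e3 e4 by (simp add: e5_def)
 obtain t1 where t1: "0 < t1" "\<And>t. 0 < t ==> t < t1 ==> close e5 z (%i. z i + t * q' i)"
  by (rule close_line[OF e50, of z q']) blast
 define eta where "eta = t1 / 2"
 have eta: "0 < eta" "eta < t1" using t1 by (auto simp: eta_def)
 define Qp where "Qp = (%i. z i + eta * q' i)"
 define Qn where "Qn = (%i. z i - eta * q' i)"
 have Qv: "Qp \<in> vecs J" "Qn \<in> vecs J" unfolding Qp_def Qn_def using z q' by (auto intro!: vecs_intros)
 have cp: "close e5 z Qp" unfolding Qp_def by (rule t1(2)[OF eta])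
 have cn: "close e5 z Qn" using cp unfolding close_def Qp_def Qn_def by auto
 have dQ: "dot h Qp = dot h z + eta * dot h q'" "dot h Qn = dot h z - eta * dot h q'" for h
  unfolding Qp_def Qn_def by (simp_all add: dot_add dot_diff dot_scale)
 have nearz: "0 < dot (nrm e) z * dot (nrm e) Qp & 0 < dot (nrm e) z * dot (nrm e) Qn"
  if "e \<in> posN J" "dg e < int k" "\<not> par (nrm e) (nrm v)" for e
  using that e3(2)[of Qp "nrm e"] e3(2)[of Qn "nrm e"] z cp cn close_mono unfolding e5_def H_def
  by (auto simp: min_def split: if_splits)
 have arrQ: "arr k Qp" "arr k Qn"
 proof -
  have "dot (nrm e) Qp ~= 0 & dot (nrm e) Qn ~= 0" if e: "e \<in> posN J" "dg e < int k" for e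
  proof (cases "par (nrm e) (nrm v)")
   case True
   hence "dot (nrm e) z = 0" using par_dot z by blast
   thus ?thesis unfolding dQ using q'(3)[OF e] eta by simp
  next
   case False
   thus ?thesis using nearz[OF e False] by auto
  qed
  thus "arr k Qp" "arr k Qn" using Qv by (auto simp: arr_def)
 qed
 have side: "0 < dot (nrm v) Qp" "dot (nrm v) Qn < 0" unfolding dQ using z eta q' by (simp_all)
 have cr: "req (int k) (rw (pw k Qn :: ('i,'k) word)) (rw (pw k Qp) @ [crF v (wprod W z) 1])"
  unfolding W_def by (rule pw_cross[OF v(1) gz arrQ nearz side])
 have QK: "Qp \<in> {y \<in> K0. 0 < dot (nrm v) y}" "Qn \<in> {y \<in> K0. 0 < dot (%i. - nrm v i) y}"
  using e4(2) Qv cp cn side close_mono[of e5 z _ e4] by (auto simp: e5_def dot_uminusl)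
 define dl where "dl = dot (nrm v) b - dot (nrm v) a"
 have dl: "dl ~= 0" using tr w1 by (auto simp: pairR_dot dot_diff dl_def v_def)
 have dy: "dot (nrm v) (pt a b y) = (y - r) * dl" for y
  using xperp by (simp add: dot_pt dl_def algebra_simps)
 obtain rr where rr: "0 < rr" "\<And>s' t'. \<bar>s' - t'\<bar> < rr ==> close e (pt a b t') (pt a b s')" by (rule close_pt[OF e0, of a b]) blast
 define s' where "s' = max s (r - rr / 2)"
 define t' where "t' = min t (r + rr / 2)"
 have s': "s <= s'" "s' < r" "\<bar>s' - r\<bar> < rr" using st rr by (auto simp: s'_def)
 have t': "t' <= t" "r < t'" "\<bar>t' - r\<bar> < rr" using st rr by (auto simp: t'_def)
 have K0s: "pt a b s' \<in> K0" "pt a b t' \<in> K0" using rr(2)[OF s'(3)] rr(2)[OF t'(3)] vecs_pt[OF ab] by (auto simp: K0_def)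
 have avs: "avoid W (pt a b y)" if "s <= y" "y <= t" "y ~= r" for y by (rule av[OF that])
 have P1: "req (int k) (rw (pd k (pt a b s))) (rw (pd k (pt a b s') :: ('i,'k) word))"
 proof (rule pd_segment[OF vecs_pt[OF ab] vecs_pt[OF ab]])
  fix y :: real assume y: "0 <= y" "y <= 1"
  have "0 <= y * (s' - s)" "y * (s' - s) <= s' - s" using y s' mult_right_mono[of y 1 "s' - s"] by simp_all
  thus "avoid (Dk J (SD :: ('i,'k) wall set) k) (pt (pt a b s) (pt a b s') y)"
   unfolding pt_pt W_def[symmetric] using s' st by (intro avs) auto
 qed
 have P2: "req (int k) (rw (pd k (pt a b t'))) (rw (pd k (pt a b t) :: ('i,'k) word))"
 proof (rule pd_segment[OF vecs_pt[OF ab] vecs_pt[OF ab]])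
  fix y :: real assume y: "0 <= y" "y <= 1"
  have "0 <= y * (t - t')" "y * (t - t') <= t - t'" using y t' mult_right_mono[of y 1 "t - t'"] by simp_all
  thus "avoid (Dk J (SD :: ('i,'k) wall set) k) (pt (pt a b t') (pt a b t) y)"
   unfolding pt_pt W_def[symmetric] using t' st by (intro avs) auto
 qed
 have F0: "fps_nth (wprod W ?x) 0 = 1" using wprod_0 okW by (auto simp: okW_def)
 have okc: "okr (crF v (wprod W ?x) \<sigma>)" for \<sigma> by (rule okr_crF[OF v(2) F0])
 have okcrs: "okrs (crs a b ws)" by (rule okrs_crs) (use ws(3) okW_wall[OF okW] in auto)
 have crsF: "req (int k) (crs a b ws) [crF v (wprod W ?x) (sgnc a b v)]"
  unfolding req_def rc_def
  using crs_single[OF okW v(2) ws(1,3)] ws(3) same by (auto simp: ract_def)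
 have sx: "avoid W (pt a b s)" "avoid W (pt a b t)" using avs st by auto
 have okp: "okw (pd k (pt a b s) :: ('i,'k) word)" "okw (pd k (pt a b t) :: ('i,'k) word)"
  using sx vecs_pt[OF ab] unfolding W_def by auto
 have okQ: "okw (pw k Qp :: ('i,'k) word)" "okw (pw k Qn :: ('i,'k) word)" using arrQ by auto
 have main: "req (int k) (rw (pd k (pt a b s)) @ crs a b ws) (rw (pd k (pt a b t)))"
  if 1: "req (int k) (rw (pd k (pt a b s))) (rw (pw k Q :: ('i,'k) word))" "arr k Q"
   and 2: "req (int k) (rw (pw k Q' :: ('i,'k) word)) (rw (pd k (pt a b t)))"
   and 3: "req (int k) (rw (pw k Q) @ [crF v (wprod W ?x) (sgnc a b v)]) (rw (pw k Q' :: ('i,'k) word))" for Q Q'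
 proof -
  have "req (int k) (rw (pd k (pt a b s)) @ crs a b ws) (rw (pw k Q) @ [crF v (wprod W ?x) (sgnc a b v)])"
   by (rule req_append[OF 1(1) crsF]) (use okp 1(2) okcrs okc in auto)
  thus ?thesis using req_trans 3 2 by blast
 qed
 show ?thesis
 proof (cases "dl < 0")
  case True
  have sg: "sgnc a b v = 1" using True by (simp add: sgnc_def pairR_dot dot_diff dl_def)
  have ps: "pt a b s' \<in> {y \<in> K0. 0 < dot (nrm v) y}" "pt a b t' \<in> {y \<in> K0. 0 < dot (%i. - nrm v i) y}"
   using K0s True s' t' by (auto simp: dy dot_uminusl mult_neg_neg mult_pos_neg)
  show ?thesis
  proof (rule main[OF _ arrQ(1)])
   show "req (int k) (rw (pd k (pt a b s))) (rw (pw k Qp :: ('i,'k) word))"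
    using P1 pd_region[OF regP[unfolded W_def] ps(1) QK(1) arrQ(1)] req_trans by blast
   show "req (int k) (rw (pw k Qn :: ('i,'k) word)) (rw (pd k (pt a b t)))"
    using P2 pd_region[OF regN[unfolded W_def] ps(2) QK(2) arrQ(2)] req_trans req_sym by blast
   show "req (int k) (rw (pw k Qp) @ [crF v (wprod W ?x) (sgnc a b v)]) (rw (pw k Qn :: ('i,'k) word))"
    using cr unfolding sg wpz by (rule req_sym)
  qed
 next
  case False
  hence dlp: "0 < dl" using dl by simp
  have sg: "sgnc a b v = -1" using dlp by (simp add: sgnc_def pairR_dot dot_diff dl_def)
  have ps: "pt a b t' \<in> {y \<in> K0. 0 < dot (nrm v) y}" "pt a b s' \<in> {y \<in> K0. 0 < dot (%i. - nrm v i) y}"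
   using K0s dlp s' t' by (auto simp: dy dot_uminusl mult_neg_pos)
  show ?thesis
  proof (rule main[OF _ arrQ(2)])
   show "req (int k) (rw (pd k (pt a b s))) (rw (pw k Qn :: ('i,'k) word))"
    using P1 pd_region[OF regN[unfolded W_def] ps(2) QK(2) arrQ(2)] req_trans by blast
   show "req (int k) (rw (pw k Qp :: ('i,'k) word)) (rw (pd k (pt a b t)))"
    using P2 pd_region[OF regP[unfolded W_def] ps(1) QK(1) arrQ(1)] req_trans req_sym by blast
   \<comment> \<open>For the opposite direction the crossing \<open>cr\<close> is followed by its
     inverse.\<close>
   have "req (int k) (rw (pw k Qn :: ('i,'k) word) @ [crF v (wprod W ?x) (- 1)])
     ((rw (pw k Qp) @ [crF v (wprod W z) 1]) @ [crF v (wprod W ?x) (- 1)])"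
    by (rule req_append[OF cr req_refl]) (use okQ okc in "auto simp: wpz")
   moreover have "req (int k) ((rw (pw k Qp) @ [crF v (wprod W z) 1]) @ [crF v (wprod W ?x) (- 1)]) (rw (pw k Qp :: ('i,'k) word))"
    unfolding req_def rc_def wpz
    using rop_crF_inv[OF ract_sup0[OF okrs_rw[OF okQ(1)]] v(2) F0, of "delta 0" 1]
    by (simp add: ract_append) (simp add: ract_def)
   ultimately show "req (int k) (rw (pw k Qn) @ [crF v (wprod W ?x) (sgnc a b v)]) (rw (pw k Qp :: ('i,'k) word))"
    unfolding sg by (rule req_trans)
  qed
 qed
qed

subsection \<open>Crossing times\<close>

lemma ctime_unique:
 assumes w: "is_wall J d w" and tr: "pairR J d (%i. b i - a i) (fst w) ~= 0"
  and t: "t \<in> {0..1}" "pt a b t \<in> cn w"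
 shows "ctime a b w = t"
 unfolding ctime_def
proof (rule the_equality)
 show "t \<in> {0..1} & pt a b t \<in> cn w" using t by simp
 fix s assume s: "s \<in> {0..1} & pt a b s \<in> cn w"
 have "dot (nw w) (pt a b s) = 0" "dot (nw w) (pt a b t) = 0" using wall_perp[OF w] s t by auto
 hence "(s - t) * (dot (nw w) b - dot (nw w) a) = 0" by (simp add: dot_pt algebra_simps)
 thus "s = t" using tr by (simp add: pairR_dot dot_diff)
qed

lemma crossed_ctime:
 assumes W: "okW W" and sg: "seg_generic J d W a b" and w: "w \<in> crossed W a b"
 shows "0 < ctime a b w" "ctime a b w < 1" "pt a b (ctime a b w) \<in> cn w" "is_wall J d w"
  "pairR J d (%i. b i - a i) (fst w) ~= 0"
proof -
 obtain t where t: "w \<in> W" "t \<in> {0..1}" "pt a b t \<in> cn w" using w by (auto simp: crossed_def)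
 show wl: "is_wall J d w" using okW_wall[OF W t(1)] .
 show tr: "pairR J d (%i. b i - a i) (fst w) ~= 0" using sg t unfolding seg_generic_def by blast
 have c: "ctime a b w = t" by (rule ctime_unique[OF wl tr t(2,3)])
 show "pt a b (ctime a b w) \<in> cn w" using c t by simp
 have "t ~= 0" "t ~= 1" using sg t unfolding seg_generic_def by auto
 thus "0 < ctime a b w" "ctime a b w < 1" using t c by auto
qed

text \<open>The walls with the earliest crossing time r are exactly those through one point and are
  handled by \<open>local_cross\<close>. The induction continues from a point between r and the next
  time; the remaining times are rescaled by an increasing affine map, so the order and the crossing
  signs are kept.\<close>

lemma seg_transport:
 fixes ws :: "('i,'k::field_char_0) wall list" and k :: nat
 defines "W \<equiv> Dk J (SD :: ('i,'k) wall set) k"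
 assumes "a \<in> vecs J" "b \<in> vecs J" "seg_generic J d W a b" "distinct ws" "set ws = crossed W a b"
  "sorted_wrt (%w w'. ctime a b w <= ctime a b w') ws"
 shows "req (int k) (rw (pd k a) @ crs a b ws) (rw (pd k b))"
 using assms(2-)
proof (induction "length ws" arbitrary: ws a rule: less_induct)
 case less
 note ab = less.prems(1,2) and sg = less.prems(3) and ws = less.prems(4-6)
 have okW: "okW W" unfolding W_def by (rule okW_SD)
 note C = crossed_ctime[OF okW sg]
 show ?case
 proof (cases "ws = []")
  case True
  have "req (int k) (rw (pd k a)) (rw (pd k b :: ('i,'k) word))"
  proof (rule pd_segment[OF ab])
   fix t :: real assume "0 <= t" "t <= 1"
   hence "t \<in> {0..1}" by simp
   moreover have "crossed W a b = {}" using ws(2) True by simp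
   ultimately have "ALL w:W. pt a b t \<notin> cn w" unfolding crossed_def by blast
   thus "avoid (Dk J (SD :: ('i,'k) wall set) k) (pt a b t)" by (simp add: avoid_def W_def)
  qed
  thus ?thesis using True by simp
 next
  case False
  define r where "r = ctime a b (hd ws)"
  define ws1 where "ws1 = takeWhile (%w. ctime a b w = r) ws"
  define ws2 where "ws2 = dropWhile (%w. ctime a b w = r) ws"
  have split: "ws = ws1 @ ws2" by (simp add: ws1_def ws2_def)
  have ne1: "ws1 ~= []" using False by (cases ws) (auto simp: ws1_def r_def)
  have hd: "hd ws \<in> crossed W a b" using False ws(2) hd_in_set by blast
  have r01: "0 < r" "r < 1" using C[OF hd] by (auto simp: r_def)
  have ge: "r <= ctime a b w" if "w \<in> set ws" for w
   using that ws(3) False by (cases ws) (auto simp: r_def)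
  have eq1: "ctime a b w = r" if "w \<in> set ws1" for w using that by (auto simp: ws1_def dest: set_takeWhileD)
  have sorted2: "sorted_wrt (%w w'. ctime a b w <= ctime a b w') ws2" using ws(3) split by (simp add: sorted_wrt_append)
  have gt2: "r < ctime a b w" if w: "w \<in> set ws2" for w
  proof -
   have ne: "ws2 ~= []" using w by auto
   have "ctime a b (hd ws2) ~= r" using hd_dropWhile[of "%w. ctime a b w = r" ws] ne by (simp add: ws2_def)
   moreover have "r <= ctime a b (hd ws2)" using ge split ne by simp
   moreover have "ctime a b (hd ws2) <= ctime a b w" using sorted2 w ne by (cases ws2) auto
   ultimately show ?thesis by simp
  qed
  have sub12: "set ws = set ws1 \<union> set ws2" using split by (metis set_append)
  have sub2: "set ws2 \<subseteq> crossed W a b" using sub12 ws(2) by blast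
  have sub1: "set ws1 \<subseteq> crossed W a b" using sub12 ws(2) by blast
  \<comment> \<open>The next crossing time; with no further wall the end of the segment serves as
    the bound.\<close>
  define T where "T = (if ws2 = [] then 1 else ctime a b (hd ws2))"
  have T: "r < T" "T <= 1"
  proof -
   have "r < T & T <= 1"
   proof (cases "ws2 = []")
    case F: False
    hence h: "hd ws2 \<in> set ws2" by simp
    hence "hd ws2 \<in> crossed W a b" using sub2 by blast
    from C(2)[OF this] gt2[OF h] F show ?thesis by (simp add: T_def)
   qed (use r01 in "simp add: T_def")
   thus "r < T" "T <= 1" by auto
  qed
  have Tmin: "T <= ctime a b w" if "w \<in> set ws2" for w
   using that sorted2 by (cases ws2) (auto simp: T_def)
  define t where "t = (r + T) / 2"
  have t: "r < t" "t < T" "t < 1" using T by (auto simp: t_def)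
  have inC: "w \<in> crossed W a b & ctime a b w = y" if "w \<in> W" "0 <= y" "y <= 1" "pt a b y \<in> cn w" for w y
  proof -
   have cr: "w \<in> crossed W a b" using that by (auto simp: crossed_def)
   thus ?thesis using ctime_unique[OF C(4,5)[OF cr], of y] that by auto
  qed
  have set1: "set ws1 = {w\<in>W. pt a b r \<in> cn w}"
  proof (intro set_eqI iffI)
   fix w assume w: "w \<in> set ws1"
   hence "w \<in> crossed W a b" using ws(2) split by auto
   thus "w \<in> {w\<in>W. pt a b r \<in> cn w}" using C(3)[of w] eq1[OF w] by (auto simp: crossed_def)
  next
   fix w assume "w \<in> {w\<in>W. pt a b r \<in> cn w}"
   hence "w \<in> set ws" "ctime a b w = r" using inC[of w r] r01 ws(2) by auto
   thus "w \<in> set ws1" using gt2[of w] split by auto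
  qed
  have av: "avoid W (pt a b y)" if y: "0 <= y" "y <= t" "y ~= r" for y
   unfolding avoid_def
  proof (intro ballI notI)
   fix w assume w: "w \<in> W" "pt a b y \<in> cn w"
   hence c: "w \<in> set ws" "ctime a b w = y" using inC[of w y] y t ws(2) by auto
   have "w \<notin> set ws1" using eq1[of w] c y by auto
   hence "w \<in> set ws2" using c split by auto
   thus False using Tmin[of w] c t y by simp
  qed
  define c where "c = pt a b t"
  have cv: "c \<in> vecs J" unfolding c_def by (rule vecs_pt[OF ab])
  have S1: "req (int k) (rw (pd k (pt a b 0)) @ crs a b ws1) (rw (pd k (pt a b t)))"
  proof (rule local_cross[OF ab])
   have hW: "hd ws \<in> W" "r \<in> {0..1}" "pt a b r \<in> fst (snd (hd ws))"
    using hd C(3)[OF hd] r01 by (simp_all add: crossed_def r_def)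
   thus "good_pt J d (Dk J (SD :: ('i,'k) wall set) k) (pt a b r)"
    using sg unfolding seg_generic_def W_def[symmetric] by blast
   show "distinct ws1" using ws(1) split by simp
   show "set ws1 = {w \<in> Dk J SD k. pt a b r \<in> cn w}" using set1 by (simp add: W_def)
   show "ALL w:set ws1. pairR J d (%i. b i - a i) (fst w) ~= 0" using C(5) ws(2) split by auto
  qed (use r01 t ne1 av in "auto simp: W_def")
  have ptc: "pt c b y = pt a b (t + y * (1 - t))" for y unfolding c_def by (rule pt_end)
  have diff: "(%i. b i - c i) = (%i. (1 - t) * (b i - a i))" by (auto simp: c_def pt_def algebra_simps)
  have pc: "pairR J d (%i. b i - c i) n = (1 - t) * pairR J d (%i. b i - a i) n" for n
   unfolding pairR_dot diff dot_scale ..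
  have tt: "0 <= t + y * (1 - t) & t + y * (1 - t) <= 1" if "y \<in> {0..1}" for y
  proof -
   have "0 <= y * (1 - t)" "y * (1 - t) <= 1 - t" using that t r01 mult_right_mono[of y 1 "1 - t"] by simp_all
   thus ?thesis using t r01 by linarith
  qed
  have cav: "avoid W c" unfolding c_def by (rule av) (use t r01 in auto)
  have sgc: "seg_generic J d W c b"
   unfolding seg_generic_def
  proof (intro conjI ballI impI)
   fix w assume w: "w \<in> W"
   show "c \<notin> cn w" using cav w by (auto simp: avoid_def)
   show "b \<notin> cn w" using sg w by (auto simp: seg_generic_def)
   fix y assume y: "y \<in> {0..1}" "pt c b y \<in> cn w"
   thus "good_pt J d W (pt c b y)" "pairR J d (%i. b i - c i) (fst w) ~= 0"
    using sg w tt[OF y(1)] t unfolding seg_generic_def ptc pc by auto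
  qed
  have ct: "w \<in> crossed W c b \<longleftrightarrow> w \<in> set ws2" and ctv: "w \<in> set ws2 ==> ctime c b w = (ctime a b w - t) / (1 - t)" for w
  proof -
   show "w \<in> crossed W c b \<longleftrightarrow> w \<in> set ws2"
   proof
    assume "w \<in> crossed W c b"
    then obtain y where y: "w \<in> W" "y \<in> {0..1}" "pt a b (t + y * (1 - t)) \<in> cn w" by (auto simp: crossed_def ptc)
    hence c: "w \<in> set ws" "ctime a b w = t + y * (1 - t)" using inC[of w] tt[OF y(2)] ws(2) by auto
    hence "r < ctime a b w" using y(2) t by (simp add: add_strict_increasing2 add_pos_nonneg less_le_trans)
    thus "w \<in> set ws2" using c(1) eq1[of w] split by auto
   next
    assume w: "w \<in> set ws2"
    hence cr: "w \<in> crossed W a b" using ws(2) split by auto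
    let ?y = "(ctime a b w - t) / (1 - t)"
    have "t + ?y * (1 - t) = ctime a b w" using t by simp
    moreover have "?y \<in> {0..1}" using Tmin[OF w] C(2)[OF cr] t by (auto simp: field_simps)
    ultimately have "pt c b ?y \<in> cn w" using C(3)[OF cr] by (simp add: ptc)
    thus "w \<in> crossed W c b" using \<open>?y \<in> {0..1}\<close> cr by (auto simp: crossed_def)
   qed
   assume w: "w \<in> set ws2"
   hence cr: "w \<in> crossed W a b" using ws(2) split by auto
   let ?y = "(ctime a b w - t) / (1 - t)"
   have e: "t + ?y * (1 - t) = ctime a b w" using t by simp
   have y: "?y \<in> {0..1}" using Tmin[OF w] C(2)[OF cr] t by (auto simp: field_simps)
   show "ctime c b w = ?y"
    by (rule ctime_unique[OF C(4)[OF cr] _ y]) (use C(5,3)[OF cr] t e in "auto simp: pc ptc")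
  qed
  have srt: "sorted_wrt (%w w'. ctime c b w <= ctime c b w') ws2"
   by (rule sorted_wrt_mono_rel[OF _ sorted2]) (use t ctv in "auto simp: divide_right_mono")
  have "req (int k) (rw (pd k c) @ crs c b ws2) (rw (pd k b))"
  proof (rule less.hyps)
   show "length ws2 < length ws" using split ne1 by simp
   show "set ws2 = crossed W c b" using ct by auto
  qed (use ws(1) split srt sgc cv ab in auto)
  moreover have "crs c b ws2 = crs a b ws2"
   unfolding crs_def sgnc_def pc using t by (simp add: zero_less_mult_iff)
  ultimately have S2: "req (int k) (rw (pd k c) @ crs a b ws2) (rw (pd k b))" by simp
  have aav: "avoid W a" using sg by (auto simp: seg_generic_def avoid_def)
  have okwall: "okrs (crs a b ws1)" "okrs (crs a b ws2)"
   using C(4) ws(2) split by (auto intro!: okrs_crs)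
  have "req (int k) ((rw (pd k a) @ crs a b ws1) @ crs a b ws2) (rw (pd k c) @ crs a b ws2)"
   by (rule req_append[OF S1[simplified, folded c_def] req_refl])
     (use aav cav cv ab okwall in "auto simp: W_def")
  hence "req (int k) ((rw (pd k a) @ crs a b ws1) @ crs a b ws2) (rw (pd k b))"
   using S2 by (rule req_trans)
  thus ?thesis using split by simp
 qed
qed

text \<open>The products along the segments telescope, so that pd(start) times the path product
  equals pd(end). For a loop the two chamber elements coincide and cancel.\<close>

theorem SD_consistent: "consistent_k J d eps (Dk J (SD :: ('i,'k::field_char_0) wall set) k) k"
proof -
 define W where "W = Dk J (SD :: ('i,'k) wall set) k"
 have okW: "okW W" unfolding W_def by (rule okW_SD)
 have P: "req (int k) (rw (pd k (hd ps)) @ pathl W ps) (rw (pd k (last ps)))"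
  if "ps ~= []" "set ps \<subseteq> vecs J" "ALL i. Suc i < length ps --> seg_generic J d W (ps ! i) (ps ! Suc i)" for ps
  using that
 proof (induction ps rule: induct_list012)
  case (3 a b r)
  have sg: "seg_generic J d W a b" using 3(5)[rule_format, of 0] by simp
  have ih: "req (int k) (rw (pd k b) @ pathl W (b # r)) (rw (pd k (last (b # r))))"
  proof -
   have "ALL i. Suc i < length (b # r) --> seg_generic J d W ((b # r) ! i) ((b # r) ! Suc i)"
   proof (intro allI impI)
    fix i assume "Suc i < length (b # r)"
    thus "seg_generic J d W ((b # r) ! i) ((b # r) ! Suc i)" using 3(5)[rule_format, of "Suc i"] by simp
   qed
   thus ?thesis using 3(2) 3(4) by simp
  qed
  have s: "req (int k) (rw (pd k a) @ crs a b (segl W a b)) (rw (pd k b))"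
   unfolding W_def by (rule seg_transport) (use 3 sg okW in "auto simp: W_def okW_def segl_props")
  have av: "avoid W a" "avoid W b" using sg by (auto simp: seg_generic_def avoid_def)
  have "req (int k) ((rw (pd k a) @ crs a b (segl W a b)) @ pathl W (b # r)) (rw (pd k b) @ pathl W (b # r))"
   by (rule req_append[OF s req_refl]) (use av 3 okW in "auto simp: W_def okrs_segl okrs_pathl")
  hence "req (int k) ((rw (pd k a) @ crs a b (segl W a b)) @ pathl W (b # r)) (rw (pd k (last (b # r))))"
   using ih by (rule req_trans)
  thus ?case by simp
 qed auto
 show ?thesis unfolding consistent_k_def W_def[symmetric]
 proof (intro allI impI ballI)
  fix ps m n n'
  assume ps: "2 <= length ps & set ps \<subseteq> vecs J & hd ps = last ps &
    (ALL i. Suc i < length ps --> seg_generic J d W (ps ! i) (ps ! Suc i))"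
   and m: "m \<in> latt J" and n: "n \<in> nonneg J" and n': "dg n' < int k"
  have ne: "ps ~= []" using ps by auto
  have "seg_generic J d W (ps ! 0) (ps ! Suc 0)" using ps by auto
  hence av: "avoid W (hd ps)" using ne by (auto simp: seg_generic_def avoid_def hd_conv_nth)
  have hv: "hd ps \<in> vecs J" using ps ne by auto
  have "req (int k) (rw (pd k (hd ps)) @ pathl W ps) (rw (pd k (hd ps)) @ [])"
   using P[OF ne] ps by simp
  hence triv: "req (int k) (pathl W ps) []"
   by (rule req_cancel_left[OF _ req_refl]) (use av hv okW in "auto simp: W_def okrs_pathl")
  have "path_prod J d eps W ps m (delta n) n' = ract (pathl W ps) m (delta n) n'"
   using path_prod_ract[OF okW, of "delta n" ps m] n by simp
  also have "\<dots> = ract [] m (delta n) n'"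
   by (rule req_ract[OF triv _ _ m _ n']) (use n okW in "auto simp: okrs_pathl")
  finally show "path_prod J d eps W ps m (delta n) n' = (if n' = n then 1 else 0)" by (simp add: delta_def)
 qed
qed

theorem clusterSD_exists: "clusterSD J d eps (SD :: ('i,'k::field_char_0) wall set)"
 unfolding clusterSD_def
 by (intro conjI ballI allI SD_wall SD_finite SD_consistent SD_outgoing) (auto simp: SD_def)

end

section \<open>Generic end points and connecting segments\<close>

lemma pt_rev: "pt b a t = pt a b (1 - t)"
 by (simp add: pt_def fun_eq_iff algebra_simps)

context seed begin

text \<open>Stronger than \<open>avoid\<close>: the whole hyperplanes of the walls are excluded, so
  the complement consists of chambers given by finitely many signs.\<close>

definition off :: "('i,'k) wall set => 'i vec => bool" where
 "off W x \<longleftrightarrow> x \<in> vecs J & (ALL w:W. dot (nw w) x ~= 0)"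

lemma off_avoid: "okW W ==> off W x ==> avoid W x"
 unfolding off_def avoid_def using wall_perp okW_wall by blast

lemma seg_generic_sym: "seg_generic J d W a b ==> seg_generic J d W b a"
 unfolding seg_generic_def pt_rev[of b a]
proof (intro conjI ballI impI)
 assume sg: "(ALL w:W. a \<notin> cn w & b \<notin> cn w) &
  (ALL t:{0..1}. ALL w:W. pt a b t \<in> cn w --> good_pt J d W (pt a b t) & pairR J d (%i. b i - a i) (fst w) ~= 0)"
 fix w assume w: "w \<in> W"
 show "b \<notin> cn w" "a \<notin> cn w" using sg w by auto
 fix t :: real assume t: "t \<in> {0..1}" "pt a b (1 - t) \<in> cn w"
 have "1 - t \<in> {0..1}" using t by simp
 hence "good_pt J d W (pt a b (1 - t))" "pairR J d (%i. b i - a i) (fst w) ~= 0" using sg t w by blast+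
 moreover have "pairR J d (%i. a i - b i) n = - pairR J d (%i. b i - a i) n" for n
  by (simp add: pairR_dot dot_diff)
 ultimately show "good_pt J d W (pt a b (1 - t))" "pairR J d (%i. a i - b i) (fst w) ~= 0" by simp_all
qed

text \<open>A covector that vanishes at \<open>a\<close> and on the codimension two set h1 = h2 = 0.
  A line from \<open>a\<close> to a point off its kernel meets that set at most at \<open>a\<close>;
  if \<open>a\<close> itself lies in the set, \<open>h1\<close> serves.\<close>

definition jf :: "'i vec => 'i vec => 'i vec => 'i vec" where
 "jf a h1 h2 = (if dot h1 a = 0 & dot h2 a = 0 then h1 else (%i. dot h2 a * h1 i - dot h1 a * h2 i))"

lemma jf_nz:
 assumes "nz h1" "\<not> par h2 h1"
 shows "nz (jf a h1 h2)"
proof (cases "dot h1 a = 0 & dot h2 a = 0")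
 case False
 have "nz (%i. dot h2 a * h1 i - dot h1 a * h2 i)"
 proof (rule ccontr)
  assume "\<not> ?thesis"
  hence e: "ALL i:J. dot h2 a * h1 i = dot h1 a * h2 i" by (simp add: nz_def)
  show False
  proof (cases "dot h1 a = 0")
   case True
   hence "ALL i:J. h1 i = 0" using e False by simp
   thus False using assms by (simp add: nz_def)
  next
   case F: False
   hence "ALL i:J. h2 i = (dot h2 a / dot h1 a) * h1 i" using e by (simp add: field_simps)
   thus False using assms unfolding par_def by blast
  qed
 qed
 thus ?thesis using False assms by (simp add: jf_def)
qed (use assms in "simp add: jf_def")

lemma jf_self: "dot (jf a h1 h2) a = 0"
 by (simp add: jf_def dot_diffl dot_scalel)

lemma jf_zero: "dot h1 x = 0 ==> dot h2 x = 0 ==> dot (jf a h1 h2) x = 0"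
 by (simp add: jf_def dot_diffl dot_scalel)

lemma generic_point:
 assumes Z: "finite Z" "\<forall>(h1,h2)\<in>Z. nz h1 & nz h2 & \<not> par h2 h1" and S: "finite S"
  and H: "finite H" "ALL h:H. nz h" and x: "x \<in> vecs J" "0 < e"
 obtains c where "c \<in> vecs J" "close e x c" "ALL h:H. dot h c ~= 0"
  "\<And>a t h1 h2. a \<in> S ==> (h1,h2) \<in> Z ==> dot h1 (pt a c t) = 0 ==> dot h2 (pt a c t) = 0 ==> t = 0"
proof -
 define K where "K = H \<union> (\<Union>a\<in>S. (%(h1,h2). jf a h1 h2) ` Z)"
 have fK: "finite K" unfolding K_def using H S Z by auto
 have nzK: "ALL h:K. nz h" unfolding K_def using H(2) Z(2) jf_nz by fastforce
 obtain c where c: "c \<in> vecs J" "close e x c" "ALL h:K. dot h c ~= 0" by (rule generic_near[OF fK nzK x])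
 have "t = 0" if a: "a \<in> S" and h: "(h1,h2) \<in> Z" "dot h1 (pt a c t) = 0" "dot h2 (pt a c t) = 0" for a t h1 h2
 proof -
  have "jf a h1 h2 \<in> K" using h a unfolding K_def by blast
  hence "dot (jf a h1 h2) c ~= 0" using c(3) by blast
  thus ?thesis using jf_zero[OF h(2,3), of a] by (simp add: dot_pt jf_self)
 qed
 thus ?thesis using that c by (auto simp: K_def)
qed

lemma normals:
 assumes "okW W"
 shows "finite ((%w. nw w) ` W)" "ALL h:(%w. nw w) ` W. nz h"
proof -
 show "finite ((%w. nw w) ` W)" using assms by (simp add: okW_def)
 show "ALL h:(%w. nw w) ` W. nz h" using nz_nrm is_wall_props(2)[OF okW_wall[OF assms]] by blast
qed

text \<open>One target \<open>c\<close> is chosen generic as seen from all members of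
  \<open>S\<close>; two points that avoid the walls are then joined by a path of two segments
  through \<open>c\<close>.\<close>

lemma generic_connect:
 assumes W: "okW W" and S: "finite S" "ALL a:S. a \<in> vecs J & avoid W a"
 obtains c where "off W c" "ALL a:S. seg_generic J d W a c"
proof -
 obtain Z where Z: "finite Z" "\<forall>(h1,h2)\<in>Z. nz h1 & nz h2 & \<not> par h2 h1"
  "ALL x:vecs J. \<not> good_pt J d W x --> (\<exists>(h1,h2)\<in>Z. dot h1 x = 0 & dot h2 x = 0)"
  using bad_set[of W] W unfolding okW_def by blast
 have N: "finite ((%w. nw w) ` W)" "ALL h:(%w. nw w) ` W. nz h"
  by (rule normals[OF W])+
 obtain c where c: "c \<in> vecs J" "ALL h:(%w. nw w) ` W. dot h c ~= 0"
  "\<And>a t h1 h2. a \<in> S ==> (h1,h2) \<in> Z ==> dot h1 (pt a c t) = 0 ==> dot h2 (pt a c t) = 0 ==> t = 0"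
  by (rule generic_point[OF Z(1,2) S(1) N, of "%i. 0" 1]) (auto simp: vecs_def)
 have off: "off W c" using c by (auto simp: off_def)
 have "seg_generic J d W a c" if a: "a \<in> S" for a
  unfolding seg_generic_def
 proof (intro conjI ballI impI)
  have aa: "a \<in> vecs J" "avoid W a" using S a by auto
  fix w assume w: "w \<in> W"
  show "a \<notin> cn w" "c \<notin> cn w" using aa off_avoid[OF W off] w by (auto simp: avoid_def)
  fix t :: real assume t: "t \<in> {0..1}" "pt a c t \<in> cn w"
  have pv: "pt a c t \<in> vecs J" using vecs_pt aa c by auto
  have "t ~= 0" using t w aa by (auto simp: avoid_def)
  thus "good_pt J d W (pt a c t)" using Z(3) pv c(3)[OF a] by blast
  show "pairR J d (%i. c i - a i) (fst w) ~= 0"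
  proof
   assume "pairR J d (%i. c i - a i) (fst w) = 0"
   hence "dot (nw w) c = dot (nw w) (pt a c t)" by (simp add: pairR_dot dot_diff dot_pt)
   thus False using wall_perp[OF okW_wall[OF W w] t(2)] off w by (simp add: off_def)
  qed
 qed
 thus ?thesis using that off by auto
qed

subsection \<open>Path independence\<close>

definition gpath :: "('i,'k::field) wall set => 'i vec list => bool" where
 "gpath W ps \<longleftrightarrow> ps ~= [] & set ps \<subseteq> vecs J & (ALL i. Suc i < length ps --> seg_generic J d W (ps ! i) (ps ! Suc i))"

lemma gpath_simps:
 "gpath W [a] \<longleftrightarrow> a \<in> vecs J"
 "gpath W (a # b # r) \<longleftrightarrow> a \<in> vecs J & seg_generic J d W a b & gpath W (b # r)"
proof -
 show "gpath W [a] \<longleftrightarrow> a \<in> vecs J" by (simp add: gpath_def)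
 show "gpath W (a # b # r) \<longleftrightarrow> a \<in> vecs J & seg_generic J d W a b & gpath W (b # r)"
  unfolding gpath_def by (auto simp: nth_Cons split: nat.splits)
qed

lemma gpath_append: "gpath W ps ==> gpath W qs ==> last ps = hd qs ==>
  gpath W (ps @ tl qs) & pathl W (ps @ tl qs) = pathl W ps @ pathl W qs &
  hd (ps @ tl qs) = hd ps & last (ps @ tl qs) = last qs"
proof (induction ps rule: induct_list012)
 case (2 a)
 then obtain r where "qs = a # r" by (cases qs) (auto simp: gpath_def)
 thus ?case using 2 by simp
next
 case (3 a b r)
 have g: "gpath W (b # r)" "a \<in> vecs J" "seg_generic J d W a b" using 3(3) by (auto simp: gpath_simps)
 have "gpath W ((b # r) @ tl qs) & pathl W ((b # r) @ tl qs) = pathl W (b # r) @ pathl W qs &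
   hd ((b # r) @ tl qs) = b & last ((b # r) @ tl qs) = last qs" using 3(2)[OF g(1) 3(4)] 3(5) by simp
 thus ?case using g by (auto simp: gpath_simps)
qed (simp add: gpath_def)

lemma gpath_rev: "gpath W ps ==> gpath W (rev ps)"
proof (induction ps rule: induct_list012)
 case (3 a b r)
 have g: "gpath W (b # r)" "a \<in> vecs J" "seg_generic J d W a b" using 3(3) by (auto simp: gpath_simps)
 have bv: "b \<in> vecs J" using g(1) by (auto simp: gpath_def)
 have "gpath W [b, a]" using g bv seg_generic_sym by (auto simp: gpath_simps)
 moreover have "last (rev (b # r)) = b" by simp
 ultimately have "gpath W (rev (b # r) @ tl [b, a])" using gpath_append[OF 3(2)[OF g(1)], of "[b,a]"] by simp
 thus ?case by simp
qed auto

definition cons :: "nat => ('i,'k::field) wall set => bool" where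
 "cons k W \<longleftrightarrow> okW W & consistent_k J d eps W k"

lemma loop_trivial:
 assumes W: "cons k W" and ps: "gpath W ps" "hd ps = last ps"
 shows "req (int k) (pathl W ps) []"
proof (cases "2 <= length ps")
 case True
 have okW: "okW W" using W by (simp add: cons_def)
 show ?thesis unfolding req_def
 proof (intro ballI allI impI)
  fix m n assume mn: "m \<in> latt J" "dg n < int k"
  have "(0::'i lat) \<in> nonneg J" by (simp add: nonneg_def latt_def fun_app)
  moreover have "2 <= length ps & set ps \<subseteq> vecs J & hd ps = last ps &
    (ALL i. Suc i < length ps --> seg_generic J d W (ps ! i) (ps ! Suc i))"
   using ps True by (auto simp: gpath_def)
  ultimately have "path_prod J d eps W ps m (delta 0) n = (if n = 0 then 1 else 0)"
   using W mn unfolding cons_def consistent_k_def by blast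
  moreover have "path_prod J d eps W ps m (delta 0) n = rc (pathl W ps) m n"
   unfolding rc_def by (simp add: path_prod_ract[OF okW])
  ultimately show "rc (pathl W ps) m n = rc [] m n" by (simp add: rc_Nil)
 qed
next
 case False
 hence "pathl W ps = []" by (cases ps) (auto simp: not_le less_Suc_eq_0_disj)
 thus ?thesis by simp
qed

text \<open>Either path followed by the reverse of the second is a loop and hence trivial; the
  common reverse path cancels.\<close>

lemma path_independent:
 assumes W: "cons k W" and ps: "gpath W ps" "gpath W qs" "hd ps = hd qs" "last ps = last qs"
 shows "req (int k) (pathl W ps) (pathl W qs)"
proof -
 have okW: "okW W" using W by (simp add: cons_def)
 have ne: "ps ~= []" "qs ~= []" using ps by (auto simp: gpath_def)
 have r: "gpath W (rev qs)" "hd (rev qs) = last qs" "last (rev qs) = hd qs"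
  using gpath_rev[OF ps(2)] ne by (auto simp: hd_rev last_rev)
 have "req (int k) (pathl W ps @ pathl W (rev qs)) []"
  using gpath_append[OF ps(1) r(1)] loop_trivial[OF W, of "ps @ tl (rev qs)"] ps r by auto
 moreover have "req (int k) (pathl W qs @ pathl W (rev qs)) []"
  using gpath_append[OF ps(2) r(1)] loop_trivial[OF W, of "qs @ tl (rev qs)"] ps r by auto
 ultimately have "req (int k) (pathl W ps @ pathl W (rev qs)) (pathl W qs @ pathl W (rev qs))"
  using req_sym req_trans by blast
 thus ?thesis by (rule req_cancel_right[OF _ req_refl]) (use okW okrs_pathl in auto)
qed

text \<open>The transport between two points, made from an arbitrary path; by
  \<open>trp_path\<close> the choice is invisible modulo degree \<open>k\<close>.\<close>

definition trp :: "('i,'k::field) wall set => 'i vec => 'i vec => ('i,'k) rword" where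
 "trp W a b = pathl W (SOME ps. gpath W ps & hd ps = a & last ps = b)"

lemma okrs_trp [simp]: "okW W ==> okrs (trp W a b)" by (simp add: trp_def okrs_pathl)

lemma trp_path:
 assumes W: "cons k W" and ps: "gpath W ps" "hd ps = a" "last ps = b"
 shows "req (int k) (trp W a b) (pathl W ps)"
proof -
 let ?P = "%ps. gpath W ps & hd ps = a & last ps = b"
 have "?P (SOME ps. ?P ps)" by (rule someI[of ?P ps]) (use ps in blast)
 thus ?thesis unfolding trp_def using path_independent[OF W] ps by auto
qed

lemma gpath_ex:
 assumes W: "okW W" and a: "a \<in> vecs J" "avoid W a" and b: "b \<in> vecs J" "avoid W b"
 obtains ps where "gpath W ps" "hd ps = a" "last ps = b"
proof -
 obtain c where c: "off W c" "ALL x:{a,b}. seg_generic J d W x c"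
  by (rule generic_connect[OF W, of "{a,b}"]) (use a b in auto)
 have "gpath W [a, c, b]" using c a b seg_generic_sym by (auto simp: gpath_simps off_def)
 thus ?thesis using that by force
qed

lemma trp_refl: "cons k W ==> a \<in> vecs J ==> req (int k) (trp W a a) []"
 using trp_path[of k W "[a]" a a] by (simp add: gpath_simps)

lemma trp_comp:
 assumes W: "cons k W" and a: "a \<in> vecs J" "avoid W a" and b: "b \<in> vecs J" "avoid W b" and c: "c \<in> vecs J" "avoid W c"
 shows "req (int k) (trp W a c) (trp W a b @ trp W b c)"
proof -
 have okW: "okW W" using W by (simp add: cons_def)
 obtain ps where ps: "gpath W ps" "hd ps = a" "last ps = b" by (rule gpath_ex[OF okW a b])
 obtain qs where qs: "gpath W qs" "hd qs = b" "last qs = c" by (rule gpath_ex[OF okW b c])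
 have "req (int k) (trp W a c) (pathl W ps @ pathl W qs)"
  using gpath_append[OF ps(1) qs(1)] trp_path[OF W, of "ps @ tl qs" a c] ps qs by auto
 moreover have "req (int k) (trp W a b @ trp W b c) (pathl W ps @ pathl W qs)"
  by (rule req_append[OF trp_path[OF W ps] trp_path[OF W qs]]) (use okW okrs_pathl in auto)
 ultimately show ?thesis using req_sym req_trans by blast
qed

lemma trp_seg:
 assumes W: "cons k W" and ab: "a \<in> vecs J" "b \<in> vecs J" and sg: "seg_generic J d W a b"
 shows "req (int k) (trp W a b) (crs a b (segl W a b))"
 using trp_path[OF W, of "[a,b]" a b] ab sg by (simp add: gpath_simps)

lemma trp_same_side:
 assumes W: "cons k W" and ab: "a \<in> vecs J" "b \<in> vecs J"
  and s: "ALL w:W. 0 < dot (nw w) a * dot (nw w) b"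
 shows "req (int k) (trp W a b) []"
proof -
 have okW: "okW W" using W by (simp add: cons_def)
 have nz: "dot (nw w) (pt a b t) ~= 0" if w: "w \<in> W" and t: "t \<in> {0..1}" for w t
 proof -
  have e: "dot (nw w) (pt a b t) = (1 - t) * dot (nw w) a + t * dot (nw w) b"
   by (simp add: dot_pt algebra_simps)
  consider "0 < dot (nw w) a" "0 < dot (nw w) b" | "dot (nw w) a < 0" "dot (nw w) b < 0"
   using s w by (auto simp: zero_less_mult_iff)
  thus ?thesis
  proof cases
   case 1
   have "0 < (1 - t) * dot (nw w) a + t * dot (nw w) b"
    using 1 t by (cases "t = 0") (auto intro: add_nonneg_pos)
   thus ?thesis using e by simp
  next
   case 2
   have "(1 - t) * dot (nw w) a + t * dot (nw w) b < 0"
    using 2 t by (cases "t = 0") (auto intro!: add_nonpos_neg mult_nonneg_nonpos mult_pos_neg)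
   thus ?thesis using e by simp
  qed
 qed
 have no: "pt a b t \<notin> cn w" if "w \<in> W" "t \<in> {0..1}" for w t
  using nz[OF that] wall_perp[OF okW_wall[OF okW that(1)]] by blast
 have "seg_generic J d W a b" unfolding seg_generic_def using no no[of _ 0] no[of _ 1] by auto
 moreover have "crossed W a b = {}" using no by (auto simp: crossed_def)
 hence "segl W a b = []" using segl_props(2)[of W a b] okW by (simp add: okW_def)
 ultimately show ?thesis using trp_seg[OF W ab] by simp
qed

text \<open>Walls are tested through their full hyperplanes rather than their supports. Which walls
  really pass through the crossing point is left open, so one segment can serve two different
  diagrams.\<close>

definition crossing :: "('i,'k) wall set => 'i vec => 'i vec => real => 'i lat => bool" where
 "crossing W a b r v \<longleftrightarrow> a \<in> vecs J & b \<in> vecs J & 0 < r & r < 1 &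
   (ALL t:{0..1}. ALL w:W. dot (nw w) (pt a b t) = 0 --> t = r & fst w = v) &
   dot (nrm v) (pt a b r) = 0 & good_pt J d W (pt a b r)"

lemma trp_crossing:
 assumes W: "cons k W" and c: "crossing W a b r v" and v: "v \<in> posN J"
 shows "req (int k) (trp W a b) [crF v (wprod W (pt a b r)) (sgnc a b v)]"
proof -
 have okW: "okW W" using W by (simp add: cons_def)
 have z: "t = r & fst w = v" if "t \<in> {0..1}" "w \<in> W" "pt a b t \<in> cn w" for t w
  using c wall_perp[OF okW_wall[OF okW that(2)] that(3)] that unfolding crossing_def by blast
 have ab: "a \<in> vecs J" "b \<in> vecs J" using c by (auto simp: crossing_def)
 have r: "0 < r" "r < 1" using c by (auto simp: crossing_def)
 have tr: "pairR J d (%i. b i - a i) (fst w) ~= 0" if "t \<in> {0..1}" "w \<in> W" "pt a b t \<in> cn w" for t w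
 proof
  assume "pairR J d (%i. b i - a i) (fst w) = 0"
  hence "dot (nw w) (pt a b 0) = dot (nw w) (pt a b t)" by (simp add: pairR_dot dot_diff dot_pt)
  hence "dot (nw w) (pt a b 0) = 0" using wall_perp[OF okW_wall[OF okW that(2)] that(3)] by simp
  moreover have "(0::real) \<in> {0..1}" by simp
  ultimately have "0 = r" using c that(2) unfolding crossing_def by blast
  thus False using r by simp
 qed
 have sg: "seg_generic J d W a b"
  unfolding seg_generic_def
 proof (intro conjI ballI impI)
  fix w assume w: "w \<in> W"
  show "a \<notin> cn w" using z[of 0 w] w r by auto
  show "b \<notin> cn w" using z[of 1 w] w r by auto
  fix t :: real assume t: "t \<in> {0..1}" "pt a b t \<in> cn w"
  show "pairR J d (%i. b i - a i) (fst w) ~= 0" by (rule tr[OF t(1) w t(2)])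
  have "t = r" using z[OF t(1) w t(2)] by simp
  thus "good_pt J d W (pt a b t)" using c by (simp add: crossing_def)
 qed
 have fin: "finite W" using okW by (simp add: okW_def)
 have set: "set (segl W a b) = {w\<in>W. pt a b r \<in> cn w}"
 proof -
  have "r \<in> {0..1}" using r by simp
  thus ?thesis unfolding segl_props(2)[OF fin] crossed_def using z by blast
 qed
 have vv: "ALL w:set (segl W a b). fst w = v" using set z[of r] r by auto
 have "req (int k) (crs a b (segl W a b)) [crF v (wprod W (pt a b r)) (sgnc a b v)]"
  unfolding req_def rc_def using crs_single[OF okW v segl_props(1)[OF fin] set vv] by (auto simp: ract_def)
 with trp_seg[OF W ab sg] show ?thesis by (rule req_trans)
qed

lemma rc_snoc_crF:
 assumes "okrs r" "v \<in> posN J"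
 shows "rc (r @ [crF v F s]) m n = (\<Sum>i\<le>nat (dg n). rc r m (n - nsc i v) * fps_nth (fpow F (s * pairNo J d v (m + B n))) i)"
 by (simp add: rc_def[abs_def] ract_append) (simp add: ract_def rop_def ray_def crF_def)

lemma rc_single_crF:
 assumes "v \<in> posN J"
 shows "rc [crF v F s] m (nsc i v) = fps_nth (fpow F (s * pairNo J d v m)) i"
proof -
 have "rc ([] @ [crF v F s]) m (nsc i v) = (\<Sum>j\<le>nat (dg (nsc i v)). rc [] m (nsc i v - nsc j v) *
   fps_nth (fpow F (s * pairNo J d v (m + B (nsc i v)))) j)"
  by (rule rc_snoc_crF) (use assms in auto)
 also have "\<dots> = (\<Sum>j\<le>nat (dg (nsc i v)). if j = i then fps_nth (fpow F (s * pairNo J d v m)) i else 0)"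
  by (intro sum.cong refl) (use nsc_inj[OF assms] pairNo_add pairNo_self in "auto")
 also have "\<dots> = fps_nth (fpow F (s * pairNo J d v m)) i"
 proof -
  have "int i * 1 <= int i * dg v" using deg_pos1[OF assms] by (intro mult_left_mono) auto
  hence "i <= nat (dg (nsc i v))" by (simp add: degN_nsc)
  thus ?thesis by simp
 qed
 finally show ?thesis by simp
qed

subsection \<open>Uniqueness of consistent diagrams\<close>

text \<open>Lower coefficients of the transports agree at \<open>a\<close> and \<open>b\<close>,
  hence so do the coefficients of the two crossings below degree \<open>D\<close>. In degree
  \<open>D\<close> the products differ only through the term in which the crossing alone reaches n,
  and \<open>alt\<close> either excludes it or makes the wall functions equal.\<close>

lemma crossing_difference:
 fixes W W' :: "('i,'k::field_char_0) wall set" and D k :: nat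
 assumes W: "cons k W" "cons k W'" and c: "crossing W a b r v" "crossing W' a b r v" and v: "v \<in> posN J"
  and q: "q \<in> vecs J" "avoid W q" "avoid W' q" and ab: "avoid W a" "avoid W' a" "avoid W b" "avoid W' b"
  and IH: "req (int D) (trp W q a) (trp W' q a)" "req (int D) (trp W q b) (trp W' q b)" and Dk: "D < k"
  and m: "m \<in> latt J" and n: "dg n = int D" "n ~= 0"
  and alt: "(ALL s. n ~= nsc s v) \<or> wprod W (pt a b r) = wprod W' (pt a b r)"
 shows "rc (trp W q b) m n - rc (trp W' q b) m n = rc (trp W q a) m n - rc (trp W' q a) m n"
proof -
 let ?s = "sgnc a b v" and ?F = "wprod W (pt a b r)" and ?F' = "wprod W' (pt a b r)"
 have av: "a \<in> vecs J" "b \<in> vecs J" using c by (auto simp: crossing_def)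
 have ok: "okW W" "okW W'" using W by (auto simp: cons_def)
 have F0: "fps_nth ?F 0 = 1" "fps_nth ?F' 0 = 1" using ok wprod_0 by (auto simp: okW_def)
 have okc: "okr (crF v ?F ?s)" "okr (crF v ?F' ?s)" using okr_crF[OF v] F0 by auto
 have 1: "req (int k) (trp W q b) (trp W q a @ [crF v ?F ?s])"
  using trp_comp[OF W(1) q(1,2) av(1) ab(1) av(2) ab(3)]
   req_append[OF req_refl trp_crossing[OF W(1) c(1) v], of "trp W q a"] ok okc req_trans by auto
 have 2: "req (int k) (trp W' q b) (trp W' q a @ [crF v ?F' ?s])"
  using trp_comp[OF W(2) q(1,3) av(1) ab(2) av(2) ab(4)]
   req_append[OF req_refl trp_crossing[OF W(2) c(2) v], of "trp W' q a"] ok okc req_trans by auto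
 have Dk': "int D <= int k" using Dk by simp
 have "req (int D) (trp W q a @ [crF v ?F ?s]) (trp W' q a @ [crF v ?F' ?s])"
  by (rule req_trans[OF req_sym[OF req_mono[OF 1 Dk']] req_trans[OF IH(2) req_mono[OF 2 Dk']]])
 hence cr: "req (int D) [crF v ?F ?s] [crF v ?F' ?s]"
  by (rule req_cancel_left[OF _ IH(1)]) (use ok okc in auto)
 have FF: "fps_nth (fpow ?F (?s * pairNo J d v mu)) i = fps_nth (fpow ?F' (?s * pairNo J d v mu)) i"
  if "mu \<in> latt J" "int i * dg v < int D" for mu i
  using reqD[OF cr that(1), of "nsc i v"] that(2) by (simp add: rc_single_crF[OF v] degN_nsc)
 let ?e = "?s * pairNo J d v (m + B n)"
 have nk: "dg n < int k" using n Dk by simp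
 have "rc (trp W q b) m n - rc (trp W' q b) m n =
  (\<Sum>i\<le>nat (dg n). rc (trp W q a) m (n - nsc i v) * fps_nth (fpow ?F ?e) i -
    rc (trp W' q a) m (n - nsc i v) * fps_nth (fpow ?F' ?e) i)"
  using reqD[OF 1 m nk] reqD[OF 2 m nk] rc_snoc_crF[OF okrs_trp[OF ok(1)] v] rc_snoc_crF[OF okrs_trp[OF ok(2)] v]
  by (simp add: sum_subtractf)
 also have "\<dots> = (\<Sum>i\<le>nat (dg n). if i = 0 then rc (trp W q a) m n - rc (trp W' q a) m n else 0)"
 proof (intro sum.cong refl)
  fix i
  show "rc (trp W q a) m (n - nsc i v) * fps_nth (fpow ?F ?e) i - rc (trp W' q a) m (n - nsc i v) * fps_nth (fpow ?F' ?e) i =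
   (if i = 0 then rc (trp W q a) m n - rc (trp W' q a) m n else 0)"
  proof (cases "i = 0")
   case True
   thus ?thesis using fpow_nth_0[OF F0(1)] fpow_nth_0[OF F0(2)] by simp
  next
   case False
   hence dl: "dg (n - nsc i v) < int D" using deg_pos[OF v] n by (simp add: degN_diff degN_nsc)
   hence e: "rc (trp W q a) m (n - nsc i v) = rc (trp W' q a) m (n - nsc i v)" by (rule reqD[OF IH(1) m])
   show ?thesis
   proof (cases "int i * dg v < int D")
    case True
    thus ?thesis using FF[of "m + B n" i] m e False by simp
   next
    case F: False
    have "dg (n - nsc i v) < 1" using F n by (simp add: degN_diff degN_nsc)
    hence "rc (trp W' q a) m (n - nsc i v) = (if n = nsc i v then 1 else 0)"
     using rc_deg0[OF okrs_trp[OF ok(2)]] by simp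
    thus ?thesis using alt e False by auto
   qed
  qed
 qed
 also have "\<dots> = rc (trp W q a) m n - rc (trp W' q a) m n" by simp
 finally show ?thesis .
qed

end

lemma sign_trans: "0 < (a::real) * b ==> 0 < a * c ==> 0 < b * c"
 by (auto simp: zero_less_mult_iff)

context seed begin

definition nice :: "('i,'k::field) wall set => 'i vec => bool" where
 "nice W x \<longleftrightarrow> good_pt J d W x &
   (ALL w:W. ALL w':W. dot (nw w) x = 0 --> dot (nw w') x = 0 --> fst w = fst w')"

lemma nice_off_codim2:
 assumes "okW W"
 obtains Z where "finite Z" "\<forall>(h1,h2)\<in>Z. nz h1 & nz h2 & \<not> par h2 h1"
  "\<And>x. x \<in> vecs J ==> ALL h1 h2. (h1,h2) \<in> Z --> dot h1 x = 0 --> dot h2 x ~= 0 ==> nice W x"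
proof -
 obtain Z where Z: "finite Z" "\<forall>(h1,h2)\<in>Z. nz h1 & nz h2 & \<not> par h2 h1"
  "ALL x:vecs J. \<not> good_pt J d W x --> (\<exists>(h1,h2)\<in>Z. dot h1 x = 0 & dot h2 x = 0)"
  "ALL w:W. ALL w':W. fst w ~= fst w' --> (nw w, nw w') \<in> Z"
  using bad_set[of W] assms unfolding okW_def by blast
 have "nice W x" if x: "x \<in> vecs J" "ALL h1 h2. (h1,h2) \<in> Z --> dot h1 x = 0 --> dot h2 x ~= 0" for x
  unfolding nice_def using x Z(3,4) by blast
 thus ?thesis using that Z(1,2) by blast
qed

lemma seg_sign: "0 < dot h a * dot h b ==> 0 <= t ==> t <= 1 ==> 0 < dot h a * dot h (pt a b t)"
proof -
 assume a: "0 < dot h a * dot h b" "0 <= t" "t <= 1"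
 have e: "dot h a * dot h (pt a b t) = (1 - t) * (dot h a * dot h a) + t * (dot h a * dot h b)"
  by (simp add: dot_pt algebra_simps)
 have p: "0 < dot h a * dot h a" using a(1) by (auto simp: zero_less_mult_iff)
 show ?thesis
 proof (cases "t = 0")
  case False
  have "0 <= (1 - t) * (dot h a * dot h a)" "0 < t * (dot h a * dot h b)" using a p False by auto
  thus ?thesis unfolding e by simp
 qed (use p in simp)
qed

lemma crossing_mono: "crossing U a b r v ==> W \<subseteq> U ==> crossing W a b r v"
 unfolding crossing_def good_pt_def by blast

lemma crossingI:
 assumes ac: "a \<in> vecs J" "c \<in> vecs J" and st: "s < r" "r < t" and w: "w \<in> U" "dot (nw w) (pt a c r) = 0"
  and n: "nice U (pt a c r)"
  and o: "\<And>q w. s <= q ==> q <= t ==> w \<in> U ==> dot (nw w) (pt a c q) = 0 ==> q = r"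
 shows "crossing U (pt a c s) (pt a c t) ((r - s) / (t - s)) (fst w)"
 unfolding crossing_def pt_pt
proof (intro conjI ballI impI)
 have e: "s + (r - s) / (t - s) * (t - s) = r" using st by simp
 show "good_pt J d U (pt a c (s + (r - s) / (t - s) * (t - s)))" using n unfolding e nice_def by blast
 show "dot (nw w) (pt a c (s + (r - s) / (t - s) * (t - s))) = 0" unfolding e by (rule w)
 fix q :: real and w' assume q: "q \<in> {0..1}" "w' \<in> U" "dot (nw w') (pt a c (s + q * (t - s))) = 0"
 have "0 <= q * (t - s)" "q * (t - s) <= 1 * (t - s)" using q(1) st by (auto intro: mult_right_mono)
 hence qr: "s + q * (t - s) = r" using o[of "s + q * (t - s)" w'] q by simp
 thus "q = (r - s) / (t - s)" using st by (simp add: field_simps)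
 show "fst w' = fst w" using n w q unfolding qr nice_def by blast
qed (use st ac vecs_pt in auto)

text \<open>Both points are joined to a generic point near \<open>a\<close>, along segments that
  meet the hyperplanes of \<open>U\<close> one at a time and keep all signs of \<open>H\<close>. The
  hypotheses \<open>same\<close> and \<open>cross\<close> then treat the pieces.\<close>

lemma const_connect:
 fixes G :: "'i vec => 'x"
 assumes U: "okW U" and H: "finite H"
  and same: "\<And>a b. off U a ==> off U b ==> ALL w:U. 0 < dot (nw w) a * dot (nw w) b ==> G a = G b"
  and cross: "\<And>a b r w. off U a ==> off U b ==> w \<in> U ==> crossing U a b r (fst w) ==>
    ALL h:H. 0 < dot h a * dot h b ==> G a = G b"
  and ab: "off U a" "off U b" "ALL h:H. 0 < dot h a * dot h b"
 shows "G a = G b"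
proof -
 obtain Z where Z: "finite Z" "\<forall>(h1,h2)\<in>Z. nz h1 & nz h2 & \<not> par h2 h1"
  "\<And>x. x \<in> vecs J ==> ALL h1 h2. (h1,h2) \<in> Z --> dot h1 x = 0 --> dot h2 x ~= 0 ==> nice U x"
  by (rule nice_off_codim2[OF U]) blast
 obtain e where e: "0 < e" "\<And>y h. close e a y ==> h \<in> H ==> dot h a ~= 0 ==> 0 < dot h a * dot h y"
  by (rule sign_stable[OF H]) blast
 have av: "a \<in> vecs J" "b \<in> vecs J" using ab by (auto simp: off_def)
 let ?N = "(%w. nw w) ` U"
 have fs: "finite {a, b}" by simp
 obtain c where c: "c \<in> vecs J" "close e a c" "ALL h:?N. dot h c ~= 0"
  "\<And>x t h1 h2. x \<in> {a, b} ==> (h1,h2) \<in> Z ==> dot h1 (pt x c t) = 0 ==> dot h2 (pt x c t) = 0 ==> t = 0"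
  by (rule generic_point[OF Z(1,2) fs normals[OF U] av(1) e(1)]) blast
 have "G x = G c" if x: "x \<in> {a, b}" for x
 proof -
  have ox: "off U x" "x \<in> vecs J" using x ab av by auto
  have "0 < dot h a * dot h x & 0 < dot h a * dot h c" if h: "h \<in> H" for h
  proof -
   have "0 < dot h a * dot h b" using ab(3) h by blast
   moreover from this have "dot h a ~= 0" by auto
   moreover from this have "0 < dot h a * dot h a" by (simp add: zero_less_mult_iff linorder_neq_iff disj_commute)
   ultimately show ?thesis using x e(2)[OF c(2) h] by auto
  qed
  hence sg: "ALL h:H. 0 < dot h x * dot h c" using sign_trans by blast
  define X where "X = {t. EX h:?N. dot h (pt x c t) = 0}"
  have fX: "finite X" unfolding X_def
   by (rule line_zeros_finite) (use normals(1)[OF U] ox in "auto simp: off_def")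
  have X01: "0 \<notin> X" "1 \<notin> X" using ox c(3) by (auto simp: X_def off_def)
  have offX: "off U (pt x c t)" if "t \<notin> X" for t
   using that vecs_pt[OF ox(2) c(1)] by (auto simp: off_def X_def)
  have step: "G (pt x c s) = G (pt x c t)"
   if st: "0 <= s" "s < t" "t <= 1" "s \<notin> X" "t \<notin> X" "card (X \<inter> {s..t}) <= 1" for s t
  proof (cases "X \<inter> {s..t} = {}")
   case True
   have "0 < dot (nw w) (pt x c s) * dot (nw w) (pt x c t)" if w: "w \<in> U" for w
    by (rule no_zero_sign[OF st(2)]) (use st True w in "fastforce simp: X_def")+
   thus ?thesis using same offX st by blast
  next
   case False
   then obtain r where r: "r \<in> X" "s <= r" "r <= t" by auto
   have un: "q = r" if "q \<in> X" "s <= q" "q <= t" for q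
   proof -
    have "finite (X \<inter> {s..t})" using fX by simp
    thus ?thesis using card_le_Suc0_iff_eq[of "X \<inter> {s..t}"] st(6) r that by auto
   qed
   have sr: "s < r" "r < t" using r st by (auto simp: order.order_iff_strict)
   obtain w where w: "w \<in> U" "dot (nw w) (pt x c r) = 0" using r by (auto simp: X_def)
   have "nice U (pt x c r)"
    by (rule Z(3)[OF vecs_pt[OF ox(2) c(1)]]) (use c(4)[OF x] sr st(1) in fastforce)
   hence "crossing U (pt x c s) (pt x c t) ((r - s) / (t - s)) (fst w)"
    by (rule crossingI[OF ox(2) c(1) sr w]) (use un in "auto simp: X_def")
   moreover have "ALL h:H. 0 < dot h (pt x c s) * dot h (pt x c t)"
    using sg st seg_sign sign_trans by (meson less_eq_real_def order_trans)
   ultimately show ?thesis using cross offX st w by blast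
  qed
  have "G (pt x c 0) = G (pt x c 1)"
   by (rule finite_crossings[OF fX _ X01, of "%s t. G (pt x c s) = G (pt x c t)"]) (use step in "simp, metis, blast")
  thus ?thesis by simp
 qed
 thus ?thesis by auto
qed

subsection \<open>Uniqueness\<close>

text \<open>The base point of all transports. It lies in the open positive orthant, which no wall
  hyperplane meets because normals are positive vectors.\<close>

definition Qp :: "'i vec" where "Qp = (%i. if i \<in> J then 1 else 0)"

lemma Qp_vecs [simp]: "Qp \<in> vecs J" by (simp add: Qp_def vecs_def)

lemma positive_dot:
 assumes "n \<in> posN J" "ALL i:J. 0 < Q i"
 shows "0 < dot (nrm n) Q"
proof -
 have ge: "ALL i:J. 0 <= n i" using assms by (simp add: posN_def nonneg_def)
 have "EX i:J. n i ~= 0"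
 proof (rule ccontr)
  assume "\<not> ?thesis"
  hence "dg n = 0" by (simp add: degN_def)
  thus False using deg_pos[OF assms(1)] by simp
 qed
 then obtain j where j: "j \<in> J" "0 < n j" using ge by force
 have "0 < nrm n j * Q j" using j assms dpos by (simp add: nrm_def)
 thus ?thesis unfolding dot_def
  by (intro sum_pos2[OF finJ j(1)]) (use ge assms dpos in "auto simp: nrm_def less_imp_le intro!: divide_nonneg_nonneg mult_nonneg_nonneg")
qed

lemma Qp_pos: "n \<in> posN J ==> 0 < dot (nrm n) Qp"
 by (rule positive_dot) (auto simp: Qp_def)

lemma off_Qp: "okW W ==> off W Qp"
 unfolding off_def using Qp_pos is_wall_props(2) okW_wall by (metis Qp_vecs less_irrefl)

definition incW :: "('i,'k::field) wall set => bool" where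
 "incW W \<longleftrightarrow> (ALL w:W. w \<in> Din J \<or> outgoing J eps w)"

text \<open>Choose \<open>z\<close> generic on the hyperplane of \<open>v\<close> and close to B v.
  By closedness every wall through \<open>z\<close> contains B v, so it is not outgoing and must be
  incoming.\<close>

lemma crossing_near_incoming:
 fixes U :: "('i,'k::field_char_0) wall set"
 assumes U: "okW U" and v: "primN J v" and inc: "incW U"
 obtains a b where "off U a" "off U b" "crossing U a b (1/2) v" "0 < dot (nrm v) a" "dot (nrm v) b < 0"
  "ALL w:U. pt a b (1/2) \<in> cn w --> w \<in> Din J"
proof -
 have vp: "v \<in> posN J" using v by (simp add: primN_def)
 have nv: "nz (nrm v)" using nz_nrm[OF vp] .
 obtain Z where Z: "finite Z" "\<forall>(h1,h2)\<in>Z. nz h1 & nz h2 & \<not> par h2 h1"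
  "\<And>x. x \<in> vecs J ==> ALL h1 h2. (h1,h2) \<in> Z --> dot h1 x = 0 --> dot h2 x ~= 0 ==> nice U x"
  by (rule nice_off_codim2[OF U]) blast
 let ?x = "rv (B v)" and ?N = "(%w. nw w) ` U"
 have x: "?x \<in> vecs J" "dot (nrm v) ?x = 0" by (simp_all add: dot_pr) (simp add: rv_def vecs_def matB_def)
 obtain e where e: "0 < e" "\<And>y w. y \<in> vecs J ==> close e ?x y ==> w \<in> U ==> y \<in> cn w ==> ?x \<in> cn w"
  by (rule walls_closed[of U ?x]) (use U x in "auto simp: okW_def")
 define K where "K = {h \<in> fst ` Z \<union> snd ` Z \<union> ?N. \<not> par h (nrm v)}"
 have K: "finite K" "ALL h:K. \<not> par h (nrm v)" using Z(1) normals(1)[OF U] by (auto simp: K_def)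
 obtain z where z: "z \<in> vecs J" "close e ?x z" "dot (nrm v) z = 0" "ALL h:K. dot h z ~= 0"
  by (rule generic_near_in[OF K(1) nv K(2) x e(1)])
 have "nice U z"
 proof (rule Z(3)[OF z(1)], intro allI impI notI)
  fix h1 h2 assume h: "(h1,h2) \<in> Z" "dot h1 z = 0" "dot h2 z = 0"
  have "h1 \<in> fst ` Z" "h2 \<in> snd ` Z" using h(1) by force+
  hence "par h1 (nrm v)" "par h2 (nrm v)" using z(4) h(2,3) by (auto simp: K_def)
  moreover have "nz h1" "\<not> par h2 h1" using Z(2) h(1) by auto
  ultimately show False using par_trans par_sym by blast
 qed
 hence good: "good_pt J d U z" by (simp add: nice_def)
 have only: "fst w = v" if w: "w \<in> U" "dot (nw w) z = 0" for w
 proof -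
  have "par (nw w) (nrm v)" using z(4) w by (auto simp: K_def)
  thus ?thesis using par_prim[OF is_wall_props(1)[OF okW_wall[OF U w(1)]] v] by simp
 qed
 obtain j where j: "j \<in> J" "dot (nrm v) (uvec j) ~= 0" using nz_dot[OF nv] by blast
 obtain u where u: "u \<in> vecs J" "0 < dot (nrm v) u"
 proof (cases "0 < dot (nrm v) (uvec j)")
  case False
  hence "0 < dot (nrm v) (%i. (-1) * uvec j i)" unfolding dot_scale using j(2) by simp
  moreover have "(%i. (-1) * uvec j i) \<in> vecs J" using uvec_vecs[OF j(1)] by (auto simp: vecs_def)
  ultimately show ?thesis using that by blast
 qed (use that uvec_vecs[OF j(1)] in blast)
 obtain g where g: "0 < g" "\<And>y h. close g z y ==> h \<in> ?N ==> dot h z ~= 0 ==> 0 < dot h z * dot h y"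
  by (rule sign_stable[OF normals(1)[OF U]]) blast
 obtain t1 where t1: "0 < t1" "\<And>t. 0 < t ==> t < t1 ==> close g z (%i. z i + t * u i)"
  by (rule close_line[OF g(1), of z u]) blast
 let ?t = "t1 / 2"
 let ?a = "%i. z i + ?t * u i" and ?b = "%i. z i + (- ?t) * u i"
 have cl: "close g z (%i. z i + q * u i)" if "\<bar>q\<bar> <= ?t" for q
  unfolding close_def
 proof
  fix i assume i: "i \<in> J"
  have "\<bar>q * u i\<bar> <= ?t * \<bar>u i\<bar>" unfolding abs_mult by (rule mult_right_mono[OF that]) simp
  also have "\<dots> < g" using t1(2)[of ?t] t1(1) i by (auto simp: close_def abs_mult)
  finally show "\<bar>z i + q * u i - z i\<bar> < g" by simp
 qed
 have pt: "pt ?a ?b q = (%i. z i + ((1 - 2 * q) * ?t) * u i)" for q by (auto simp: pt_def fun_eq_iff algebra_simps)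
 have vu: "(%i. z i + q * u i) \<in> vecs J" for q using z u by (auto simp: vecs_def)
 have dt: "dot (nrm v) (%i. z i + q * u i) = q * dot (nrm v) u" for q by (simp add: dot_add dot_scale z)
 have zero: "q = 0 & fst w = v" if w: "w \<in> U" "dot (nw w) (%i. z i + q * u i) = 0" and q: "\<bar>q\<bar> <= ?t" for q w
 proof -
  have v: "fst w = v" using only[OF w(1)] g(2)[OF cl[OF q], of "nw w"] w by fastforce
  thus ?thesis using w(2) dt u by simp
 qed
 have off: "off U (%i. z i + q * u i)" if "\<bar>q\<bar> <= ?t" "q ~= 0" for q
  using zero that vu by (auto simp: off_def)
 have cr: "crossing U ?a ?b (1/2) v"
  unfolding crossing_def pt
 proof (intro conjI ballI impI)
  fix q :: real and w assume q: "q \<in> {0..1}" "w \<in> U" "dot (nw w) (%i. z i + (1 - 2 * q) * (t1 / 2) * u i) = 0"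
  have "\<bar>1 - 2 * q\<bar> * ?t <= 1 * ?t" using q t1 by (intro mult_right_mono) auto
  hence "\<bar>(1 - 2 * q) * ?t\<bar> <= ?t" using t1 by (simp add: abs_mult)
  note zero[OF q(2,3) this]
  thus "q = 1/2" "fst w = v" using t1 by auto
 qed (use vu[of ?t] vu[of "- ?t"] good z(3) in auto)
 have Din: "ALL w:U. pt ?a ?b (1/2) \<in> cn w --> w \<in> Din J"
 proof (intro ballI impI)
  fix w assume w: "w \<in> U" "pt ?a ?b (1/2) \<in> cn w"
  have "pt ?a ?b (1/2) = z" unfolding pt by simp
  hence zw: "z \<in> cn w" using w(2) by (simp only:)
  have "fst w = v" using only[OF w(1)] wall_perp[OF okW_wall[OF U w(1)] zw] by blast
  hence "\<not> outgoing J eps w" using e(2)[OF z(1,2) w(1) zw] by (simp add: outgoing_def rv_def)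
  thus "w \<in> Din J" using inc w(1) by (auto simp: incW_def)
 qed
 have "0 < dot (nrm v) ?a" "dot (nrm v) ?b < 0" unfolding dt using t1(1) u(2) by (auto simp: mult_neg_pos)
 moreover have "off U ?a" "off U ?b" by (rule off; use t1(1) in simp)+
 ultimately show ?thesis using that cr Din by blast
qed

lemma wprod_cong:
 assumes "ALL w:W \<union> W'. z \<in> cn w --> w \<in> Din J" "W \<inter> Din J = W' \<inter> Din J"
 shows "wprod W z = wprod W' z"
proof -
 have "{w\<in>W. z \<in> cn w} = {w\<in>W'. z \<in> cn w}" using assms by blast
 thus ?thesis by (simp add: wprod_def)
qed

text \<open>For fixed n the discrepancy \<open>G\<close> is constant on each side of the hyperplane
  of the primitive vector v of n. The base point makes it 0 on the positive side, and the crossing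
  near B v, where both diagrams have the same walls, carries this value to the other side.\<close>

theorem transport_unique:
 fixes W W' :: "('i,'k::field_char_0) wall set" and k D :: nat
 assumes W: "cons k W" "cons k W'" and inc: "incW W" "incW W'" and Din: "W \<inter> Din J = W' \<inter> Din J"
 shows "D <= k ==> ALL Q. off (W \<union> W') Q --> req (int D) (trp W Qp Q) (trp W' Qp Q)"
proof (induction D)
 case 0
 have "okW W" "okW W'" using W by (auto simp: cons_def)
 thus ?case by (auto intro: req_1)
next
 case (Suc D)
 let ?U = "W \<union> W'"
 have ok: "okW W" "okW W'" "okW ?U" using W by (auto simp: cons_def okW_def)
 have IH: "\<And>Q. off ?U Q ==> req (int D) (trp W Qp Q) (trp W' Qp Q)" using Suc by simp
 have Dk: "D < k" using Suc by simp
 have av: "q \<in> vecs J" "avoid W q" "avoid W' q" if "off ?U q" for q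
  using that off_avoid[OF ok(3) that] by (auto simp: off_def avoid_def)
 note avQ = av[OF off_Qp[OF ok(3)]]
 show ?case unfolding req_def
 proof (intro allI impI ballI)
  fix Q m n assume Q: "off ?U Q" and m: "m \<in> latt J" and "dg n < int (Suc D)"
  then consider "dg n < int D" | "n = 0" | "n \<notin> nonneg J" | "dg n = int D" "n \<in> posN J" by (force simp: posN_def)
  thus "rc (trp W Qp Q) m n = rc (trp W' Qp Q) m n"
  proof cases
   case 1
   thus ?thesis using reqD[OF IH[OF Q] m] by simp
  next
   case 4
   have nk: "dg n < int k" using 4 Dk by simp
   obtain v j where v: "primN J v" "0 < j" "n = nsc j v" by (rule prim_decomp[OF 4(2)])
   have n0: "n ~= 0" using 4 by (auto simp: posN_def)
   define G where "G Q = rc (trp W Qp Q) m n - rc (trp W' Qp Q) m n" for Q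
   have same: "G a = G b" if o: "off ?U a" "off ?U b" and s: "ALL w:?U. 0 < dot (nw w) a * dot (nw w) b" for a b
   proof -
    have "rc (trp V Qp b) m n = rc (trp V Qp a) m n" if V: "V \<in> {W, W'}" for V
    proof -
     have cV: "cons k V" "okW V" using V W ok by auto
     have "req (int k) (trp V Qp b) (trp V Qp a @ trp V a b)"
      by (rule trp_comp[OF cV(1)]) (use av[OF o(1)] av[OF o(2)] avQ V in auto)
     moreover have "req (int k) (trp V Qp a @ trp V a b) (trp V Qp a @ [])"
      by (rule req_append[OF req_refl trp_same_side[OF cV(1)]]) (use av[OF o(1)] av[OF o(2)] V s cV in auto)
     ultimately show ?thesis using req_trans reqD[OF _ m nk] by fastforce
    qed
    thus ?thesis by (simp add: G_def)
   qed
   have cr: "G a = G b" if o: "off ?U a" "off ?U b" and c: "crossing ?U a b r u" and u: "u \<in> posN J"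
    and alt: "(ALL s. n ~= nsc s u) \<or> wprod W (pt a b r) = wprod W' (pt a b r)" for a b r u
    unfolding G_def
    by (rule sym, rule crossing_difference[OF W crossing_mono[OF c] crossing_mono[OF c] u avQ])
     (use av[OF o(1)] av[OF o(2)] IH[OF o(1)] IH[OF o(2)] Dk m 4 n0 alt in auto)
   have npar: "n ~= nsc s (fst w)" if w: "w \<in> ?U" "fst w ~= v" for s w
   proof
    assume e: "n = nsc s (fst w)"
    have "s ~= 0"
    proof
     assume "s = 0"
     thus False using e n0 by simp
    qed
    moreover have "nsc s (fst w) = nsc j v" using e v(3) by simp
    ultimately show False using prim_unique[OF is_wall_props(1)[OF okW_wall[OF ok(3) w(1)]] v(1), of s j] v(2) w(2) by blast
   qed
   \<comment> \<open>If no wall has normal \<open>v\<close>, there is nothing that could change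
     \<open>G\<close> and it is constant throughout.\<close>
   have con: "G a = G b" if o: "off ?U a" "off ?U b" and s: "v \<in> fst ` ?U ==> 0 < dot (nrm v) a * dot (nrm v) b" for a b
   proof (rule const_connect[OF ok(3), where H = "if v \<in> fst ` ?U then {nrm v} else {}"])
    fix a b r w
    assume o: "off ?U a" "off ?U b" and w: "w \<in> ?U" and c: "crossing ?U a b r (fst w)"
     and h: "ALL h:if v \<in> fst ` ?U then {nrm v} else {}. 0 < dot h a * dot h b"
    have "fst w ~= v"
    proof
     assume wv: "fst w = v"
     hence h': "0 < dot (nrm v) a * dot (nrm v) b" using h w by (metis image_eqI insertI1)
     have "0 < dot (nrm v) a * dot (nrm v) (pt a b r)" using seg_sign[OF h'] c by (auto simp: crossing_def)
     thus False using c wv by (simp add: crossing_def)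
    qed
    thus "G a = G b" using cr[OF o c is_wall_props(2)[OF okW_wall[OF ok(3) w]]] npar[OF w] by blast
   qed (use same o s in auto)
   have "G Q = G Qp"
   proof (cases "v \<in> fst ` ?U & dot (nrm v) Q < 0")
    case True
    have "incW ?U" using inc by (auto simp: incW_def)
    then obtain a b where ab: "off ?U a" "off ?U b" "crossing ?U a b (1/2) v" "0 < dot (nrm v) a" "dot (nrm v) b < 0"
     "ALL w:?U. pt a b (1/2) \<in> cn w --> w \<in> Din J"
     by (rule crossing_near_incoming[OF ok(3) v(1)])
    have vp: "v \<in> posN J" using v(1) by (simp add: primN_def)
    have "G Q = G b" by (rule con[OF Q ab(2)]) (use True ab mult_neg_neg in auto)
    also have "\<dots> = G a" using cr[OF ab(1,2,3) vp] wprod_cong[OF ab(6) Din] by simp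
    also have "\<dots> = G Qp" by (rule con[OF ab(1) off_Qp[OF ok(3)]]) (use ab Qp_pos[OF vp] in auto)
    finally show ?thesis .
   next
    case False
    show ?thesis
    proof (rule con[OF Q off_Qp[OF ok(3)]])
     assume vU: "v \<in> fst ` ?U"
     hence "dot (nrm v) Q ~= 0" using Q by (auto simp: off_def)
     hence "0 < dot (nrm v) Q" using False vU by auto
     thus "0 < dot (nrm v) Q * dot (nrm v) Qp" using Qp_pos v(1) by (auto simp: primN_def)
    qed
   qed
   also have "G Qp = 0"
    using reqD[OF trp_refl[OF W(1) Qp_vecs] m nk] reqD[OF trp_refl[OF W(2) Qp_vecs] m nk] by (simp add: G_def)
   finally show ?thesis by (simp add: G_def)
  qed (use ok in "simp_all add: rc_0 rc_neg")
 qed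
qed

subsection \<open>Transport of theta series\<close>

text \<open>In the expansion at \<open>n\<close> a lower exponent contributes equally to both sides,
  and any other exponent of degree at least dg n is multiplied by a coefficient of degree below 1,
  which is 0 except for \<open>n\<close> itself, where it is 1.\<close>

lemma ract_unipotent:
 assumes rs: "okrs rs" and s: "sup0 J s" "sup0 J s'" and low: "\<And>a. dg a < dg n ==> s a = s' a"
 shows "ract rs m s n - ract rs m s' n = s n - s' n"
proof -
 have "ract rs m s n - ract rs m s' n = (\<Sum>a\<in>Nk (dg n + 1). (s a - s' a) * rc rs (m + B a) (n - a))"
  using ract_expand[OF rs s(1), of n "dg n + 1" m] ract_expand[OF rs s(2), of n "dg n + 1" m]
  by (simp add: sum_subtractf left_diff_distrib)
 also have "\<dots> = (\<Sum>a\<in>Nk (dg n + 1). if a = n then s n - s' n else 0)"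
 proof (rule sum.cong[OF refl])
  fix a assume a: "a \<in> Nk (dg n + 1)"
  show "(s a - s' a) * rc rs (m + B a) (n - a) = (if a = n then s n - s' n else 0)"
  proof (cases "dg a < dg n")
   case True
   thus ?thesis using low by auto
  next
   case False
   hence "dg (n - a) < 1" by (simp add: degN_diff)
   thus ?thesis using rc_deg0[OF rs] by auto
  qed
 qed
 also have "\<dots> = (if n \<in> Nk (dg n + 1) then s n - s' n else 0)" by simp
 also have "\<dots> = s n - s' n" using sup0_0[OF s(1)] sup0_0[OF s(2)] by (auto simp: Nk_def)
 finally show ?thesis .
qed

lemma off_facts: "okW W ==> off W x ==> x \<in> vecs J & avoid W x"
 using off_avoid by (auto simp: off_def)

text \<open>If \<open>s\<close> is the expansion of a function at base points in the positive
  orthant, this is its expansion at the base point \<open>Q\<close>.\<close>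

definition FF :: "('i,'k::field) wall set => 'i lat => ('i,'k) zser => 'i vec => ('i,'k) zser" where
 "FF W m s Q = ract (trp W Qp Q) m s"

lemma FF_comp:
 assumes W: "cons k W" and m: "m \<in> latt J" and s: "sup0 J s" and ab: "off W a" "off W b" and n: "dg n < int k"
 shows "FF W m s b n = ract (trp W a b) m (FF W m s a) n"
proof -
 have ok: "okW W" using W by (simp add: cons_def)
 note f = off_facts[OF ok ab(1)] off_facts[OF ok ab(2)] off_facts[OF ok off_Qp[OF ok]]
 have "req (int k) (trp W Qp b) (trp W Qp a @ trp W a b)" by (rule trp_comp[OF W]) (use f in auto)
 from req_ract[OF this _ _ m s n] show ?thesis using ok by (simp add: FF_def ract_append)
qed

lemma FF_sup0: "okW W ==> sup0 J s ==> sup0 J (FF W m s Q)"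
 unfolding FF_def by (rule ract_sup0) auto

lemma FF_same:
 assumes W: "cons k W" and m: "m \<in> latt J" and s: "sup0 J s" and ab: "off W a" "off W b" and n: "dg n < int k"
  and sg: "ALL w:W. 0 < dot (nw w) a * dot (nw w) b"
 shows "FF W m s a n = FF W m s b n"
proof -
 have ok: "okW W" using W by (simp add: cons_def)
 note f = off_facts[OF ok ab(1)] off_facts[OF ok ab(2)]
 have "req (int k) (trp W a b) []" by (rule trp_same_side[OF W]) (use f sg in auto)
 from req_ract[OF this _ _ m FF_sup0[OF ok s] n] show ?thesis using FF_comp[OF W m s ab n] ok by simp
qed

lemma FF_cross:
 assumes W: "cons k W" and m: "m \<in> latt J" and s: "sup0 J s" and ab: "off W a" "off W b" and n: "dg n < int k"
  and c: "crossing W a b r v" and v: "v \<in> posN J"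
 shows "FF W m s b n = (\<Sum>i\<le>nat (dg n). FF W m s a (n - nsc i v) *
   fps_nth (fpow (wprod W (pt a b r)) (sgnc a b v * pairNo J d v (m + B n))) i)"
proof -
 have ok: "okW W" using W by (simp add: cons_def)
 have F0: "fps_nth (wprod W (pt a b r)) 0 = 1" using ok wprod_0 by (auto simp: okW_def)
 from req_ract[OF trp_crossing[OF W c v] _ _ m FF_sup0[OF ok s] n] okr_crF[OF v F0] FF_comp[OF W m s ab n] ok
 show ?thesis by (simp add: ract_def rop_def ray_def crF_def)
qed

text \<open>The chambers whose closure contains the direction \<open>mu\<close>.\<close>

definition NC :: "('i,'k) wall set => 'i lat => 'i vec => bool" where
 "NC W mu Q \<longleftrightarrow> off W Q & (ALL w:W. dot (nw w) (rv mu) ~= 0 --> 0 < dot (nw w) (rv mu) * dot (nw w) Q)"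

lemma NC_ex:
 assumes "okW W" "mu \<in> latt J" obtains Q where "NC W mu Q"
proof -
 let ?N = "(%w. nw w) ` W"
 have x: "rv mu \<in> vecs J" using assms(2) by (auto simp: rv_def vecs_def latt_def)
 obtain e where e: "0 < e" "\<And>y h. close e (rv mu) y ==> h \<in> ?N ==> dot h (rv mu) ~= 0 ==> 0 < dot h (rv mu) * dot h y"
  by (rule sign_stable[OF normals(1)[OF assms(1)]]) blast
 obtain Q where "Q \<in> vecs J" "close e (rv mu) Q" "ALL h:?N. dot h Q ~= 0"
  by (rule generic_near[OF normals[OF assms(1)] x e(1)])
 hence "NC W mu Q" using e(2) by (auto simp: NC_def off_def)
 thus ?thesis by (rule that)
qed

lemma pairNo_dot: "pairNo J d v mu = 0 \<longleftrightarrow> dot (nrm v) (rv mu) = 0"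
 by (simp add: pairNo_eq_0_iff dot_pr pr_eq_0_iff)

text \<open>Between two chambers near m + nB only hyperplanes containing m + nB are crossed. There
  the power of the wall function at the exponent n is 0, so the coefficient at n does not
  change.\<close>

lemma FF_const:
 fixes W :: "('i,'k::field_char_0) wall set"
 assumes W: "cons k W" and m: "m \<in> latt J" and s: "sup0 J s" and ab: "NC W (m + B n) a" "NC W (m + B n) b" and n: "dg n < int k"
 shows "FF W m s a n = FF W m s b n"
proof (rule const_connect[where U = W and H = "{h \<in> (%w. nw w) ` W. dot h (rv (m + B n)) ~= 0}"])
 have ok: "okW W" using W by (simp add: cons_def)
 thus "okW W" "finite {h \<in> (%w. nw w) ` W. dot h (rv (m + B n)) ~= 0}" by (auto simp: okW_def)
 show "off W a" "off W b" using ab by (auto simp: NC_def)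
 show "ALL h:{h \<in> (%w. nw w) ` W. dot h (rv (m + B n)) ~= 0}. 0 < dot h a * dot h b"
  using ab sign_trans unfolding NC_def by blast
 fix a b r w assume o: "off W a" "off W b" and w: "w \<in> W" and c: "crossing W a b r (fst w)"
  and h: "ALL h:{h \<in> (%w. nw w) ` W. dot h (rv (m + B n)) ~= 0}. 0 < dot h a * dot h b"
 have "dot (nw w) (rv (m + B n)) = 0"
 proof (rule ccontr)
  assume "\<not> ?thesis"
  hence "0 < dot (nw w) a * dot (nw w) b" using h w by blast
  from seg_sign[OF this, of r] show False using c by (auto simp: crossing_def)
 qed
 hence "FF W m s b n = (\<Sum>i\<le>nat (dg n). if i = 0 then FF W m s a (n - nsc i (fst w)) else 0)"
  using FF_cross[OF W m s o n c is_wall_props(2)[OF okW_wall[OF ok w]]] pairNo_dot[of "fst w" "m + B n"]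
  by (simp add: if_distrib cong: if_cong)
 thus "FF W m s a n = FF W m s b n" by simp
qed (use FF_same[OF W m s _ _ n] in blast)

text \<open>A description of theta functions without broken lines. Traced backwards, a broken line
  with final exponent m + nB moves in the direction m + nB; if it ends in a chamber near this
  direction, it meets no wall, so it never bent and n = 0.\<close>

definition tseries :: "('i,'k::field_char_0) wall set => nat => 'i lat => ('i,'k) zser => bool" where
 "tseries W k m s \<longleftrightarrow> sup0 J s & s 0 = 1 &
   (ALL n:posN J. dg n < int k --> (ALL Q. NC W (m + B n) Q --> FF W m s Q n = 0))"

lemma latt_muB: "m \<in> latt J ==> m + B n \<in> latt J" by (auto simp: latt_def matB_def fun_app)

text \<open>Degree by degree, the unwanted coefficient at a representative chamber
  \<open>R n\<close> is subtracted from the series. By unipotence the transported coefficient drops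
  by exactly this amount, and by \<open>FF_const\<close> one representative suffices.\<close>

lemma tseries_ex:
 fixes W :: "('i,'k::field_char_0) wall set" and D :: nat
 assumes W: "cons k W" and m: "m \<in> latt J"
 shows "D <= k ==> EX s. tseries W D m s"
proof (induction D)
 case 0
 have "sup0 J (delta 0 :: ('i,'k) zser)" by (rule sup0_delta) (simp add: nonneg_def latt_def fun_app)
 hence "tseries W 0 m (delta 0)" unfolding tseries_def using deg_pos by (fastforce simp: delta_def)
 thus ?case by blast
next
 case (Suc D)
 have ok: "okW W" using W by (simp add: cons_def)
 obtain s where s: "tseries W D m s" using Suc by auto
 have s0: "sup0 J s" "s 0 = 1" using s by (auto simp: tseries_def)
 define R where "R n = (SOME Q. NC W (m + B n) Q)" for n
 have R: "NC W (m + B n) (R n)" for n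
 proof -
  have "EX Q. NC W (m + B n) Q" by (rule NC_ex[OF ok latt_muB[OF m]]) blast
  thus ?thesis unfolding R_def by (rule someI_ex)
 qed
 define s' where "s' = (%n. if dg n = int D & n \<in> posN J then s n - FF W m s (R n) n else s n)"
 have s'0: "sup0 J s'" using s0 posN_nonneg by (auto simp: sup0_def s'_def)
 have low: "FF W m s' Q n - FF W m s Q n = s' n - s n" if "dg n <= int D" for Q n
  unfolding FF_def by (rule ract_unipotent) (use that s0 s'0 ok in "auto simp: s'_def")
 have "FF W m s' Q n = 0" if n: "n \<in> posN J" "dg n < int (Suc D)" and Q: "NC W (m + B n) Q" for n Q
 proof (cases "dg n = int D")
  case True
  have "FF W m s Q n = FF W m s (R n) n" by (rule FF_const[OF W m s0(1) Q R]) (use True Suc in auto)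
  thus ?thesis using low[of n Q] True n by (simp add: s'_def)
 next
  case False
  hence "FF W m s Q n = 0" using s n Q by (auto simp: tseries_def)
  thus ?thesis using low[of n Q] n False by (simp add: s'_def)
 qed
 hence "tseries W (Suc D) m s'" using s0 s'0 by (auto simp: tseries_def s'_def posN_def)
 thus ?case by blast
qed

text \<open>At a lowest disagreement n take a chamber near m + nB for both diagrams together. The
  two transports to it agree, both transported coefficients vanish there, and unipotence carries the
  equality back to the base point. Incoming walls have degree 1, whence the condition 1 < k.\<close>

lemma tseries_unique:
 fixes W W' :: "('i,'k::field_char_0) wall set" and k :: nat
 assumes W: "cons k W" "cons k W'" and inc: "incW W" "incW W'" and Din: "1 < k ==> W \<inter> Din J = W' \<inter> Din J"
  and m: "m \<in> latt J" and s: "tseries W k m s" "tseries W' k m s'"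
 shows "dg n < int k ==> s n = s' n"
proof (induction "nat (dg n)" arbitrary: n rule: less_induct)
 case less
 have s0: "sup0 J s" "sup0 J s'" "s 0 = 1" "s' 0 = 1" using s by (auto simp: tseries_def)
 consider "n = 0" | "n \<notin> nonneg J" | "n \<in> posN J" by (auto simp: posN_def)
 thus ?case
 proof cases
  case 3
  have ok: "okW W" "okW W'" "okW (W \<union> W')" using W by (auto simp: cons_def okW_def)
  have k1: "1 < k" using deg_pos1[OF 3] less by linarith
  obtain Q where Q: "NC (W \<union> W') (m + B n) Q" by (rule NC_ex[OF ok(3) latt_muB[OF m]])
  have Q': "NC W (m + B n) Q" "NC W' (m + B n) Q" using Q by (auto simp: NC_def off_def)
  have "req (int k) (trp W Qp Q) (trp W' Qp Q)"
   using transport_unique[OF W inc Din[OF k1], of k] Q by (auto simp: NC_def)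
  from req_ract[OF this _ _ m s0(2) less(2)] have "FF W m s' Q n = FF W' m s' Q n" using ok by (simp add: FF_def)
  hence "FF W m s Q n - FF W m s' Q n = 0" using s 3 less(2) Q' by (simp add: tseries_def)
  moreover have "FF W m s Q n - FF W m s' Q n = s n - s' n"
   unfolding FF_def
  proof (rule ract_unipotent)
   fix a assume "dg a < dg n"
   thus "s a = s' a" using less(1)[of a] less(2) deg_pos[OF 3] by auto
  qed (use s0 ok in auto)
  ultimately show ?thesis by simp
 qed (use s0 sup0_0[OF s0(1)] sup0_0[OF s0(2)] in auto)
qed

lemma cons_mono: "cons k W ==> l <= k ==> cons l W"
 by (fastforce simp: cons_def consistent_k_def)

lemma tseries_mono: "tseries W k m s ==> l <= k ==> tseries W l m s"
 by (auto simp: tseries_def)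

lemma clusterSD_Dk:
 fixes D :: "('i,'k::field) wall set"
 assumes "clusterSD J d eps D"
 shows "cons k (Dk J D k)" "incW (Dk J D k)" "1 < k ==> Dk J D k \<inter> Din J = Din J"
proof -
 show "cons k (Dk J D k)" "incW (Dk J D k)" using assms by (auto simp: cons_def okW_def incW_def clusterSD_def Dk_def)
 assume k: "1 < k"
 have "ntriv J k w" if w: "w \<in> Din J" for w :: "('i,'k) wall"
 proof -
  obtain i where i: "i \<in> J" "w = (unitv i, {x \<in> vecs J. x i = 0}, 1 + fps_X)" using w unfolding Din_def by blast
  have "dg (unitv i) = 1" using i(1) finJ by (simp add: degN_def unitv_def)
  thus ?thesis using i k by (auto simp: ntriv_def intro!: exI[of _ 1])
 qed
 thus "Dk J D k \<inter> Din J = Din J" using assms unfolding clusterSD_def Dk_def by blast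
qed

text \<open>The coefficient at n is taken from the truncation of \<open>SD\<close> just beyond
  degree dg n; uniqueness makes these choices fit together and compares them with any other
  diagram.\<close>

theorem theta_series_ex:
 assumes m: "m \<in> latt J"
 obtains s :: "('i,'k::field_char_0) zser" where "sup0 J s" "s 0 = 1"
  "\<And>(D :: ('i,'k) wall set) k. clusterSD J d eps D ==> EX g. tseries (Dk J D k) k m g & (ALL n. dg n < int k --> g n = s n)"
proof -
 let ?W = "%k. Dk J (SD :: ('i,'k) wall set) k"
 have "ALL k. EX s. tseries (?W k) k m s" using tseries_ex[OF clusterSD_Dk(1)[OF clusterSD_exists] m] by blast
 then obtain f where f: "\<And>k. tseries (?W k) k m (f k)" by metis
 define s where "s n = f (nat (dg n) + 1) n" for n
 have s: "sup0 J s" "s 0 = 1" using f by (auto simp: s_def tseries_def sup0_def)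
 have "EX g. tseries (Dk J D k) k m g & (ALL n. dg n < int k --> g n = s n)"
  if D: "clusterSD J d eps D" for D :: "('i,'k) wall set" and k
 proof -
  obtain g where g: "tseries (Dk J D k) k m g" using tseries_ex[OF clusterSD_Dk(1)[OF D] m] by blast
  have "g n = s n" if n: "dg n < int k" for n
  proof (cases "0 <= dg n")
   case True
   define l where "l = nat (dg n) + 1"
   have l: "l <= k" "dg n < int l" using n True by (auto simp: l_def)
   have "g n = f l n"
    by (rule tseries_unique[OF cons_mono[OF clusterSD_Dk(1)[OF D] l(1)] clusterSD_Dk(1)[OF clusterSD_exists]
       clusterSD_Dk(2)[OF D] clusterSD_Dk(2)[OF clusterSD_exists] _ m tseries_mono[OF g l(1)] f l(2)])
     (use clusterSD_Dk(3)[OF D] clusterSD_Dk(3)[OF clusterSD_exists, of l] l(1) in auto)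
   thus ?thesis by (simp add: s_def l_def)
  next
   case False
   thus ?thesis using sup0_deg[OF s(1)] sup0_deg g by (fastforce simp: tseries_def)
  qed
  thus ?thesis using g by blast
 qed
 thus ?thesis using that s by blast
qed

subsection \<open>Broken lines\<close>

definition bl_seg :: "('i,'k::field) wall set => 'i lat => 'i vec => (real \<times> 'k \<times> 'i lat) list => nat => bool" where
 "bl_seg W m Q L j \<longleftrightarrow> (ALL t. t <= bl_t L (j + 1) & (j = 0 \<or> bl_t L j <= t) -->
    good_pt J d W (%i. bl_P J eps m Q L (j + 1) i + (bl_t L (j + 1) - t) * real_of_int (bl_mu J eps m L j i)))"

definition bend :: "('i,'k::field) wall set => 'i lat => 'i vec => 'i lat => 'k => 'i lat => 'k => bool" where
 "bend W m P n' c' n c \<longleftrightarrow> (\<exists>n0 (s::nat). 0 < s & (ALL w:W. P \<in> cn w --> fst w = n0) &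
    n = n' + (%i. int s * n0 i) &
    c = c' * fps_nth (\<Prod>w\<in>{w\<in>W. P \<in> cn w}. fpow (fn w) \<bar>pairNo J d n0 (m + B n')\<bar>) s & c ~= 0)"

lemma brokenline_iff:
 "brokenline J d eps W m Q L \<longleftrightarrow> sorted_wrt (<) (map fst L) & (ALL x:set L. fst x < 0) &
   (\<forall>j\<le>length L. bl_seg W m Q L j) &
   (ALL j:{1..length L}. bend W m (bl_P J eps m Q L j) (bl_n L (j - 1)) (bl_c L (j - 1)) (bl_n L j) (bl_c L j))"
 unfolding brokenline_def bl_seg_def bend_def bl_mu_def ..

text \<open>Prolongs a line that ended at time 0 by a bend there and a further segment of duration
  t. All earlier times are shifted by t so that the new end is again at time 0.\<close>

definition bl_ext :: "real => 'k => 'i lat => (real \<times> 'k \<times> 'i lat) list => (real \<times> 'k \<times> 'i lat) list" where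
 "bl_ext t c n L = map (%x. (fst x - t, snd x)) L @ [(- t, c, n)]"

lemma bl_ext_coords:
 "length (bl_ext t c n L) = Suc (length L)"
 "1 <= j ==> j <= Suc (length L) ==> bl_t (bl_ext t c n L) j = bl_t L j - t"
 "bl_t (bl_ext t c n L) (Suc (Suc (length L))) = 0"
 "j <= length L ==> bl_n (bl_ext t c n L) j = bl_n L j" "bl_n (bl_ext t c n L) (Suc (length L)) = n"
 by (auto simp: bl_ext_def bl_t_def bl_n_def nth_append)

lemma bl_ext_c: "j <= length L ==> bl_c (bl_ext t c n L) j = bl_c L j" "bl_c (bl_ext t c n L) (Suc (length L)) = c"
 by (auto simp: bl_ext_def bl_c_def nth_append)

text \<open>Velocities are the negatives of exponents, so the old end point lies at x + t (m + nB),
  and the earlier bending points are unchanged.\<close>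

lemma bl_ext_P:
 assumes "1 <= j" "j <= Suc (length L)"
 shows "bl_P J eps m x (bl_ext t c n L) j = bl_P J eps m (%i. x i + t * rv (m + B n) i) L j"
proof
 fix i
 let ?E = "bl_ext t c n L"
 have "(\<Sum>l\<in>{j..Suc (length L)}. (bl_t ?E (l + 1) - bl_t ?E l) * real_of_int (bl_mu J eps m ?E l i)) =
  (\<Sum>l\<in>{j..length L}. (bl_t ?E (l + 1) - bl_t ?E l) * real_of_int (bl_mu J eps m ?E l i)) + t * rv (m + B n) i"
  using assms(2) by (simp add: bl_ext_coords bl_mu_def rv_def bl_t_def[of L])
 also have "(\<Sum>l\<in>{j..length L}. (bl_t ?E (l + 1) - bl_t ?E l) * real_of_int (bl_mu J eps m ?E l i)) =
  (\<Sum>l\<in>{j..length L}. (bl_t L (l + 1) - bl_t L l) * real_of_int (bl_mu J eps m L l i))"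
  by (rule sum.cong[OF refl]) (use assms(1) in "simp add: bl_ext_coords bl_mu_def")
 finally show "bl_P J eps m x ?E j i = bl_P J eps m (%i. x i + t * rv (m + B n) i) L j i"
  by (simp add: bl_P_def bl_ext_coords)
qed

lemma bl_ext_end: "bl_P J eps m x (bl_ext t c n L) (Suc (Suc (length L))) = x" "bl_P J eps m x L (Suc (length L)) = x"
 by (simp_all add: bl_P_def bl_ext_coords)

lemma bl_ext_seg:
 assumes "j <= length L"
 shows "bl_seg W m x (bl_ext t c n L) j \<longleftrightarrow> bl_seg W m (%i. x i + t * rv (m + B n) i) L j"
proof -
 have all: "(\<forall>q::real. Q q) \<longleftrightarrow> (ALL q. Q (q - t))" for Q by (metis add_diff_cancel_right')
 show ?thesis
  unfolding bl_seg_def by (subst all) (use assms in \<open>cases "j = 0"; simp add: bl_ext_coords bl_ext_P bl_mu_def algebra_simps\<close>)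
qed

text \<open>The recursion on the last segment: all conditions before the last bend are those of a
  broken line that ends at the bending point, and only the final segment and bend remain.\<close>

lemma brokenline_ext:
 "brokenline J d eps W m x (bl_ext t c n L) \<longleftrightarrow>
  brokenline J d eps W m (%i. x i + t * rv (m + B n) i) L & 0 < t &
  (ALL q. 0 <= q & q <= t --> good_pt J d W (%i. x i + q * rv (m + B n) i)) &
  bend W m (%i. x i + t * rv (m + B n) i) (bl_n L (length L)) (bl_c L (length L)) n c"
  (is "_ \<longleftrightarrow> ?R")
proof -
 let ?E = "bl_ext t c n L" and ?y = "%i. x i + t * rv (m + B n) i"
 have le: "(\<forall>j\<le>Suc N. Q j) \<longleftrightarrow> (\<forall>j\<le>N. Q j) & Q (Suc N)" for Q N by (auto simp: le_Suc_eq)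
 have iv: "(ALL j:{1..Suc N}. Q j) \<longleftrightarrow> (ALL j:{1..N}. Q j) & Q (Suc N)" for Q N by (simp add: atLeastAtMostSuc_conv conj_commute)
 have time: "sorted_wrt (<) (map fst ?E) & (ALL q:set ?E. fst q < 0) \<longleftrightarrow>
   sorted_wrt (<) (map fst L) & (ALL q:set L. fst q < 0) & 0 < t"
  by (auto simp: bl_ext_def sorted_wrt_append sorted_wrt_map)
 have last: "bl_seg W m x ?E (Suc (length L)) \<longleftrightarrow> (ALL q. 0 <= q & q <= t --> good_pt J d W (%i. x i + q * rv (m + B n) i))"
 proof -
  have all: "(\<forall>q::real. Q q) \<longleftrightarrow> (ALL q. Q (- q))" for Q by (metis minus_minus)
  have t: "bl_t ?E (Suc (length L)) = - t" by (simp add: bl_ext_coords(2)) (simp add: bl_t_def)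
  show ?thesis unfolding bl_seg_def by (subst all) (simp add: bl_ext_coords(3,5) t bl_ext_end bl_mu_def rv_def conj_commute)
 qed
 have segs: "(\<forall>j\<le>length L. bl_seg W m x ?E j) \<longleftrightarrow> (\<forall>j\<le>length L. bl_seg W m ?y L j)"
  by (auto simp: bl_ext_seg)
 have bends: "(ALL j:{1..length L}. bend W m (bl_P J eps m x ?E j) (bl_n ?E (j - 1)) (bl_c ?E (j - 1)) (bl_n ?E j) (bl_c ?E j)) \<longleftrightarrow>
   (ALL j:{1..length L}. bend W m (bl_P J eps m ?y L j) (bl_n L (j - 1)) (bl_c L (j - 1)) (bl_n L j) (bl_c L j))"
  by (rule ball_cong[OF refl]) (auto simp: bl_ext_coords bl_ext_c bl_ext_P)
 have P: "bl_P J eps m x ?E (Suc (length L)) = ?y" by (simp add: bl_ext_P bl_ext_end)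
 show ?thesis
  unfolding brokenline_iff[of W m x ?E] bl_ext_coords(1) le iv segs bends last P diff_Suc_1
  using time unfolding brokenline_iff[of W m ?y L] by (auto simp: bl_ext_coords bl_ext_c)
qed

lemma brokenline_Nil: "brokenline J d eps W m x [] \<longleftrightarrow> (\<forall>q\<ge>0. good_pt J d W (%i. x i + q * rv m i))"
proof -
 have all: "(\<forall>q::real. Q q) \<longleftrightarrow> (ALL q. Q (- q))" for Q by (metis minus_minus)
 have "bl_seg W m x [] 0 \<longleftrightarrow> (\<forall>q\<ge>0. good_pt J d W (%i. x i + q * rv m i))"
  unfolding bl_seg_def by (subst all) (simp add: bl_t_def bl_P_def bl_mu_def bl_n_def rv_def)
 thus ?thesis unfolding brokenline_iff by simp
qed

lemma bl_cases:
 obtains "L = []" | t c n L' where "L = bl_ext t c n L'"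
proof (cases L rule: rev_cases)
 case (snoc xs x)
 obtain t c n where x: "x = (t, c, n)" by (cases x)
 have "L = bl_ext (- t) c n (map (%x. (fst x + (- t), snd x)) xs)"
  by (simp add: bl_ext_def snoc x comp_def)
 thus ?thesis by (rule that(2))
qed (use that in blast)

lemma bl_ext_inj:
 fixes c c' :: 'k
 shows "bl_ext t c n L = bl_ext t' c' n' L' \<longleftrightarrow> t = t' & c = c' & n = n' & L = L'"
proof
 assume e: "bl_ext t c n L = bl_ext t' c' n' L'"
 hence h: "t = t'" "c = c'" "n = n'" "map (%x. (fst x - t, snd x)) L = map (%x. (fst x - t, snd x)) L'" by (auto simp: bl_ext_def)
 have "inj (%x :: real \<times> 'k \<times> ('i => int). (fst x - t, snd x))" by (auto simp: inj_def)
 thus "t = t' & c = c' & n = n' & L = L'" using h by (simp add: inj_map_eq_map)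
qed simp

text \<open>The definition would admit any normal at a point on no wall. There the product is 1,
  however, and its coefficient in positive degree is 0, so a bend always happens on a wall.\<close>

lemma bend_iff:
 fixes c :: "'k::field"
 assumes W: "okW W"
 shows "bend W m P n' c' n c \<longleftrightarrow> (EX w:W. \<exists>s>0. P \<in> cn w & (ALL w':W. P \<in> cn w' --> fst w' = fst w) &
  n = n' + nsc s (fst w) & c = c' * fps_nth (fpow (wprod W P) \<bar>pairNo J d (fst w) (m + B n')\<bar>) s & c ~= 0)"
proof -
 have e: "(\<Prod>w\<in>{w\<in>W. P \<in> cn w}. fpow (fn w) q) = fpow (wprod W P) q" for q
  unfolding wprod_def by (rule fpow_prod[symmetric]) (use is_wall_props(3) okW_wall[OF W] in blast)
 show ?thesis (is "_ \<longleftrightarrow> ?R")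
 proof
  assume "bend W m P n' c' n c"
  then obtain n0 s where h: "0 < s" "ALL w:W. P \<in> cn w --> fst w = n0" "n = n' + nsc s n0"
   "c = c' * fps_nth (fpow (wprod W P) \<bar>pairNo J d n0 (m + B n')\<bar>) s" "c ~= 0"
   unfolding bend_def e nsc_def by blast
  have "EX w:W. P \<in> cn w"
  proof (rule ccontr)
   assume "\<not> ?thesis"
   hence "{w\<in>W. P \<in> cn w} = {}" by blast
   hence "wprod W P = 1" unfolding wprod_def by (simp only: prod.empty)
   thus False using h(1,4,5) by simp
  qed
  thus ?R using h by metis
 qed (unfold bend_def e nsc_def, blast)
qed

lemma brokenline_end:
 fixes L :: "(real \<times> 'k::field \<times> 'i lat) list"
 assumes W: "okW W"
 shows "brokenline J d eps W m x L ==> bl_n L (length L) \<in> nonneg J & bl_c L (length L) ~= 0"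
proof (induction "length L" arbitrary: x L)
 case 0
 thus ?case by (simp add: bl_n_def bl_c_def nonneg_def latt_def fun_app)
next
 case (Suc N)
 obtain t c n L' where L: "L = bl_ext t c n L'" using Suc(2) by (cases L rule: bl_cases) auto
 note b = Suc(3)[unfolded L brokenline_ext]
 have IH: "bl_n L' (length L') \<in> nonneg J" using Suc(1)[of L'] Suc(2) b L by (auto simp: bl_ext_coords)
 obtain w s where w: "w \<in> W" "n = bl_n L' (length L') + nsc s (fst w)" "c ~= 0" using b unfolding bend_iff[OF W] by blast
 have "fst w \<in> posN J" using w is_wall_props(2) okW_wall[OF W] by blast
 hence "n \<in> nonneg J" using IH w(2) nonneg_nsc[OF posN_nonneg] by (auto simp: nonneg_def latt_def fun_app)
 thus ?case using w(3) by (simp add: L bl_ext_coords bl_ext_c)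
qed

definition BL :: "('i,'k::field) wall set => 'i lat => 'i lat => 'i vec => (real \<times> 'k \<times> 'i lat) list set" where
 "BL W m n x = {L. brokenline J d eps W m x L & bl_n L (length L) = n}"

lemma thk_BL: "thk J d eps W m x n = (\<Sum>L\<in>BL W m n x. bl_c L (length L))"
 by (simp add: thk_def BL_def)

lemma BL_neg: "okW W ==> n \<notin> nonneg J ==> BL W m n x = {}"
 using brokenline_end by (auto simp: BL_def)

subsection \<open>Broken lines compute transported series\<close>

text \<open>\<open>Q\<close> lies in the chamber entered from \<open>x\<close> in the direction
  \<open>mu\<close>. Thus \<open>x\<close> may lie on walls, as bending points do.\<close>

definition adj :: "('i,'k::field) wall set => 'i vec => 'i lat => 'i vec => bool" where
 "adj W x mu Q \<longleftrightarrow> off W Q & (ALL w:W. 0 < (if dot (nw w) x = 0 then dot (nw w) (rv mu)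
   else dot (nw w) x) * dot (nw w) Q)"

lemma crossing_rev:
 assumes "crossing W a b r v"
 shows "crossing W b a (1 - r) v"
 unfolding crossing_def pt_rev[of b a]
proof (intro conjI ballI impI)
 fix t :: real and w assume t: "t \<in> {0..1}" "w \<in> W" "dot (nw w) (pt a b (1 - t)) = 0"
 have "1 - t \<in> {0..1}" using t(1) by auto
 hence "1 - t = r & fst w = v" using assms t(2,3) unfolding crossing_def by blast
 thus "t = 1 - r" "fst w = v" by auto
qed (use assms in "auto simp: crossing_def")

lemma pairNo_sgn: "0 < pairNo J d v mu \<longleftrightarrow> 0 < dot (nrm v) (rv mu)"
proof -
 have "real_of_int (pairNo J d v mu) = real (nscale J d v) * dot (nrm v) (rv mu)"
  unfolding dot_pr by (rule pairNo_pr)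
 hence "0 < real_of_int (pairNo J d v mu) \<longleftrightarrow> 0 < dot (nrm v) (rv mu)"
  using nscale_props(1)[of v] by (simp add: zero_less_mult_iff)
 thus ?thesis by simp
qed

lemma dot_inv: "dot (nrm v) (rv (m + B (n - nsc s v))) = dot (nrm v) (rv (m + B n))"
 by (simp add: dot_pr pr_inv)

definition BLok :: "('i,'k::field_char_0) wall set => 'i lat => ('i,'k) zser => 'i lat => 'i vec set => bool" where
 "BLok W m g n H \<longleftrightarrow> finite H & (ALL h:H. nz h) &
   (ALL x:vecs J. (ALL h:H. dot h x = 0 --> dot h (rv (m + B n)) ~= 0) -->
    finite (BL W m n x) & (ALL Q. adj W x (m + B n) Q --> FF W m g Q n = thk J d eps W m x n))"

text \<open>The backward ray \<open>t \<mapsto> x + t (m + B n)\<close>, \<open>t \<ge> 0\<close>, contains the last segment of every broken line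
 ending at \<open>x\<close> with exponent \<open>n\<close>; the last bend is one of its wall crossings.\<close>

lemma BLok_step:
 fixes W :: "('i,'k::field_char_0) wall set" and k D :: nat
 assumes W: "cons k W" and m: "m \<in> latt J" and g: "tseries W k m g"
  and Hf: "\<And>n'. dg n' < int D ==> BLok W m g n' (Hf n')" and n: "n \<in> nonneg J" "dg n < int (Suc D)" "dg n < int k"
 shows "EX H. BLok W m g n H"
proof -
 have ok: "okW W" using W by (simp add: cons_def)
 have g0: "sup0 J g" "g 0 = 1" using g by (auto simp: tseries_def)
 define M where "M = rv (m + B n)"
 define K where "K = nat (dg n)"
 obtain Z where Z: "finite Z" "\<forall>(h1,h2)\<in>Z. nz h1 & nz h2 & \<not> par h2 h1"
  "\<And>x. x \<in> vecs J ==> ALL h1 h2. (h1,h2) \<in> Z --> dot h1 x = 0 --> dot h2 x ~= 0 ==> nice W x"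
  by (rule nice_off_codim2[OF ok]) blast
 let ?N = "(%w. nw w) ` W"
 have vp: "fst w \<in> posN J" if "w \<in> W" for w using is_wall_props(2)[OF okW_wall[OF ok that]] .
 have low: "dg (n - nsc s (fst w)) < int D" if "w \<in> W" "1 <= s" for w s
 proof -
  have "1 * 1 <= int s * dg (fst w)" using deg_pos1[OF vp[OF that(1)]] that(2) by (intro mult_mono) auto
  thus ?thesis using n(2) by (simp add: degN_diff degN_nsc)
 qed
 \<comment> \<open>Three things could go wrong: the backward ray stays in a wall hyperplane, it
   meets a joint, or it reaches a wall at a point that is bad for the shorter exponent. As
   \<open>jf M\<close> vanishes at M, the last two become conditions on \<open>x\<close> alone.
   Covectors parallel to the wall normal need no such condition, since the ray is transverse to the
   wall.\<close>
 define H where "H = ?N \<union> (%(h1,h2). jf M h1 h2) ` Z \<union>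
   (\<Union>(w,s)\<in>W \<times> {1..K}. jf M (nw w) ` {h \<in> Hf (n - nsc s (fst w)). \<not> par h (nw w)})"
 have fH: "finite (Hf (n - nsc s (fst w)))" "ALL h:Hf (n - nsc s (fst w)). nz h" if "w \<in> W" "1 <= s" for w s
  using Hf[OF low[OF that]] by (auto simp: BLok_def)
 have "finite H" unfolding H_def using ok Z(1) fH by (auto simp: okW_def)
 moreover have "ALL h:H. nz h" unfolding H_def using normals(2)[OF ok] Z(2) jf_nz by fastforce
 moreover have "finite (BL W m n x) & (ALL Q. adj W x (m + B n) Q --> FF W m g Q n = thk J d eps W m x n)"
  if x: "x \<in> vecs J" and gen: "ALL h:H. dot h x = 0 --> dot h M ~= 0" for x
 proof -
  \<comment> \<open>The ray is written as a line through two points so that the lemmas on segments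
    apply; \<open>y t\<close> is x + t M for every real t.\<close>
  define x1 where "x1 = (%i. x i + M i)"
  define y where "y t = pt x x1 t" for t
  have M: "M \<in> vecs J" using latt_muB[OF m, of n] by (auto simp: M_def rv_def vecs_def latt_def)
  have x1: "x1 \<in> vecs J" using x M by (auto simp: x1_def vecs_def)
  have yv: "y t \<in> vecs J" for t unfolding y_def by (rule vecs_pt[OF x x1])
  have ye: "y t = (%i. x i + t * rv (m + B n) i)" for t by (simp add: y_def pt_def x1_def M_def)
  have dy: "dot h (y t) = dot h x + t * dot h M" for h t by (simp add: ye M_def dot_add dot_scale)
  have jfx: "\<not> (dot h1 (y t) = 0 & dot h2 (y t) = 0)" if "jf M h1 h2 \<in> H" for h1 h2 t
   using gen that jf_self[of M h1 h2] jf_zero[of h1 "y t" h2 M] by (auto simp: dy)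
  have nice: "nice W (y t)" for t
   by (rule Z(3)[OF yv]) (use jfx in "fastforce simp: H_def")
  have trans: "dot (nw w) M ~= 0" if "w \<in> W" "dot (nw w) (y t) = 0" for w t
  proof
   assume z: "dot (nw w) M = 0"
   have "nw w \<in> H" using that(1) by (simp add: H_def)
   thus False using gen that(2) z by (simp add: dy)
  qed
  define T where "T = {t. 0 < t & (EX w:W. dot (nw w) (y t) = 0)}"
  define X where "X = {t. EX h:?N. dot h (y t) = 0}"
  have fX: "finite X" unfolding X_def y_def
  proof (rule line_zeros_finite[OF normals(1)[OF ok]], intro ballI)
   fix h assume "h \<in> ?N"
   thus "dot h x ~= 0 \<or> dot h x1 ~= 0" using trans dy[of h 0] dy[of h 1] by (auto simp: x1_def dot_add)
  qed
  have TX: "t \<in> T \<longleftrightarrow> 0 < t & t \<in> X" for t by (auto simp: T_def X_def)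
  have fT: "finite T" by (rule finite_subset[OF _ fX]) (use TX in auto)
  define wt where "wt t = (SOME w. w \<in> W & dot (nw w) (y t) = 0)" for t
  define nu where "nu t = fst (wt t)" for t
  have wt: "wt t \<in> W" "dot (nrm (nu t)) (y t) = 0" if "t \<in> T" for t
  proof -
   have "EX w. w \<in> W & dot (nw w) (y t) = 0" using that unfolding T_def by blast
   hence "wt t \<in> W & dot (nrm (fst (wt t))) (y t) = 0" unfolding wt_def by (rule someI_ex)
   thus "wt t \<in> W" "dot (nrm (nu t)) (y t) = 0" by (auto simp: nu_def)
  qed
  have nu1: "fst w = nu t" if "t \<in> T" "w \<in> W" "dot (nw w) (y t) = 0" for w t
   using nice[of t] wt[OF that(1)] that unfolding nice_def nu_def by blast
  have nup: "nu t \<in> posN J" if "t \<in> T" for t using vp wt(1)[OF that] by (simp add: nu_def)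
  have IH: "finite (BL W m (n - nsc s (nu t)) (y t))"
   "\<And>Q. adj W (y t) (m + B (n - nsc s (nu t))) Q ==> FF W m g Q (n - nsc s (nu t)) = thk J d eps W m (y t) (n - nsc s (nu t))"
   if t: "t \<in> T" and s: "s \<in> {1..K}" for t s
  proof -
   let ?n' = "n - nsc s (nu t)"
   note w = wt[OF t]
   have b: "BLok W m g ?n' (Hf ?n')" using Hf[OF low[OF w(1)]] s by (simp add: nu_def)
   have "dot h (rv (m + B ?n')) ~= 0" if h: "h \<in> Hf ?n'" "dot h (y t) = 0" for h
   proof (cases "par h (nrm (nu t))")
    case True
    have "nz h" using b h by (auto simp: BLok_def)
    hence p: "par (nrm (nu t)) h" using True par_sym by blast
    show ?thesis
    proof
     assume "dot h (rv (m + B ?n')) = 0"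
     hence "dot (nrm (nu t)) (rv (m + B ?n')) = 0" by (rule par_dot[OF p])
     hence "dot (nrm (nu t)) M = 0" unfolding dot_inv M_def .
     thus False using trans w by (simp add: nu_def)
    qed
   next
    case False
    have "jf M (nrm (fst (wt t))) h \<in> H" unfolding H_def using w(1) s h(1) False
     by (intro UnI2 UN_I[of "(wt t, s)"]) (auto simp: nu_def)
    thus ?thesis using jfx w(2) h(2) unfolding nu_def by blast
   qed
   thus "finite (BL W m ?n' (y t))" "\<And>Q. adj W (y t) (m + B ?n') Q ==> FF W m g Q ?n' = thk J d eps W m (y t) ?n'"
    using b yv[of t] unfolding BLok_def by blast+
  qed
  define a where "a t s = fps_nth (fpow (wprod W (y t)) \<bar>pairNo J d (nu t) (m + B n)\<bar>) s" for t s
  define R where "R t = (\<Sum>s\<in>{1..K}. a t s * thk J d eps W m (y t) (n - nsc s (nu t)))" for t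
  define Ph where "Ph = (%(t,s) L. bl_ext t (bl_c L (length L) * a t s) n L)"
  define S where "S = (%(t,s). if a t s = 0 then {} else BL W m (n - nsc s (nu t)) (y t))"
  \<comment> \<open>A line with final exponent n either never bends, so that n = 0, or prolongs
    uniquely a line with exponent n - s v ending at the point of the ray where it meets a hyperplane
    with normal v.\<close>
  have dec: "BL W m n x = (if n = 0 then {[]} else {}) \<union> (\<Union>p\<in>T \<times> {1..K}. Ph p ` S p)"
  proof (intro set_eqI iffI)
   fix L assume L: "L \<in> BL W m n x"
   show "L \<in> (if n = 0 then {[]} else {}) \<union> (\<Union>p\<in>T \<times> {1..K}. Ph p ` S p)"
   proof (cases L rule: bl_cases)
    case 1
    thus ?thesis using L by (simp add: BL_def bl_n_def)
   next
    case (2 t c n1 L')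
    have n1: "n1 = n" using L 2 by (simp add: BL_def bl_ext_coords)
    have b: "brokenline J d eps W m (y t) L'" "0 < t" "bend W m (y t) (bl_n L' (length L')) (bl_c L' (length L')) n c"
    proof -
     have "brokenline J d eps W m x (bl_ext t c n L')" using L 2 n1 by (simp add: BL_def)
     from this[unfolded brokenline_ext] show "brokenline J d eps W m (y t) L'" "0 < t"
      "bend W m (y t) (bl_n L' (length L')) (bl_c L' (length L')) n c" by (auto simp: ye)
    qed
    let ?n' = "bl_n L' (length L')"
    obtain w s where w: "w \<in> W" "0 < s" "y t \<in> cn w" "n = ?n' + nsc s (fst w)"
     "c = bl_c L' (length L') * fps_nth (fpow (wprod W (y t)) \<bar>pairNo J d (fst w) (m + B ?n')\<bar>) s" "c ~= 0"
     using b(3) unfolding bend_iff[OF ok] by blast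
    have yz: "dot (nw w) (y t) = 0" using wall_perp[OF okW_wall[OF ok w(1)] w(3)] .
    have t: "t \<in> T" using b(2) w(1) yz by (auto simp: T_def)
    have nt: "fst w = nu t" by (rule nu1[OF t w(1) yz])
    have n': "?n' = n - nsc s (nu t)" using w(4) nt by simp
    have "0 <= dg ?n'" using brokenline_end[OF ok b(1)] by (auto simp: nonneg_def degN_def intro: sum_nonneg)
    hence "int s * dg (nu t) <= dg n" unfolding n' by (simp add: degN_diff degN_nsc)
    moreover have "int s * 1 <= int s * dg (nu t)" using deg_pos1[OF nup[OF t]] by (intro mult_left_mono) auto
    ultimately have "int s <= dg n" by linarith
    hence sK: "s \<in> {1..K}" using w(2) by (simp add: K_def)
    have ca: "c = bl_c L' (length L') * a t s" using w(5) unfolding nt n' a_def pairNo_inv .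
    have "L' \<in> S (t, s)" using b(1) n' ca w(6) by (auto simp: S_def BL_def)
    moreover have "L = Ph (t, s) L'" using 2 n1 ca by (simp add: Ph_def)
    ultimately show ?thesis using t sK by blast
   qed
  next
   fix L assume "L \<in> (if n = 0 then {[]} else {}) \<union> (\<Union>p\<in>T \<times> {1..K}. Ph p ` S p)"
   then consider "n = 0" "L = []" | t s L' where "t \<in> T" "s \<in> {1..K}" "L' \<in> S (t, s)" "L = Ph (t, s) L'"
    by (auto split: if_splits)
   thus "L \<in> BL W m n x"
   proof cases
    case 1
    thus ?thesis using nice ye unfolding nice_def by (simp add: BL_def brokenline_Nil bl_n_def)
   next
    case 2
    let ?n' = "n - nsc s (nu t)" and ?c = "bl_c L' (length L') * a t s"
    have as: "a t s ~= 0" and L': "L' \<in> BL W m ?n' (y t)" using 2(3) by (auto simp: S_def split: if_splits)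
    have b: "brokenline J d eps W m (y t) L'" "bl_n L' (length L') = ?n'" using L' by (auto simp: BL_def)
    have c0: "?c ~= 0" using brokenline_end[OF ok b(1)] as by simp
    have "EX w:W. y t \<in> cn w"
    proof (rule ccontr)
     assume "\<not> ?thesis"
     hence "{w\<in>W. y t \<in> cn w} = {}" by blast
     hence "wprod W (y t) = 1" unfolding wprod_def by (simp only: prod.empty)
     thus False using as 2(2) by (simp add: a_def)
    qed
    then obtain w where w: "w \<in> W" "y t \<in> cn w" by blast
    have on: "fst w' = nu t" if "w' \<in> W" "y t \<in> cn w'" for w'
     using nu1[OF 2(1) that(1)] wall_perp[OF okW_wall[OF ok that(1)] that(2)] by blast
    have bd: "bend W m (y t) ?n' (bl_c L' (length L')) n ?c"
     unfolding bend_iff[OF ok]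
     by (intro bexI[OF _ w(1)] exI[of _ s]) (use 2(2) w on c0 in "auto simp: a_def pairNo_inv")
    have "0 < t" using 2(1) by (simp add: T_def)
    hence "brokenline J d eps W m x (bl_ext t ?c n L')"
     unfolding brokenline_ext using b bd nice ye unfolding nice_def by simp
    thus ?thesis using 2(4) by (simp add: BL_def Ph_def bl_ext_coords)
   qed
  qed
  have fS: "finite (S p)" if "p \<in> T \<times> {1..K}" for p using IH(1) that by (auto simp: S_def)
  have fU: "finite (\<Union>p\<in>T \<times> {1..K}. Ph p ` S p)" using fT fS by blast
  have fin: "finite (BL W m n x)" unfolding dec using fU by simp
  \<comment> \<open>The time is read off from the last entry of the prolonged line, and the
    multiplicity s from the exponent of the line before it.\<close>
  have disj: "ALL p:T \<times> {1..K}. ALL q:T \<times> {1..K}. p ~= q --> Ph p ` S p \<inter> Ph q ` S q = {}"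
  proof (intro ballI impI)
   fix p q assume pq: "p \<in> T \<times> {1..K}" "q \<in> T \<times> {1..K}" "p ~= q"
   obtain t s t' s' where e: "p = (t, s)" "q = (t', s')" by fastforce
   show "Ph p ` S p \<inter> Ph q ` S q = {}"
   proof (rule ccontr)
    assume "\<not> ?thesis"
    then obtain L L' where L: "L \<in> S p" "L' \<in> S q" "Ph p L = Ph q L'" by blast
    hence t: "t = t'" "L = L'" by (auto simp: e Ph_def bl_ext_inj)
    hence "n - nsc s (nu t) = n - nsc s' (nu t)" using L(1,2) by (auto simp: S_def e BL_def split: if_splits)
    hence "nsc s (nu t) = nsc s' (nu t)" by simp
    thus False using nsc_inj nup[of t] pq e t by blast
   qed
  qed
  have thk: "thk J d eps W m x n = (if n = 0 then 1 else 0) + (\<Sum>t\<in>T. R t)"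
  proof -
   have nil: "[] \<notin> (\<Union>p\<in>T \<times> {1..K}. Ph p ` S p)" by (auto simp: Ph_def bl_ext_def)
   have "thk J d eps W m x n = (\<Sum>L\<in>(if n = 0 then {[]} else {} :: (real \<times> 'k \<times> 'i lat) list set). bl_c L (length L)) +
     (\<Sum>L\<in>(\<Union>p\<in>T \<times> {1..K}. Ph p ` S p). bl_c L (length L))"
    unfolding thk_BL dec by (rule sum.union_disjoint) (use fU nil in auto)
   also have "(\<Sum>L\<in>(if n = 0 then {[]} else {} :: (real \<times> 'k \<times> 'i lat) list set). bl_c L (length L)) = (if n = 0 then 1 else (0 :: 'k))"
    by (simp add: bl_c_def)
   also have "(\<Sum>L\<in>(\<Union>p\<in>T \<times> {1..K}. Ph p ` S p). bl_c L (length L)) =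
     (\<Sum>p\<in>T \<times> {1..K}. \<Sum>L\<in>Ph p ` S p. bl_c L (length L))"
    by (rule sum.UNION_disjoint) (use fT fS disj in auto)
   also have "\<dots> = (\<Sum>(t,s)\<in>T \<times> {1..K}. a t s * thk J d eps W m (y t) (n - nsc s (nu t)))"
   proof (rule sum.cong[OF refl])
    fix p assume "p \<in> T \<times> {1..K}"
    obtain t s where p: "p = (t, s)" by fastforce
    have "inj_on (Ph p) (S p)" by (auto simp: inj_on_def Ph_def p bl_ext_inj)
    hence "(\<Sum>L\<in>Ph p ` S p. bl_c L (length L)) = (\<Sum>L\<in>S p. bl_c (Ph p L) (length (Ph p L)))"
     by (simp add: sum.reindex)
    also have "\<dots> = (\<Sum>L\<in>S p. bl_c L (length L) * a t s)" by (simp add: p Ph_def bl_ext_coords bl_ext_c)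
    also have "\<dots> = a t s * thk J d eps W m (y t) (n - nsc s (nu t))"
     by (simp add: S_def p thk_BL sum_distrib_left mult.commute)
    finally show "(\<Sum>L\<in>Ph p ` S p. bl_c L (length L)) = (case p of (t, s) => a t s * thk J d eps W m (y t) (n - nsc s (nu t)))"
     by (simp add: p)
   qed
   also have "\<dots> = (\<Sum>t\<in>T. R t)" by (simp add: R_def sum.cartesian_product)
   finally show ?thesis .
  qed
  have offy: "off W (y t)" if "t \<notin> X" for t using that yv by (auto simp: off_def X_def)
  have side: "0 < dot (nw w) (y s) * dot (nw w) (y t)"
   if "s < t" "w \<in> W" "\<And>q. s <= q ==> q <= t ==> dot (nw w) (y q) ~= 0" for s t w
   unfolding y_def by (rule no_zero_sign[OF that(1)]) (use that(1) that(3)[unfolded y_def] in auto)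
  \<comment> \<open>Moving towards \<open>x\<close> across one hyperplane adds the lines that bend
    there: the constant term of the crossing reproduces the old coefficient, and the higher terms
    are counts of shorter lines by the induction hypothesis.\<close>
  have step: "FF W m g (y s) n = FF W m g (y t) n + (\<Sum>q\<in>T \<inter> {s..t}. R q)"
   if st: "0 < s" "s < t" "s \<notin> X" "t \<notin> X" "card (X \<inter> {s..t}) <= 1" for s t
  proof (cases "X \<inter> {s..t} = {}")
   case True
   have "0 < dot (nw w) (y s) * dot (nw w) (y t)" if "w \<in> W" for w
    by (rule side[OF st(2) that]) (use True that in "fastforce simp: X_def")
   hence "FF W m g (y s) n = FF W m g (y t) n"
    using FF_same[OF W m g0(1) offy[OF st(3)] offy[OF st(4)] n(3)] by blast
   moreover have "T \<inter> {s..t} = {}" using True TX by blast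
   ultimately show ?thesis by simp
  next
   case False
   then obtain r where r: "r \<in> X" "s <= r" "r <= t" by auto
   have un: "q = r" if "q \<in> X" "s <= q" "q <= t" for q
   proof -
    have "finite (X \<inter> {s..t})" using fX by simp
    thus ?thesis using card_le_Suc0_iff_eq[of "X \<inter> {s..t}"] st(5) r that by auto
   qed
   have sr: "s < r" "r < t" using r st by (auto simp: order.order_iff_strict)
   have rT: "r \<in> T" using r sr st(1) by (simp add: TX)
   have "q = r" if "q \<in> T \<inter> {s..t}" for q using un[of q] that TX[of q] by simp
   moreover have "r \<in> T \<inter> {s..t}" using rT sr by simp
   ultimately have Tr: "T \<inter> {s..t} = {r}" by blast
   note w = wt[OF rT]
   let ?v = "nu r"
   have "crossing W (y s) (y t) ((r - s) / (t - s)) (fst (wt r))"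
    unfolding y_def by (rule crossingI[OF x x1 sr w(1) w(2)[unfolded nu_def y_def] nice[unfolded y_def]])
     (use un in "auto simp: X_def y_def")
   hence cr: "crossing W (y t) (y s) (1 - (r - s) / (t - s)) ?v" unfolding nu_def by (rule crossing_rev)
   have pr: "pt (y t) (y s) (1 - (r - s) / (t - s)) = y r"
   proof -
    have "t + (1 - (r - s) / (t - s)) * (s - t) = r" using st by (simp add: field_simps)
    thus ?thesis unfolding y_def pt_pt by simp
   qed
   have vM: "dot (nrm ?v) M ~= 0" using trans w by (simp add: nu_def)
   have "pairR J d (%i. y s i - y t i) ?v = (s - t) * dot (nrm ?v) M"
    by (simp add: pairR_dot dot_diff dy algebra_simps)
   hence "0 < pairR J d (%i. y s i - y t i) ?v \<longleftrightarrow> dot (nrm ?v) M < 0"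
    using st(2) by (simp add: zero_less_mult_iff)
   \<comment> \<open>Travelling along - M, the crossing sign always makes the power nonnegative;
     this matches the absolute value in the rule for bends.\<close>
   hence sg: "sgnc (y t) (y s) ?v * pairNo J d ?v (m + B n) = \<bar>pairNo J d ?v (m + B n)\<bar>"
    using pairNo_sgn[of ?v "m + B n"] vM by (auto simp: sgnc_def M_def)
   have F0: "fps_nth (wprod W (y r)) 0 = 1" using ok wprod_0 by (auto simp: okW_def)
   have "adj W (y r) (m + B (n - nsc i ?v)) (y t)" for i
    unfolding adj_def
   proof (intro conjI ballI)
    show "off W (y t)" by (rule offy[OF st(4)])
    fix w assume w': "w \<in> W"
    show "0 < (if dot (nw w) (y r) = 0 then dot (nw w) (rv (m + B (n - nsc i ?v)))
     else dot (nw w) (y r)) * dot (nw w) (y t)"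
    proof (cases "dot (nw w) (y r) = 0")
     case True
     have v: "fst w = ?v" by (rule nu1[OF rT w' True])
     have "dot (nrm ?v) (y t) = (t - r) * dot (nrm ?v) M" using w(2) by (simp add: dy algebra_simps)
     moreover have "0 < dot (nrm ?v) M * dot (nrm ?v) M" using vM by (auto simp: zero_less_mult_iff)
     ultimately show ?thesis using True sr(2) v dot_inv[of ?v m n i] by (simp add: M_def mult.left_commute)
    next
     case False
     have "0 < dot (nw w) (y r) * dot (nw w) (y t)"
      by (rule side[OF sr(2) w']) (use False un sr w' in "fastforce simp: X_def")
     thus ?thesis using False by simp
    qed
   qed
   hence IHr: "FF W m g (y t) (n - nsc i ?v) = thk J d eps W m (y r) (n - nsc i ?v)" if "i \<in> {1..K}" for i
    using IH(2)[OF rT that] by blast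
   have "FF W m g (y s) n = (\<Sum>i\<le>K. FF W m g (y t) (n - nsc i ?v) * a r i)"
    using FF_cross[OF W m g0(1) offy[OF st(4)] offy[OF st(3)] n(3) cr nup[OF rT]] by (simp add: sg pr a_def K_def)
   also have "\<dots> = FF W m g (y t) n * a r 0 + (\<Sum>i\<in>{1..K}. FF W m g (y t) (n - nsc i ?v) * a r i)"
   proof -
    have "{..K} = insert 0 {1..K}" by auto
    thus ?thesis by simp
   qed
   also have "a r 0 = 1" unfolding a_def by (rule fpow_nth_0[OF F0])
   also have "(\<Sum>i\<in>{1..K}. FF W m g (y t) (n - nsc i ?v) * a r i) = R r"
    unfolding R_def by (rule sum.cong[OF refl]) (simp add: IHr mult.commute)
   finally show ?thesis by (simp add: Tr)
  qed
  have "FF W m g Q n = thk J d eps W m x n" if Q: "adj W x (m + B n) Q" for Q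
  proof -
   \<comment> \<open>\<open>e\<close> comes before all crossings and represents the chamber entered
     from \<open>x\<close>; \<open>f\<close> comes after all of them, where only the line without
     bends remains. Inserting 1 keeps Min and Max meaningful when there are no crossings.\<close>
   define e where "e = Min (insert 1 T) / 2"
   define f where "f = Max (insert 1 T) + 1"
   have e: "0 < e" "ALL t:T. e < t" "e < 1"
   proof -
    have p: "0 < Min (insert 1 T)" using fT by (auto simp: T_def)
    thus "0 < e" by (simp add: e_def)
    have le: "Min (insert 1 T) <= t" if "t \<in> insert 1 T" for t by (rule Min_le) (use fT that in auto)
    show "e < 1" using p le[of 1] unfolding e_def by simp
    show "ALL t:T. e < t"
    proof
     fix t assume "t \<in> T"
     thus "e < t" using p le[of t] unfolding e_def by simp
    qed
   qed
   have f: "1 < f" "ALL t:T. t < f"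
   proof -
    have le: "t <= Max (insert 1 T)" if "t \<in> insert 1 T" for t by (rule Max_ge) (use fT that in auto)
    show "1 < f" using le[of 1] unfolding f_def by simp
    show "ALL t:T. t < f"
    proof
     fix t assume "t \<in> T"
     thus "t < f" using le[of t] unfolding f_def by simp
    qed
   qed
   have ef: "e \<notin> X" "f \<notin> X"
   proof -
    have "e \<notin> T" "f \<notin> T" using e f by blast+
    thus "e \<notin> X" "f \<notin> X" using e(1) f(1) by (simp_all add: TX)
   qed
   have "FF W m g (y e) n = FF W m g (y f) n + (\<Sum>q\<in>T \<inter> {e..f}. R q)"
   proof (rule finite_crossings[OF fX _ ef, of "%s t. FF W m g (y s) n = FF W m g (y t) n + (\<Sum>q\<in>T \<inter> {s..t}. R q)"])
    fix s t u assume h: "s < t" "t < u" "t \<notin> X"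
     "FF W m g (y s) n = FF W m g (y t) n + (\<Sum>q\<in>T \<inter> {s..t}. R q)"
     "FF W m g (y t) n = FF W m g (y u) n + (\<Sum>q\<in>T \<inter> {t..u}. R q)"
    have "T \<inter> {s..u} = T \<inter> {s..t} \<union> T \<inter> {t..u}" "T \<inter> {s..t} \<inter> (T \<inter> {t..u}) = {}"
    proof -
     have "t \<notin> T" using h(3) by (simp add: TX)
     thus "T \<inter> {s..t} \<inter> (T \<inter> {t..u}) = {}" by (auto dest: order_antisym)
     show "T \<inter> {s..u} = T \<inter> {s..t} \<union> T \<inter> {t..u}" using h(1,2) by auto
    qed
    hence "(\<Sum>q\<in>T \<inter> {s..u}. R q) = (\<Sum>q\<in>T \<inter> {s..t}. R q) + (\<Sum>q\<in>T \<inter> {t..u}. R q)"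
     using fT by (simp add: sum.union_disjoint)
    thus "FF W m g (y s) n = FF W m g (y u) n + (\<Sum>q\<in>T \<inter> {s..u}. R q)" using h by (simp add: add_ac)
   next
    show "e < f" using e f by simp
    fix s t assume h: "e <= s" "s < t" "s \<notin> X" "t \<notin> X" "card (X \<inter> {s..t}) <= 1"
    have "0 < s" using e(1) h(1) by simp
    thus "FF W m g (y s) n = FF W m g (y t) n + (\<Sum>q\<in>T \<inter> {s..t}. R q)" by (rule step[OF _ h(2-5)])
   qed
   moreover have "T \<inter> {e..f} = T" using e(2) f(2) by (auto simp: order.order_iff_strict)
   moreover have "FF W m g (y f) n = (if n = 0 then 1 else 0)"
   proof (cases "n = 0")
    case True
    have "FF W m g (y f) 0 - ract (trp W Qp (y f)) m (delta 0) 0 = g 0 - (delta 0 :: ('i,'k) zser) 0"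
     unfolding FF_def
    proof (rule ract_unipotent[of "trp W Qp (y f)" g "delta 0" 0 m])
     have "n \<in> nonneg J" by (rule n)
     thus d: "sup0 J (delta 0 :: ('i,'k) zser)" using True by (auto intro: sup0_delta)
     fix a :: "'i lat" assume "dg a < dg 0"
     thus "g a = delta 0 a" using sup0_deg[OF g0(1), of a] sup0_deg[OF d, of a] by (simp add: degN_def fun_app)
    qed (use ok g0 in auto)
    thus ?thesis using True rc_0[OF okrs_trp[OF ok], of Qp "y f" m] g0 by (simp add: rc_def delta_def)
   next
    case False
    \<comment> \<open>On a line the sign of an affine function beyond its zero is the sign of its
      slope, here the value at M.\<close>
    have "NC W (m + B n) (y f)"
     unfolding NC_def
    proof (intro conjI ballI impI)
     show "off W (y f)" by (rule offy[OF ef(2)])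
     fix w assume w: "w \<in> W" "dot (nw w) (rv (m + B n)) ~= 0"
     let ?q = "dot (nw w) M" and ?p = "dot (nw w) x"
     have q: "?q ~= 0" using w(2) by (simp add: M_def)
     have "- ?p / ?q < f"
     proof (cases "0 < - ?p / ?q")
      case True
      have "dot (nw w) (y (- ?p / ?q)) = 0" using q by (simp add: dy)
      hence "- ?p / ?q \<in> T" using True w(1) unfolding T_def by blast
      thus ?thesis using f by blast
     qed (use f in simp)
     hence "0 < ?q * ?q * (f - - ?p / ?q)" using q by (auto simp: zero_less_mult_iff)
     also have "\<dots> = ?q * dot (nw w) (y f)" using q by (simp add: dy field_simps)
     finally show "0 < dot (nw w) (rv (m + B n)) * dot (nw w) (y f)" by (simp add: M_def)
    qed
    thus ?thesis using g False n by (auto simp: tseries_def posN_def)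
   qed
   moreover have "FF W m g Q n = FF W m g (y e) n"
   proof (rule FF_same[OF W m g0(1) _ offy[OF ef(1)] n(3)])
    show "off W Q" using Q by (simp add: adj_def)
    show "ALL w:W. 0 < dot (nw w) Q * dot (nw w) (y e)"
    proof
     fix w assume w: "w \<in> W"
     let ?c = "if dot (nw w) x = 0 then dot (nw w) M else dot (nw w) x"
     have "0 < ?c * dot (nw w) (y e)"
     proof (cases "dot (nw w) x = 0")
      case True
      hence "dot (nw w) M ~= 0" using trans[OF w, of 0] by (simp add: dy)
      hence "0 < e * (dot (nw w) M * dot (nw w) M)" using e(1) by (auto simp: zero_less_mult_iff)
      thus ?thesis using True by (simp add: dy mult_ac)
     next
      case False
      have "0 < dot (nw w) (y 0) * dot (nw w) (y e)"
      proof (rule side[OF e(1) w])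
       fix q assume q: "0 <= q" "q <= e"
       show "dot (nw w) (y q) ~= 0"
       proof (cases "q = 0")
        case True
        thus ?thesis using False by (simp add: dy)
       next
        case qF: False
        hence "q \<notin> T" using e(2) q by force
        thus ?thesis using q qF w by (auto simp: T_def)
       qed
      qed
      thus ?thesis using False by (simp add: dy)
     qed
     moreover have "0 < ?c * dot (nw w) Q" using Q w unfolding adj_def M_def by blast
     ultimately show "0 < dot (nw w) Q * dot (nw w) (y e)" using sign_trans by blast
    qed
   qed
   ultimately show ?thesis using thk by (simp add: add_ac)
  qed
  thus ?thesis using fin by blast
 qed
 ultimately have "BLok W m g n H" unfolding BLok_def M_def by blast
 thus ?thesis ..
qed

subsection \<open>Theta functions\<close>

text \<open>In the positive orthant all wall covectors are positive, so \<open>Q\<close> serves as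
  its own adjacent chamber and transport from the base point is trivial.\<close>

lemma thk_positive:
 fixes W :: "('i,'k::field_char_0) wall set" and k :: nat
 assumes W: "cons k W" and m: "m \<in> latt J" and g: "tseries W k m g"
 obtains H where "finite H" "ALL h:H. nz h"
  "\<And>Q n. Q \<in> vecs J ==> ALL i:J. 0 < Q i ==> ALL h:H. dot h Q ~= 0 ==> dg n < int k ==> thk J d eps W m Q n = g n"
proof -
 have ok: "okW W" using W by (simp add: cons_def)
 have g0: "sup0 J g" using g by (simp add: tseries_def)
 have neg: "BLok W m g n {}" if "n \<notin> nonneg J" for n
  using that by (simp add: BLok_def BL_neg[OF ok] thk_BL sup0_0[OF FF_sup0[OF ok g0]])
 have "ALL n. dg n < int D --> (EX H. BLok W m g n H)" if "D <= k" for D :: nat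
  using that
 proof (induction D)
  case 0
  have "n \<notin> nonneg J" if "dg n < 0" for n
  proof
   assume "n \<in> nonneg J"
   hence "0 <= dg n" by (auto simp: nonneg_def degN_def intro: sum_nonneg)
   thus False using that by simp
  qed
  thus ?case using neg by auto
 next
  case (Suc D)
  hence "ALL n. dg n < int D --> (EX H. BLok W m g n H)" by simp
  hence "ALL n. EX H. dg n < int D --> BLok W m g n H" by blast
  from choice[OF this] obtain Hf where Hf: "\<And>n. dg n < int D ==> BLok W m g n (Hf n)" by blast
  have "EX H. BLok W m g n H" if "dg n < int (Suc D)" for n
  proof (cases "n \<in> nonneg J")
   case True
   have "dg n < int k" using that Suc(2) by simp
   with True that show ?thesis by (intro BLok_step[OF W m g Hf])
  qed (use neg in blast)
  thus ?case by blast
 qed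
 from this[of k] have "ALL n. EX H. dg n < int k --> BLok W m g n H" by blast
 from choice[OF this] obtain Hf where Hf: "\<And>n. dg n < int k ==> BLok W m g n (Hf n)" by blast
 define H where "H = (\<Union>n\<in>Nk (int k). Hf n)"
 have "finite H" "ALL h:H. nz h" using Hf by (auto simp: H_def BLok_def Nk_def intro!: finite_UN_I[OF Nk_fin[unfolded Nk_def]])
 moreover have "thk J d eps W m Q n = g n"
  if Q: "Q \<in> vecs J" "ALL i:J. 0 < Q i" "ALL h:H. dot h Q ~= 0" and n: "dg n < int k" for Q n
 proof (cases "n \<in> nonneg J")
  case True
  have pos: "0 < dot (nw w) Q" if "w \<in> W" for w
   by (rule positive_dot[OF is_wall_props(2)[OF okW_wall[OF ok that]] Q(2)])
  have oQ: "off W Q" using Q(1) pos by (fastforce simp: off_def)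
  have "adj W Q (m + B n) Q" using oQ pos by (fastforce simp: adj_def)
  moreover have "n \<in> Nk (int k)" using True n by (simp add: Nk_def)
  hence "ALL h:Hf n. dot h Q ~= 0" using Q(3) unfolding H_def by blast
  ultimately have "thk J d eps W m Q n = FF W m g Q n" using Hf[OF n] Q(1) unfolding BLok_def by auto
  also have "\<dots> = FF W m g Qp n"
   by (rule FF_same[OF W m g0 oQ off_Qp[OF ok] n]) (use pos Qp_pos[OF is_wall_props(2)[OF okW_wall[OF ok]]] in "auto intro: mult_pos_pos")
  also have "\<dots> = g n" unfolding FF_def using req_ract[OF trp_refl[OF W Qp_vecs] _ _ m g0 n] ok by simp
  finally show ?thesis .
 next
  case False
  thus ?thesis using BL_neg[OF ok] sup0_0[OF g0] by (simp add: thk_BL)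
 qed
 ultimately show ?thesis by (rule that)
qed

definition computes :: "'i lat => ('i,'k::field) wall set => nat => ('i,'k) zser => bool" where
 "computes m W k s \<longleftrightarrow> (EX H. finite H & (ALL h:H. nz h) & (ALL Q:vecs J. (ALL i:J. 0 < Q i) & (ALL h:H. dot h Q ~= 0) -->
   (ALL n. dg n < int k --> thk J d eps W m Q n = s n)))"

lemma theta_ser_computes:
 "theta_ser J d eps m = (THE s. \<forall>D::('i,'k::field) wall set. clusterSD J d eps D --> (ALL k. computes m (Dk J D k) k s))"
 unfolding theta_ser_def computes_def nz_def dot_def ..

lemma computes_unique:
 assumes "computes m W k s" "computes m W k s'" "dg n < int k"
 shows "s n = s' n"
proof -
 obtain H where H: "finite H" "ALL h:H. nz h" "ALL Q:vecs J. (ALL i:J. 0 < Q i) & (ALL h:H. dot h Q ~= 0) -->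
   (ALL n. dg n < int k --> thk J d eps W m Q n = s n)" using assms(1) unfolding computes_def by blast
 obtain H' where H': "finite H'" "ALL h:H'. nz h" "ALL Q:vecs J. (ALL i:J. 0 < Q i) & (ALL h:H'. dot h Q ~= 0) -->
   (ALL n. dg n < int k --> thk J d eps W m Q n = s' n)" using assms(2) unfolding computes_def by blast
 have HH: "finite (H \<union> H')" "ALL h:H \<union> H'. nz h" "(0::real) < 1" using H(1,2) H'(1,2) by auto
 obtain Q where Q: "Q \<in> vecs J" "close 1 Qp Q" "ALL h:H \<union> H'. dot h Q ~= 0"
  by (rule generic_near[OF HH(1,2) Qp_vecs HH(3)])
 have "ALL i:J. 0 < Q i" using Q(2) by (force simp: close_def Qp_def)
 hence "thk J d eps W m Q n = s n" "thk J d eps W m Q n = s' n" using H(3) H'(3) Q(1,3) assms(3) by blast+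
 thus ?thesis by simp
qed

text \<open>The definite description in \<open>theta_ser\<close> must be shown to have exactly one
  solution. Uniqueness depends on the existence of a cluster diagram, since otherwise every series
  would satisfy the condition vacuously.\<close>

theorem theta_ser_ps:
 assumes m: "m \<in> latt J"
 shows "sup0 J (theta_ser J d eps m :: ('i,'k::field_char_0) zser)" "theta_ser J d eps m 0 = (1 :: 'k)"
proof -
 obtain s :: "('i,'k) zser" where s: "sup0 J s" "s 0 = 1"
  "\<And>(D :: ('i,'k) wall set) k. clusterSD J d eps D ==> EX g. tseries (Dk J D k) k m g & (ALL n. dg n < int k --> g n = s n)"
  by (rule theta_series_ex[OF m]) blast
 have Ps: "computes m (Dk J D k) k s" if D: "clusterSD J d eps D" for D :: "('i,'k) wall set" and k
 proof -
  obtain g where g: "tseries (Dk J D k) k m g" "ALL n. dg n < int k --> g n = s n" using s(3)[OF D] by blast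
  obtain H where H: "finite H" "ALL h:H. nz h"
   "\<And>Q n. Q \<in> vecs J ==> ALL i:J. 0 < Q i ==> ALL h:H. dot h Q ~= 0 ==> dg n < int k ==> thk J d eps (Dk J D k) m Q n = g n"
   by (rule thk_positive[OF clusterSD_Dk(1)[OF D] m g(1)]) blast
  show ?thesis unfolding computes_def by (rule exI[of _ H]) (use H g(2) in simp)
 qed
 have "s' = s" if s': "\<forall>D::('i,'k) wall set. clusterSD J d eps D --> (ALL k. computes m (Dk J D k) k s')" for s'
 proof
  fix n
  have D: "clusterSD J d eps (SD :: ('i,'k) wall set)" by (rule clusterSD_exists)
  have "dg n < int (nat (dg n) + 1)" by simp
  from computes_unique[OF _ Ps[OF D] this] s' D show "s' n = s n" by blast
 qed
 hence "theta_ser J d eps m = s" unfolding theta_ser_computes by (intro the_equality) (use Ps in blast)+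
 thus "sup0 J (theta_ser J d eps m :: ('i,'k) zser)" "theta_ser J d eps m 0 = (1 :: 'k)" using s by auto
qed

lemma ps1_theta: "m \<in> latt J ==> ps1 J m (thetaA J d eps m :: ('i,'k::field_char_0) elt)"
proof -
 assume m: "m \<in> latt J"
 note t = theta_ser_ps[OF m]
 show ?thesis using t(1) by (auto simp: ps1_def thetaA_def sup0_def t(2))
qed

subsection \<open>Triangular expansions\<close>

lemma sigma_mult: "multA (sigmaA J eps n) v m' n' = (v (m' + B n) (n' - n) :: 'k::comm_ring_1)"
proof -
 have "{((m1, n1), (m2, n2)). (sigmaA J eps n :: ('i,'k) elt) m1 n1 ~= 0 & v m2 n2 ~= 0 & m1 + m2 = m' & n1 + n2 = n'} =
  (if v (m' + B n) (n' - n) = 0 then {} else {((- B n, n), (m' + B n, n' - n))})"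
  by (auto simp: sigmaA_def split: if_splits)
 thus ?thesis unfolding multA_def by (simp add: sigmaA_def)
qed

text \<open>The element sigma^n v_(p + nB), indexed by its degree p instead of the index of v. For
  fixed p these elements start at zeta^n with coefficient 1, so the family is triangular in
  n.\<close>

definition EE :: "('i lat => ('i,'k::field) elt) => 'i lat \<times> 'i lat => ('i,'k) elt" where
 "EE v q = multA (sigmaA J eps (snd q)) (v (fst q + B (snd q)))"

abbreviation LL :: "('i lat \<times> 'i lat) set" where "LL \<equiv> latt J \<times> latt J"

abbreviation le :: "'i lat => 'i lat => bool" where "le b n \<equiv> ALL i:J. b i <= n i"

definition iv :: "'i lat => 'i lat => 'i lat set" where "iv b n' = {n \<in> latt J. le b n & le n n'}"

lemma le_antisym:
 assumes "n \<in> latt J" "n' \<in> latt J" "le n n'" "le n' n"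
 shows "n = n'"
proof
 fix i
 show "n i = n' i" using assms by (cases "i \<in> J") (simp_all add: order.antisym latt_def)
qed

lemma fin_iv: "finite (iv b n')"
proof -
 have "iv b n' \<subseteq> (%f i. if i \<in> J then f i else 0) ` (\<Pi>\<^sub>E i\<in>J. {b i..n' i})"
 proof
  fix n assume n: "n \<in> iv b n'"
  have "n = (%i. if i \<in> J then restrict n J i else 0)" using n by (auto simp: iv_def latt_def fun_eq_iff)
  moreover have "restrict n J \<in> (\<Pi>\<^sub>E i\<in>J. {b i..n' i})" using n by (auto simp: iv_def)
  ultimately show "n \<in> (%f i. if i \<in> J then f i else 0) ` (\<Pi>\<^sub>E i\<in>J. {b i..n' i})" by (rule image_eqI)
 qed
 thus ?thesis by (rule finite_subset) (simp add: finJ finite_PiE)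
qed

lemma countable_latt: "countable (latt J :: 'i lat set)"
proof -
 have "latt J \<subseteq> (\<Union>N::nat. iv (%i. - int N) (%i. int N))"
 proof
  fix n :: "'i lat" assume n: "n \<in> latt J"
  have "- int (nat (\<Sum>i\<in>J. \<bar>n i\<bar>)) <= n i & n i <= int (nat (\<Sum>i\<in>J. \<bar>n i\<bar>))" if "i \<in> J" for i
   using member_le_sum[OF that, of "%i. \<bar>n i\<bar>"] finJ by (simp add: abs_le_iff)
  hence "n \<in> iv (%i. - int (nat (\<Sum>i\<in>J. \<bar>n i\<bar>))) (%i. int (nat (\<Sum>i\<in>J. \<bar>n i\<bar>)))" using n by (simp add: iv_def)
  thus "n \<in> (\<Union>N::nat. iv (%i. - int N) (%i. int N))" by blast
 qed
 thus ?thesis by (rule countable_subset) (simp add: fin_iv countable_finite)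
qed

lemma sumsA_reindex:
 assumes "inj_on f X"
 shows "sumsA J t (f ` X) s \<longleftrightarrow> sumsA J (%x. t (f x)) X s"
proof -
 have s: "{y \<in> f ` X. t y m n ~= 0} = f ` {x \<in> X. t (f x) m n ~= 0}" for m n by blast
 have i: "inj_on f {x \<in> X. t (f x) m n ~= 0}" for m n using assms by (rule inj_on_subset) blast
 show ?thesis unfolding sumsA_def s by (simp add: finite_image_iff[OF i] sum.reindex[OF i])
qed

lemma latt_closed: "m \<in> latt J ==> n \<in> latt J ==> m - n \<in> latt J" "m \<in> latt J ==> n \<in> latt J ==> m + n \<in> latt J"
 by (auto simp: latt_def fun_app)

context
 fixes v :: "'i lat => ('i,'k::field) elt"
 assumes v: "ALL m:latt J. ps1 J m (v m)"
begin

lemma EE_supp: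
 assumes "q \<in> LL" "EE v q m n ~= 0"
 shows "m = fst q" "n - snd q \<in> nonneg J"
proof -
 have "fst q + B (snd q) \<in> latt J" using assms(1) by (auto intro: latt_muB)
 hence "m + B (snd q) = fst q + B (snd q)" "n - snd q \<in> nonneg J"
  using assms(2) v unfolding EE_def sigma_mult ps1_def by blast+
 thus "m = fst q" "n - snd q \<in> nonneg J" by simp_all
qed

lemma EE_lead: "(p, n) \<in> LL ==> EE v (p, n) p n = 1"
 using v latt_muB[of p n] by (auto simp: EE_def sigma_mult ps1_def)

lemma EE_le: "q \<in> LL ==> EE v q m n ~= 0 ==> le (snd q) n & n \<in> latt J"
proof -
 assume q: "q \<in> LL" "EE v q m n ~= 0"
 have "n - snd q \<in> nonneg J" by (rule EE_supp[OF q])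
 thus ?thesis using q(1) by (auto simp: nonneg_def latt_def fun_app)
qed

lemma EE_inj: "inj_on (EE v) LL"
proof (rule inj_onI)
 fix q q' assume q: "q \<in> LL" "q' \<in> LL" "EE v q = EE v q'"
 have 1: "EE v q (fst q) (snd q) ~= 0" "EE v q' (fst q') (snd q') ~= 0" using EE_lead q(1,2) by (metis prod.collapse one_neq_zero)+
 have f: "fst q = fst q'" using EE_supp(1)[OF q(2)] 1(1) q(3) by metis
 have "le (snd q) (snd q')" "le (snd q') (snd q)" using EE_le q 1 by metis+
 moreover have "snd q \<in> latt J" "snd q' \<in> latt J" using q(1,2) by auto
 ultimately have "snd q = snd q'" by (intro le_antisym)
 thus "q = q'" using f by (simp add: prod_eq_iff)
qed

text \<open>\<open>EE v (p, n)\<close> starts at zeta^n, so at zeta^n' only the indices between the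
  lower bound and n' contribute, and this interval is finite.\<close>

lemma EE_sum:
 assumes X: "X \<subseteq> LL" and c: "\<And>q. q \<in> X ==> c q ~= 0 ==> le b (snd q)"
 shows "finite {q\<in>X. c q * EE v q m n' ~= 0}"
  "(\<Sum>q\<in>{q\<in>X. c q * EE v q m n' ~= 0}. c q * EE v q m n') =
   (\<Sum>n\<in>iv b n'. if (m, n) \<in> X then c (m, n) * EE v (m, n) m n' else 0)"
proof -
 have sub: "{q\<in>X. c q * EE v q m n' ~= 0} \<subseteq> Pair m ` iv b n'"
 proof
  fix q assume q: "q \<in> {q\<in>X. c q * EE v q m n' ~= 0}"
  hence qX: "q \<in> X" "c q ~= 0" "EE v q m n' ~= 0" "q \<in> LL" using X by auto
  have "m = fst q" "snd q \<in> iv b n'"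
   using EE_supp(1)[OF qX(4,3)] EE_le[OF qX(4,3)] c[OF qX(1,2)] qX(4) by (auto simp: iv_def)
  thus "q \<in> Pair m ` iv b n'" by (metis image_eqI prod.collapse)
 qed
 thus "finite {q\<in>X. c q * EE v q m n' ~= 0}" by (rule finite_subset) (simp add: fin_iv)
 have "(\<Sum>q\<in>{q\<in>X. c q * EE v q m n' ~= 0}. c q * EE v q m n') =
  (\<Sum>q\<in>Pair m ` iv b n'. if q \<in> X then c q * EE v q m n' else 0)"
  by (rule sum.mono_neutral_cong_left) (use fin_iv sub in auto)
 also have "\<dots> = (\<Sum>n\<in>iv b n'. if (m, n) \<in> X then c (m, n) * EE v (m, n) m n' else 0)"
  by (subst sum.reindex) (auto simp: inj_on_def)
 finally show "(\<Sum>q\<in>{q\<in>X. c q * EE v q m n' ~= 0}. c q * EE v q m n') =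
   (\<Sum>n\<in>iv b n'. if (m, n) \<in> X then c (m, n) * EE v (m, n) m n' else 0)" .
qed

text \<open>The leading coefficient 1 detects every nonzero \<open>c q\<close>, so the convergence
  conditions on the terms turn into conditions on the coefficients.\<close>

lemma sumsA_EE:
 assumes X: "X \<subseteq> LL"
 shows "sumsA J (%q. smultA (c q) (EE v q)) X x \<longleftrightarrow> finite (fst ` {q\<in>X. c q ~= 0}) &
  (EX b. ALL q:X. c q ~= 0 --> le b (snd q)) & x = (%m n. \<Sum>q\<in>{q\<in>X. c q * EE v q m n ~= 0}. c q * EE v q m n)"
proof -
 have lead: "EE v q (fst q) (snd q) = 1" if "q \<in> X" for q using EE_lead[of "fst q" "snd q"] that X by auto
 have comps: "{m. EX q:X. EX n. c q * EE v q m n ~= 0} = fst ` {q\<in>X. c q ~= 0}"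
 proof (intro set_eqI iffI)
  fix m assume "m \<in> {m. EX q:X. EX n. c q * EE v q m n ~= 0}"
  then obtain q n where q: "q \<in> X" "c q ~= 0" "EE v q m n ~= 0" by auto
  hence "m = fst q" using EE_supp(1) X by blast
  thus "m \<in> fst ` {q\<in>X. c q ~= 0}" using q by blast
 next
  fix m assume "m \<in> fst ` {q\<in>X. c q ~= 0}"
  then obtain q where q: "q \<in> X" "c q ~= 0" "m = fst q" by blast
  hence "c q * EE v q m (snd q) ~= 0" using lead by simp
  thus "m \<in> {m. EX q:X. EX n. c q * EE v q m n ~= 0}" using q by blast
 qed
 have inA: "inA J (smultA (c q) (EE v q))" if q: "q \<in> X" for q
 proof -
  have qL: "q \<in> LL" using q X by blast
  have "{m. EX n. smultA (c q) (EE v q) m n ~= 0} \<subseteq> {fst q}" using EE_supp(1)[OF qL] by (auto simp: smultA_def)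
  moreover have "m \<in> latt J & n \<in> latt J & le (snd q) n" if "smultA (c q) (EE v q) m n ~= 0" for m n
  proof -
   have "EE v q m n ~= 0" using that by (auto simp: smultA_def)
   from EE_supp(1)[OF qL this] EE_le[OF qL this] qL show ?thesis by (simp add: mem_Times_iff)
  qed
  ultimately show ?thesis unfolding inA_def using finite_subset by blast
 qed
 have bnd: "(EX b. ALL q:X. ALL m n. c q * EE v q m n ~= 0 --> le b n) \<longleftrightarrow> (EX b. ALL q:X. c q ~= 0 --> le b (snd q))"
 proof (intro iffI; elim exE)
  fix b assume b: "ALL q:X. ALL m n. c q * EE v q m n ~= 0 --> le b n"
  have "le b (snd q)" if q: "q \<in> X" "c q ~= 0" for q
  proof -
   have "c q * EE v q (fst q) (snd q) ~= 0" using q lead by simp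
   thus ?thesis using b q(1) by blast
  qed
  thus "EX b. ALL q:X. c q ~= 0 --> le b (snd q)" by blast
 next
  fix b assume b: "ALL q:X. c q ~= 0 --> le b (snd q)"
  have "le b n" if q: "q \<in> X" "c q * EE v q m n ~= 0" for q m n
  proof -
   have "c q ~= 0" "EE v q m n ~= 0" using q(2) by auto
   hence "le b (snd q)" "le (snd q) n" using b q(1) EE_le X by blast+
   thus ?thesis using order_trans by blast
  qed
  thus "EX b. ALL q:X. ALL m n. c q * EE v q m n ~= 0 --> le b n" by blast
 qed
 have fin: "finite {q\<in>X. c q * EE v q m n ~= 0}" if "EX b. ALL q:X. c q ~= 0 --> le b (snd q)" for m n
  using that EE_sum(1)[OF X] by blast
 show ?thesis unfolding sumsA_def using inA fin
  by (simp only: smultA_def comps bnd) blast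
qed

text \<open>The unitriangular system is solved by recursion on the distance from the lower bound:
  the coefficient at n' is that of \<open>x\<close> minus the contributions of smaller indices. At
  the corner \<open>b\<close> there are none, which gives the last claim.\<close>

lemma expansion:
 assumes P: "finite P" "P \<subseteq> latt J" and x: "\<And>m n. x m n ~= 0 ==> m \<in> P & n \<in> latt J & le b n"
 obtains c where "\<And>q. c q ~= 0 ==> fst q \<in> P & snd q \<in> latt J & le b (snd q)"
  "sumsA J (%q. smultA (c q) (EE v q)) LL x" "\<And>p. p \<in> P ==> b \<in> latt J ==> c (p, b) = x p b"
proof -
 define F where "F p = (%f n'. x p n' - (\<Sum>n\<in>iv b n' - {n'}. f n * EE v (p, n) p n'))" for p
 define R where "R = measure (%n. nat (dg (n - b)))"
 define c0 where "c0 p = wfrec R (F p)" for p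
 have less: "(n, n') \<in> R" if n: "n \<in> iv b n'" "n ~= n'" "n' \<in> latt J" for n n'
 proof -
  have "n' - n \<in> posN J" using n by (auto simp: iv_def posN_def nonneg_def latt_def fun_app)
  from deg_pos[OF this] have "dg n < dg n'" by (simp add: degN_diff)
  moreover have "0 <= dg (n - b)" unfolding degN_def by (rule sum_nonneg) (use n in "auto simp: iv_def fun_app")
  ultimately show ?thesis by (simp add: R_def degN_diff)
 qed
 have rec: "c0 p n' = x p n' - (\<Sum>n\<in>iv b n' - {n'}. c0 p n * EE v (p, n) p n')" if n': "n' \<in> latt J" for p n'
 proof -
  have "c0 p n' = F p (cut (c0 p) R n') n'" unfolding c0_def by (rule wfrec) (simp add: R_def)
  also have "\<dots> = x p n' - (\<Sum>n\<in>iv b n' - {n'}. c0 p n * EE v (p, n) p n')"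
   unfolding F_def by (intro arg_cong[where f = "%z. x p n' - z"] sum.cong refl) (use less n' in "auto simp: cut_apply")
  finally show ?thesis .
 qed
 define c where "c = (%(p, n). if p \<in> P & n \<in> latt J & le b n then c0 p n else 0)"
 have supp: "fst q \<in> P & snd q \<in> latt J & le b (snd q)" if "c q ~= 0" for q
  using that by (auto simp: c_def split: if_splits prod.splits)
 have eq: "x m n' = (\<Sum>q\<in>{q\<in>LL. c q * EE v q m n' ~= 0}. c q * EE v q m n')" for m n'
 proof -
  have "(\<Sum>q\<in>{q\<in>LL. c q * EE v q m n' ~= 0}. c q * EE v q m n') =
   (\<Sum>n\<in>iv b n'. if (m, n) \<in> LL then c (m, n) * EE v (m, n) m n' else 0)"
   by (rule EE_sum(2)) (use supp in auto)
  also have "\<dots> = x m n'"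
  proof (cases "m \<in> P & n' \<in> latt J & le b n'")
   case True
   hence iv: "iv b n' = insert n' (iv b n' - {n'})" by (auto simp: iv_def)
   have mL: "m \<in> latt J" using True P by blast
   have "(\<Sum>n\<in>iv b n'. if (m, n) \<in> LL then c (m, n) * EE v (m, n) m n' else 0) =
    (\<Sum>n\<in>iv b n'. c0 m n * EE v (m, n) m n')"
    by (rule sum.cong[OF refl]) (use True mL in "auto simp: c_def iv_def")
   also have "\<dots> = c0 m n' * EE v (m, n') m n' + (\<Sum>n\<in>iv b n' - {n'}. c0 m n * EE v (m, n) m n')"
    by (subst iv, subst sum.insert) (auto simp: fin_iv)
   also have "\<dots> = x m n'" using rec[of n' m] EE_lead[of m n'] True mL by simp
   finally show ?thesis .
  next
   case False
   have "c (m, n) * EE v (m, n) m n' = 0" if "(m, n) \<in> LL" "n \<in> iv b n'" for n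
   proof (rule ccontr)
    assume nz: "c (m, n) * EE v (m, n) m n' ~= 0"
    hence "EE v (m, n) m n' ~= 0" "c (m, n) ~= 0" by auto
    hence "n' \<in> latt J" "m \<in> P" using EE_le[OF that(1)] supp by fastforce+
    moreover have "le b n'" using that(2) order_trans unfolding iv_def by blast
    ultimately show False using False by blast
   qed
   hence "(\<Sum>n\<in>iv b n'. if (m, n) \<in> LL then c (m, n) * EE v (m, n) m n' else 0) = 0" by (intro sum.neutral) auto
   thus ?thesis using x False by metis
  qed
  finally show ?thesis by simp
 qed
 have "sumsA J (%q. smultA (c q) (EE v q)) LL x"
  unfolding sumsA_EE[OF order_refl]
 proof (intro conjI)
  show "finite (fst ` {q\<in>LL. c q ~= 0})" by (rule finite_subset[OF _ P(1)]) (use supp in blast)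
  show "EX b. ALL q:LL. c q ~= 0 --> le b (snd q)" using supp by blast
 qed (use eq in "simp add: fun_eq_iff")
 moreover have "c (p, b) = x p b" if "p \<in> P" "b \<in> latt J" for p
 proof -
  have emp: "iv b b - {b} = {}" using le_antisym[OF that(2)] unfolding iv_def by blast
  show ?thesis using rec[OF that(2), of p] that unfolding emp by (simp add: c_def)
 qed
 ultimately show ?thesis using that supp by blast
qed

text \<open>Both families of coefficients are bounded below, so a common bound exists from which
  equality propagates upwards, the diagonal entries being 1.\<close>

lemma expansion_unique:
 assumes s: "sumsA J (%q. smultA (c q) (EE v q)) LL x" "sumsA J (%q. smultA (c' q) (EE v q)) LL x" and q: "q \<in> LL"
 shows "c q = c' q"
proof -
 note S = s[unfolded sumsA_EE[OF order_refl]]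
 obtain b1 b2 where b12: "ALL q:LL. c q ~= 0 --> le b1 (snd q)" "ALL q:LL. c' q ~= 0 --> le b2 (snd q)" using S by blast
 define b where "b i = min (b1 i) (b2 i)" for i
 have b: "le b (snd q)" if "q \<in> LL" "c q ~= 0 \<or> c' q ~= 0" for q
  using b12 that by (force simp: b_def min_le_iff_disj)
 obtain p n where pn: "q = (p, n)" "p \<in> latt J" "n \<in> latt J" using q by blast
 have e: "(\<Sum>n\<in>iv b n'. c (p, n) * EE v (p, n) p n') = (\<Sum>n\<in>iv b n'. c' (p, n) * EE v (p, n) p n')" for n'
 proof -
  have xe: "x p n' = (\<Sum>n\<in>iv b n'. if (p, n) \<in> LL then f (p, n) * EE v (p, n) p n' else 0)" if f: "f = c \<or> f = c'" for f
  proof -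
   have "sumsA J (%q. smultA (f q) (EE v q)) LL x" using f s by blast
   hence "x = (%m n. \<Sum>q\<in>{q\<in>LL. f q * EE v q m n ~= 0}. f q * EE v q m n)"
    unfolding sumsA_EE[OF order_refl] by blast
   from fun_cong[OF fun_cong[OF this]]
   have "x p n' = (\<Sum>q\<in>{q\<in>LL. f q * EE v q p n' ~= 0}. f q * EE v q p n')" .
   also have "\<dots> = (\<Sum>n\<in>iv b n'. if (p, n) \<in> LL then f (p, n) * EE v (p, n) p n' else 0)"
    by (rule EE_sum(2)) (use b f in auto)
   finally show ?thesis .
  qed
  have xr: "(\<Sum>n\<in>iv b n'. if (p, n) \<in> LL then f (p, n) * EE v (p, n) p n' else 0) = (\<Sum>n\<in>iv b n'. f (p, n) * EE v (p, n) p n')" for f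
   by (rule sum.cong[OF refl]) (use pn(2) in "auto simp: iv_def")
  have "x p n' = (\<Sum>n\<in>iv b n'. c (p, n) * EE v (p, n) p n')" "x p n' = (\<Sum>n\<in>iv b n'. c' (p, n) * EE v (p, n) p n')"
   using xe[of c] xe[of c'] unfolding xr by blast+
  thus ?thesis by simp
 qed
 have "c (p, n) = c' (p, n)" using pn(3)
 proof (induction "nat (dg (n - b))" arbitrary: n rule: less_induct)
  case less
  show ?case
  proof (cases "le b n")
   case True
   hence iv: "iv b n = insert n (iv b n - {n})" using less(2) by (auto simp: iv_def)
   have "(\<Sum>l\<in>iv b n - {n}. c (p, l) * EE v (p, l) p n) = (\<Sum>l\<in>iv b n - {n}. c' (p, l) * EE v (p, l) p n)"
   proof (rule sum.cong[OF refl])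
    fix l assume l: "l \<in> iv b n - {n}"
    have "n - l \<in> posN J" using l less(2) by (auto simp: iv_def posN_def nonneg_def latt_def fun_app)
    from deg_pos[OF this] have "dg l < dg n" by (simp add: degN_diff)
    moreover have "0 <= dg (l - b)" unfolding degN_def by (rule sum_nonneg) (use l in "auto simp: iv_def fun_app")
    ultimately have "c (p, l) = c' (p, l)" using less(1)[of l] l by (simp add: degN_diff iv_def)
    thus "c (p, l) * EE v (p, l) p n = c' (p, l) * EE v (p, l) p n" by simp
   qed
   moreover have "(\<Sum>l\<in>iv b n. f (p, l) * EE v (p, l) p n) = f (p, n) + (\<Sum>l\<in>iv b n - {n}. f (p, l) * EE v (p, l) p n)" for f
    by (subst iv, subst sum.insert) (use fin_iv EE_lead[of p n] pn(2) less(2) in auto)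
   ultimately show ?thesis using e[of n] by simp
  next
   case False
   show ?thesis
   proof (rule ccontr)
    assume "c (p, n) ~= c' (p, n)"
    hence "c (p, n) ~= 0 \<or> c' (p, n) ~= 0" by auto
    hence "le b n" using b[of "(p, n)"] pn(2) less(2) by simp
    thus False using False by blast
   qed
  qed
 qed
 thus ?thesis using pn(1) by simp
qed

end

section \<open>Reduced bases and pointed families\<close>

lemma canA_bounded:
 assumes "x \<in> canA J d eps"
 shows "EX P b. finite P & P \<subseteq> latt J & (ALL m n. (x :: ('i,'k::field_char_0) elt) m n ~= 0 --> m \<in> P & n \<in> latt J & le b n)"
 using assms
proof (induction rule: canA.induct)
 case (theta m)
 thus ?case using ps1_theta[OF theta]
  by (intro exI[of _ "{m}"] exI[of _ "0 :: 'i lat"]) (auto simp: ps1_def nonneg_def fun_app)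
next
 case (sigma n)
 have "- B n \<in> latt J" by (auto simp: latt_def matB_def fun_app)
 thus ?case using sigma by (intro exI[of _ "{- B n}"] exI[of _ n]) (auto simp: sigmaA_def split: if_splits)
next
 case (add x y)
 then obtain P b P' b' where h: "finite P" "P \<subseteq> latt J" "ALL m n. x m n ~= 0 --> m \<in> P & n \<in> latt J & le b n"
  "finite P'" "P' \<subseteq> latt J" "ALL m n. y m n ~= 0 --> m \<in> P' & n \<in> latt J & le b' n" by blast
 have "m \<in> P \<union> P' & n \<in> latt J & le (%i. min (b i) (b' i)) n" if "addA x y m n ~= 0" for m n
 proof -
  have "x m n ~= 0 \<or> y m n ~= 0" using that by (auto simp: addA_def)
  thus ?thesis
  proof
   assume "x m n ~= 0"
   hence "m \<in> P & n \<in> latt J & le b n" using h(3) by blast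
   thus ?thesis by (auto simp: min_le_iff_disj)
  next
   assume "y m n ~= 0"
   hence "m \<in> P' & n \<in> latt J & le b' n" using h(6) by blast
   thus ?thesis by (auto simp: min_le_iff_disj)
  qed
 qed
 thus ?case using h(1,2,4,5) by (intro exI[of _ "P \<union> P'"] exI[of _ "%i. min (b i) (b' i)"]) blast
next
 case (mult x y)
 then obtain P b P' b' where h: "finite P" "P \<subseteq> latt J" "ALL m n. x m n ~= 0 --> m \<in> P & n \<in> latt J & le b n"
  "finite P'" "P' \<subseteq> latt J" "ALL m n. y m n ~= 0 --> m \<in> P' & n \<in> latt J & le b' n" by blast
 let ?P = "(%(p, p'). p + p') ` (P \<times> P')"
 have "m \<in> ?P & n \<in> latt J & le (%i. b i + b' i) n" if "multA x y m n ~= 0" for m n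
 proof -
  have "{((m1, n1), (m2, n2)). x m1 n1 ~= 0 & y m2 n2 ~= 0 & m1 + m2 = m & n1 + n2 = n} ~= {}"
  proof
   assume "{((m1, n1), (m2, n2)). x m1 n1 ~= 0 & y m2 n2 ~= 0 & m1 + m2 = m & n1 + n2 = n} = {}"
   thus False using that unfolding multA_def by (simp only: sum.empty) simp
  qed
  then obtain m1 n1 m2 n2 where q: "x m1 n1 ~= 0" "y m2 n2 ~= 0" "m = m1 + m2" "n = n1 + n2" by blast
  have 1: "m1 \<in> P" "n1 \<in> latt J" "le b n1" and 2: "m2 \<in> P'" "n2 \<in> latt J" "le b' n2" using h(3,6) q(1,2) by blast+
  have "m \<in> ?P" using 1(1) 2(1) q(3) by force
  moreover have "n \<in> latt J" using latt_closed(2)[OF 1(2) 2(2)] q(4) by simp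
  ultimately show ?thesis using 1(3) 2(3) q(4) by (auto simp: fun_app add_mono)
 qed
 moreover have "?P \<subseteq> latt J" using h(2,5) by (auto intro!: latt_closed(2))
 moreover have "finite ?P" using h by simp
 ultimately show ?case by (intro exI[of _ ?P] exI[of _ "%i. b i + b' i"]) blast
next
 case (smult x c)
 then obtain P b where "finite P" "P \<subseteq> latt J" "ALL m n. x m n ~= 0 --> m \<in> P & n \<in> latt J & le b n" by blast
 thus ?case by (intro exI[of _ P] exI[of _ b]) (auto simp: smultA_def)
qed

lemma EE_image: "EE v ` LL = {multA (sigmaA J eps n) (v m) | m n. m \<in> latt J & n \<in> latt J}"
proof (intro set_eqI iffI)
 fix y assume "y \<in> EE v ` LL"
 then obtain p n where q: "p \<in> latt J" "n \<in> latt J" "y = multA (sigmaA J eps n) (v (p + B n))" by (auto simp: EE_def)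
 thus "y \<in> {multA (sigmaA J eps n) (v m) | m n. m \<in> latt J & n \<in> latt J}" using latt_muB[OF q(1)] by blast
next
 fix y assume "y \<in> {multA (sigmaA J eps n) (v m) | m n. m \<in> latt J & n \<in> latt J}"
 then obtain m n where q: "m \<in> latt J" "n \<in> latt J" "y = multA (sigmaA J eps n) (v m)" by blast
 have "(m - B n, n) \<in> LL" using latt_muB[OF q(1), of "- n"] q(2) by (simp add: matB_uminus)
 moreover have "EE v (m - B n, n) = y" using q(3) by (simp add: EE_def)
 ultimately show "y \<in> EE v ` LL" by blast
qed

text \<open>\<open>canA_bounded\<close> makes every element expandable. The expansion is indexed by
  pairs, while \<open>isBasis\<close> speaks of coefficients on the basis elements themselves;
  injectivity of \<open>EE v\<close> translates between the two.\<close>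

lemma reducedBasis_iff:
 fixes v :: "'i lat => ('i,'k::field_char_0) elt"
 assumes can: "ALL m:latt J. v m \<in> canA J d eps"
 shows "reducedBasis J d eps v \<longleftrightarrow> (ALL m:latt J. ps1 J m (v m))"
proof
 assume v: "ALL m:latt J. ps1 J m (v m)"
 let ?U = "EE v ` LL"
 have sub: "?U \<subseteq> canA J d eps" unfolding EE_def using can latt_muB by (auto intro!: canA.mult canA.sigma)
 have cnt: "countable ?U" by (intro countable_image countable_SIGMA countable_latt)
 have uniq: "\<exists>!a. (ALL u. u \<notin> ?U --> a u = 0) & sumsA J (%u. smultA (a u) u) ?U x" if x: "x \<in> canA J d eps" for x
 proof -
  note R = sumsA_reindex[OF EE_inj[OF v]]
  obtain P b where P: "finite P" "P \<subseteq> latt J" "\<And>m n. x m n ~= 0 ==> m \<in> P & n \<in> latt J & le b n"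
   using canA_bounded[OF x] by blast
  obtain c where c: "sumsA J (%q. smultA (c q) (EE v q)) LL x" by (rule expansion[OF v P(1,2), of x b]) (use P(3) in blast)+
  define a where "a u = (if u \<in> ?U then c (inv_into LL (EE v) u) else 0)" for u
  have "a (EE v q) = c q" if "q \<in> LL" for q using that inv_into_f_f[OF EE_inj[OF v] that] by (simp add: a_def)
  hence "sumsA J (%q. smultA (a (EE v q)) (EE v q)) LL x \<longleftrightarrow> sumsA J (%q. smultA (c q) (EE v q)) LL x"
   by (simp add: sumsA_def cong: conj_cong)
  hence a: "sumsA J (%u. smultA (a u) u) ?U x" unfolding R using c by blast
  show ?thesis
  proof (rule ex1I[of _ a])
   show "(ALL u. u \<notin> ?U --> a u = 0) & sumsA J (%u. smultA (a u) u) ?U x" using a by (simp add: a_def)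
   fix a' assume a': "(ALL u. u \<notin> ?U --> a' u = 0) & sumsA J (%u. smultA (a' u) u) ?U x"
   show "a' = a"
   proof
    fix u
    show "a' u = a u"
    proof (cases "u \<in> ?U")
     case True
     then obtain q where q: "q \<in> LL" "u = EE v q" by blast
     have "a' (EE v q) = a (EE v q)"
      by (rule expansion_unique[OF v _ _ q(1), of "%q. a' (EE v q)" x "%q. a (EE v q)"])
       (use a a' in "simp_all only: R")
     thus ?thesis using q by simp
    qed (use a' in "simp add: a_def")
   qed
  qed
 qed
 show "reducedBasis J d eps v" unfolding reducedBasis_def isBasis_def EE_image[symmetric]
  by (intro conjI sub cnt) (use v can uniq in simp_all)
qed (simp add: reducedBasis_def)

lemma gdeg_ps1: "ps1 J m (v :: ('i,'k::field) elt) ==> gdeg v = m"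
proof -
 assume v: "ps1 J m v"
 have v1: "v m 0 ~= 0" using v by (simp add: ps1_def)
 show ?thesis unfolding gdeg_def
 proof (rule some_equality)
  have "v ~= (%_ _. 0)"
  proof
   assume "v = (%_ _. 0)"
   thus False using v1 by simp
  qed
  thus "v ~= (%_ _. 0) & (ALL m' n. v m' n ~= 0 --> m' = m)" using v by (auto simp: ps1_def)
 qed (use v1 in blast)
qed

lemma EE_pair: "EE v (m, n) = multA (sigmaA J eps n) (v (m + B n))" by (simp add: EE_def)

lemma nonneg_le: "n \<in> nonneg J \<longleftrightarrow> n \<in> latt J & le 0 n" by (auto simp: nonneg_def fun_app)

text \<open>Expand \<open>u\<close> from the lower bound 0 in the single degree \<open>m\<close>:
  the coefficient at 0 is 1 and the remaining terms form S. Conversely all terms of S start at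
  positive exponents, so the constant term of \<open>v m\<close> is not disturbed.\<close>

lemma pointed_iff:
 fixes u :: "('i,'k::field) elt"
 assumes v: "ALL m:latt J. ps1 J m (v m)" and m: "m \<in> latt J"
 shows "ps1 J m u \<longleftrightarrow> (\<exists>(c::'i lat => 'k) S. sumsA J (%n. smultA (c n) (multA (sigmaA J eps n) (v (m + B n)))) (posN J) S
   & u = addA (v m) S)"
proof -
 let ?X = "Pair m ` posN J"
 have X: "?X \<subseteq> LL" using m by (auto simp: posN_def nonneg_def)
 have inj: "inj_on (Pair m) (posN J)" by (auto simp: inj_on_def)
 have R: "sumsA J (%n. smultA (c (m, n)) (multA (sigmaA J eps n) (v (m + B n)))) (posN J) S \<longleftrightarrow>
   sumsA J (%q. smultA (c q) (EE v q)) ?X S" for c :: "'i lat \<times> 'i lat => 'k" and S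
  unfolding sumsA_reindex[OF inj] EE_pair ..
 have E0: "EE v (m, 0) = v m" by (simp add: EE_def sigma_mult fun_eq_iff)
 show ?thesis
 proof
  assume u: "ps1 J m u"
  have f: "finite {m}" "{m} \<subseteq> latt J" using m by auto
  have uu: "\<And>m' n. u m' n ~= 0 ==> m' \<in> {m} & n \<in> latt J & le 0 n" using u by (auto simp: ps1_def nonneg_le)
  obtain c where c: "\<And>q. c q ~= 0 ==> fst q \<in> {m} & snd q \<in> latt J & le 0 (snd q)"
   "sumsA J (%q. smultA (c q) (EE v q)) LL u" "\<And>p. p \<in> {m} ==> 0 \<in> latt J ==> c (p, 0) = u p 0"
   by (rule expansion[OF v f, of u 0], erule uu, rule that)
  have c0: "c (m, 0) = 1" using c(3)[of m] u by (simp add: ps1_def)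
  define S where "S = (%m' n. \<Sum>q\<in>{q\<in>?X. c q * EE v q m' n ~= 0}. c q * EE v q m' n)"
  have "sumsA J (%q. smultA (c q) (EE v q)) ?X S"
   unfolding sumsA_EE[OF v X]
  proof (intro conjI)
   show "finite (fst ` {q\<in>?X. c q ~= 0})" by (rule finite_subset[of _ "{m}"]) auto
   show "EX b. ALL q:?X. c q ~= 0 --> le b (snd q)" using c(1) by blast
  qed (simp add: S_def)
  hence "sumsA J (%n. smultA (c (m, n)) (multA (sigmaA J eps n) (v (m + B n)))) (posN J) S" by (rule iffD2[OF R])
  moreover have "u = addA (v m) S"
  proof (intro ext)
   fix m' n
   have "u = (%m n. \<Sum>q\<in>{q\<in>LL. c q * EE v q m n ~= 0}. c q * EE v q m n)"
    using c(2) unfolding sumsA_EE[OF v order_refl] by blast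
   from fun_cong[OF fun_cong[OF this]]
   have "u m' n = (\<Sum>q\<in>{q\<in>LL. c q * EE v q m' n ~= 0}. c q * EE v q m' n)" .
   also have "{q\<in>LL. c q * EE v q m' n ~= 0} = {q\<in>insert (m, 0) ?X. c q * EE v q m' n ~= 0}"
   proof (intro set_eqI iffI)
    fix q assume q: "q \<in> {q\<in>LL. c q * EE v q m' n ~= 0}"
    hence "c q ~= 0" by auto
    hence "fst q = m" "snd q \<in> nonneg J" using c(1) nonneg_le by blast+
    hence "q \<in> insert (m, 0) ?X" by (cases q) (auto simp: posN_def)
    thus "q \<in> {q\<in>insert (m, 0) ?X. c q * EE v q m' n ~= 0}" using q by blast
   qed (use X m in auto)
   also have "(\<Sum>q\<in>\<dots>. c q * EE v q m' n) = v m m' n + S m' n"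
   proof -
    have fin: "finite {q\<in>?X. c q * EE v q m' n ~= 0}" by (rule EE_sum(1)[OF v X, of _ 0]) (use c(1) in blast)
    have notin: "(m, 0) \<notin> {q\<in>?X. c q * EE v q m' n ~= 0}" by (auto simp: posN_def)
    show ?thesis
    proof (cases "v m m' n = 0")
     case True
     hence "{q\<in>insert (m, 0) ?X. c q * EE v q m' n ~= 0} = {q\<in>?X. c q * EE v q m' n ~= 0}" by (auto simp: E0)
     thus ?thesis using True by (simp only: S_def) simp
    next
     case False
     hence "{q\<in>insert (m, 0) ?X. c q * EE v q m' n ~= 0} = insert (m, 0) {q\<in>?X. c q * EE v q m' n ~= 0}"
      by (auto simp: E0 c0)
     thus ?thesis using fin notin by (simp only: S_def sum.insert) (simp add: E0 c0)
    qed
   qed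
   finally show "u m' n = addA (v m) S m' n" by (simp add: addA_def)
  qed
  ultimately show "\<exists>(c::'i lat => 'k) S. sumsA J (%n. smultA (c n) (multA (sigmaA J eps n) (v (m + B n)))) (posN J) S
   & u = addA (v m) S" by (intro exI conjI)
 next
  assume "\<exists>(c::'i lat => 'k) S. sumsA J (%n. smultA (c n) (multA (sigmaA J eps n) (v (m + B n)))) (posN J) S
   & u = addA (v m) S"
  then obtain c :: "'i lat => 'k" and S where c: "sumsA J (%n. smultA (c n) (multA (sigmaA J eps n) (v (m + B n)))) (posN J) S"
   "u = addA (v m) S" by blast
  have "sumsA J (%q. smultA (c (snd q)) (EE v q)) ?X S" using c(1) R[of "%q. c (snd q)" S] by simp
  hence S: "S = (%m' n. \<Sum>q\<in>{q\<in>?X. c (snd q) * EE v q m' n ~= 0}. c (snd q) * EE v q m' n)"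
   unfolding sumsA_EE[OF v X] by blast
  have sup: "m' = m & n \<in> nonneg J & n ~= 0" if "S m' n ~= 0" for m' n
  proof -
   have "{q\<in>?X. c (snd q) * EE v q m' n ~= 0} ~= {}"
   proof
    assume e: "{q\<in>?X. c (snd q) * EE v q m' n ~= 0} = {}"
    have "S m' n = 0" by (subst S) (simp only: e sum.empty)
    thus False using that by simp
   qed
   then obtain l where l: "l \<in> posN J" "EE v (m, l) m' n ~= 0" by auto
   hence L: "(m, l) \<in> LL" using X by blast
   have "m' = m" "n - l \<in> nonneg J" using EE_supp[OF v L l(2)] by auto
   moreover from posN_add[OF this(2) l(1)] have "n \<in> posN J" by simp
   ultimately show ?thesis by (auto simp: posN_def)
  qed
  show "ps1 J m u" unfolding c(2) ps1_def addA_def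
  proof (intro conjI allI impI)
   have vm: "ps1 J m (v m)" using v m by blast
   have "S m 0 = 0" using sup by blast
   thus "v m m 0 + S m 0 = 1" using vm by (simp add: ps1_def)
   fix m' n assume "v m m' n + S m' n ~= 0"
   hence "v m m' n ~= 0 \<or> S m' n ~= 0" by auto
   thus "m' = m" "n \<in> nonneg J" using vm sup by (auto simp: ps1_def)
  qed
 qed
qed

end

section \<open>The four equivalent conditions\<close>

theorem mainTheorem5:
  fixes I Iuf :: "'i set" and eps :: "'i \<Rightarrow> 'i \<Rightarrow> int" and d :: "'i \<Rightarrow> nat"
    and u :: "'i lat \<Rightarrow> ('i, 'k::field_char_0) elt"
  assumes "finite I" and "Iuf \<subseteq> I"
    and "\<forall>i\<in>Iuf. 0 < d i"
    and "\<forall>i\<in>Iuf. \<forall>j\<in>Iuf. int (d i) * eps i j = - (int (d j) * eps j i)"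
    and "nondeg_coeffs I Iuf eps"
    and "\<forall>m\<in>latt Iuf. u m \<in> canA Iuf d eps"
  shows "((reducedBasis Iuf d eps u \<and> (\<forall>p\<in>latt Iuf. gdeg (u p) = p))
            \<longleftrightarrow> (\<forall>m\<in>latt Iuf. ps1 Iuf m (u m)))
       \<and> ((reducedBasis Iuf d eps u \<and> (\<forall>p\<in>latt Iuf. gdeg (u p) = p))
            \<longleftrightarrow> (\<forall>m\<in>latt Iuf. \<exists>(c::'i lat \<Rightarrow> 'k) S.
                   sumsA Iuf (\<lambda>n. smultA (c n) (multA (sigmaA Iuf eps n)
                                 (thetaA Iuf d eps (m + matB Iuf eps n)))) (posN Iuf) S
                   \<and> u m = addA (thetaA Iuf d eps m) S))
       \<and> ((reducedBasis Iuf d eps u \<and> (\<forall>p\<in>latt Iuf. gdeg (u p) = p))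
            \<longleftrightarrow> (\<forall>v. reducedBasis Iuf d eps v \<and> (\<forall>p\<in>latt Iuf. gdeg (v p) = p) \<longrightarrow>
                   (\<forall>m\<in>latt Iuf. \<exists>(c::'i lat \<Rightarrow> 'k) S.
                      sumsA Iuf (\<lambda>n. smultA (c n) (multA (sigmaA Iuf eps n)
                                    (v (m + matB Iuf eps n)))) (posN Iuf) S
                      \<and> u m = addA (v m) S)))"
proof -
 have "finite Iuf" using assms(1,2) by (rule rev_finite_subset)
 then interpret seed Iuf d eps by unfold_locales (use assms(3,4) in blast)+
 have red: "(reducedBasis Iuf d eps w & (ALL p:latt Iuf. gdeg (w p) = p)) \<longleftrightarrow> (ALL m:latt Iuf. ps1 Iuf m (w m))"
  if "ALL m:latt Iuf. w m \<in> canA Iuf d eps" for w :: "'i lat => ('i,'k) elt"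
  using reducedBasis_iff[OF that] gdeg_ps1 by blast
 have th: "ALL m:latt Iuf. ps1 Iuf m (thetaA Iuf d eps m :: ('i,'k) elt)" using ps1_theta by blast
 have can: "ALL m:latt Iuf. (thetaA Iuf d eps m :: ('i,'k) elt) \<in> canA Iuf d eps" using canA.theta by blast
 have thr: "reducedBasis Iuf d eps (thetaA Iuf d eps :: 'i lat => ('i,'k) elt) & (ALL p:latt Iuf. gdeg (thetaA Iuf d eps p :: ('i,'k) elt) = p)"
  using red[OF can] th by blast
 let ?iii = "%v :: 'i lat => ('i,'k) elt. ALL m:latt Iuf. \<exists>(c::'i lat => 'k) S.
    sumsA Iuf (%n. smultA (c n) (multA (sigmaA Iuf eps n) (v (m + matB Iuf eps n)))) (posN Iuf) S & u m = addA (v m) S"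
 have iii: "(ALL m:latt Iuf. ps1 Iuf m (u m)) \<longleftrightarrow> ?iii v" if "ALL m:latt Iuf. ps1 Iuf m (v m)" for v
  by (rule ball_cong[OF refl]) (rule pointed_iff[OF that])
 have iv: "(ALL m:latt Iuf. ps1 Iuf m (u m)) \<longleftrightarrow>
   (ALL v. reducedBasis Iuf d eps v & (ALL p:latt Iuf. gdeg (v p) = p) --> ?iii v)" (is "?a \<longleftrightarrow> ?b")
 proof
  assume a: ?a
  show ?b
  proof (intro allI impI)
   fix v :: "'i lat => ('i,'k) elt" assume "reducedBasis Iuf d eps v & (ALL p:latt Iuf. gdeg (v p) = p)"
   hence "ALL m:latt Iuf. ps1 Iuf m (v m)" by (simp add: reducedBasis_def)
   from iii[OF this] a show "?iii v" by (rule iffD1)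
  qed
 next
  assume b: ?b
  \<comment> \<open>The theta functions are themselves a reduced basis of the required kind, so the
    universal statement can be applied to them.\<close>
  have "?iii (thetaA Iuf d eps)" by (rule b[THEN spec, THEN mp, OF thr])
  thus ?a by (rule iffD2[OF iii[OF th]])
 qed
 show ?thesis unfolding red[OF assms(6)] using iii[OF th] iv by (intro conjI refl)
qed

end
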